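(* Let the reward be $g(s,t,x)=\mathbf B(t-s)\log x$ with $\mathbf B(t)=\int_0^\infty e^{-\beta t}p(\beta)\,d\beta$. If $\mathrm{supp}(p)$ is not a singleton, then for any open subset $C$ of $(0,\infty)$ with $C\ne(0,\infty)$ and $C\ne\varnothing$, and any constant $\theta^*>0$, the pair $(\theta^*,C\times[0,\infty))$ cannot be an equilibrium.
   Context: Constants $\mu,\sigma>0$. $p$ is a probability density on $(0,\infty)$, where discrete distributions (combinations of Dirac masses) are also allowed. Problem. A control (investment proportion) is a measurable function $\theta$ of wealth with values in $(0,\infty)$; it is admissible if $x\mapsto x\theta(x)$ is Lipschitz (constants $\vartheta\in(0,\infty)$ are admissible). The wealth, with values in $(0,\infty)$, follows $dX^\theta_t=\mu\theta(X^\theta_t)X^\theta_t\,dt+\sigma\theta(X^\theta_t)X^\theta_t\,dW_t$, $W$ a one-dimensional Brownian motion. $\mathbb E^{t,x}$ is expectation when wealth is $x$ at time $t$. For open $C\subset(0,\infty)$, $C\times[0,\infty)$ denotes the continuation region of all (time, wealth) pairs with wealth in $C$, and $\tau_{(u,C,s)}=\inf\{r\ge s:X^u_r\notin C\}$ ($\inf\varnothing=\infty$). The pay-off is $$J(t,x;u,\tau)=\mathbb E^{t,x}\big[g(t,\tau,X^u_\tau)I_{\{\tau<\infty\}}\big]=\mathbb E^{t,x}\big[\mathbf B(\tau-t)\log(X^u_\tau)I_{\{\tau<\infty\}}\big].$$ For $\vartheta\in(0,\infty)$, $\epsilon>0$, the perturbed control $\theta_{(t,\epsilon,\vartheta)}$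 equals $\vartheta$ on times $[t,t+\epsilon)$ and $\theta$ otherwise. $(\theta,C\times[0,\infty))$ is an equilibrium iff, with $\hat\tau=\tau_{(\theta,C,t)}$: (i) $\log x\le J(t,x;\theta,\hat\tau)$ for all $t\ge0,x>0$; (ii) $\limsup_{\epsilon\downarrow0}\epsilon^{-1}\big(J(t,x;\theta,\tau_{(\theta,C,t+\epsilon)})-J(t,x;\theta,\hat\tau)\big)\le0$ for all $t\ge0,x>0$; (iii) $\limsup_{\epsilon\downarrow0}\epsilon^{-1}\big(J(t,x;\theta_{(t,\epsilon,\vartheta)},\tau_{(\theta_{(t,\epsilon,\vartheta)},C,t)})-J(t,x;\theta,\hat\tau)\big)\le0$ for all $t\ge0$, $x\in C$, $\vartheta\in(0,\infty)$. *)

theory Defs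
  imports "HOL-Probability.Probability"
begin

section \<open>Brownian motion and the Ito integral\<close>

text \<open>Time is the set of nonnegative reals. The filtration is indexed by all reals only because
  \<^locale>\<open>filtration\<close> is indexed by a type; its values at negative times play no role.\<close>

locale brownian_motion = prob_space M + filtration "space M" F
  for M :: "'a measure" and F :: "real \<Rightarrow> 'a measure" +
  fixes W :: "real \<Rightarrow> 'a \<Rightarrow> real"
  assumes subalgebra_F: "0 \<le> t \<Longrightarrow> subalgebra M (F t)"
    and adapted_W: "0 \<le> t \<Longrightarrow> W t \<in> borel_measurable (F t)"
    and W_0: "AE \<omega> in M. W 0 \<omega> = 0"
    and continuous_W: "\<omega> \<in> space M \<Longrightarrow> continuous_on {0..} (\<lambda>t. W t \<omega>)"
    and normal_increments: "0 \<le> s \<Longrightarrow> s < t \<Longrightarrow>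
      distributed M lborel (\<lambda>\<omega>. W t \<omega> - W s \<omega>) (normal_density 0 (sqrt (t - s)))"
    and indep_increments: "0 \<le> s \<Longrightarrow> s < t \<Longrightarrow>
      indep_set (sets (F s)) {(\<lambda>\<omega>. W t \<omega> - W s \<omega>) -` A \<inter> space M | A. A \<in> sets borel}"

definition converges_in_prob :: "'a measure \<Rightarrow> (nat \<Rightarrow> 'a \<Rightarrow> real) \<Rightarrow> ('a \<Rightarrow> real) \<Rightarrow> bool" where
  "converges_in_prob M Y Z \<longleftrightarrow>
    (\<forall>\<epsilon>>0. (\<lambda>k. measure M {\<omega> \<in> space M. \<epsilon> < \<bar>Y k \<omega> - Z \<omega>\<bar>}) \<longlonglongrightarrow> 0)"

text \<open>A simple integrand on \<open>[a, b]\<close> is given by grid points \<open>T 0 \<le> \<dots> \<le> T n\<close> in \<open>[a, b]\<close> and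
  bounded \<open>F (T i)\<close>-measurable random variables \<open>\<xi> i\<close>; it takes the value \<open>\<xi> i\<close> on
  \<open>(T i, T (i + 1)]\<close>.\<close>

definition simple_integrand ::
  "'a measure \<Rightarrow> (real \<Rightarrow> 'a measure) \<Rightarrow> real \<Rightarrow> real \<Rightarrow> nat \<Rightarrow> (nat \<Rightarrow> real) \<Rightarrow> (nat \<Rightarrow> 'a \<Rightarrow> real) \<Rightarrow> bool"
  where
  "simple_integrand M F a b n T \<xi> \<longleftrightarrow>
    (\<forall>i\<le>n. T i \<in> {a..b}) \<and> (\<forall>i<n. T i \<le> T (Suc i)) \<and>
    (\<forall>i<n. \<xi> i \<in> borel_measurable (F (T i)) \<and> (\<exists>K. \<forall>\<omega>\<in>space M. \<bar>\<xi> i \<omega>\<bar> \<le> K))"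

definition simple_process :: "nat \<Rightarrow> (nat \<Rightarrow> real) \<Rightarrow> (nat \<Rightarrow> 'a \<Rightarrow> real) \<Rightarrow> real \<Rightarrow> 'a \<Rightarrow> real" where
  "simple_process n T \<xi> s \<omega> = (\<Sum>i<n. \<xi> i \<omega> * indicator {T i<..T (Suc i)} s)"

definition simple_integral ::
  "(real \<Rightarrow> 'a \<Rightarrow> real) \<Rightarrow> nat \<Rightarrow> (nat \<Rightarrow> real) \<Rightarrow> (nat \<Rightarrow> 'a \<Rightarrow> real) \<Rightarrow> 'a \<Rightarrow> real" where
  "simple_integral W n T \<xi> \<omega> = (\<Sum>i<n. \<xi> i \<omega> * (W (T (Suc i)) \<omega> - W (T i) \<omega>))"

text \<open>\<open>has_ito_integral M F W H a b I\<close> says that \<open>H\<close> is progressively measurable on \<open>[a, b]\<close>,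
  almost surely square integrable in time, and \<open>I\<close> is (a version of) its Ito integral
  with respect to \<open>W\<close> over \<open>[a, b]\<close>: there are simple integrands whose squared time-\<open>L\<^sup>2\<close> distance
  from \<open>H\<close> tends to 0 in probability and whose elementary integrals tend to \<open>I\<close> in probability.
  The distance is an extended nonnegative integral, so a divergent one counts as infinite.\<close>

definition has_ito_integral ::
  "'a measure \<Rightarrow> (real \<Rightarrow> 'a measure) \<Rightarrow> (real \<Rightarrow> 'a \<Rightarrow> real) \<Rightarrow> (real \<Rightarrow> 'a \<Rightarrow> real) \<Rightarrow>
    real \<Rightarrow> real \<Rightarrow> ('a \<Rightarrow> real) \<Rightarrow> bool" where
  "has_ito_integral M F W H a b I \<longleftrightarrow>
    (\<forall>r\<in>{a..b}. (\<lambda>(s, \<omega>). H s \<omega>) \<in> borel_measurable (restrict_space borel {a..r} \<Otimes>\<^sub>M F r)) \<and>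
    (AE \<omega> in M. (\<integral>\<^sup>+s\<in>{a..b}. ennreal ((H s \<omega>)\<^sup>2) \<partial>lborel) < \<infinity>) \<and>
    I \<in> borel_measurable M \<and>
    (\<exists>n T \<xi>.
      (\<forall>k::nat. simple_integrand M F a b (n k) (T k) (\<xi> k)) \<and>
      (\<forall>\<epsilon>>0. (\<lambda>k. measure M {\<omega> \<in> space M. ennreal \<epsilon> <
          (\<integral>\<^sup>+s\<in>{a..b}. ennreal ((simple_process (n k) (T k) (\<xi> k) s \<omega> - H s \<omega>)\<^sup>2) \<partial>lborel)})
        \<longlonglongrightarrow> 0) \<and>
      converges_in_prob M (\<lambda>k. simple_integral W (n k) (T k) (\<xi> k)) I)"


section \<open>Controls and wealth\<close>

definition admissible :: "(real \<Rightarrow> real) \<Rightarrow> bool" where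
  "admissible \<theta> \<longleftrightarrow>
    \<theta> \<in> borel_measurable (restrict_space borel {0<..}) \<and> (\<forall>x>0. 0 < \<theta> x) \<and>
    (\<exists>L. L-lipschitz_on {0<..} (\<lambda>x. x * \<theta> x))"

text \<open>The perturbed control depends on time, so the dynamics are set up for controls that are
  functions \<open>u s x\<close> of time and wealth. A control \<open>\<theta>\<close> of wealth alone is \<open>\<lambda>s. \<theta>\<close>.\<close>

definition perturbed :: "(real \<Rightarrow> real) \<Rightarrow> real \<Rightarrow> real \<Rightarrow> real \<Rightarrow> real \<Rightarrow> real \<Rightarrow> real" where
  "perturbed \<theta> t \<epsilon> \<eta> = (\<lambda>s x. if t \<le> s \<and> s < t + \<epsilon> then \<eta> else \<theta> x)"

text \<open>\<open>X\<close> is the \<open>(0, \<infinity>)\<close>-valued wealth on \<open>[t, \<infinity>)\<close> under the control \<open>u\<close>, starting from \<open>x\<close> at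
  time \<open>t\<close>, i.e. \<open>dX = \<mu> u X ds + \<sigma> u X dW\<close> in integrated form.\<close>

definition wealth_process ::
  "'a measure \<Rightarrow> (real \<Rightarrow> 'a measure) \<Rightarrow> (real \<Rightarrow> 'a \<Rightarrow> real) \<Rightarrow> real \<Rightarrow> real \<Rightarrow>
    (real \<Rightarrow> real \<Rightarrow> real) \<Rightarrow> real \<Rightarrow> real \<Rightarrow> (real \<Rightarrow> 'a \<Rightarrow> real) \<Rightarrow> bool" where
  "wealth_process M F W \<mu> \<sigma> u t x X \<longleftrightarrow>
    (\<forall>r\<ge>t. X r \<in> borel_measurable (F r)) \<and>
    (\<forall>\<omega>\<in>space M. continuous_on {t..} (\<lambda>r. X r \<omega>) \<and> (\<forall>r\<ge>t. 0 < X r \<omega>) \<and> X t \<omega> = x) \<and>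
    (\<forall>r\<ge>t. \<exists>I.
      has_ito_integral M F W (\<lambda>s \<omega>. \<sigma> * u s (X s \<omega>) * X s \<omega>) t r I \<and>
      (AE \<omega> in M.
        set_integrable lborel {t..r} (\<lambda>s. \<mu> * u s (X s \<omega>) * X s \<omega>) \<and>
        X r \<omega> = x + (LBINT s:{t..r}. \<mu> * u s (X s \<omega>) * X s \<omega>) + I \<omega>))"

text \<open>A wealth family chooses for the control \<open>\<theta>\<close>, each of its perturbations and every
  initial time \<open>t\<close> and wealth \<open>x\<close> a version \<open>X u t x\<close> of the wealth; expectation under
  \<open>E^{t,x}\<close> is expectation of functionals of \<open>X u t x\<close>.\<close>

definition wealth_family ::
  "'a measure \<Rightarrow> (real \<Rightarrow> 'a measure) \<Rightarrow> (real \<Rightarrow> 'a \<Rightarrow> real) \<Rightarrow> real \<Rightarrow> real \<Rightarrow> (real \<Rightarrow> real) \<Rightarrow>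
    ((real \<Rightarrow> real \<Rightarrow> real) \<Rightarrow> real \<Rightarrow> real \<Rightarrow> real \<Rightarrow> 'a \<Rightarrow> real) \<Rightarrow> bool" where
  "wealth_family M F W \<mu> \<sigma> \<theta> X \<longleftrightarrow>
    (\<forall>u \<in> insert (\<lambda>s. \<theta>) {perturbed \<theta> s \<epsilon> \<eta> | s \<epsilon> \<eta>. 0 \<le> s \<and> 0 < \<epsilon> \<and> 0 < \<eta>}.
      \<forall>t\<ge>0. \<forall>x>0. wealth_process M F W \<mu> \<sigma> u t x (X u t x))"


section \<open>Discounting, pay-off and equilibrium\<close>

text \<open>The weighting density or discrete weighting \<open>p\<close> is a probability measure \<open>P\<close>
  on the Borel sets of the reals that is concentrated on \<open>(0, \<infinity>)\<close>.\<close>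

definition weighting_distribution :: "real measure \<Rightarrow> bool" where
  "weighting_distribution P \<longleftrightarrow> prob_space P \<and> sets P = sets borel \<and> (AE \<beta> in P. 0 < \<beta>)"

definition measure_support :: "real measure \<Rightarrow> real set" where
  "measure_support P = {\<beta>. \<forall>U. open U \<longrightarrow> \<beta> \<in> U \<longrightarrow> 0 < emeasure P U}"

definition discount :: "real measure \<Rightarrow> real \<Rightarrow> real" where
  "discount P s = (\<integral>\<beta>. exp (- \<beta> * s) \<partial>P)"

definition reward :: "real measure \<Rightarrow> real \<Rightarrow> real \<Rightarrow> real \<Rightarrow> real" where
  "reward P s t x = discount P (t - s) * ln x"

definition exit_time :: "(real \<Rightarrow> 'a \<Rightarrow> real) \<Rightarrow> real set \<Rightarrow> real \<Rightarrow> 'a \<Rightarrow> ereal" where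
  "exit_time X C s \<omega> = Inf {ereal r | r. s \<le> r \<and> X r \<omega> \<notin> C}"

text \<open>The expectation is the Bochner integral, which is 0 for a non-integrable integrand. For
  \<open>s = t\<close> the pay-off of \<open>exit_time X C s\<close> is always a bounded random variable if \<open>C\<close> is an open
  proper subset of \<open>(0, \<infinity>)\<close>: up to that time \<open>X\<close> stays in one component of \<open>C\<close>, so it is
  stopped at its initial value or at one of at most two boundary points.\<close>

definition payoff ::
  "'a measure \<Rightarrow> real measure \<Rightarrow> (real \<Rightarrow> 'a \<Rightarrow> real) \<Rightarrow> real \<Rightarrow> ('a \<Rightarrow> ereal) \<Rightarrow> real" where
  "payoff M P X t \<tau> =
    (\<integral>\<omega>. (if \<tau> \<omega> < \<infinity>
          then reward P t (real_of_ereal (\<tau> \<omega>)) (X (real_of_ereal (\<tau> \<omega>)) \<omega>) else 0) \<partial>M)"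

text \<open>\<open>X\<close> is a wealth family and \<open>C\<close> is the section of the continuation region
  \<open>C \<times> [0, \<infinity>)\<close>.\<close>

definition equilibrium ::
  "'a measure \<Rightarrow> real measure \<Rightarrow> ((real \<Rightarrow> real \<Rightarrow> real) \<Rightarrow> real \<Rightarrow> real \<Rightarrow> real \<Rightarrow> 'a \<Rightarrow> real) \<Rightarrow>
    (real \<Rightarrow> real) \<Rightarrow> real set \<Rightarrow> bool" where
  "equilibrium M P X \<theta> C \<longleftrightarrow>
    (let J = (\<lambda>t x u s. payoff M P (X u t x) t (exit_time (X u t x) C s)) in
      admissible \<theta> \<and>
      (\<forall>t\<ge>0. \<forall>x>0. ln x \<le> J t x (\<lambda>s. \<theta>) t) \<and>
      (\<forall>t\<ge>0. \<forall>x>0.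
        Limsup (at_right 0) (\<lambda>\<epsilon>. ereal ((J t x (\<lambda>s. \<theta>) (t + \<epsilon>) - J t x (\<lambda>s. \<theta>) t) / \<epsilon>)) \<le> 0) \<and>
      (\<forall>t\<ge>0. \<forall>x\<in>C. \<forall>\<eta>>0.
        Limsup (at_right 0)
          (\<lambda>\<epsilon>. ereal ((J t x (perturbed \<theta> t \<epsilon> \<eta>) t - J t x (\<lambda>s. \<theta>) t) / \<epsilon>)) \<le> 0))"

end

(*
  While the control is a constant c, the logarithm of the wealth is a Brownian motion with drift
  mu c - (sigma c)^2 / 2 and volatility sigma c. In a bounded component (l, h) of C (or in (0, h) with h <> 1) the value is
  therefore J(y) = E_P[v_beta(y)], y = ln x, where D v'' + a v' = beta v for the drift a and D = (sigma theta)^2 / 2, with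
  boundary values ln l and ln h. Condition (iii) says that eta |-> mu eta J' + sigma^2 eta^2 / 2 (J'' - J') - E_P[beta v_beta]
  is at most 0, and it vanishes at eta = theta; stationarity there gives J'' = kappa_0 J'. Inserting this into the equations
  for E_P[beta^n v_beta] yields E_P[beta (beta - kappa)^2 v_beta] = 0 for a constant kappa, and as v_beta(y) has a sign independent
  of beta for some y, P is the Dirac mass at kappa. If C contains a ray (l, oo) as a component, the pay-off is bounded there,
  against (i). The remaining set C = (0, 1) violates (ii) at x = 1, where waiting for a time eps gains an amount of order
  sqrt eps.
*)

theory Submission imports Defs begin

text \<open>The hypotheses describe the wealth only through limits in probability of elementary
  integrals, so its logarithm is extracted by hand: Riemann sums converge to the integral, relative
  increments over a coarse grid are compared with Riemann sums over a much finer one, and a discrete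
  Ito formula adds up their logarithms.

  The expansion behind condition (iii) avoids the Markov property. Outside an event of probability
  O(eps^2) the path stays in a small window up to time eps. That event is decided at time eps, and
  optional stopping started there and restricted to its complement expresses the pay-off through
  v_beta. The error is O(eps^(3/2)), so the difference quotient converges.

  P may have no finite moments. The mixture is smooth nevertheless, because beta^n times each
  y-derivative of v_beta is bounded uniformly in beta away from the boundary. The sign of v_beta is
  delicate for l < 1 < h: near h the contribution of h dominates that of l by a factor that can be
  chosen independently of beta.\<close>

section \<open>Independence and moments of Brownian increments\<close>

lemma Int_stable_vimage: "Int_stable {f -` A \<inter> S | A. A \<in> sets N}"
  unfolding Int_stable_def
proof (intro ballI, elim CollectE exE conjE)
  fix a b A B assume "a = f -` A \<inter> S" "A \<in> sets N" "b = f -` B \<inter> S" "B \<in> sets N"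
  then show "a \<inter> b \<in> {f -` A \<inter> S | A. A \<in> sets N}"
    by (intro CollectI exI[of _ "A \<inter> B"]) auto
qed

context brownian_motion begin

lemma measurable_F_M: "0 \<le> s \<Longrightarrow> f \<in> borel_measurable (F s) \<Longrightarrow> f \<in> borel_measurable M"
  using measurable_from_subalg[OF subalgebra_F] by blast

lemma measurable_F_mono:
  "s \<le> t \<Longrightarrow> f \<in> borel_measurable (F s) \<Longrightarrow> f \<in> borel_measurable (F t)"
  using measurable_mono[OF order_refl _ sets_F_mono[of s t]] by (auto simp: space_F)

lemma W_measurable: "0 \<le> t \<Longrightarrow> W t \<in> borel_measurable M"
  by (rule measurable_F_M[OF _ adapted_W])

text \<open>A preimage under \<open>f\<close> of the increment is also a preimage under the
  increment, so \<open>indep_increments\<close> covers both generators; these are stable under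
  intersection and hand independence on to the generated sigma-algebras. A general \<open>f\<close>
  is kept because the identity, centred squares and exponentials of increments all occur
  later.\<close>

lemma indep_var_increment:
  assumes s: "0 \<le> s" "s < t" and \<xi>: "\<xi> \<in> borel_measurable (F s)" and f: "f \<in> borel_measurable borel"
  shows "indep_var borel \<xi> borel (\<lambda>\<omega>. f (W t \<omega> - W s \<omega>))"
proof -
  have W: "W s \<in> borel_measurable M" "W t \<in> borel_measurable M"
    using s W_measurable by auto
  have "indep_set {\<xi> -` A \<inter> space M | A. A \<in> sets borel}
      {(\<lambda>\<omega>. f (W t \<omega> - W s \<omega>)) -` A \<inter> space M | A. A \<in> sets borel}"
  proof (rule indep_setI)
    show "{\<xi> -` A \<inter> space M | A. A \<in> sets borel} \<subseteq> events"
      using measurable_sets[OF measurable_F_M[OF s(1) \<xi>]] by auto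
    show "{(\<lambda>\<omega>. f (W t \<omega> - W s \<omega>)) -` A \<inter> space M | A. A \<in> sets borel} \<subseteq> events"
      using W f by (auto intro!: measurable_sets[of _ M borel])
    fix a b assume a: "a \<in> {\<xi> -` A \<inter> space M | A. A \<in> sets borel}"
      and b: "b \<in> {(\<lambda>\<omega>. f (W t \<omega> - W s \<omega>)) -` A \<inter> space M | A. A \<in> sets borel}"
    have "a \<in> sets (F s)"
      using a measurable_sets[OF \<xi>] by (auto simp: space_F)
    moreover obtain B where B: "B \<in> sets borel" "b = (\<lambda>\<omega>. f (W t \<omega> - W s \<omega>)) -` B \<inter> space M"
      using b by blast
    have "b \<in> {(\<lambda>\<omega>. W t \<omega> - W s \<omega>) -` A \<inter> space M | A. A \<in> sets borel}"
      using B measurable_sets[OF f B(1)] by (auto intro!: exI[of _ "f -` B"])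
    ultimately show "prob (a \<inter> b) = prob a * prob b"
      using indep_setD[OF indep_increments[OF s]] by blast
  qed
  then have "indep_set (sigma_sets (space M) {\<xi> -` A \<inter> space M | A. A \<in> sets borel})
      (sigma_sets (space M) {(\<lambda>\<omega>. f (W t \<omega> - W s \<omega>)) -` A \<inter> space M | A. A \<in> sets borel})"
    by (rule indep_set_sigma_sets) (rule Int_stable_vimage)+
  then show ?thesis
    using measurable_F_M[OF s(1) \<xi>] W f by (auto simp: indep_var_eq)
qed

lemma expectation_mult_increment:
  fixes f :: "real \<Rightarrow> real"
  assumes "0 \<le> s" "s < t" "\<xi> \<in> borel_measurable (F s)" "f \<in> borel_measurable borel"
    and "integrable M \<xi>" "integrable M (\<lambda>\<omega>. f (W t \<omega> - W s \<omega>))"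
  shows "integrable M (\<lambda>\<omega>. \<xi> \<omega> * f (W t \<omega> - W s \<omega>))"
    and "expectation (\<lambda>\<omega>. \<xi> \<omega> * f (W t \<omega> - W s \<omega>)) =
      expectation \<xi> * expectation (\<lambda>\<omega>. f (W t \<omega> - W s \<omega>))"
  using indep_var_integrable[OF indep_var_increment[OF assms(1-4)] assms(5,6)]
    indep_var_lebesgue_integral[OF indep_var_increment[OF assms(1-4)] assms(5,6)] by auto

lemma has_bochner_integral_increment:
  fixes f :: "real \<Rightarrow> real"
  assumes s: "0 \<le> s" "s < t" and f: "f \<in> borel_measurable borel"
    and "has_bochner_integral lborel (\<lambda>x. normal_density 0 (sqrt (t - s)) x * f x) c"
  shows "has_bochner_integral M (\<lambda>\<omega>. f (W t \<omega> - W s \<omega>)) c"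
proof -
  have i: "integrable M (\<lambda>\<omega>. f (W t \<omega> - W s \<omega>)) = integrable lborel (\<lambda>x. normal_density 0 (sqrt (t - s)) x * f x)"
    by (rule distributed_integrable[symmetric, OF normal_increments[OF s]])
      (use f in \<open>auto intro: normal_density_nonneg\<close>)
  have e: "expectation (\<lambda>\<omega>. f (W t \<omega> - W s \<omega>)) = (\<integral>x. normal_density 0 (sqrt (t - s)) x * f x \<partial>lborel)"
    by (rule distributed_integral[symmetric, OF normal_increments[OF s]])
      (use f in \<open>auto intro: normal_density_nonneg\<close>)
  show ?thesis
    using assms(4) i e by (simp add: has_bochner_integral_iff)
qed

lemma increment_moments:
  assumes s: "0 \<le> s" "s < t"
  shows "has_bochner_integral M (\<lambda>\<omega>. W t \<omega> - W s \<omega>) 0"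
    and "has_bochner_integral M (\<lambda>\<omega>. (W t \<omega> - W s \<omega>)\<^sup>2) (t - s)"
    and "has_bochner_integral M (\<lambda>\<omega>. (W t \<omega> - W s \<omega>) ^ 4) (3 * (t - s)\<^sup>2)"
    and "has_bochner_integral M (\<lambda>\<omega>. exp (l * (W t \<omega> - W s \<omega>))) (exp (l\<^sup>2 * (t - s) / 2))"
proof -
  have p: "0 < sqrt (t - s)" using s by simp
  show "has_bochner_integral M (\<lambda>\<omega>. W t \<omega> - W s \<omega>) 0"
    using normal_moment_odd[OF p, of 0 0] by (intro has_bochner_integral_increment[OF s, of "\<lambda>x. x"]) auto
  have sq: "sqrt (t-s)^2 = t - s" using s by simp
  show "has_bochner_integral M (\<lambda>\<omega>. (W t \<omega> - W s \<omega>)\<^sup>2) (t - s)"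
  proof (intro has_bochner_integral_increment[OF s, of "\<lambda>x. x\<^sup>2"])
    have "fact (2*1) / ((2 / (sqrt (t - s))\<^sup>2)^1 * fact 1) = t - s"
      using s by (simp add: sq)
    then show "has_bochner_integral lborel (\<lambda>x. normal_density 0 (sqrt (t - s)) x * x\<^sup>2) (t - s)"
      using normal_moment_even[OF p, of 0 1] unfolding mult_1_right diff_zero by metis
  qed simp
  have "fact (2*2) / ((2 / (sqrt (t - s))\<^sup>2)^2 * fact 2) = 3 * (t-s)^2"
    using s by (simp add: sq fact_numeral field_simps power2_eq_square)
  then show "has_bochner_integral M (\<lambda>\<omega>. (W t \<omega> - W s \<omega>) ^ 4) (3 * (t - s)\<^sup>2)"
    using normal_moment_even[OF p, of 0 2] s
    by (intro has_bochner_integral_increment[OF s, of "\<lambda>x. x^4"]) (auto simp: )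
  \<comment> \<open>Completing the square: the exponential tilt shifts the mean of the normal
    density to \<open>l * (t - s)\<close> and multiplies it by a constant. The shifted density has
    mass 1, so that constant is the exponential moment.\<close>
  have "normal_density 0 (sqrt (t - s)) x * exp (l * x) =
     exp (l\<^sup>2 * (t - s) / 2) * normal_density (l * (t - s)) (sqrt (t - s)) x" for x
  proof -
    have "- (x\<^sup>2) / (2 * (t-s)) + l * x = l\<^sup>2 * (t - s) / 2 - (x - l * (t-s))\<^sup>2 / (2 * (t-s))"
      using s by (simp add: field_simps power2_eq_square)
    then have "exp (- (x\<^sup>2) / (2 * (t-s))) * exp (l * x) = exp (l\<^sup>2 * (t - s) / 2) * exp (- ((x - l * (t-s))\<^sup>2 / (2 * (t-s))))"
      by (simp flip: exp_add)
    then show ?thesis using s by (simp add: normal_density_def)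
  qed
  moreover have "has_bochner_integral lborel (normal_density (l * (t - s)) (sqrt (t - s))) 1"
    using p by (simp add: has_bochner_integral_iff)
  ultimately have "has_bochner_integral lborel (\<lambda>x. normal_density 0 (sqrt (t - s)) x * exp (l * x)) (exp (l\<^sup>2 * (t - s) / 2))"
    using has_bochner_integral_mult_right[of "exp (l\<^sup>2 * (t - s) / 2)" lborel "normal_density (l * (t - s)) (sqrt (t - s))" 1] by simp
  then show "has_bochner_integral M (\<lambda>\<omega>. exp (l * (W t \<omega> - W s \<omega>))) (exp (l\<^sup>2 * (t - s) / 2))"
    by (intro has_bochner_integral_increment[OF s, of "\<lambda>x. exp (l * x)"]) auto
qed

text \<open>Grid points of a simple integrand may coincide, so \<open>s = t\<close> has to be
  allowed; the increment is then the constant 0.\<close>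

lemma expectation_mult_increment':
  fixes f :: "real \<Rightarrow> real"
  assumes "0 \<le> s" "s \<le> t" "\<xi> \<in> borel_measurable (F s)" "f \<in> borel_measurable borel"
    and "integrable M \<xi>" "integrable M (\<lambda>\<omega>. f (W t \<omega> - W s \<omega>))"
  shows "integrable M (\<lambda>\<omega>. \<xi> \<omega> * f (W t \<omega> - W s \<omega>))"
    and "expectation (\<lambda>\<omega>. \<xi> \<omega> * f (W t \<omega> - W s \<omega>)) =
      expectation \<xi> * expectation (\<lambda>\<omega>. f (W t \<omega> - W s \<omega>))"
  using expectation_mult_increment[OF assms(1) _ assms(3-6)] assms(2,5) 
  by (cases "s = t"; simp add: prob_space)+

text \<open>Orthogonality of martingale differences: the sum so far times \<open>\<xi> n\<close> is
  known at time \<open>T n\<close>, and the next factor is centred and independent of it, so cross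
  terms vanish. With \<open>f i\<close> the identity this is the Ito isometry, with
  \<open>f i\<close> a centred square it gives the variance of the quadratic variation.
  Measurability of the partial sum and \<open>0 \<le> T n\<close> are carried along for the
  induction.\<close>

lemma expectation_square_sum_increments:
  fixes T :: "nat \<Rightarrow> real" and \<xi> :: "nat \<Rightarrow> 'a \<Rightarrow> real" and f :: "nat \<Rightarrow> real \<Rightarrow> real"
  assumes "0 \<le> T 0" and "\<And>i. i < n \<Longrightarrow> T i \<le> T (Suc i)"
    and "\<And>i. i < n \<Longrightarrow> \<xi> i \<in> borel_measurable (F (T i))"
    and "\<And>i. i < n \<Longrightarrow> \<exists>K. \<forall>\<omega>\<in>space M. \<bar>\<xi> i \<omega>\<bar> \<le> K"
    and "\<And>i. i < n \<Longrightarrow> f i \<in> borel_measurable borel"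
    and "\<And>i. i < n \<Longrightarrow> has_bochner_integral M (\<lambda>\<omega>. f i (W (T (Suc i)) \<omega> - W (T i) \<omega>)) 0"
    and "\<And>i. i < n \<Longrightarrow> has_bochner_integral M (\<lambda>\<omega>. (f i (W (T (Suc i)) \<omega> - W (T i) \<omega>))\<^sup>2) (q i)"
  shows "(\<lambda>\<omega>. \<Sum>i<n. \<xi> i \<omega> * f i (W (T (Suc i)) \<omega> - W (T i) \<omega>)) \<in> borel_measurable (F (T n)) \<and>
    has_bochner_integral M (\<lambda>\<omega>. (\<Sum>i<n. \<xi> i \<omega> * f i (W (T (Suc i)) \<omega> - W (T i) \<omega>))\<^sup>2)
    (\<Sum>i<n. expectation (\<lambda>\<omega>. (\<xi> i \<omega>)\<^sup>2) * q i) \<and> 0 \<le> T n"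
  using assms
proof (induction n)
  case 0
  show ?case
    unfolding lessThan_0 sum.empty power_zero_numeral
    by (intro conjI has_bochner_integral_zero \<open>0 \<le> T 0\<close>) simp
next
  case (Suc n)
  let ?S = "\<lambda>\<omega>. \<Sum>i<n. \<xi> i \<omega> * f i (W (T (Suc i)) \<omega> - W (T i) \<omega>)"
  let ?D = "\<lambda>\<omega>. W (T (Suc n)) \<omega> - W (T n) \<omega>"
  have IH: "?S \<in> borel_measurable (F (T n))"
    "has_bochner_integral M (\<lambda>\<omega>. (?S \<omega>)\<^sup>2) (\<Sum>i<n. expectation (\<lambda>\<omega>. (\<xi> i \<omega>)\<^sup>2) * q i)" "0 \<le> T n"
    using Suc.IH Suc.prems by auto
  have T: "T n \<le> T (Suc n)" using Suc.prems by auto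
  have \<xi>: "\<xi> n \<in> borel_measurable (F (T n))" using Suc.prems by auto
  note \<xi>M = measurable_F_M[OF IH(3) \<xi>]
  note SM = measurable_F_M[OF IH(3) IH(1)]
  obtain K where K: "\<And>\<omega>. \<omega> \<in> space M \<Longrightarrow> \<bar>\<xi> n \<omega>\<bar> \<le> K" using Suc.prems(4)[of n] by auto
  have fm[measurable]: "f n \<in> borel_measurable borel" using Suc.prems by auto
  have D: "?D \<in> borel_measurable (F (T (Suc n)))"
    using measurable_F_mono[OF T adapted_W[OF IH(3)]] adapted_W[of "T (Suc n)"] IH(3) T by auto
  have m: "(\<lambda>\<omega>. ?S \<omega> + \<xi> n \<omega> * f n (?D \<omega>)) \<in> borel_measurable (F (T (Suc n)))"
    using measurable_F_mono[OF T IH(1)] measurable_F_mono[OF T \<xi>] D by measurable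
  have i\<xi>: "integrable M (\<lambda>\<omega>. (\<xi> n \<omega>)\<^sup>2)"
  proof (rule integrable_const_bound[of _ "K^2"])
    show "AE \<omega> in M. norm ((\<xi> n \<omega>)\<^sup>2) \<le> K\<^sup>2"
      using power_mono[OF K abs_ge_zero, of _ 2] by (intro AE_I2) simp
  qed (use \<xi>M in simp)
  have f0: "has_bochner_integral M (\<lambda>\<omega>. f n (?D \<omega>)) 0" and 
    f2: "has_bochner_integral M (\<lambda>\<omega>. (f n (?D \<omega>))\<^sup>2) (q n)" using Suc.prems(6,7) by auto
  have S1: "integrable M ?S"
    using square_integrable_imp_integrable[OF SM] IH(2) by (auto simp: has_bochner_integral_iff)
  have iS\<xi>: "integrable M (\<lambda>\<omega>. ?S \<omega> * \<xi> n \<omega>)"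
  proof (rule Bochner_Integration.integrable_bound[where f="\<lambda>\<omega>. K * ?S \<omega>"])
    have "\<bar>?S \<omega> * \<xi> n \<omega>\<bar> \<le> \<bar>K * ?S \<omega>\<bar>" if "\<omega> \<in> space M" for \<omega>
      using mult_left_mono[of "\<bar>\<xi> n \<omega>\<bar>" "\<bar>K\<bar>" "\<bar>?S \<omega>\<bar>"] K[OF that] by (simp add: abs_mult mult.commute)
    then show "AE \<omega> in M. norm (?S \<omega> * \<xi> n \<omega>) \<le> norm (K * ?S \<omega>)"
      by (intro AE_I2) (simp only: real_norm_def)
  qed (use S1 \<xi>M SM in simp_all)
  have "has_bochner_integral M (\<lambda>\<omega>. (?S \<omega>)\<^sup>2 + 2 * ((?S \<omega> * \<xi> n \<omega>) * f n (?D \<omega>)) + (\<xi> n \<omega>)\<^sup>2 * (f n (?D \<omega>))\<^sup>2)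
     ((\<Sum>i<n. expectation (\<lambda>\<omega>. (\<xi> i \<omega>)\<^sup>2) * q i) + 2 * (expectation (\<lambda>\<omega>. ?S \<omega> * \<xi> n \<omega>) * 0) + expectation (\<lambda>\<omega>. (\<xi> n \<omega>)\<^sup>2) * q n)"
    using expectation_mult_increment'[OF IH(3) T _ _ iS\<xi>, of "f n"] f0 IH(1) \<xi>
      expectation_mult_increment'[OF IH(3) T _ _ i\<xi>, of "\<lambda>x. (f n x)\<^sup>2"] f2
    by (intro has_bochner_integral_add IH(2) has_bochner_integral_mult_right)
      (auto simp: has_bochner_integral_iff)
  moreover have "(?S \<omega>)\<^sup>2 + 2 * ((?S \<omega> * \<xi> n \<omega>) * f n (?D \<omega>)) + (\<xi> n \<omega>)\<^sup>2 * (f n (?D \<omega>))\<^sup>2 =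
     (\<Sum>i<Suc n. \<xi> i \<omega> * f i (W (T (Suc i)) \<omega> - W (T i) \<omega>))\<^sup>2" for \<omega>
    by (simp add: power2_eq_square algebra_simps)
  ultimately show ?case using m IH(3) T by simp
qed

end

section \<open>Convergence to zero in probability\<close>

lemma tendsto_by_subsubseq:
  fixes f :: "nat \<Rightarrow> 'b::metric_space"
  assumes "\<And>r. strict_mono (r :: nat \<Rightarrow> nat) \<Longrightarrow> \<exists>s. strict_mono (s :: nat \<Rightarrow> nat) \<and> (\<lambda>k. f (r (s k))) \<longlonglongrightarrow> l"
  shows "f \<longlonglongrightarrow> l"
proof (rule ccontr)
  assume "\<not> f \<longlonglongrightarrow> l"
  then obtain e where e: "e > 0" "\<not> eventually (\<lambda>n. dist (f n) l < e) sequentially"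
    unfolding tendsto_iff by blast
  then have inf: "infinite {n. \<not> dist (f n) l < e}"
    by (simp add: frequently_cofinite[symmetric] cofinite_eq_sequentially frequently_def)
  let ?r = "enumerate {n. \<not> dist (f n) l < e}"
  obtain s where s: "(\<lambda>k. f (?r (s k))) \<longlonglongrightarrow> l"
    using assms[OF strict_mono_enumerate[OF inf]] by blast
  then obtain k where "dist (f (?r (s k))) l < e"
    using e(1) unfolding tendsto_iff by (meson eventually_sequentially le_refl)
  then show False using enumerate_in_set[OF inf, of "s k"] by simp
qed

lemma squeeze_0:
  fixes f g :: "nat \<Rightarrow> real"
  assumes "\<And>k. 0 \<le> f k" "\<And>k. f k \<le> g k" "g \<longlonglongrightarrow> 0"
  shows "f \<longlonglongrightarrow> 0"
  by (rule tendsto_sandwich[OF _ _ tendsto_const assms(3)]) (simp_all add: assms)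

context prob_space begin

text \<open>The expectation of \<open>min 1 \<bar>Y\<bar>\<close> metrizes convergence in
  probability. In this form it is an L1 convergence, so dominated convergence and the extraction of
  almost surely convergent subsequences apply directly.\<close>

definition null_in_prob :: "(nat \<Rightarrow> 'a \<Rightarrow> real) \<Rightarrow> bool" where
  "null_in_prob Y \<longleftrightarrow> (\<forall>k. Y k \<in> borel_measurable M) \<and>
    (\<lambda>k. expectation (\<lambda>\<omega>. min 1 \<bar>Y k \<omega>\<bar>)) \<longlonglongrightarrow> 0"

lemma integrable_min_1: "Z \<in> borel_measurable M \<Longrightarrow> integrable M (\<lambda>\<omega>. min 1 \<bar>Z \<omega>\<bar> :: real)"
  by (rule integrable_const_bound[of _ 1]) auto

lemma null_in_prob_measurable: "null_in_prob Y \<Longrightarrow> Y k \<in> borel_measurable M"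
  unfolding null_in_prob_def by blast

lemma null_in_prob_bound:
  assumes "null_in_prob Y" "\<And>k. Z k \<in> borel_measurable M" "\<And>k. AE \<omega> in M. \<bar>Z k \<omega>\<bar> \<le> \<bar>Y k \<omega>\<bar>"
  shows "null_in_prob Z"
proof -
  have "expectation (\<lambda>\<omega>. min 1 \<bar>Z k \<omega>\<bar>) \<le> expectation (\<lambda>\<omega>. min 1 \<bar>Y k \<omega>\<bar>)" for k
    using assms(3)[of k]
    by (intro integral_mono_AE integrable_min_1 assms null_in_prob_measurable[OF assms(1)]) auto
  from squeeze_0[OF _ this] assms(1,2) show ?thesis
    unfolding null_in_prob_def by (simp add: integral_nonneg)
qed

lemma null_in_prob_cong_AE:
  assumes "null_in_prob Y" "\<And>k. Z k \<in> borel_measurable M" "\<And>k. AE \<omega> in M. Z k \<omega> = Y k \<omega>"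
  shows "null_in_prob Z"
proof (rule null_in_prob_bound[OF assms(1,2)])
  show "AE \<omega> in M. \<bar>Z k \<omega>\<bar> \<le> \<bar>Y k \<omega>\<bar>" for k using assms(3)[of k] by auto
qed

lemma null_in_prob_uminus: "null_in_prob Y \<Longrightarrow> null_in_prob (\<lambda>k \<omega>. - Y k \<omega>)"
  unfolding null_in_prob_def by simp

lemma null_in_prob_add:
  assumes "null_in_prob Y" "null_in_prob Z"
  shows "null_in_prob (\<lambda>k \<omega>. Y k \<omega> + Z k \<omega>)"
proof -
  note m = null_in_prob_measurable[OF assms(1)] null_in_prob_measurable[OF assms(2)]
  have "expectation (\<lambda>\<omega>. min 1 \<bar>Y k \<omega> + Z k \<omega>\<bar>)
      \<le> expectation (\<lambda>\<omega>. min 1 \<bar>Y k \<omega>\<bar> + min 1 \<bar>Z k \<omega>\<bar>)" for k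
    using m by (intro integral_mono integrable_min_1 Bochner_Integration.integrable_add) auto
  then have le: "expectation (\<lambda>\<omega>. min 1 \<bar>Y k \<omega> + Z k \<omega>\<bar>)
      \<le> expectation (\<lambda>\<omega>. min 1 \<bar>Y k \<omega>\<bar>) + expectation (\<lambda>\<omega>. min 1 \<bar>Z k \<omega>\<bar>)" for k
    using m by (subst (asm) Bochner_Integration.integral_add) (auto intro: integrable_min_1)
  have lim: "(\<lambda>k. expectation (\<lambda>\<omega>. min 1 \<bar>Y k \<omega>\<bar>) + expectation (\<lambda>\<omega>. min 1 \<bar>Z k \<omega>\<bar>)) \<longlonglongrightarrow> 0"
    using assms unfolding null_in_prob_def by (intro tendsto_add_zero) auto
  have "(\<lambda>k. expectation (\<lambda>\<omega>. min 1 \<bar>Y k \<omega> + Z k \<omega>\<bar>)) \<longlonglongrightarrow> 0"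
    by (rule squeeze_0[OF _ le lim]) (simp add: integral_nonneg)
  then show ?thesis using m unfolding null_in_prob_def by simp
qed

lemma null_in_prob_diff:
  "null_in_prob Y \<Longrightarrow> null_in_prob Z \<Longrightarrow> null_in_prob (\<lambda>k \<omega>. Y k \<omega> - Z k \<omega>)"
  using null_in_prob_add[OF _ null_in_prob_uminus, of Y Z] by simp

lemma null_in_prob_AE:
  assumes "\<And>k. Y k \<in> borel_measurable M" "AE \<omega> in M. (\<lambda>k. Y k \<omega>) \<longlonglongrightarrow> 0"
  shows "null_in_prob Y"
proof -
  have "(\<lambda>k. expectation (\<lambda>\<omega>. min 1 \<bar>Y k \<omega>\<bar>)) \<longlonglongrightarrow> expectation (\<lambda>\<omega>. 0)"
  proof (rule integral_dominated_convergence[where w="\<lambda>_. 1"])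
    show "AE \<omega> in M. (\<lambda>k. min 1 \<bar>Y k \<omega>\<bar>) \<longlonglongrightarrow> 0"
      using assms(2)
    proof eventually_elim
      case (elim \<omega>)
      have "(\<lambda>k. min 1 \<bar>Y k \<omega>\<bar>) \<longlonglongrightarrow> min 1 \<bar>0\<bar>"
        by (intro tendsto_intros elim)
      then show ?case by simp
    qed
  qed (use assms in auto)
  then show ?thesis using assms(1) unfolding null_in_prob_def by simp
qed

lemma null_in_prob_subseq: "null_in_prob Y \<Longrightarrow> strict_mono r \<Longrightarrow> null_in_prob (\<lambda>k. Y (r k))"
  unfolding null_in_prob_def using LIMSEQ_subseq_LIMSEQ[of _ 0 r] by (auto simp: comp_def)

lemma null_in_prob_AE_subseq:
  assumes "null_in_prob Y"
  shows "\<exists>r::nat\<Rightarrow>nat. strict_mono r \<and> (AE \<omega> in M. (\<lambda>k. Y (r k) \<omega>) \<longlonglongrightarrow> 0)"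
proof -
  have "\<exists>r::nat\<Rightarrow>nat. strict_mono r \<and> (AE \<omega> in M. (\<lambda>k. min 1 \<bar>Y (r k) \<omega>\<bar>) \<longlonglongrightarrow> 0)"
    using assms unfolding null_in_prob_def
    by (intro tendsto_L1_AE_subseq[of M "\<lambda>k \<omega>. min 1 \<bar>Y k \<omega>\<bar>"]) (auto intro: integrable_min_1)
  then obtain r where r: "strict_mono r" "AE \<omega> in M. (\<lambda>k. min 1 \<bar>Y (r k) \<omega>\<bar>) \<longlonglongrightarrow> 0" by blast
  from r(2) have "AE \<omega> in M. (\<lambda>k. Y (r k) \<omega>) \<longlonglongrightarrow> 0"
  proof eventually_elim
    case (elim \<omega>)
    have "eventually (\<lambda>k. min 1 \<bar>Y (r k) \<omega>\<bar> < 1) sequentially"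
      using order_tendstoD(2)[OF elim, of 1] by simp
    then have "eventually (\<lambda>k. min 1 \<bar>Y (r k) \<omega>\<bar> = \<bar>Y (r k) \<omega>\<bar>) sequentially"
      by eventually_elim auto
    from tendsto_cong[THEN iffD1, OF this elim] show ?case
      by (rule tendsto_rabs_zero_cancel)
  qed
  with r show ?thesis by blast
qed

text \<open>The subsequence criterion. It transfers pathwise limit rules to convergence in
  probability, in particular multiplication by an unbounded random variable and squaring, for which
  there is no direct estimate.\<close>

lemma null_in_prob_by_subseq:
  assumes "\<And>k. Y k \<in> borel_measurable M"
    and "\<And>r. strict_mono (r :: nat \<Rightarrow> nat) \<Longrightarrow>
      \<exists>s. strict_mono (s :: nat \<Rightarrow> nat) \<and> (AE \<omega> in M. (\<lambda>k. Y (r (s k)) \<omega>) \<longlonglongrightarrow> 0)"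
  shows "null_in_prob Y"
  unfolding null_in_prob_def
proof (intro conjI allI assms tendsto_by_subsubseq)
  fix r :: "nat \<Rightarrow> nat" assume "strict_mono r"
  then obtain s where s: "strict_mono (s :: nat \<Rightarrow> nat)" "AE \<omega> in M. (\<lambda>k. Y (r (s k)) \<omega>) \<longlonglongrightarrow> 0"
    using assms(2) by blast
  have "null_in_prob (\<lambda>k. Y (r (s k)))" by (rule null_in_prob_AE[OF assms(1) s(2)])
  with s(1) show "\<exists>s. strict_mono s \<and> (\<lambda>k. expectation (\<lambda>\<omega>. min 1 \<bar>Y (r (s k)) \<omega>\<bar>)) \<longlonglongrightarrow> 0"
    unfolding null_in_prob_def by blast
qed

lemma null_in_prob_mult:
  assumes "null_in_prob Y" "\<xi> \<in> borel_measurable M"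
  shows "null_in_prob (\<lambda>k \<omega>. \<xi> \<omega> * Y k \<omega>)"
proof (rule null_in_prob_by_subseq)
  show "(\<lambda>\<omega>. \<xi> \<omega> * Y k \<omega>) \<in> borel_measurable M" for k
    using assms null_in_prob_measurable by auto
  fix r :: "nat \<Rightarrow> nat" assume "strict_mono r"
  from null_in_prob_AE_subseq[OF null_in_prob_subseq[OF assms(1) this]]
  obtain s where "strict_mono s" "AE \<omega> in M. (\<lambda>k. Y (r (s k)) \<omega>) \<longlonglongrightarrow> 0" by blast
  then show "\<exists>s. strict_mono s \<and> (AE \<omega> in M. (\<lambda>k. \<xi> \<omega> * Y (r (s k)) \<omega>) \<longlonglongrightarrow> 0)"
    by (intro exI[of _ s] conjI) (auto elim!: eventually_mono intro: tendsto_mult_right_zero)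
qed

lemma null_in_prob_sum:
  "finite I \<Longrightarrow> (\<And>i. i \<in> I \<Longrightarrow> null_in_prob (Y i)) \<Longrightarrow> null_in_prob (\<lambda>k \<omega>. \<Sum>i\<in>I. Y i k \<omega>)"
proof (induction I rule: finite_induct)
  case empty
  then show ?case by (simp add: null_in_prob_def)
next
  case (insert i I)
  then show ?case using null_in_prob_add[of "Y i"] by simp
qed

text \<open>The link to \<open>converges_in_prob\<close>: \<open>min 1 \<bar>Y k\<bar>\<close> is at
  most \<open>e / 2\<close> off the event \<open>e / 2 < \<bar>Y k\<bar>\<close> and at most 1 on
  it.\<close>

lemma null_in_probI_prob:
  assumes m: "\<And>k. Y k \<in> borel_measurable M"
    and p: "\<And>\<epsilon>. \<epsilon> > 0 \<Longrightarrow> (\<lambda>k. prob {\<omega> \<in> space M. \<epsilon> < \<bar>Y k \<omega>\<bar>}) \<longlonglongrightarrow> 0"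
  shows "null_in_prob Y"
  unfolding null_in_prob_def
proof (intro conjI allI m)
  show "(\<lambda>k. expectation (\<lambda>\<omega>. min 1 \<bar>Y k \<omega>\<bar>)) \<longlonglongrightarrow> 0"
  proof (rule LIMSEQ_I)
    fix e :: real assume e: "0 < e"
    have le: "expectation (\<lambda>\<omega>. min 1 \<bar>Y k \<omega>\<bar>) \<le> e / 2 + prob {\<omega> \<in> space M. e / 2 < \<bar>Y k \<omega>\<bar>}" for k
    proof -
      have [measurable]: "Y k \<in> borel_measurable M" by (rule m)
      have i: "integrable M (indicat_real {\<omega> \<in> space M. e / 2 < \<bar>Y k \<omega>\<bar>})"
        by (rule integrable_real_indicator) (measurable, simp add: emeasure_eq_measure)
      have "expectation (\<lambda>\<omega>. min 1 \<bar>Y k \<omega>\<bar>) \<le> expectation (\<lambda>\<omega>. e / 2 + indicat_real {\<omega> \<in> space M. e / 2 < \<bar>Y k \<omega>\<bar>} \<omega>)"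
        using e by (intro integral_mono integrable_min_1[OF m] Bochner_Integration.integrable_add[OF integrable_const i])
          (auto simp: indicator_def)
      also have "\<dots> = e / 2 + prob {\<omega> \<in> space M. e / 2 < \<bar>Y k \<omega>\<bar>}"
        by (subst Bochner_Integration.integral_add[OF integrable_const i]) (auto simp: prob_space intro!: arg_cong[of _ _ prob])
      finally show ?thesis .
    qed
    have "eventually (\<lambda>k. prob {\<omega> \<in> space M. e / 2 < \<bar>Y k \<omega>\<bar>} < e / 2) sequentially"
      using order_tendstoD(2)[OF p[of "e/2"], of "e/2"] e by auto
    then have "eventually (\<lambda>k. norm (expectation (\<lambda>\<omega>. min 1 \<bar>Y k \<omega>\<bar>) - 0) < e) sequentially"
    proof eventually_elim
      case (elim k)
      have "0 \<le> expectation (\<lambda>\<omega>. min 1 \<bar>Y k \<omega>\<bar>)" by (rule Bochner_Integration.integral_nonneg) simp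
      then show ?case using le[of k] elim by simp
    qed
    then show "\<exists>no. \<forall>k\<ge>no. norm (expectation (\<lambda>\<omega>. min 1 \<bar>Y k \<omega>\<bar>) - 0) < e"
      by (simp add: eventually_sequentially)
  qed
qed

text \<open>Chebyshev's inequality: convergence to zero in L2 is enough.\<close>

lemma null_in_prob_square:
  assumes "\<And>k. Y k \<in> borel_measurable M" "\<And>k. integrable M (\<lambda>\<omega>. (Y k \<omega>)\<^sup>2)"
    and "(\<lambda>k. expectation (\<lambda>\<omega>. (Y k \<omega>)\<^sup>2)) \<longlonglongrightarrow> 0"
  shows "null_in_prob Y"
proof (rule null_in_probI_prob[OF assms(1)])
  fix e :: real assume e: "e > 0"
  have le: "prob {\<omega> \<in> space M. e < \<bar>Y k \<omega>\<bar>} \<le> expectation (\<lambda>\<omega>. (Y k \<omega>)\<^sup>2) / e\<^sup>2" for k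
  proof -
    have [measurable]: "Y k \<in> borel_measurable M" by (rule assms)
    have "prob {\<omega> \<in> space M. e < \<bar>Y k \<omega>\<bar>} \<le> prob {\<omega> \<in> space M. e\<^sup>2 \<le> (Y k \<omega>)\<^sup>2}"
      using e by (intro finite_measure_mono) (auto intro!: abs_le_square_iff[THEN iffD1])
    also have "\<dots> \<le> expectation (\<lambda>\<omega>. (Y k \<omega>)\<^sup>2) / e\<^sup>2"
      using e assms(2)[of k] by (intro integral_Markov_inequality_measure[where A="{}"]) auto
    finally show ?thesis .
  qed
  have lim: "(\<lambda>k. expectation (\<lambda>\<omega>. (Y k \<omega>)\<^sup>2) / e\<^sup>2) \<longlonglongrightarrow> 0"
    using tendsto_divide[OF assms(3) tendsto_const, of "e\<^sup>2"] e by simp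
  show "(\<lambda>k. prob {\<omega> \<in> space M. e < \<bar>Y k \<omega>\<bar>}) \<longlonglongrightarrow> 0"
    by (rule squeeze_0[OF _ le lim]) simp
qed

end

section \<open>Elementary integrals and their continuity in probability\<close>

text \<open>Elementary integrands: finite sums of processes \<open>\<xi> 1\<^bsub>(u, v]\<^esub>\<close> over arbitrary, possibly
  overlapping intervals. Unlike simple integrands they are closed under addition by concatenation.\<close>

definition elem_integral :: "(real \<Rightarrow> 'a \<Rightarrow> real) \<Rightarrow> (real \<times> real \<times> ('a \<Rightarrow> real)) list \<Rightarrow> 'a \<Rightarrow> real" where
  "elem_integral W es \<omega> = (\<Sum>(u, v, \<xi>)\<leftarrow>es. \<xi> \<omega> * (W v \<omega> - W u \<omega>))"

definition elem_process :: "(real \<times> real \<times> ('a \<Rightarrow> real)) list \<Rightarrow> real \<Rightarrow> 'a \<Rightarrow> real" where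
  "elem_process es s \<omega> = (\<Sum>(u, v, \<xi>)\<leftarrow>es. \<xi> \<omega> * indicator {u<..v} s)"

text \<open>The cells are disjoint, so no cross terms survive. The second conjunct says that the
  process of the first \<open>n\<close> cells is dead after \<open>T n\<close>; this is what kills
  the cross term with the next cell in the induction.\<close>

lemma simple_process_square:
  assumes "\<And>i. i < n \<Longrightarrow> T i \<le> T (Suc i)"
  shows "(simple_process n T \<xi> s \<omega>)\<^sup>2 = (\<Sum>i<n. (\<xi> i \<omega>)\<^sup>2 * indicator {T i<..T (Suc i)} s) \<and>
    (simple_process n T \<xi> s \<omega> \<noteq> 0 \<longrightarrow> s \<le> T n)"
  using assms
proof (induction n)
  case (Suc n)
  let ?t = "\<xi> n \<omega> * indicator {T n<..T (Suc n)} s"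
  have eq: "simple_process (Suc n) T \<xi> s \<omega> = simple_process n T \<xi> s \<omega> + ?t"
    by (simp add: simple_process_def)
  have IH: "(simple_process n T \<xi> s \<omega>)\<^sup>2 = (\<Sum>i<n. (\<xi> i \<omega>)\<^sup>2 * indicator {T i<..T (Suc i)} s)"
    "simple_process n T \<xi> s \<omega> \<noteq> 0 \<Longrightarrow> s \<le> T n" using Suc by auto
  have le: "T n \<le> T (Suc n)" using Suc.prems by auto
  have z: "simple_process n T \<xi> s \<omega> * ?t = 0" using IH(2) by (auto simp: indicator_def)
  have "(simple_process (Suc n) T \<xi> s \<omega>)\<^sup>2 = (simple_process n T \<xi> s \<omega>)\<^sup>2 + 2 * (simple_process n T \<xi> s \<omega> * ?t) + ?t\<^sup>2"
    unfolding eq by (simp add: power2_sum)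
  also have "?t\<^sup>2 = (\<xi> n \<omega>)\<^sup>2 * indicator {T n<..T (Suc n)} s" by (simp add: indicator_def)
  finally have "(simple_process (Suc n) T \<xi> s \<omega>)\<^sup>2 = (\<Sum>i<Suc n. (\<xi> i \<omega>)\<^sup>2 * indicator {T i<..T (Suc i)} s)"
    using z IH(1) by simp
  moreover have "s \<le> T (Suc n)" if "simple_process (Suc n) T \<xi> s \<omega> \<noteq> 0"
  proof (cases "simple_process n T \<xi> s \<omega> = 0")
    case True
    with that show ?thesis unfolding eq by (auto simp: indicator_def split: if_splits)
  qed (use IH(2) le in simp)
  ultimately show ?case by blast
qed (simp add: simple_process_def)

lemma nn_integral_simple_process_square:
  assumes "\<And>i. i < n \<Longrightarrow> T i \<le> T (Suc i)"
  shows "(\<integral>\<^sup>+s. ennreal ((simple_process n T \<xi> s \<omega>)\<^sup>2) \<partial>lborel) = ennreal (\<Sum>i<n. (\<xi> i \<omega>)\<^sup>2 * (T (Suc i) - T i))"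
proof -
  have "(\<integral>\<^sup>+s. ennreal ((simple_process n T \<xi> s \<omega>)\<^sup>2) \<partial>lborel)
      = (\<integral>\<^sup>+s. (\<Sum>i<n. ennreal ((\<xi> i \<omega>)\<^sup>2) * indicator {T i<..T (Suc i)} s) \<partial>lborel)"
  proof (rule nn_integral_cong)
    fix s
    have "ennreal ((simple_process n T \<xi> s \<omega>)\<^sup>2) = ennreal (\<Sum>i<n. (\<xi> i \<omega>)\<^sup>2 * indicator {T i<..T (Suc i)} s)"
      using simple_process_square[of n T \<xi> s \<omega>] assms by presburger
    also have "\<dots> = (\<Sum>i<n. ennreal ((\<xi> i \<omega>)\<^sup>2 * indicator {T i<..T (Suc i)} s))"
      by (rule sum_ennreal[symmetric]) simp
    finally show "ennreal ((simple_process n T \<xi> s \<omega>)\<^sup>2) = (\<Sum>i<n. ennreal ((\<xi> i \<omega>)\<^sup>2) * indicator {T i<..T (Suc i)} s)"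
      by (simp add: ennreal_mult' ennreal_indicator)
  qed
  also have "\<dots> = (\<Sum>i<n. ennreal ((\<xi> i \<omega>)\<^sup>2) * emeasure lborel {T i<..T (Suc i)})"
    by (subst nn_integral_sum) (auto simp: nn_integral_cmult_indicator)
  also have "\<dots> = (\<Sum>i<n. ennreal ((\<xi> i \<omega>)\<^sup>2 * (T (Suc i) - T i)))"
    using assms by (intro sum.cong) (auto simp: ennreal_mult')
  also have "\<dots> = ennreal (\<Sum>i<n. (\<xi> i \<omega>)\<^sup>2 * (T (Suc i) - T i))"
    using assms by (intro sum_ennreal) auto
  finally show ?thesis .
qed

text \<open>The running totals increase, so the kept terms form an initial segment whose total is at
  most \<open>d\<close>. The bound by the full sum is the induction's handle: if the last term is
  kept, the full sum itself is at most \<open>d\<close>.\<close>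

lemma sum_truncated_le:
  fixes q :: "nat \<Rightarrow> real"
  assumes "\<And>i. i < m \<Longrightarrow> 0 \<le> q i" "0 \<le> d"
  shows "(\<Sum>i<m. if (\<Sum>j<Suc i. q j) \<le> d then q i else 0) \<le> d \<and>
    (\<Sum>i<m. if (\<Sum>j<Suc i. q j) \<le> d then q i else 0) \<le> (\<Sum>j<m. q j)"
  using assms
proof (induction m)
  case (Suc m)
  then have "(\<Sum>i<m. if (\<Sum>j<Suc i. q j) \<le> d then q i else 0) \<le> d"
    "(\<Sum>i<m. if (\<Sum>j<Suc i. q j) \<le> d then q i else 0) \<le> (\<Sum>j<m. q j)" "0 \<le> q m"
    by auto
  then show ?case by simp
qed simp

context brownian_motion begin

definition elem_adapted :: "(real \<times> real \<times> ('a \<Rightarrow> real)) list \<Rightarrow> bool" where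
  "elem_adapted es \<longleftrightarrow> (\<forall>(u, v, \<xi>)\<in>set es. 0 \<le> u \<and> u \<le> v \<and> \<xi> \<in> borel_measurable (F u))"

text \<open>Overlapping intervals are cut at the points of a common grid, and on each cell the
  values of the covering intervals add up. The new coefficient on a cell stays adapted because an
  interval covering the cell starts no later than the cell does.\<close>

lemma elem_adapted_grid:
  assumes xs: "sorted xs" "distinct xs" "xs \<noteq> []"
    and es: "elem_adapted es" "\<forall>(u, v, \<xi>)\<in>set es. u \<in> set xs \<and> v \<in> set xs"
  shows "\<exists>\<eta>. (\<forall>i<length xs - 1. \<eta> i \<in> borel_measurable (F (xs ! i))) \<and>
    (\<forall>\<omega>. elem_integral W es \<omega> = simple_integral W (length xs - 1) ((!) xs) \<eta> \<omega>) \<and>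
    (\<forall>s \<omega>. elem_process es s \<omega> = simple_process (length xs - 1) ((!) xs) \<eta> s \<omega>)"
  using es
proof (induction es)
  case Nil
  show ?case by (rule exI[of _ "\<lambda>_ _. 0"]) (simp add: elem_integral_def elem_process_def simple_integral_def simple_process_def)
next
  case (Cons e es)
  obtain u v \<xi> where e: "e = (u, v, \<xi>)" by (cases e)
  let ?N = "length xs - 1"
  obtain \<eta> where \<eta>: "\<And>i. i < ?N \<Longrightarrow> \<eta> i \<in> borel_measurable (F (xs ! i))"
    "\<And>\<omega>. elem_integral W es \<omega> = simple_integral W ?N ((!) xs) \<eta> \<omega>"
    "\<And>s \<omega>. elem_process es s \<omega> = simple_process ?N ((!) xs) \<eta> s \<omega>"
    using Cons by (auto simp: elem_adapted_def)
  obtain i j where ij: "i < length xs" "xs ! i = u" "j < length xs" "xs ! j = v"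
    using Cons.prems(2) by (auto simp: e in_set_conv_nth)
  have uv: "0 \<le> u" "u \<le> v" and \<xi>: "\<xi> \<in> borel_measurable (F u)"
    using Cons.prems(1) by (auto simp: e elem_adapted_def)
  have "i \<le> j"
  proof (rule ccontr)
    assume "\<not> i \<le> j"
    then have "xs ! j < xs ! i" using xs ij sorted_wrt_nth_less[of "(<)" xs j i]
      by (simp add: strict_sorted_iff)
    then show False using ij uv by simp
  qed
  \<comment> \<open>Stated for a general \<open>f\<close>: with \<open>f\<close> the path of
    \<open>W\<close> it yields the integral, with \<open>f t\<close> the indicator of
    \<open>{..t}\<close> at \<open>s\<close> it yields the process.\<close>
  have tele: "(\<Sum>l<?N. (if i \<le> l \<and> l < j then c else 0) * (f (xs ! Suc l) - f (xs ! l))) = c * (f v - f u)"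
    for f :: "real \<Rightarrow> real" and c
  proof -
    have "(\<Sum>l<?N. (if i \<le> l \<and> l < j then c else 0) * (f (xs ! Suc l) - f (xs ! l)))
      = (\<Sum>l\<in>{i..<j}. c * (f (xs ! Suc l) - f (xs ! l)))"
      using ij by (intro sum.mono_neutral_cong_right) auto
    also have "\<dots> = c * (\<Sum>l\<in>{i..<j}. (f (xs ! Suc l) - f (xs ! l)))" by (simp add: sum_distrib_left)
    also have "\<dots> = c * (f v - f u)" using \<open>i \<le> j\<close> ij by (simp add: sum_Suc_diff'[of i j "\<lambda>l. f (xs ! l)"])
    finally show ?thesis .
  qed
  let ?\<eta> = "\<lambda>l \<omega>. \<eta> l \<omega> + (if i \<le> l \<and> l < j then \<xi> \<omega> else 0)"
  have "?\<eta> l \<in> borel_measurable (F (xs ! l))" if "l < ?N" for l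
  proof (cases "i \<le> l \<and> l < j")
    case True
    then have "u \<le> xs ! l" using sorted_nth_mono[OF xs(1), of i l] ij that by auto
    then show ?thesis using \<eta>(1)[OF that] measurable_F_mono[OF _ \<xi>] True by simp
  next
    case False
    then show ?thesis using \<eta>(1)[OF that] by (simp only: if_False add_0_right)
  qed
  moreover have "elem_integral W (e # es) \<omega> = simple_integral W ?N ((!) xs) ?\<eta> \<omega>" for \<omega>
    using \<eta>(2)[of \<omega>] tele[of "\<xi> \<omega>" "\<lambda>t. W t \<omega>"]
    by (simp add: elem_integral_def simple_integral_def e distrib_right sum.distrib)
  moreover have "elem_process (e # es) s \<omega> = simple_process ?N ((!) xs) ?\<eta> s \<omega>" for s \<omega>
  proof -
    have ind: "(indicator {a<..b} s :: real) = indicator {..b} s - indicator {..a} s" if "a \<le> b" for a b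
      using that by (auto simp: indicator_def)
    have "(\<Sum>l<?N. (if i \<le> l \<and> l < j then \<xi> \<omega> else 0) * (indicator {xs ! l<..xs ! Suc l} s :: real))
       = (\<Sum>l<?N. (if i \<le> l \<and> l < j then \<xi> \<omega> else 0) * (indicator {..xs ! Suc l} s - indicator {..xs ! l} s))"
      using sorted_nth_mono[OF xs(1)] by (intro sum.cong) (auto simp: ind)
    also have "\<dots> = \<xi> \<omega> * (indicator {..v} s - indicator {..u} s)" 
      by (rule tele[of "\<xi> \<omega>" "\<lambda>t. indicator {..t} s"])
    also have "\<dots> = \<xi> \<omega> * indicator {u<..v} s" using ind[OF uv(2)] by simp
    finally show ?thesis using \<eta>(3)[of s \<omega>]
      by (simp add: elem_process_def simple_process_def e distrib_right sum.distrib)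
  qed
  ultimately show ?case by (intro exI[of _ ?\<eta>]) simp
qed

text \<open>A Lenglart-type inequality, which controls the integral without second moments of the
  integrand: switch the integrand off before its accumulated squared norm exceeds \<open>d\<close>,
  use the isometry and Chebyshev's inequality for the truncated integral, and pay the probability
  that the truncation acts at all.\<close>

lemma simple_integral_prob_bound:
  assumes T: "0 \<le> T 0" "\<And>i. i < n \<Longrightarrow> T i \<le> T (Suc i)"
    and \<eta>: "\<And>i. i < n \<Longrightarrow> \<eta> i \<in> borel_measurable (F (T i))" and e: "0 < e" "0 < d"
  shows "simple_integral W n T \<eta> \<in> borel_measurable M \<and> (\<lambda>\<omega>. \<Sum>i<n. (\<eta> i \<omega>)\<^sup>2 * (T (Suc i) - T i)) \<in> borel_measurable M \<and>
    prob {\<omega> \<in> space M. e < \<bar>simple_integral W n T \<eta> \<omega>\<bar>} \<le>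
    prob {\<omega> \<in> space M. d < (\<Sum>i<n. (\<eta> i \<omega>)\<^sup>2 * (T (Suc i) - T i))} + d / e\<^sup>2"
proof (intro conjI)
  have T0: "0 \<le> T i" if "i \<le> n" for i
    using that T by (induction i) (auto intro: order_trans)
  have mono: "T j \<le> T i" if "j \<le> i" "i \<le> n" for i j
    using that
  proof (induction i rule: dec_induct)
    case (step m)
    then show ?case using T(2)[of m] by linarith
  qed simp
  have \<eta>M[measurable]: "\<eta> i \<in> borel_measurable M" if "i < n" for i
    using measurable_F_M[OF _ \<eta>[OF that]] T0 that by simp
  have W'[measurable]: "W (T i) \<in> borel_measurable M" if "i \<le> n" for i
    using W_measurable T0 that by simp
  show int: "simple_integral W n T \<eta> \<in> borel_measurable M"
    unfolding simple_integral_def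
    by (intro borel_measurable_sum borel_measurable_times borel_measurable_diff) auto
  show S: "(\<lambda>\<omega>. \<Sum>i<n. (\<eta> i \<omega>)\<^sup>2 * (T (Suc i) - T i)) \<in> borel_measurable M"
    by (intro borel_measurable_sum borel_measurable_times) auto
  define q where "q i \<omega> = (\<eta> i \<omega>)\<^sup>2 * (T (Suc i) - T i)" for i \<omega>
  \<comment> \<open>The norm accumulated through cell \<open>i\<close> is already known at the left
    end \<open>T i\<close>, so the truncation is adapted. Cells of length zero are switched off too:
    they contribute nothing to the accumulated norm, which therefore would not bound their
    coefficient.\<close>
  define \<zeta> where "\<zeta> i \<omega> = (if T i < T (Suc i) \<and> (\<Sum>j<Suc i. q j \<omega>) \<le> d then \<eta> i \<omega> else 0)" for i \<omega>
  have q0: "0 \<le> q i \<omega>" if "i < n" for i \<omega> using T(2)[OF that] by (simp add: q_def)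
  have \<zeta>m: "\<zeta> i \<in> borel_measurable (F (T i))" if "i < n" for i
  proof -
    have [measurable]: "\<eta> j \<in> borel_measurable (F (T i))" if "j \<le> i" for j
      using \<open>i < n\<close> that by (intro measurable_F_mono[OF mono \<eta>]) auto
    have [measurable]: "(\<lambda>\<omega>. \<Sum>j<Suc i. q j \<omega>) \<in> borel_measurable (F (T i))"
      unfolding q_def by (intro borel_measurable_sum) auto
    have [measurable]: "\<eta> i \<in> borel_measurable (F (T i))" by (rule \<eta>[OF that])
    show ?thesis unfolding \<zeta>_def by measurable
  qed
  have \<zeta>q: "(\<zeta> i \<omega>)\<^sup>2 * (T (Suc i) - T i) = (if (\<Sum>j<Suc i. q j \<omega>) \<le> d then q i \<omega> else 0)" if "i < n" for i \<omega>
    using T(2)[OF that] unfolding \<zeta>_def by (auto simp: q_def)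
  have \<zeta>b: "\<exists>K. \<forall>\<omega>\<in>space M. \<bar>\<zeta> i \<omega>\<bar> \<le> K" if i: "i < n" for i
  proof (cases "T i < T (Suc i)")
    case True
    have "\<bar>\<zeta> i \<omega>\<bar> \<le> sqrt (d / (T (Suc i) - T i))" for \<omega>
    proof (rule real_le_rsqrt)
      have "(\<zeta> i \<omega>)\<^sup>2 * (T (Suc i) - T i) \<le> d"
        unfolding \<zeta>q[OF i]
      proof (cases "(\<Sum>j<Suc i. q j \<omega>) \<le> d")
        case True
        moreover have "q i \<omega> \<le> (\<Sum>j<Suc i. q j \<omega>)" using q0 i by (intro member_le_sum) auto
        ultimately show "(if (\<Sum>j<Suc i. q j \<omega>) \<le> d then q i \<omega> else 0) \<le> d" by simp
      qed (use e in simp)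
      then show "\<bar>\<zeta> i \<omega>\<bar>\<^sup>2 \<le> d / (T (Suc i) - T i)"
        using True by (simp add: field_simps)
    qed
    then show ?thesis by blast
  next
    case False
    then show ?thesis by (intro exI[of _ 0]) (simp add: \<zeta>_def)
  qed
  have mom: "has_bochner_integral M (\<lambda>\<omega>. W (T (Suc i)) \<omega> - W (T i) \<omega>) 0"
     "has_bochner_integral M (\<lambda>\<omega>. (W (T (Suc i)) \<omega> - W (T i) \<omega>)\<^sup>2) (T (Suc i) - T i)" if "i < n" for i
  proof -
    have "T i < T (Suc i) \<or> T (Suc i) = T i" using T(2)[OF that] by linarith
    then show "has_bochner_integral M (\<lambda>\<omega>. W (T (Suc i)) \<omega> - W (T i) \<omega>) 0"
     "has_bochner_integral M (\<lambda>\<omega>. (W (T (Suc i)) \<omega> - W (T i) \<omega>)\<^sup>2) (T (Suc i) - T i)"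
      using increment_moments(1,2)[OF T0[OF less_imp_le[OF that]]] by (auto simp: has_bochner_integral_zero)
  qed
  have iso: "has_bochner_integral M (\<lambda>\<omega>. (simple_integral W n T \<zeta> \<omega>)\<^sup>2)
      (\<Sum>i<n. expectation (\<lambda>\<omega>. (\<zeta> i \<omega>)\<^sup>2) * (T (Suc i) - T i))"
    using expectation_square_sum_increments[where f="\<lambda>_ x. x", OF T \<zeta>m \<zeta>b _ mom]
    by (simp add: simple_integral_def)
  have i\<zeta>: "integrable M (\<lambda>\<omega>. (\<zeta> i \<omega>)\<^sup>2)" if i: "i < n" for i
  proof -
    obtain K where K: "\<And>\<omega>. \<omega>\<in>space M \<Longrightarrow> \<bar>\<zeta> i \<omega>\<bar> \<le> K" using \<zeta>b[OF i] by auto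
    show ?thesis
    proof (rule integrable_const_bound[of _ "K^2"])
      show "AE \<omega> in M. norm ((\<zeta> i \<omega>)\<^sup>2) \<le> K\<^sup>2"
        using power_mono[OF K abs_ge_zero, of _ 2] by (intro AE_I2) simp
    qed (use measurable_F_M[OF T0 \<zeta>m[OF i]] i in simp)
  qed
  have "(\<Sum>i<n. expectation (\<lambda>\<omega>. (\<zeta> i \<omega>)\<^sup>2) * (T (Suc i) - T i))
     = expectation (\<lambda>\<omega>. \<Sum>i<n. (\<zeta> i \<omega>)\<^sup>2 * (T (Suc i) - T i))"
    using i\<zeta> by (subst Bochner_Integration.integral_sum) auto
  also have "\<dots> \<le> expectation (\<lambda>\<omega>. d)"
  proof (rule integral_mono)
    show "integrable M (\<lambda>\<omega>. \<Sum>i<n. (\<zeta> i \<omega>)\<^sup>2 * (T (Suc i) - T i))" using i\<zeta> by auto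
    show "(\<Sum>i<n. (\<zeta> i \<omega>)\<^sup>2 * (T (Suc i) - T i)) \<le> d" for \<omega>
    proof -
      have "(\<Sum>i<n. (\<zeta> i \<omega>)\<^sup>2 * (T (Suc i) - T i)) = (\<Sum>i<n. if (\<Sum>j<Suc i. q j \<omega>) \<le> d then q i \<omega> else 0)"
        using \<zeta>q by (intro sum.cong) (simp_all only: lessThan_iff)
      also have "\<dots> \<le> d" using sum_truncated_le[of n "\<lambda>i. q i \<omega>" d, OF q0] e by simp
      finally show ?thesis .
    qed
  qed simp
  finally have le: "(\<Sum>i<n. expectation (\<lambda>\<omega>. (\<zeta> i \<omega>)\<^sup>2) * (T (Suc i) - T i)) \<le> d" by (simp add: prob_space)
  \<comment> \<open>If the total does not exceed \<open>d\<close>, no partial total does, so the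
    truncation has changed nothing except on cells of length zero, where the increment
    vanishes.\<close>
  have eq: "simple_integral W n T \<zeta> \<omega> = simple_integral W n T \<eta> \<omega>" if "(\<Sum>i<n. q i \<omega>) \<le> d" for \<omega>
    unfolding simple_integral_def
  proof (rule sum.cong[OF refl])
    fix i assume i: "i \<in> {..<n}"
    then have "(\<Sum>j<Suc i. q j \<omega>) \<le> (\<Sum>i<n. q i \<omega>)" using q0 by (intro sum_mono2) auto
    then show "\<zeta> i \<omega> * (W (T (Suc i)) \<omega> - W (T i) \<omega>) = \<eta> i \<omega> * (W (T (Suc i)) \<omega> - W (T i) \<omega>)"
      using T(2)[of i] i that by (cases "T i < T (Suc i)") (auto simp: \<zeta>_def)
  qed
  have \<zeta>int[measurable]: "simple_integral W n T \<zeta> \<in> borel_measurable M"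
    unfolding simple_integral_def using measurable_F_M[OF T0 \<zeta>m]
    by (intro borel_measurable_sum borel_measurable_times borel_measurable_diff) auto
  note [measurable] = int S
  have "prob {\<omega> \<in> space M. e < \<bar>simple_integral W n T \<eta> \<omega>\<bar>} \<le>
    prob ({\<omega> \<in> space M. d < (\<Sum>i<n. (\<eta> i \<omega>)\<^sup>2 * (T (Suc i) - T i))} \<union> {\<omega> \<in> space M. e\<^sup>2 \<le> (simple_integral W n T \<zeta> \<omega>)\<^sup>2})"
  proof (rule finite_measure_mono)
    show "{\<omega> \<in> space M. e < \<bar>simple_integral W n T \<eta> \<omega>\<bar>} \<subseteq>
      {\<omega> \<in> space M. d < (\<Sum>i<n. (\<eta> i \<omega>)\<^sup>2 * (T (Suc i) - T i))} \<union> {\<omega> \<in> space M. e\<^sup>2 \<le> (simple_integral W n T \<zeta> \<omega>)\<^sup>2}"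
    proof
      fix \<omega> assume \<omega>: "\<omega> \<in> {\<omega> \<in> space M. e < \<bar>simple_integral W n T \<eta> \<omega>\<bar>}"
      show "\<omega> \<in> {\<omega> \<in> space M. d < (\<Sum>i<n. (\<eta> i \<omega>)\<^sup>2 * (T (Suc i) - T i))} \<union> {\<omega> \<in> space M. e\<^sup>2 \<le> (simple_integral W n T \<zeta> \<omega>)\<^sup>2}"
      proof (cases "(\<Sum>i<n. q i \<omega>) \<le> d")
        case True
        then show ?thesis using \<omega> e eq[OF True] abs_le_square_iff[of e "simple_integral W n T \<zeta> \<omega>"] by auto
      next
        case False
        then show ?thesis using \<omega> by (simp add: q_def)
      qed
    qed
  qed measurable
  also have "\<dots> \<le> prob {\<omega> \<in> space M. d < (\<Sum>i<n. (\<eta> i \<omega>)\<^sup>2 * (T (Suc i) - T i))} + prob {\<omega> \<in> space M. e\<^sup>2 \<le> (simple_integral W n T \<zeta> \<omega>)\<^sup>2}"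
    by (rule measure_Un_le) measurable
  also have "prob {\<omega> \<in> space M. e\<^sup>2 \<le> (simple_integral W n T \<zeta> \<omega>)\<^sup>2} \<le> d / e\<^sup>2"
  proof -
    have "prob {\<omega> \<in> space M. e\<^sup>2 \<le> (simple_integral W n T \<zeta> \<omega>)\<^sup>2} \<le> expectation (\<lambda>\<omega>. (simple_integral W n T \<zeta> \<omega>)\<^sup>2) / e\<^sup>2"
      using e iso by (intro integral_Markov_inequality_measure[where A="{}"]) (auto simp: has_bochner_integral_iff)
    also have "\<dots> \<le> d / e\<^sup>2" using le iso by (intro divide_right_mono) (auto simp: has_bochner_integral_iff)
    finally show ?thesis .
  qed
  finally show "prob {\<omega> \<in> space M. e < \<bar>simple_integral W n T \<eta> \<omega>\<bar>} \<le>
    prob {\<omega> \<in> space M. d < (\<Sum>i<n. (\<eta> i \<omega>)\<^sup>2 * (T (Suc i) - T i))} + d / e\<^sup>2" by simp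
qed

text \<open>Elementary integrals are continuous in probability with respect to the time-\<open>L\<^sup>2\<close> norm of the
  integrand; hence the Ito integral does not depend on the approximating sequence.\<close>

lemma elem_integral_null_in_prob:
  assumes es: "\<And>k. elem_adapted (es k)"
    and R: "\<And>k. R k \<in> borel_measurable M"
      "\<And>k \<omega>. \<omega> \<in> space M \<Longrightarrow> (\<integral>\<^sup>+s. ennreal ((elem_process (es k) s \<omega>)\<^sup>2) \<partial>lborel) \<le> R k \<omega>"
      "\<And>d. 0 < d \<Longrightarrow> (\<lambda>k. prob {\<omega> \<in> space M. ennreal d < R k \<omega>}) \<longlonglongrightarrow> 0"
  shows "null_in_prob (\<lambda>k. elem_integral W (es k))"
proof -
  have key: "elem_integral W (es k) \<in> borel_measurable M \<and>
    (\<forall>e d. 0 < e \<longrightarrow> 0 < d \<longrightarrow> prob {\<omega> \<in> space M. e < \<bar>elem_integral W (es k) \<omega>\<bar>} \<le> prob {\<omega> \<in> space M. ennreal d < R k \<omega>} + d / e\<^sup>2)" for k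
  proof -
    \<comment> \<open>Inserting 0 among the end points keeps the grid nonempty even when
      \<open>es k\<close> is the empty list.\<close>
    define xs where "xs = sorted_list_of_set (insert 0 (\<Union>(u, v, \<xi>)\<in>set (es k). {u, v}))"
    have fin: "finite (insert 0 (\<Union>(u, v, \<xi>)\<in>set (es k). {u, v}))" by auto
    have xs: "sorted xs" "distinct xs" "set xs = insert 0 (\<Union>(u, v, \<xi>)\<in>set (es k). {u, v})"
      unfolding xs_def by (rule sorted_sorted_list_of_set, rule distinct_sorted_list_of_set, rule set_sorted_list_of_set[OF fin])
    then have ne: "xs \<noteq> []" by auto
    have "\<forall>(u, v, \<xi>)\<in>set (es k). u \<in> set xs \<and> v \<in> set xs" using xs(3) by fastforce
    from elem_adapted_grid[OF xs(1,2) ne es this] obtain \<eta> where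
      \<eta>: "\<And>i. i < length xs - 1 \<Longrightarrow> \<eta> i \<in> borel_measurable (F (xs ! i))"
        "\<And>\<omega>. elem_integral W (es k) \<omega> = simple_integral W (length xs - 1) ((!) xs) \<eta> \<omega>"
        "\<And>s \<omega>. elem_process (es k) s \<omega> = simple_process (length xs - 1) ((!) xs) \<eta> s \<omega>" by blast
    have "\<forall>x\<in>set xs. 0 \<le> x" using es[of k] xs(3) by (fastforce simp: elem_adapted_def)
    then have 0: "0 \<le> xs ! 0" using ne by simp
    have mono: "xs ! i \<le> xs ! Suc i" if "i < length xs - 1" for i
      using sorted_nth_mono[OF xs(1), of i "Suc i"] that by auto
    let ?S = "\<lambda>\<omega>. \<Sum>i<length xs - 1. (\<eta> i \<omega>)\<^sup>2 * (xs ! Suc i - xs ! i)"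
    note b = simple_integral_prob_bound[of "(!) xs" "length xs - 1" \<eta>, OF 0 mono \<eta>(1), simplified]
    have fun_eq: "elem_integral W (es k) = simple_integral W (length xs - 1) ((!) xs) \<eta>"
      using \<eta>(2) by (rule ext)
    have "prob {\<omega> \<in> space M. e < \<bar>elem_integral W (es k) \<omega>\<bar>} \<le> prob {\<omega> \<in> space M. ennreal d < R k \<omega>} + d / e\<^sup>2"
      if "0 < e" "0 < d" for e d
    proof -
      have "prob {\<omega> \<in> space M. e < \<bar>elem_integral W (es k) \<omega>\<bar>} \<le> prob {\<omega> \<in> space M. d < ?S \<omega>} + d / e\<^sup>2"
        using b[OF that] by (simp add: fun_eq)
      also have "prob {\<omega> \<in> space M. d < ?S \<omega>} \<le> prob {\<omega> \<in> space M. ennreal d < R k \<omega>}"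
      proof (rule finite_measure_mono)
        show "{\<omega> \<in> space M. d < ?S \<omega>} \<subseteq> {\<omega> \<in> space M. ennreal d < R k \<omega>}"
        proof safe
          fix \<omega> assume \<omega>: "\<omega> \<in> space M" "d < ?S \<omega>"
          have "ennreal d < ennreal (?S \<omega>)" using \<omega>(2) that by (simp add: ennreal_lessI)
          also have "\<dots> \<le> R k \<omega>" using R(2)[OF \<omega>(1), of k] nn_integral_simple_process_square[of "length xs - 1" "(!) xs" \<eta> \<omega>, OF mono]
            by (simp add: \<eta>(3))
          finally show "ennreal d < R k \<omega>" .
        qed
        show "{\<omega> \<in> space M. ennreal d < R k \<omega>} \<in> events" using R(1)[of k] by measurable
      qed
      finally show ?thesis by simp
    qed
    then show ?thesis using b[of 1 1] fun_eq by simp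
  qed
  show ?thesis
  proof (rule null_in_probI_prob)
    show "elem_integral W (es k) \<in> borel_measurable M" for k using key by blast
    fix e :: real assume e: "0 < e"
    show "(\<lambda>k. prob {\<omega> \<in> space M. e < \<bar>elem_integral W (es k) \<omega>\<bar>}) \<longlonglongrightarrow> 0"
    proof (rule LIMSEQ_I)
      fix r :: real assume r: "0 < r"
      define d where "d = r * e\<^sup>2 / 2"
      have d: "0 < d" "d / e\<^sup>2 = r / 2" using r e by (auto simp: d_def)
      have "eventually (\<lambda>k. prob {\<omega> \<in> space M. ennreal d < R k \<omega>} < r / 2) sequentially"
        using order_tendstoD(2)[OF R(3)[OF d(1)], of "r/2"] r by auto
      then have "eventually (\<lambda>k. norm (prob {\<omega> \<in> space M. e < \<bar>elem_integral W (es k) \<omega>\<bar>} - 0) < r) sequentially"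
      proof eventually_elim
        case (elim k)
        have "prob {\<omega> \<in> space M. e < \<bar>elem_integral W (es k) \<omega>\<bar>} \<le> prob {\<omega> \<in> space M. ennreal d < R k \<omega>} + d / e\<^sup>2"
          using key e d by blast
        then have "prob {\<omega> \<in> space M. e < \<bar>elem_integral W (es k) \<omega>\<bar>} < r" using elim d(2) by linarith
        then show ?case by simp
      qed
      then show "\<exists>no. \<forall>k\<ge>no. norm (prob {\<omega> \<in> space M. e < \<bar>elem_integral W (es k) \<omega>\<bar>} - 0) < r"
        by (simp add: eventually_sequentially)
    qed
  qed
qed

end

section \<open>Ito integrals of continuous integrands as limits of Riemann sums\<close>

lemma elem_integral_append: "elem_integral W (es @ fs) \<omega> = elem_integral W es \<omega> + elem_integral W fs \<omega>"
  by (simp add: elem_integral_def)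

lemma elem_process_append: "elem_process (es @ fs) s \<omega> = elem_process es s \<omega> + elem_process fs s \<omega>"
  by (simp add: elem_process_def)

text \<open>The factor \<open>c\<close> turns subtraction into concatenation: a difference of simple
  integrals is the elementary integral of a list whose second part is built with
  \<open>c = -1\<close>.\<close>

definition elem_of_simple :: "real \<Rightarrow> nat \<Rightarrow> (nat \<Rightarrow> real) \<Rightarrow> (nat \<Rightarrow> 'a \<Rightarrow> real) \<Rightarrow> (real \<times> real \<times> ('a \<Rightarrow> real)) list" where
  "elem_of_simple c n T \<xi> = map (\<lambda>i. (T i, T (Suc i), \<lambda>\<omega>. c * \<xi> i \<omega>)) [0..<n]"

lemma elem_of_simple:
  shows "elem_integral W (elem_of_simple c n T \<xi>) \<omega> = c * simple_integral W n T \<xi> \<omega>"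
    and "elem_process (elem_of_simple c n T \<xi>) s \<omega> = c * simple_process n T \<xi> s \<omega>"
  unfolding elem_of_simple_def elem_integral_def elem_process_def simple_integral_def simple_process_def
  by (simp_all add: comp_def sum_list_distinct_conv_sum_set atLeast0LessThan sum_distrib_left mult.assoc del: sum_mult_indicator sum_indicator_mult)

lemma simple_process_measurable_time [measurable]:
  "(\<lambda>s. simple_process n T \<xi> s \<omega>) \<in> borel_measurable borel"
  unfolding simple_process_def by measurable

lemma nn_integral_cmult_add3:
  assumes "f \<in> borel_measurable N" "g \<in> borel_measurable N" "h \<in> borel_measurable N"
  shows "(\<integral>\<^sup>+x. c * (f x + g x + h x) \<partial>N) = c * ((\<integral>\<^sup>+x. f x \<partial>N) + (\<integral>\<^sup>+x. g x \<partial>N) + (\<integral>\<^sup>+x. h x \<partial>N))"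
  using assms by (simp add: nn_integral_cmult nn_integral_add)

lemma simple_process_outside:
  assumes "\<And>i. i \<le> n \<Longrightarrow> T i \<in> {a..b}" "s \<le> a \<or> b < s"
  shows "simple_process n T \<xi> s \<omega> = 0"
  unfolding simple_process_def
proof (rule sum.neutral, rule ballI)
  fix i assume "i \<in> {..<n}"
  then have "T i \<in> {a..b}" "T (Suc i) \<in> {a..b}" using assms(1) by auto
  then show "\<xi> i \<omega> * indicator {T i<..T (Suc i)} s = 0"
    using assms(2) by (auto simp: indicator_def)
qed

lemma simple_process_eq:
  assumes "\<And>i j. i \<le> j \<Longrightarrow> j \<le> n \<Longrightarrow> T i \<le> T j" "i < n" "s \<in> {T i<..T (Suc i)}"
  shows "simple_process n T \<xi> s \<omega> = \<xi> i \<omega>"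
proof -
  have "simple_process n T \<xi> s \<omega> = (\<Sum>l<n. if l = i then \<xi> i \<omega> else 0)"
    unfolding simple_process_def
  proof (rule sum.cong[OF refl])
    fix l assume l: "l \<in> {..<n}"
    consider "l < i" | "i < l" | "l = i" by linarith
    then show "\<xi> l \<omega> * indicator {T l<..T (Suc l)} s = (if l = i then \<xi> i \<omega> else 0)"
    proof cases
      case 1
      then have "T (Suc l) \<le> T i" using assms by auto
      then show ?thesis using assms(3) 1 by auto
    next
      case 2
      then have "T (Suc i) \<le> T l" using assms l by auto
      then show ?thesis using assms(3) 2 by auto
    qed (use assms(3) in simp)
  qed
  then show ?thesis using assms(2) by simp
qed

lemma uniform_grid_cell:
  fixes s s' r :: real and m :: nat
  assumes "s < r" "r \<le> s'"
  defines "g \<equiv> \<lambda>j. s + real j * ((s' - s) / real (Suc m))"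
  shows "\<exists>j<Suc m. r \<in> {g j<..g (Suc j)}"
proof -
  define h where "h = (s' - s) / real (Suc m)"
  have h: "h > 0" using assms by (simp add: h_def)
  \<comment> \<open>The cells are open on the left and closed on the right, hence the ceiling minus
    one and not the floor.\<close>
  define j where "j = nat (\<lceil>(r - s) / h\<rceil> - 1)"
  have pos: "0 < (r - s) / h" using h assms by simp
  then have c: "0 < \<lceil>(r - s) / h\<rceil>" by simp
  then have j: "real j = \<lceil>(r - s) / h\<rceil> - 1" by (simp add: j_def)
  have "real j < (r - s) / h" "(r - s) / h \<le> real (Suc j)" using j by linarith+
  then have 1: "s + real j * h < r" "r \<le> s + real (Suc j) * h" using h by (simp_all add: field_simps)
  moreover have "j < Suc m"
  proof -
    have "real (Suc m) * h = s' - s" by (simp add: h_def)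
    then have "real j * h < real (Suc m) * h" using 1 assms by linarith
    then show ?thesis using h by simp
  qed
  ultimately show ?thesis unfolding g_def h_def by auto
qed

lemma uniform_grid_mono:
  fixes s s' :: real
  assumes "s \<le> s'" "i \<le> j"
  shows "s + real i * ((s' - s) / real (Suc m)) \<le> s + real j * ((s' - s) / real (Suc m))"
  using assms by (intro add_left_mono mult_right_mono) auto

lemma uniform_grid_last: "s + real (Suc m) * ((s' - s) / real (Suc m)) = (s' :: real)"
  by simp

lemma uniform_grid_in:
  fixes s s' :: real
  assumes "s \<le> s'" "j \<le> Suc m"
  shows "s + real j * ((s' - s) / real (Suc m)) \<in> {s..s'}"
  using uniform_grid_mono[OF assms, of m] uniform_grid_mono[OF assms(1), of 0 j m] uniform_grid_last[of s m s'] by auto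

text \<open>Dominated convergence for indicators; it turns statements about single paths, such as
  uniform continuity, into probabilities tending to zero.\<close>

lemma (in prob_space) prob_tendsto_0:
  fixes f :: "nat \<Rightarrow> 'a \<Rightarrow> bool"
  assumes [measurable]: "\<And>k. Measurable.pred M (f k)"
    and ev: "\<And>\<omega>. \<omega> \<in> space M \<Longrightarrow> eventually (\<lambda>k. \<not> f k \<omega>) sequentially"
  shows "(\<lambda>k. prob {\<omega> \<in> space M. f k \<omega>}) \<longlonglongrightarrow> 0"
proof -
  have "(\<lambda>k. expectation (\<lambda>\<omega>. indicat_real {\<omega> \<in> space M. f k \<omega>} \<omega>)) \<longlonglongrightarrow> expectation (\<lambda>\<omega>. 0)"
  proof (rule integral_dominated_convergence[where w="\<lambda>_. 1"])
    show "AE \<omega> in M. (\<lambda>k. indicat_real {\<omega> \<in> space M. f k \<omega>} \<omega>) \<longlonglongrightarrow> 0"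
    proof (rule AE_I2)
      fix \<omega> assume "\<omega> \<in> space M"
      then have "eventually (\<lambda>k. indicat_real {\<omega> \<in> space M. f k \<omega>} \<omega> = 0) sequentially"
        using ev[of \<omega>] by (auto elim!: eventually_mono)
      then show "(\<lambda>k. indicat_real {\<omega> \<in> space M. f k \<omega>} \<omega>) \<longlonglongrightarrow> 0"
        by (rule tendsto_eventually)
    qed
  qed (auto simp: indicator_def)
  moreover have "{\<omega> \<in> space M. f k \<omega>} \<inter> space M = {\<omega> \<in> space M. f k \<omega>}" for k by blast
  ultimately show ?thesis by simp
qed

context brownian_motion begin

lemma elem_adapted_append: "elem_adapted (es @ fs) \<longleftrightarrow> elem_adapted es \<and> elem_adapted fs"
  unfolding elem_adapted_def set_append ball_Un by (rule refl)

lemma elem_adapted_of_simple: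
  assumes "\<And>i. i < n \<Longrightarrow> 0 \<le> T i \<and> T i \<le> T (Suc i) \<and> \<xi> i \<in> borel_measurable (F (T i))"
  shows "elem_adapted (elem_of_simple c n T \<xi>)"
  using assms by (auto simp: elem_adapted_def elem_of_simple_def intro!: borel_measurable_times)

lemma measurable_ident_F: "0 \<le> r \<Longrightarrow> (\<lambda>\<omega>. \<omega>) \<in> measurable M (F r)"
  using measurable_from_subalg[OF subalgebra_F measurable_ident] by (simp add: id_def)

text \<open>Progressive measurability concerns times in \<open>{a..r}\<close> only. Clamping the
  time gives a function on the full product with \<open>lborel\<close>, to which the measurability
  of parameter integrals applies, and it changes nothing on \<open>{a..r}\<close>.\<close>

lemma measurable_clamped_integrand:
  assumes ar: "0 \<le> a" "a \<le> r"
    and H: "(\<lambda>(s, \<omega>). H s \<omega>) \<in> borel_measurable (restrict_space borel {a..r} \<Otimes>\<^sub>M F r)"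
  shows "(\<lambda>x. H (max a (min r (snd x))) (fst x)) \<in> borel_measurable (M \<Otimes>\<^sub>M lborel)"
proof -
  have cl: "(\<lambda>s. max a (min r s)) \<in> measurable borel (restrict_space borel {a..r})"
    using ar by (intro measurable_restrict_space2) auto
  have "(\<lambda>x. (max a (min r (snd x)), fst x)) \<in> measurable (M \<Otimes>\<^sub>M lborel) (restrict_space borel {a..r} \<Otimes>\<^sub>M F r)"
  proof (rule measurable_Pair)
    have "snd \<in> borel_measurable (M \<Otimes>\<^sub>M lborel)" using measurable_snd[of M lborel] by simp
    then show "(\<lambda>x. max a (min r (snd x))) \<in> measurable (M \<Otimes>\<^sub>M lborel) (restrict_space borel {a..r})"
      by (rule measurable_compose[OF _ cl])
    show "fst \<in> measurable (M \<Otimes>\<^sub>M lborel) (F r)"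
      using measurable_compose[OF measurable_fst[of M lborel] measurable_ident_F[of r]] ar by simp
  qed
  from measurable_compose[OF this H] show ?thesis by simp
qed

lemma measurable_time_L2_distance:
  assumes ar: "0 \<le> a" "a \<le> r" and sub: "a \<le> c" "d \<le> r"
    and H: "(\<lambda>(s, \<omega>). H s \<omega>) \<in> borel_measurable (restrict_space borel {a..r} \<Otimes>\<^sub>M F r)"
    and \<xi>: "\<And>i. i < n \<Longrightarrow> \<xi> i \<in> borel_measurable M"
  shows "(\<lambda>\<omega>. \<integral>\<^sup>+s\<in>{c..d}. ennreal ((simple_process n T \<xi> s \<omega> - H s \<omega>)\<^sup>2) \<partial>lborel) \<in> borel_measurable M"
proof -
  note [measurable] = measurable_clamped_integrand[OF ar H]
  have [measurable]: "\<xi> i \<in> borel_measurable M" if "i < n" for i by (rule \<xi>[OF that])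
  have [measurable]: "(\<lambda>x. simple_process n T \<xi> (snd x) (fst x)) \<in> borel_measurable (M \<Otimes>\<^sub>M lborel)"
    unfolding simple_process_def by (intro borel_measurable_sum borel_measurable_times) auto
  have "(\<lambda>\<omega>. \<integral>\<^sup>+s. ennreal ((simple_process n T \<xi> s \<omega> - H (max a (min r s)) \<omega>)\<^sup>2) * indicator {c..d} s \<partial>lborel) \<in> borel_measurable M"
    by (intro lborel.borel_measurable_nn_integral) (simp add: case_prod_unfold, measurable)
  moreover have "(\<integral>\<^sup>+s. ennreal ((simple_process n T \<xi> s \<omega> - H (max a (min r s)) \<omega>)\<^sup>2) * indicator {c..d} s \<partial>lborel)
     = (\<integral>\<^sup>+s\<in>{c..d}. ennreal ((simple_process n T \<xi> s \<omega> - H s \<omega>)\<^sup>2) \<partial>lborel)" for \<omega>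
  proof (rule nn_integral_cong)
    fix s
    have "max a (min r s) = s" if "s \<in> {c..d}" using that sub by (simp add: min_absorb2 max_absorb2)
    then show "ennreal ((simple_process n T \<xi> s \<omega> - H (max a (min r s)) \<omega>)\<^sup>2) * indicator {c..d} s =
      ennreal ((simple_process n T \<xi> s \<omega> - H s \<omega>)\<^sup>2) * indicator {c..d} s"
      by (cases "s \<in> {c..d}") auto
  qed
  ultimately show ?thesis by simp
qed

text \<open>The approximants of \<open>I'\<close>, minus those of \<open>I\<close>, minus the
  Riemann sums, form one elementary integral. Its process is small in time-L2: up to
  \<open>s\<close> the first two approximate the same \<open>H\<close>, after \<open>s\<close> the
  first and the last do. So additivity in the interval and convergence of Riemann sums are obtained
  at once. \<open>H\<close> has to agree with the continuous \<open>Y\<close> only before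
  \<open>s'\<close>, as the perturbed control may jump at \<open>s'\<close>.\<close>

lemma ito_integral_Riemann_sums:
  assumes t: "0 \<le> t" "t \<le> s" "s < s'"
    and I: "has_ito_integral M F W H t s I" and I': "has_ito_integral M F W H t s' I'"
    and Y: "\<And>r. s \<le> r \<Longrightarrow> r \<le> s' \<Longrightarrow> Y r \<in> borel_measurable (F r)"
      "\<And>\<omega>. \<omega> \<in> space M \<Longrightarrow> continuous_on {s..s'} (\<lambda>r. Y r \<omega>)"
    and H: "\<And>r \<omega>. \<omega> \<in> space M \<Longrightarrow> s \<le> r \<Longrightarrow> r < s' \<Longrightarrow> H r \<omega> = Y r \<omega>"
  shows "null_in_prob (\<lambda>m \<omega>. (\<Sum>j<Suc m. Y (s + real j * ((s' - s) / real (Suc m))) \<omega> *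
      (W (s + real (Suc j) * ((s' - s) / real (Suc m))) \<omega> - W (s + real j * ((s' - s) / real (Suc m))) \<omega>)) - (I' \<omega> - I \<omega>))"
proof -
  from I obtain n T \<xi> where simp_I: "\<And>k. simple_integrand M F t s (n k) (T k) (\<xi> k)"
    and L_I: "\<And>\<epsilon>. 0 < \<epsilon> \<Longrightarrow> (\<lambda>k. measure M {\<omega> \<in> space M. ennreal \<epsilon> <
          (\<integral>\<^sup>+r\<in>{t..s}. ennreal ((simple_process (n k) (T k) (\<xi> k) r \<omega> - H r \<omega>)\<^sup>2) \<partial>lborel)}) \<longlonglongrightarrow> 0"
    and c_I: "converges_in_prob M (\<lambda>k. simple_integral W (n k) (T k) (\<xi> k)) I"
    and m_I: "I \<in> borel_measurable M"
    unfolding has_ito_integral_def by blast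
  from I' obtain n' T' \<xi>' where simp_I': "\<And>k. simple_integrand M F t s' (n' k) (T' k) (\<xi>' k)"
    and L_I': "\<And>\<epsilon>. 0 < \<epsilon> \<Longrightarrow> (\<lambda>k. measure M {\<omega> \<in> space M. ennreal \<epsilon> <
          (\<integral>\<^sup>+r\<in>{t..s'}. ennreal ((simple_process (n' k) (T' k) (\<xi>' k) r \<omega> - H r \<omega>)\<^sup>2) \<partial>lborel)}) \<longlonglongrightarrow> 0"
    and c_I': "converges_in_prob M (\<lambda>k. simple_integral W (n' k) (T' k) (\<xi>' k)) I'"
    and m_I': "I' \<in> borel_measurable M"
    and Hm: "\<forall>r\<in>{t..s'}. (\<lambda>(s, \<omega>). H s \<omega>) \<in> borel_measurable (restrict_space borel {t..r} \<Otimes>\<^sub>M F r)"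
    unfolding has_ito_integral_def by blast
  have Hm': "(\<lambda>(s, \<omega>). H s \<omega>) \<in> borel_measurable (restrict_space borel {t..s'} \<Otimes>\<^sub>M F s')"
    using Hm t by auto
  define g where "g m j = s + real j * ((s' - s) / real (Suc m))" for m j
  define \<kappa> where "\<kappa> m j = Y (g m j)" for m j
  have gin: "g m j \<in> {s..s'}" if "j \<le> Suc m" for m j
    unfolding g_def using uniform_grid_in[OF _ that] t by simp
  have gmono: "g m i \<le> g m j" if "i \<le> j" for m i j
    unfolding g_def using uniform_grid_mono[OF _ that] t by simp
  define es where "es k = elem_of_simple 1 (n' k) (T' k) (\<xi>' k) @ elem_of_simple (-1) (n k) (T k) (\<xi> k)
     @ elem_of_simple (-1) (Suc k) (g k) (\<kappa> k)" for k
  have S': "0 \<le> T' k i \<and> T' k i \<le> T' k (Suc i) \<and> \<xi>' k i \<in> borel_measurable (F (T' k i))" if "i < n' k" for k i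
    using simp_I'[of k, unfolded simple_integrand_def] that t(1) less_imp_le[OF that] by (meson atLeastAtMost_iff order_trans)
  have S: "0 \<le> T k i \<and> T k i \<le> T k (Suc i) \<and> \<xi> k i \<in> borel_measurable (F (T k i))" if "i < n k" for k i
    using simp_I[of k, unfolded simple_integrand_def] that t(1) less_imp_le[OF that] by (meson atLeastAtMost_iff order_trans)
  have S'': "0 \<le> g k i \<and> g k i \<le> g k (Suc i) \<and> \<kappa> k i \<in> borel_measurable (F (g k i))" if "i < Suc k" for k i
    using gin[of i k] that gmono[of i "Suc i" k] Y(1)[of "g k i"] t by (simp add: \<kappa>_def)
  have adapt: "elem_adapted (es k)" for k
    unfolding es_def elem_adapted_append by (simp only: elem_adapted_of_simple S S' S'' simp_thms)
  have \<xi>m: "\<xi> k i \<in> borel_measurable M" if "i < n k" for k i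
    using S[OF that] measurable_F_M by blast
  have \<xi>'m: "\<xi>' k i \<in> borel_measurable M" if "i < n' k" for k i
    using S'[OF that] measurable_F_M by blast
  have \<kappa>m: "\<kappa> k i \<in> borel_measurable M" if "i < Suc k" for k i
    using S''[OF that] measurable_F_M by blast
  define R1 where "R1 k \<omega> = (\<integral>\<^sup>+r\<in>{t..s'}. ennreal ((simple_process (n' k) (T' k) (\<xi>' k) r \<omega> - H r \<omega>)\<^sup>2) \<partial>lborel)" for k \<omega>
  define R2 where "R2 k \<omega> = (\<integral>\<^sup>+r\<in>{t..s}. ennreal ((simple_process (n k) (T k) (\<xi> k) r \<omega> - H r \<omega>)\<^sup>2) \<partial>lborel)" for k \<omega>
  define R3 where "R3 k \<omega> = (\<integral>\<^sup>+r\<in>{s..s'}. ennreal ((simple_process (Suc k) (g k) (\<kappa> k) r \<omega> - H r \<omega>)\<^sup>2) \<partial>lborel)" for k \<omega>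
  have [measurable]: "R1 k \<in> borel_measurable M" "R2 k \<in> borel_measurable M" "R3 k \<in> borel_measurable M" for k
    unfolding R1_def[abs_def] R2_def[abs_def] R3_def[abs_def]
    by (rule measurable_time_L2_distance[OF _ _ _ _ Hm']; use t \<xi>m \<xi>'m \<kappa>m in simp)+
  define R where "R k \<omega> = 2 * (R1 k \<omega> + R2 k \<omega> + R3 k \<omega>)" for k \<omega>
  have bound: "(\<integral>\<^sup>+r. ennreal ((elem_process (es k) r \<omega>)\<^sup>2) \<partial>lborel) \<le> R k \<omega>" if \<omega>: "\<omega> \<in> space M" for k \<omega>
  proof -
    let ?p' = "\<lambda>r. simple_process (n' k) (T' k) (\<xi>' k) r \<omega>"
    let ?p = "\<lambda>r. simple_process (n k) (T k) (\<xi> k) r \<omega>"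
    let ?q = "\<lambda>r. simple_process (Suc k) (g k) (\<kappa> k) r \<omega>"
    have p'0: "?p' r = 0" if "r \<le> t \<or> s' < r" for r
      by (rule simple_process_outside[where a=t and b=s']) (use simp_I'[of k] that in \<open>auto simp: simple_integrand_def\<close>)
    have p0: "?p r = 0" if "r \<le> t \<or> s < r" for r
      by (rule simple_process_outside[where a=t and b=s]) (use simp_I[of k] that in \<open>auto simp: simple_integrand_def\<close>)
    have q0: "?q r = 0" if "r \<le> s \<or> s' < r" for r
      by (rule simple_process_outside[where a=s and b=s']) (use gin[of _ k] that in \<open>auto\<close>)
    have e: "elem_process (es k) r \<omega> = ?p' r - ?p r - ?q r" for r
      by (simp add: es_def elem_process_append elem_of_simple)
    \<comment> \<open>Two functions that are both close to \<open>H\<close> are close to each other;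
      this is the source of the factor 2 in \<open>R\<close>.\<close>
    have sq: "(a - b)\<^sup>2 \<le> 2 * ((a - c)\<^sup>2 + (b - c)\<^sup>2)" for a b c :: real
      using sum_squares_ge_zero[of "a + b - 2 * c" 0] by (simp add: power2_eq_square algebra_simps)
    have pt: "ennreal ((elem_process (es k) r \<omega>)\<^sup>2) \<le> 2 * (ennreal ((?p' r - H r \<omega>)\<^sup>2) * indicator {t..s'} r
      + ennreal ((?p r - H r \<omega>)\<^sup>2) * indicator {t..s} r + ennreal ((?q r - H r \<omega>)\<^sup>2) * indicator {s..s'} r)" for r
    proof -
      consider "r \<le> t \<or> s' < r" | "t < r" "r \<le> s" | "s < r" "r \<le> s'" by linarith
      then have "(elem_process (es k) r \<omega>)\<^sup>2 \<le> 2 * ((?p' r - H r \<omega>)\<^sup>2 * indicator {t..s'} r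
        + (?p r - H r \<omega>)\<^sup>2 * indicator {t..s} r + (?q r - H r \<omega>)\<^sup>2 * indicator {s..s'} r)"
      proof cases
        case 1
        then have "?p' r = 0" "?p r = 0" "?q r = 0" using p'0[OF 1] p0[of r] q0[of r] t by auto
        then show ?thesis by (simp add: e indicator_def)
      next
        case 2
        then have "?q r = 0" using q0 by simp
        then have "(elem_process (es k) r \<omega>)\<^sup>2 \<le> 2 * ((?p' r - H r \<omega>)\<^sup>2 + (?p r - H r \<omega>)\<^sup>2)"
          using sq[of "?p' r" "?p r" "H r \<omega>"] by (simp add: e)
        also have "\<dots> \<le> 2 * ((?p' r - H r \<omega>)\<^sup>2 * indicator {t..s'} r
          + (?p r - H r \<omega>)\<^sup>2 * indicator {t..s} r + (?q r - H r \<omega>)\<^sup>2 * indicator {s..s'} r)"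
          using 2 t by (simp add: indicator_def)
        finally show ?thesis .
      next
        case 3
        then have "?p r = 0" using p0 by simp
        then have "(elem_process (es k) r \<omega>)\<^sup>2 \<le> 2 * ((?p' r - H r \<omega>)\<^sup>2 + (?q r - H r \<omega>)\<^sup>2)"
          using sq[of "?p' r" "?q r" "H r \<omega>"] by (simp add: e)
        also have "\<dots> \<le> 2 * ((?p' r - H r \<omega>)\<^sup>2 * indicator {t..s'} r
          + (?p r - H r \<omega>)\<^sup>2 * indicator {t..s} r + (?q r - H r \<omega>)\<^sup>2 * indicator {s..s'} r)"
          using 3 t by (simp add: indicator_def)
        finally show ?thesis .
      qed
      then have "ennreal ((elem_process (es k) r \<omega>)\<^sup>2) \<le> ennreal (2 * ((?p' r - H r \<omega>)\<^sup>2 * indicator {t..s'} r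
        + (?p r - H r \<omega>)\<^sup>2 * indicator {t..s} r + (?q r - H r \<omega>)\<^sup>2 * indicator {s..s'} r))"
        by (rule ennreal_leI)
      then show ?thesis by (simp add: ennreal_mult ennreal_plus ennreal_indicator)
    qed
    define Hc where "Hc r = H (max t (min s' r)) \<omega>" for r
    have m[measurable]: "Hc \<in> borel_measurable borel"
      using measurable_compose_Pair1[OF \<omega> measurable_clamped_integrand[OF _ _ Hm']] t
      unfolding Hc_def[abs_def] by simp
    have Hc: "ennreal ((p - Hc r)\<^sup>2) * indicator {c..d} r = ennreal ((p - H r \<omega>)\<^sup>2) * indicator {c..d} r"
      if "t \<le> c" "d \<le> s'" for p c d r
      using that by (cases "r \<in> {c..d}") (simp_all add: Hc_def min_absorb2 max_absorb2)
    have "(\<integral>\<^sup>+r. ennreal ((elem_process (es k) r \<omega>)\<^sup>2) \<partial>lborel) \<le> (\<integral>\<^sup>+r. 2 * (ennreal ((?p' r - Hc r)\<^sup>2) * indicator {t..s'} r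
      + ennreal ((?p r - Hc r)\<^sup>2) * indicator {t..s} r + ennreal ((?q r - Hc r)\<^sup>2) * indicator {s..s'} r) \<partial>lborel)"
      using pt by (intro nn_integral_mono) (simp only: Hc t order_refl less_imp_le[OF t(3)])
    also have "\<dots> = 2 * ((\<integral>\<^sup>+r. ennreal ((?p' r - Hc r)\<^sup>2) * indicator {t..s'} r \<partial>lborel)
      + (\<integral>\<^sup>+r. ennreal ((?p r - Hc r)\<^sup>2) * indicator {t..s} r \<partial>lborel) + (\<integral>\<^sup>+r. ennreal ((?q r - Hc r)\<^sup>2) * indicator {s..s'} r \<partial>lborel))"
      by (rule nn_integral_cmult_add3) measurable
    also have "\<dots> = R k \<omega>"
      unfolding R_def R1_def R2_def R3_def by (simp only: Hc t order_refl less_imp_le[OF t(3)])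
    finally show ?thesis .
  qed
  \<comment> \<open>On a fixed path, uniform continuity brings the step function within
    \<open>e\<close> of \<open>Y\<close> once the mesh is small. The choice of \<open>e\<close>
    makes the squared distance over the whole interval at most \<open>d\<close>.\<close>
  have R3_0: "(\<lambda>k. prob {\<omega> \<in> space M. ennreal d < R3 k \<omega>}) \<longlonglongrightarrow> 0" if d: "0 < d" for d
  proof (rule prob_tendsto_0)
    fix \<omega> assume \<omega>: "\<omega> \<in> space M"
    define e where "e = sqrt (d / (s' - s))"
    have e: "e > 0" "e\<^sup>2 * (s' - s) = d" using d t by (auto simp: e_def)
    have "uniformly_continuous_on {s..s'} (\<lambda>r. Y r \<omega>)"
      using Y(2)[OF \<omega>] by (intro compact_uniformly_continuous) auto
    from uniformly_continuous_onE[OF this e(1)] obtain \<delta> where \<delta>: "\<delta> > 0"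
      "\<And>x x'. x \<in> {s..s'} \<Longrightarrow> x' \<in> {s..s'} \<Longrightarrow> dist x' x < \<delta> \<Longrightarrow> dist (Y x' \<omega>) (Y x \<omega>) < e" by metis
    have "(\<lambda>k. (s' - s) / real (Suc k)) \<longlonglongrightarrow> 0"
      using LIMSEQ_Suc[OF lim_const_over_n[of "s' - s"]] by simp
    then have "eventually (\<lambda>k. (s' - s) / real (Suc k) < \<delta>) sequentially"
      using order_tendstoD(2)[of _ 0 sequentially \<delta>] \<delta>(1) by auto
    then show "eventually (\<lambda>k. \<not> ennreal d < R3 k \<omega>) sequentially"
    proof eventually_elim
      case (elim k)
      have cl: "(simple_process (Suc k) (g k) (\<kappa> k) r \<omega> - H r \<omega>)\<^sup>2 \<le> e\<^sup>2" if r: "s < r" "r < s'" for r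
      proof -
        obtain j where j: "j < Suc k" "r \<in> {g k j<..g k (Suc j)}"
          using uniform_grid_cell[of s r s' k] r unfolding g_def by force
        have "simple_process (Suc k) (g k) (\<kappa> k) r \<omega> = \<kappa> k j \<omega>"
          using gmono j by (intro simple_process_eq) auto
        moreover have "g k (Suc j) - g k j = (s' - s) / real (Suc k)"
          by (simp add: g_def algebra_simps add_divide_distrib diff_divide_distrib)
        then have "dist r (g k j) < \<delta>" using j elim by (simp add: dist_real_def)
        then have "dist (Y r \<omega>) (Y (g k j) \<omega>) < e" using \<delta>(2)[of "g k j" r] gin[of j k] j r by simp
        ultimately have "\<bar>simple_process (Suc k) (g k) (\<kappa> k) r \<omega> - H r \<omega>\<bar> \<le> e"
          using H[OF \<omega>, of r] r by (simp add: \<kappa>_def dist_real_def abs_minus_commute)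
        then show ?thesis using power_mono[of "\<bar>simple_process (Suc k) (g k) (\<kappa> k) r \<omega> - H r \<omega>\<bar>" e 2] by simp
      qed
      have "R3 k \<omega> \<le> (\<integral>\<^sup>+r\<in>{s..s'}. ennreal (e\<^sup>2) \<partial>lborel)"
        unfolding R3_def
      proof (rule nn_integral_mono_AE)
        have "AE r in lborel. r \<noteq> s" "AE r in lborel. r \<noteq> s'" by (rule AE_lborel_singleton)+
        then show "AE r in lborel. ennreal ((simple_process (Suc k) (g k) (\<kappa> k) r \<omega> - H r \<omega>)\<^sup>2) * indicator {s..s'} r
            \<le> ennreal (e\<^sup>2) * indicator {s..s'} r"
        proof eventually_elim
          case (elim r)
          then show ?case using cl[of r] by (auto simp: indicator_def intro!: ennreal_leI)
        qed
      qed
      also have "\<dots> = ennreal (e\<^sup>2) * ennreal (s' - s)" using t by (subst nn_integral_cmult_indicator) auto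
      also have "\<dots> = ennreal d" using e t by (simp flip: ennreal_mult)
      finally show ?case by simp
    qed
  qed measurable
  have R_0: "(\<lambda>k. prob {\<omega> \<in> space M. ennreal d < R k \<omega>}) \<longlonglongrightarrow> 0" if d: "0 < d" for d
  proof (rule squeeze_0)
    \<comment> \<open>The 6 comes from the factor 2 in \<open>R\<close> and its three summands: if
      each of them is at most \<open>d / 6\<close>, then \<open>R\<close> is at most
      \<open>d\<close>.\<close>
    show "prob {\<omega> \<in> space M. ennreal d < R k \<omega>} \<le> prob {\<omega> \<in> space M. ennreal (d / 6) < R1 k \<omega>}
        + prob {\<omega> \<in> space M. ennreal (d / 6) < R2 k \<omega>} + prob {\<omega> \<in> space M. ennreal (d / 6) < R3 k \<omega>}" for k
    proof -
      have "prob {\<omega> \<in> space M. ennreal d < R k \<omega>} \<le> prob (({\<omega> \<in> space M. ennreal (d / 6) < R1 k \<omega>}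
        \<union> {\<omega> \<in> space M. ennreal (d / 6) < R2 k \<omega>}) \<union> {\<omega> \<in> space M. ennreal (d / 6) < R3 k \<omega>})"
      proof (rule finite_measure_mono)
        show "{\<omega> \<in> space M. ennreal d < R k \<omega>} \<subseteq> ({\<omega> \<in> space M. ennreal (d / 6) < R1 k \<omega>}
        \<union> {\<omega> \<in> space M. ennreal (d / 6) < R2 k \<omega>}) \<union> {\<omega> \<in> space M. ennreal (d / 6) < R3 k \<omega>}"
        proof (rule subsetI, rule ccontr)
          fix \<omega> assume mem: "\<omega> \<in> {\<omega> \<in> space M. ennreal d < R k \<omega>}"
            and nmem: "\<omega> \<notin> ({\<omega> \<in> space M. ennreal (d / 6) < R1 k \<omega>}
              \<union> {\<omega> \<in> space M. ennreal (d / 6) < R2 k \<omega>}) \<union> {\<omega> \<in> space M. ennreal (d / 6) < R3 k \<omega>}"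
          have \<omega>: "ennreal d < R k \<omega>" using mem by simp
          have \<omega>': "R1 k \<omega> \<le> ennreal (d / 6)" "R2 k \<omega> \<le> ennreal (d / 6)" "R3 k \<omega> \<le> ennreal (d / 6)"
            using mem nmem by (simp_all only: mem_Collect_eq Un_iff not_less de_Morgan_disj simp_thms)
          have "R k \<omega> \<le> 2 * (ennreal (d / 6) + ennreal (d / 6) + ennreal (d / 6))"
            unfolding R_def by (intro mult_left_mono add_mono \<omega>') auto
          also have "ennreal (d / 6) + ennreal (d / 6) + ennreal (d / 6) = ennreal (d / 2)" using d by (simp flip: ennreal_plus)
          also have "2 * ennreal (d / 2) = ennreal d" using d ennreal_mult[of 2 "d / 2"] by simp
          finally show False using \<omega> by simp
        qed
      qed measurable
      also have "\<dots> \<le> prob ({\<omega> \<in> space M. ennreal (d / 6) < R1 k \<omega>}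
        \<union> {\<omega> \<in> space M. ennreal (d / 6) < R2 k \<omega>}) + prob {\<omega> \<in> space M. ennreal (d / 6) < R3 k \<omega>}"
        by (rule measure_Un_le) measurable
      also have "prob ({\<omega> \<in> space M. ennreal (d / 6) < R1 k \<omega>} \<union> {\<omega> \<in> space M. ennreal (d / 6) < R2 k \<omega>})
        \<le> prob {\<omega> \<in> space M. ennreal (d / 6) < R1 k \<omega>} + prob {\<omega> \<in> space M. ennreal (d / 6) < R2 k \<omega>}"
        by (rule measure_Un_le) measurable
      finally show ?thesis by simp
    qed
    have d6: "0 < d / 6" using d by simp
    show "(\<lambda>k. prob {\<omega> \<in> space M. ennreal (d / 6) < R1 k \<omega>}
        + prob {\<omega> \<in> space M. ennreal (d / 6) < R2 k \<omega>} + prob {\<omega> \<in> space M. ennreal (d / 6) < R3 k \<omega>}) \<longlonglongrightarrow> 0"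
      using L_I[OF d6] L_I'[OF d6] R3_0[OF d6] unfolding R1_def R2_def by (intro tendsto_add_zero) auto
  qed simp
  have null: "null_in_prob (\<lambda>k. elem_integral W (es k))"
    by (rule elem_integral_null_in_prob[OF adapt _ bound R_0]) (simp add: R_def[abs_def])
  have W'[measurable]: "W r \<in> borel_measurable M" if "0 \<le> r" for r by (rule W_measurable[OF that])
  have diff: "null_in_prob (\<lambda>k \<omega>. simple_integral W (n k) (T k) (\<xi> k) \<omega> - I \<omega>)"
  proof (rule null_in_probI_prob)
    have "0 \<le> T k i" if "i \<le> n k" for k i
      using simp_I[of k, unfolded simple_integrand_def] that t(1) by (meson atLeastAtMost_iff order_trans)
    then show "(\<lambda>\<omega>. simple_integral W (n k) (T k) (\<xi> k) \<omega> - I \<omega>) \<in> borel_measurable M" for k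
      unfolding simple_integral_def using \<xi>m m_I
      by (intro borel_measurable_diff borel_measurable_sum borel_measurable_times W') auto
  qed (use c_I in \<open>simp add: converges_in_prob_def\<close>)
  have diff': "null_in_prob (\<lambda>k \<omega>. simple_integral W (n' k) (T' k) (\<xi>' k) \<omega> - I' \<omega>)"
  proof (rule null_in_probI_prob)
    have "0 \<le> T' k i" if "i \<le> n' k" for k i
      using simp_I'[of k, unfolded simple_integrand_def] that t(1) by (meson atLeastAtMost_iff order_trans)
    then show "(\<lambda>\<omega>. simple_integral W (n' k) (T' k) (\<xi>' k) \<omega> - I' \<omega>) \<in> borel_measurable M" for k
      unfolding simple_integral_def using \<xi>'m m_I'
      by (intro borel_measurable_diff borel_measurable_sum borel_measurable_times W') auto
  qed (use c_I' in \<open>simp add: converges_in_prob_def\<close>)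
  from null_in_prob_diff[OF null_in_prob_diff[OF diff' diff] null] show ?thesis
    by (simp add: es_def elem_integral_append elem_of_simple simple_integral_def \<kappa>_def g_def algebra_simps)
qed

end

section \<open>Ito's formula for the logarithm of a linear equation\<close>

text \<open>The derivative of \<open>ln (1 + z) - z + z\<^sup>2 / 2\<close> is
  \<open>z\<^sup>2 / (1 + z)\<close>, which is at most \<open>2 * x\<^sup>2\<close> as long as
  \<open>\<bar>z\<bar> \<le> \<bar>x\<bar> \<le> 1 / 2\<close>.\<close>

lemma abs_ln_one_plus_quadratic_bound:
  fixes x :: real
  assumes "\<bar>x\<bar> \<le> 1 / 2"
  shows "\<bar>ln (1 + x) - x + x\<^sup>2 / 2\<bar> \<le> 2 * x\<^sup>2 * \<bar>x\<bar>"
proof -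
  let ?f = "\<lambda>z::real. ln (1 + z) - z + z\<^sup>2 / 2"
  have "norm (?f x - ?f 0) \<le> (2 * x\<^sup>2) * norm (x - 0)"
  proof (rule field_differentiable_bound)
    show "convex {- \<bar>x\<bar>..\<bar>x\<bar>}" by simp
    fix z :: real assume z: "z \<in> {- \<bar>x\<bar>..\<bar>x\<bar>}"
    then have z1: "1 / 2 \<le> 1 + z" using assms by auto
    have "((\<lambda>z. ln (1 + z) - z + z\<^sup>2 / 2) has_real_derivative (1 / (1 + z) * (0 + 1) - 1 + (2 * z) / 2)) (at z within {- \<bar>x\<bar>..\<bar>x\<bar>})"
      using z1 by (auto intro!: derivative_eq_intros)
    then show "(?f has_field_derivative (1 / (1 + z) - 1 + z)) (at z within {- \<bar>x\<bar>..\<bar>x\<bar>})" by simp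
    have "1 / (1 + z) - 1 + z = z\<^sup>2 / (1 + z)" using z1 by (simp add: field_simps power2_eq_square)
    moreover have "z\<^sup>2 / (1 + z) \<le> 2 * z\<^sup>2"
      using divide_left_mono[of "1 / 2" "1 + z" "z\<^sup>2"] z1 by simp
    moreover have "\<bar>z\<bar> \<le> \<bar>x\<bar>" using z by auto
    then have "z\<^sup>2 \<le> x\<^sup>2" by (simp only: abs_le_square_iff)
    moreover have "0 \<le> z\<^sup>2 / (1 + z)" using z1 by simp
    ultimately show "norm (1 / (1 + z) - 1 + z) \<le> 2 * x\<^sup>2" unfolding real_norm_def by linarith
  qed auto
  then show ?thesis by simp
qed

text \<open>The discrete form of Ito's formula for the logarithm: relative increments \<open>k dW + m dt\<close> perturbed by
  errors \<open>A\<close>, small in the sense of sums and of quadratic variation, and \<open>B\<close>, small in variation.\<close>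

lemma sum_ln_increments_tendsto:
  fixes N :: "nat \<Rightarrow> nat" and w A B :: "nat \<Rightarrow> nat \<Rightarrow> real" and h :: "nat \<Rightarrow> real"
  assumes hN: "\<And>n. real (N n) * h n = L" and L: "0 \<le> L" and h: "h \<longlonglongrightarrow> 0"
    and A: "(\<lambda>n. \<Sum>i<N n. A n i) \<longlonglongrightarrow> 0" "(\<lambda>n. \<Sum>i<N n. (A n i)\<^sup>2) \<longlonglongrightarrow> 0"
    and B: "(\<lambda>n. \<Sum>i<N n. \<bar>B n i\<bar>) \<longlonglongrightarrow> 0"
    and w: "(\<lambda>n. \<Sum>i<N n. (w n i)\<^sup>2) \<longlonglongrightarrow> L" "\<And>n. (\<Sum>i<N n. w n i) = w0"
    and small: "\<And>d. 0 < d \<Longrightarrow> eventually (\<lambda>n. \<forall>i<N n. \<bar>k * w n i + m * h n + A n i + B n i\<bar> \<le> d) sequentially"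
  shows "(\<lambda>n. \<Sum>i<N n. ln (1 + (k * w n i + m * h n + A n i + B n i))) \<longlonglongrightarrow> k * w0 + m * L - k\<^sup>2 * L / 2"
proof -
  define \<rho> where "\<rho> n i = k * w n i + m * h n + A n i + B n i" for n i
  define e where "e n i = m * h n + A n i + B n i" for n i
  define V where "V n = (\<Sum>i<N n. (w n i)\<^sup>2)" for n
  define E where "E n = (\<Sum>i<N n. (e n i)\<^sup>2)" for n
  define C where "C n = (\<Sum>i<N n. w n i * e n i)" for n
  define R where "R n = (\<Sum>i<N n. (\<rho> n i)\<^sup>2)" for n
  have V: "V \<longlonglongrightarrow> L" using w(1) unfolding V_def .
  have B0: "(\<lambda>n. \<Sum>i<N n. B n i) \<longlonglongrightarrow> 0"
    by (rule Lim_null_comparison[OF _ B]) (auto intro: always_eventually sum_abs)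
  have E: "E \<longlonglongrightarrow> 0"
  proof (rule squeeze_0)
    show "0 \<le> E n" for n unfolding E_def by (intro sum_nonneg) auto
    show "E n \<le> 3 * (m\<^sup>2 * (L * h n) + (\<Sum>i<N n. (A n i)\<^sup>2) + (\<Sum>i<N n. \<bar>B n i\<bar>)\<^sup>2)" for n
    proof -
      have sq: "(x + y + z)\<^sup>2 \<le> 3 * (x\<^sup>2 + y\<^sup>2 + z\<^sup>2)" for x y z :: real
        using sum_squares_ge_zero[of "x - y" "y - z"] zero_le_power2[of "x - z"]
        by (simp add: power2_eq_square algebra_simps)
      have "E n \<le> (\<Sum>i<N n. 3 * ((m * h n)\<^sup>2 + (A n i)\<^sup>2 + (B n i)\<^sup>2))"
        unfolding E_def e_def by (intro sum_mono sq)
      also have "\<dots> = 3 * (real (N n) * (m * h n)\<^sup>2 + (\<Sum>i<N n. (A n i)\<^sup>2) + (\<Sum>i<N n. (B n i)\<^sup>2))"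
        by (simp add: sum.distrib sum_distrib_left[symmetric])
      also have "real (N n) * (m * h n)\<^sup>2 = m\<^sup>2 * (L * h n)"
        using hN[of n] by (simp add: power2_eq_square algebra_simps flip: hN[of n])
      also have "(\<Sum>i<N n. (B n i)\<^sup>2) \<le> (\<Sum>i<N n. \<bar>B n i\<bar>)\<^sup>2"
        using power_mono[OF L2_set_le_sum_abs[of "B n" "{..<N n}"], of 2] 
        by (simp add: L2_set_def sum_nonneg)
      finally show ?thesis by simp
    qed
    show "(\<lambda>n. 3 * (m\<^sup>2 * (L * h n) + (\<Sum>i<N n. (A n i)\<^sup>2) + (\<Sum>i<N n. \<bar>B n i\<bar>)\<^sup>2)) \<longlonglongrightarrow> 0"
      using A(2) h B by (auto intro!: tendsto_eq_intros)
  qed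
  \<comment> \<open>Cauchy-Schwarz: the quadratic variation \<open>V\<close> stays bounded and that
    of the errors \<open>E\<close> vanishes. Hence the squared increments \<open>R\<close> have the
    same limit as \<open>k\<^sup>2 * V\<close>.\<close>
  have C: "C \<longlonglongrightarrow> 0"
  proof (rule Lim_null_comparison)
    have "\<bar>C n\<bar> \<le> sqrt (V n * E n)" for n
      unfolding C_def V_def E_def by (rule real_le_rsqrt) (simp add: Cauchy_Schwarz_ineq_sum)
    then show "eventually (\<lambda>n. norm (C n) \<le> sqrt (V n * E n)) sequentially" by simp
    show "(\<lambda>n. sqrt (V n * E n)) \<longlonglongrightarrow> 0" using V E by (auto intro!: tendsto_eq_intros)
  qed
  have R_eq: "R n = k\<^sup>2 * V n + 2 * k * C n + E n" for n
    unfolding R_def V_def C_def E_def sum_distrib_left sum.distrib[symmetric]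
    by (intro sum.cong refl) (simp add: \<rho>_def e_def power2_eq_square algebra_simps)
  have R: "R \<longlonglongrightarrow> k\<^sup>2 * L" unfolding R_eq using V C E by (auto intro!: tendsto_eq_intros)
  have \<rho>1: "(\<Sum>i<N n. \<rho> n i) = k * w0 + m * L + (\<Sum>i<N n. A n i) + (\<Sum>i<N n. B n i)" for n
    using hN[of n] w(2)[of n] by (simp add: \<rho>_def sum.distrib sum_distrib_left[symmetric] mult.left_commute)
  have err: "(\<lambda>n. \<Sum>i<N n. (ln (1 + \<rho> n i) - \<rho> n i + (\<rho> n i)\<^sup>2 / 2)) \<longlonglongrightarrow> 0"
  proof (rule LIMSEQ_I)
    fix \<epsilon> :: real assume \<epsilon>: "0 < \<epsilon>"
    define K where "K = k\<^sup>2 * L + 1"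
    have K: "K > 0" using L by (simp add: K_def add_nonneg_pos)
    \<comment> \<open>The cubic remainder is at most \<open>2 * d * R n\<close> when all increments
      are below \<open>d\<close>. As \<open>R n < K\<close> eventually, this \<open>d\<close> makes
      it at most \<open>\<epsilon> / 2\<close>; the cap \<open>1 / 2\<close> is the range of the
      Taylor bound.\<close>
    define d where "d = min (1 / 2) (\<epsilon> / (4 * K))"
    have d: "0 < d" "d \<le> 1 / 2" "d \<le> \<epsilon> / (4 * K)" using \<epsilon> K by (auto simp: d_def)
    have "eventually (\<lambda>n. R n < K) sequentially"
      using order_tendstoD(2)[OF R, of K] by (simp add: K_def)
    with small[OF d(1)] have "eventually (\<lambda>n. norm ((\<Sum>i<N n. (ln (1 + \<rho> n i) - \<rho> n i + (\<rho> n i)\<^sup>2 / 2)) - 0) < \<epsilon>) sequentially"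
    proof eventually_elim
      case (elim n)
      have "\<bar>\<Sum>i<N n. (ln (1 + \<rho> n i) - \<rho> n i + (\<rho> n i)\<^sup>2 / 2)\<bar> \<le> (\<Sum>i<N n. 2 * d * (\<rho> n i)\<^sup>2)"
      proof (rule order_trans[OF sum_abs sum_mono])
        fix i assume "i \<in> {..<N n}"
        then have i: "\<bar>\<rho> n i\<bar> \<le> d" using elim(1) by (simp add: \<rho>_def)
        have "\<bar>ln (1 + \<rho> n i) - \<rho> n i + (\<rho> n i)\<^sup>2 / 2\<bar> \<le> 2 * (\<rho> n i)\<^sup>2 * \<bar>\<rho> n i\<bar>"
          using i d by (intro abs_ln_one_plus_quadratic_bound) linarith
        also have "\<dots> \<le> 2 * (\<rho> n i)\<^sup>2 * d" using i by (intro mult_left_mono) auto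
        finally show "\<bar>ln (1 + \<rho> n i) - \<rho> n i + (\<rho> n i)\<^sup>2 / 2\<bar> \<le> 2 * d * (\<rho> n i)\<^sup>2" by (simp add: mult_ac)
      qed
      also have "\<dots> = 2 * d * R n" by (simp add: R_def sum_distrib_left)
      also have "\<dots> \<le> 2 * d * K" using elim(2) d by (intro mult_left_mono) auto
      also have "\<dots> \<le> 2 * (\<epsilon> / (4 * K)) * K" using d K by (intro mult_right_mono) auto
      also have "\<dots> < \<epsilon>" using K \<epsilon> by simp
      finally show ?case by simp
    qed
    then show "\<exists>no. \<forall>n\<ge>no. norm ((\<Sum>i<N n. (ln (1 + \<rho> n i) - \<rho> n i + (\<rho> n i)\<^sup>2 / 2)) - 0) < \<epsilon>"
      by (simp add: eventually_sequentially)
  qed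
  have "(\<lambda>n. (\<Sum>i<N n. (ln (1 + \<rho> n i) - \<rho> n i + (\<rho> n i)\<^sup>2 / 2)) + (\<Sum>i<N n. \<rho> n i) - R n / 2)
     \<longlonglongrightarrow> 0 + (k * w0 + m * L + 0 + 0) - k\<^sup>2 * L / 2"
    unfolding \<rho>1 using A(1) B0 by (intro tendsto_intros err R) auto
  moreover have "(\<Sum>i<N n. (ln (1 + \<rho> n i) - \<rho> n i + (\<rho> n i)\<^sup>2 / 2)) + (\<Sum>i<N n. \<rho> n i) - R n / 2
     = (\<Sum>i<N n. ln (1 + \<rho> n i))" for n
    by (simp add: R_def sum.distrib sum_subtractf sum_divide_distrib)
  ultimately show ?thesis by (simp add: \<rho>_def)
qed

lemma set_integral_approx_const:
  fixes f :: "real \<Rightarrow> real"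
  assumes "s \<le> s'" "continuous_on {s..s'} f" "\<And>r. r \<in> {s..s'} \<Longrightarrow> \<bar>f r - c\<bar> \<le> e"
  shows "\<bar>(LBINT r:{s..s'}. f r) - c * (s' - s)\<bar> \<le> e * (s' - s)"
proof -
  have i: "set_integrable lborel {s..s'} f" by (rule borel_integrable_atLeastAtMost'[OF assms(2)])
  have ic: "set_integrable lborel {s..s'} (\<lambda>_. x)" for x :: real
    by (rule borel_integrable_atLeastAtMost') (rule continuous_on_const)
  have cc: "(LBINT r:{s..s'}. x) = x * (s' - s)" for x :: real
    using assms(1) by (simp add: set_integral_const)
  have "(LBINT r:{s..s'}. f r) \<le> (LBINT r:{s..s'}. c + e)"
  proof (intro set_integral_mono i ic)
    show "f r \<le> c + e" if "r \<in> {s..s'}" for r using assms(3)[OF that] by linarith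
  qed
  moreover have "(LBINT r:{s..s'}. c - e) \<le> (LBINT r:{s..s'}. f r)"
  proof (intro set_integral_mono i ic)
    show "c - e \<le> f r" if "r \<in> {s..s'}" for r using assms(3)[OF that] by linarith
  qed
  ultimately show ?thesis unfolding cc by (simp add: abs_le_iff algebra_simps)
qed

text \<open>Fixes the order of two limits: for each truncation level \<open>d\<close> a first part
  vanishes as \<open>n\<close> grows, and only afterwards is \<open>d\<close> made small.\<close>

lemma tendsto_0_by_slack:
  fixes f :: "nat \<Rightarrow> real"
  assumes "\<And>n. 0 \<le> f n" "0 \<le> c"
    and "\<And>d. 0 < d \<Longrightarrow> d < 1 \<Longrightarrow> \<exists>g. g \<longlonglongrightarrow> 0 \<and> (\<forall>n. f n \<le> g n + c * d)"
  shows "f \<longlonglongrightarrow> 0"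
proof (rule LIMSEQ_I)
  fix \<epsilon> :: real assume \<epsilon>: "0 < \<epsilon>"
  define d where "d = min (1 / 2) (\<epsilon> / (2 * (c + 1)))"
  have d: "0 < d" "d < 1" using \<epsilon> assms(2) by (auto simp: d_def)
  have "c * d \<le> (c + 1) * (\<epsilon> / (2 * (c + 1)))"
    using assms(2) \<epsilon> d(1) by (intro mult_mono) (auto simp: d_def)
  also have "\<dots> = \<epsilon> / 2" using assms(2) by (simp add: field_simps)
  finally have cd: "c * d \<le> \<epsilon> / 2" .
  obtain g where g: "g \<longlonglongrightarrow> 0" "\<And>n. f n \<le> g n + c * d" using assms(3)[OF d] by blast
  have "eventually (\<lambda>n. g n < \<epsilon> / 2) sequentially" using order_tendstoD(2)[OF g(1), of "\<epsilon> / 2"] \<epsilon> by simp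
  then have "eventually (\<lambda>n. norm (f n - 0) < \<epsilon>) sequentially"
  proof eventually_elim
    case (elim n)
    then show ?case using g(2)[of n] cd assms(1)[of n] by simp
  qed
  then show "\<exists>no. \<forall>n\<ge>no. norm (f n - 0) < \<epsilon>" by (simp add: eventually_sequentially)
qed

lemma (in prob_space) null_in_prob_power2:
  assumes "null_in_prob Y" shows "null_in_prob (\<lambda>k \<omega>. (Y k \<omega>)\<^sup>2)"
proof (rule null_in_prob_by_subseq)
  show "(\<lambda>\<omega>. (Y k \<omega>)\<^sup>2) \<in> borel_measurable M" for k
    using null_in_prob_measurable[OF assms] by simp
  fix r :: "nat \<Rightarrow> nat" assume "strict_mono r"
  from null_in_prob_AE_subseq[OF null_in_prob_subseq[OF assms this]]
  obtain s where s: "strict_mono s" "AE \<omega> in M. (\<lambda>k. Y (r (s k)) \<omega>) \<longlonglongrightarrow> 0" by blast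
  from s(2) have "AE \<omega> in M. (\<lambda>k. (Y (r (s k)) \<omega>)\<^sup>2) \<longlonglongrightarrow> 0"
    by eventually_elim (auto intro: tendsto_eq_intros)
  with s(1) show "\<exists>s. strict_mono s \<and> (AE \<omega> in M. (\<lambda>k. (Y (r (s k)) \<omega>)\<^sup>2) \<longlonglongrightarrow> 0)" by blast
qed

lemma (in prob_space) null_in_prob_choose:
  assumes "null_in_prob Y" "0 < e"
  shows "eventually (\<lambda>k. expectation (\<lambda>\<omega>. min 1 \<bar>Y k \<omega>\<bar>) < e) sequentially"
  using assms order_tendstoD(2) unfolding null_in_prob_def by blast

context brownian_motion begin

lemma expectation_square_sum_bounded:
  fixes T :: "nat \<Rightarrow> real"
  assumes "0 \<le> T 0" "\<And>i. i < n \<Longrightarrow> T i < T (Suc i)"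
    and "\<And>i. i < n \<Longrightarrow> \<xi> i \<in> borel_measurable (F (T i))"
    and "\<And>i \<omega>. i < n \<Longrightarrow> \<omega> \<in> space M \<Longrightarrow> \<bar>\<xi> i \<omega>\<bar> \<le> d"
  shows "integrable M (\<lambda>\<omega>. (\<Sum>i<n. \<xi> i \<omega> * (W (T (Suc i)) \<omega> - W (T i) \<omega>))\<^sup>2)"
    and "expectation (\<lambda>\<omega>. (\<Sum>i<n. \<xi> i \<omega> * (W (T (Suc i)) \<omega> - W (T i) \<omega>))\<^sup>2) \<le> d\<^sup>2 * (T n - T 0)"
proof -
  have T0: "0 \<le> T i" if "i \<le> n" for i
    using that
  proof (induction i)
    case (Suc i)
    then show ?case using assms(2)[of i] by simp
  qed (rule assms(1))
  have *: "has_bochner_integral M (\<lambda>\<omega>. (\<Sum>i<n. \<xi> i \<omega> * (W (T (Suc i)) \<omega> - W (T i) \<omega>))\<^sup>2)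
      (\<Sum>i<n. expectation (\<lambda>\<omega>. (\<xi> i \<omega>)\<^sup>2) * (T (Suc i) - T i))"
    using expectation_square_sum_increments[where f="\<lambda>_ x. x" and n=n and q="\<lambda>i. T (Suc i) - T i" and \<xi>=\<xi> and T=T]
      assms(4) increment_moments(1,2)[OF T0 assms(2)] assms(1-3) less_imp_le[OF assms(2)]
    by (simp add: less_imp_le) blast
  then show "integrable M (\<lambda>\<omega>. (\<Sum>i<n. \<xi> i \<omega> * (W (T (Suc i)) \<omega> - W (T i) \<omega>))\<^sup>2)"
    by (simp add: has_bochner_integral_iff)
  have "(\<Sum>i<n. expectation (\<lambda>\<omega>. (\<xi> i \<omega>)\<^sup>2) * (T (Suc i) - T i)) \<le> (\<Sum>i<n. d\<^sup>2 * (T (Suc i) - T i))"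
  proof (intro sum_mono mult_right_mono)
    fix i assume i: "i \<in> {..<n}"
    then show "0 \<le> T (Suc i) - T i" using assms(2)[of i] by simp
    have bd: "(\<xi> i \<omega>)\<^sup>2 \<le> d\<^sup>2" if "\<omega> \<in> space M" for \<omega>
      using power_mono[OF assms(4)[OF _ that] abs_ge_zero, of i 2] i by simp
    have "expectation (\<lambda>\<omega>. (\<xi> i \<omega>)\<^sup>2) \<le> expectation (\<lambda>\<omega>. d\<^sup>2)"
    proof (rule integral_mono)
      show "integrable M (\<lambda>\<omega>. (\<xi> i \<omega>)\<^sup>2)"
        by (rule integrable_const_bound[of _ "d\<^sup>2"]) 
          (use bd i measurable_F_M[OF T0 assms(3)] in \<open>auto intro!: AE_I2\<close>)
    qed (use bd in auto)
    then show "expectation (\<lambda>\<omega>. (\<xi> i \<omega>)\<^sup>2) \<le> d\<^sup>2" by (simp add: prob_space)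
  qed
  also have "\<dots> = d\<^sup>2 * (T n - T 0)"
    unfolding sum_distrib_left[symmetric] by (simp add: sum_lessThan_telescope)
  finally show "expectation (\<lambda>\<omega>. (\<Sum>i<n. \<xi> i \<omega> * (W (T (Suc i)) \<omega> - W (T i) \<omega>))\<^sup>2) \<le> d\<^sup>2 * (T n - T 0)"
    using * by (simp add: has_bochner_integral_iff)
qed

text \<open>Each centred square of an increment over time \<open>h\<close> has variance
  \<open>2 * h\<^sup>2\<close>, by the fourth moment; summed over the orthogonal cells this is
  \<open>2 * (b - a) * h\<close>, which vanishes with the mesh.\<close>

lemma quadratic_variation_null:
  assumes ab: "0 \<le> a" "a < b"
  shows "null_in_prob (\<lambda>n \<omega>. (\<Sum>i<Suc n. (W (a + real (Suc i) * ((b - a) / real (Suc n))) \<omega> -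
      W (a + real i * ((b - a) / real (Suc n))) \<omega>)\<^sup>2) - (b - a))"
proof -
  define T where "T n i = a + real i * ((b - a) / real (Suc n))" for n i
  define h where "h n = (b - a) / real (Suc n)" for n
  have h: "h n > 0" "T n (Suc i) - T n i = h n" for n i
  proof -
    show "h n > 0" using ab by (simp add: h_def)
    show "T n (Suc i) - T n i = h n" unfolding T_def h_def[symmetric] by (simp add: distrib_right)
  qed
  have Tlt: "T n i < T n (Suc i)" for n i using h(1)[of n] h(2)[of n i] by linarith
  have T0: "0 \<le> T n i" for n i using ab by (simp add: T_def)
  have Nh: "real (Suc n) * h n = b - a" for n by (simp add: h_def)
  have hc: "has_bochner_integral M (\<lambda>_. c) c" for c :: real
    by (simp add: has_bochner_integral_iff prob_space)
  have q0: "has_bochner_integral M (\<lambda>\<omega>. (W (T n (Suc i)) \<omega> - W (T n i) \<omega>)\<^sup>2 - h n) 0" for n i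
  proof -
    have "has_bochner_integral M (\<lambda>\<omega>. (W (T n (Suc i)) \<omega> - W (T n i) \<omega>)\<^sup>2 - h n) (T n (Suc i) - T n i - h n)"
      by (rule has_bochner_integral_diff[OF increment_moments(2)[OF T0 Tlt] hc])
    then show ?thesis by (simp only: h diff_self)
  qed
  have q2: "has_bochner_integral M (\<lambda>\<omega>. ((W (T n (Suc i)) \<omega> - W (T n i) \<omega>)\<^sup>2 - h n)\<^sup>2) (2 * (h n)\<^sup>2)" for n i
  proof -
    let ?D = "\<lambda>\<omega>. W (T n (Suc i)) \<omega> - W (T n i) \<omega>"
    have "has_bochner_integral M (\<lambda>\<omega>. ?D \<omega> ^ 4 - 2 * h n * (?D \<omega>)\<^sup>2 + (h n)\<^sup>2) (3 * (h n)\<^sup>2 - 2 * h n * h n + (h n)\<^sup>2)"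
      using increment_moments(2,3)[OF T0[of n i] Tlt[of n i]] unfolding h
      by (intro has_bochner_integral_add has_bochner_integral_diff has_bochner_integral_mult_right hc)
    moreover have "x ^ 4 - 2 * c * x\<^sup>2 + c\<^sup>2 = (x\<^sup>2 - c)\<^sup>2" for x c :: real
      by (simp add: power2_eq_square power4_eq_xxxx algebra_simps)
    moreover have "3 * (h n)\<^sup>2 - 2 * h n * h n + (h n)\<^sup>2 = 2 * (h n)\<^sup>2" by (simp add: power2_eq_square)
    ultimately show ?thesis by (simp only:)
  qed
  have *: "has_bochner_integral M (\<lambda>\<omega>. (\<Sum>i<Suc n. 1 * ((W (T n (Suc i)) \<omega> - W (T n i) \<omega>)\<^sup>2 - h n))\<^sup>2)
      (\<Sum>i<Suc n. expectation (\<lambda>\<omega>. 1\<^sup>2) * (2 * (h n)\<^sup>2))" for n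
    by (rule expectation_square_sum_increments[where f="\<lambda>_ x. x\<^sup>2 - h n" and \<xi>="\<lambda>_ _. 1" and n="Suc n" and T="T n",
          THEN conjunct2, THEN conjunct1])
      (use T0 Tlt q0 q2 in \<open>auto intro: less_imp_le exI[of _ 1]\<close>)
  have "(\<Sum>i<Suc n. expectation (\<lambda>\<omega>. 1\<^sup>2) * (2 * (h n)\<^sup>2)) = 2 * (b - a) * h n" for n
  proof -
    have "(\<Sum>i<Suc n. expectation (\<lambda>\<omega>. 1\<^sup>2) * (2 * (h n)\<^sup>2)) = 2 * (real (Suc n) * h n) * h n"
      by (simp add: prob_space power2_eq_square)
    then show ?thesis by (simp only: Nh)
  qed
  moreover have "(\<Sum>i<Suc n. 1 * ((W (T n (Suc i)) \<omega> - W (T n i) \<omega>)\<^sup>2 - h n)) =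
     (\<Sum>i<Suc n. (W (T n (Suc i)) \<omega> - W (T n i) \<omega>)\<^sup>2) - (b - a)" for n \<omega>
    using Nh[of n] by (simp only: mult_1 sum_subtractf sum_constant card_lessThan)
  ultimately have **: "has_bochner_integral M (\<lambda>\<omega>. ((\<Sum>i<Suc n. (W (T n (Suc i)) \<omega> - W (T n i) \<omega>)\<^sup>2) - (b - a))\<^sup>2) (2 * (b - a) * h n)" for n
    using *[of n] by (simp only:)
  have "h \<longlonglongrightarrow> 0" unfolding h_def using LIMSEQ_Suc[OF lim_const_over_n[of "b - a"]] by simp
  then have lim: "(\<lambda>n. 2 * (b - a) * h n) \<longlonglongrightarrow> 0" by (rule tendsto_mult_right_zero)
  have m: "(\<lambda>\<omega>. (\<Sum>i<Suc n. (W (T n (Suc i)) \<omega> - W (T n i) \<omega>)\<^sup>2) - (b - a)) \<in> borel_measurable M" for n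
    using W_measurable[OF T0] by (intro borel_measurable_diff borel_measurable_sum borel_measurable_power) auto
  have "null_in_prob (\<lambda>n \<omega>. (\<Sum>i<Suc n. (W (T n (Suc i)) \<omega> - W (T n i) \<omega>)\<^sup>2) - (b - a))"
    by (rule null_in_prob_square[OF m]) (use ** lim in \<open>auto simp: has_bochner_integral_iff\<close>)
  then show ?thesis by (simp only: T_def)
qed

end

lemma sum_block:
  fixes f :: "nat \<Rightarrow> 'b::comm_monoid_add"
  shows "(\<Sum>i<N. \<Sum>j<M. f (i * M + j)) = (\<Sum>l<N * M. f l)"
proof -
  have "(\<Sum>l\<in>{i * M..<i * M + M}. f l) = (\<Sum>j<M. f (i * M + j))" for i
    using sum.shift_bounds_nat_ivl[of f 0 "i * M" M] by (simp add: atLeast0LessThan add.commute)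
  then show ?thesis by (simp flip: sum.nat_group)
qed

text \<open>Ratios of \<open>f\<close> are exponentials of differences of \<open>ln f\<close>, which
  is uniformly continuous on the compact interval.\<close>

lemma uniform_ratio_continuity:
  fixes f :: "real \<Rightarrow> real"
  assumes "continuous_on {a..b} f" "\<And>r. r \<in> {a..b} \<Longrightarrow> 0 < f r" "0 < d" "h \<longlonglongrightarrow> 0"
  shows "eventually (\<lambda>n. \<forall>s\<in>{a..b}. \<forall>s'\<in>{a..b}. \<bar>s' - s\<bar> \<le> h n \<longrightarrow> \<bar>f s' / f s - 1\<bar> \<le> d) sequentially"
proof -
  have "isCont exp (0::real)" by simp
  then obtain e where e: "0 < e" "\<And>x::real. \<bar>x\<bar> < e \<Longrightarrow> \<bar>exp x - 1\<bar> < d"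
    using assms(3) unfolding continuous_at_eps_delta by (auto simp: dist_real_def)
  have "continuous_on {a..b} (\<lambda>r. ln (f r))"
    using assms(1,2) by (intro continuous_on_ln) (auto simp: less_imp_neq[symmetric])
  then have "uniformly_continuous_on {a..b} (\<lambda>r. ln (f r))"
    by (intro compact_uniformly_continuous) auto
  from uniformly_continuous_onE[OF this e(1)] obtain \<delta> where \<delta>: "\<delta> > 0"
    "\<And>x x'. x \<in> {a..b} \<Longrightarrow> x' \<in> {a..b} \<Longrightarrow> dist x' x < \<delta> \<Longrightarrow> dist (ln (f x')) (ln (f x)) < e" by metis
  have "eventually (\<lambda>n. h n < \<delta>) sequentially" using order_tendstoD(2)[OF assms(4) \<delta>(1)] .
  then show ?thesis
  proof eventually_elim
    case (elim n)
    show ?case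
    proof (intro ballI impI)
      fix s s' assume s: "s \<in> {a..b}" "s' \<in> {a..b}" "\<bar>s' - s\<bar> \<le> h n"
      then have "\<bar>ln (f s') - ln (f s)\<bar> < e" using \<delta>(2)[OF s(1,2)] elim by (simp add: dist_real_def)
      from e(2)[OF this] have "\<bar>exp (ln (f s') - ln (f s)) - 1\<bar> < d" .
      then show "\<bar>f s' / f s - 1\<bar> \<le> d"
        using assms(2)[OF s(1)] assms(2)[OF s(2)] by (simp add: exp_diff)
    qed
  qed
qed

context brownian_motion begin

text \<open>On a coarse cell the relative increment of \<open>X\<close> is
  \<open>k dW + \<mu> h\<close> up to two errors: \<open>A\<close>, the stochastic integral of
  \<open>X / X (T n i) - 1\<close>, and \<open>B\<close>, the same deviation in the drift. The
  hypothesis gives stochastic integrals only as limits of Riemann sums, so \<open>A\<close> is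
  estimated through sums over a second, much finer grid inside each cell. With \<open>A\<close> and
  \<open>B\<close> negligible, \<open>sum_ln_increments_tendsto\<close> applies along a
  subsequence.\<close>

lemma log_increment_of_linear_sde:
  assumes ab: "0 \<le> a" "a < b"
    and Xm: "\<And>r. a \<le> r \<Longrightarrow> r \<le> b \<Longrightarrow> X r \<in> borel_measurable (F r)"
    and Xc: "\<And>\<omega>. \<omega> \<in> space M \<Longrightarrow> continuous_on {a..b} (\<lambda>r. X r \<omega>)"
    and Xp: "\<And>\<omega> r. \<omega> \<in> space M \<Longrightarrow> a \<le> r \<Longrightarrow> r \<le> b \<Longrightarrow> 0 < X r \<omega>"
    and sde: "\<And>s s'. a \<le> s \<Longrightarrow> s < s' \<Longrightarrow> s' \<le> b \<Longrightarrow>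
      null_in_prob (\<lambda>m \<omega>. (\<Sum>j<Suc m. k * X (s + real j * ((s' - s) / real (Suc m))) \<omega> *
        (W (s + real (Suc j) * ((s' - s) / real (Suc m))) \<omega> - W (s + real j * ((s' - s) / real (Suc m))) \<omega>))
        + \<mu> * (LBINT r:{s..s'}. X r \<omega>) - (X s' \<omega> - X s \<omega>))"
  shows "AE \<omega> in M. ln (X b \<omega>) - ln (X a \<omega>) = k * (W b \<omega> - W a \<omega>) + \<mu> * (b - a) - k\<^sup>2 * (b - a) / 2"
proof -
  define h where "h n = (b - a) / real (Suc n)" for n
  define T where "T n i = a + real i * h n" for n i
  define G where "G n m i j = T n i + real j * (h n / real (Suc m))" for n m i j
  have h0: "h n > 0" for n using ab by (simp add: h_def)
  have TS: "T n (Suc i) - T n i = h n" for n i by (simp add: T_def distrib_right)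
  have TN: "T n (Suc n) = b" "T n 0 = a" for n by (simp_all add: T_def h_def)
  have Tin: "a \<le> T n i" "T n i \<le> b" if "i \<le> Suc n" for n i
    using uniform_grid_in[of a b i n] that ab unfolding T_def h_def by auto
  have GT: "G n m i (Suc m) = T n (Suc i)" "G n m i 0 = T n i" for n m i
    using TS[of n i] by (simp_all add: G_def)
  have Gin: "T n i \<le> G n m i j" "G n m i j \<le> T n (Suc i)" if "j \<le> Suc m" for n m i j
    using uniform_grid_in[of "T n i" "T n (Suc i)" j m] that TS[of n i] h0[of n] unfolding G_def by auto
  have Gab: "a \<le> G n m i j" "G n m i j \<le> b" if "j \<le> Suc m" "i < Suc n" for n m i j
    using Gin[OF that(1), of n i] Tin[of i n] Tin[of "Suc i" n] that by auto
  have hlim: "h \<longlonglongrightarrow> 0" unfolding h_def using LIMSEQ_Suc[OF lim_const_over_n[of "b - a"]] by simp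
  have XM: "X r \<in> borel_measurable M" if "a \<le> r" "r \<le> b" for r
    using measurable_F_M[OF _ Xm[OF that]] ab that by simp
  have WM: "W r \<in> borel_measurable M" if "a \<le> r" for r
    using W_measurable[of r] ab that by simp
  define D where "D n i \<omega> = X (T n (Suc i)) \<omega> / X (T n i) \<omega> - 1" for n i \<omega>
  define w where "w n i \<omega> = W (T n (Suc i)) \<omega> - W (T n i) \<omega>" for n i \<omega>
  define I where "I n i \<omega> = (LBINT r:{T n i..T n (Suc i)}. X r \<omega>)" for n i \<omega>
  \<comment> \<open>Defined as a residual, so that the increment decomposes exactly; that it is a
    stochastic integral enters only through the approximation by \<open>A'\<close>.\<close>
  define A where "A n i \<omega> = D n i \<omega> - k * w n i \<omega> - \<mu> * I n i \<omega> / X (T n i) \<omega>" for n i \<omega>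
  define B where "B n i \<omega> = \<mu> * (I n i \<omega> / X (T n i) \<omega> - h n)" for n i \<omega>
  \<comment> \<open>The Riemann sum over \<open>m + 1\<close> subcells of the integral that
    \<open>A\<close> stands for.\<close>
  define A' where "A' n m i \<omega> = (\<Sum>j<Suc m. k * (X (G n m i j) \<omega> / X (T n i) \<omega> - 1) * (W (G n m i (Suc j)) \<omega> - W (G n m i j) \<omega>))" for n m i \<omega>
  have A'_null: "null_in_prob (\<lambda>m \<omega>. A' n m i \<omega> - A n i \<omega>)" if i: "i < Suc n" for n i
  proof (rule null_in_prob_cong_AE)
    let ?Z = "\<lambda>m \<omega>. 1 / X (T n i) \<omega> * ((\<Sum>j<Suc m. k * X (G n m i j) \<omega> * (W (G n m i (Suc j)) \<omega> - W (G n m i j) \<omega>))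
        + \<mu> * I n i \<omega> - (X (T n (Suc i)) \<omega> - X (T n i) \<omega>))"
    have "null_in_prob (\<lambda>m \<omega>. (\<Sum>j<Suc m. k * X (G n m i j) \<omega> * (W (G n m i (Suc j)) \<omega> - W (G n m i j) \<omega>))
        + \<mu> * I n i \<omega> - (X (T n (Suc i)) \<omega> - X (T n i) \<omega>))"
      using sde[of "T n i" "T n (Suc i)"] Tin[of i n] Tin[of "Suc i" n] i TS[of n i] h0[of n]
      unfolding G_def I_def by simp
    moreover have "(\<lambda>\<omega>. 1 / X (T n i) \<omega>) \<in> borel_measurable M"
      using XM Tin[of i n] i by simp
    ultimately show Zn: "null_in_prob ?Z" by (rule null_in_prob_mult)
    have eq: "A' n m i \<omega> - A n i \<omega> = ?Z m \<omega>" if \<omega>: "\<omega> \<in> space M" for m \<omega>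
    proof -
      have p: "X (T n i) \<omega> > 0" using Xp[OF \<omega>] Tin[of i n] i by simp
      have "(\<Sum>j<Suc m. W (G n m i (Suc j)) \<omega> - W (G n m i j) \<omega>) = w n i \<omega>"
        using sum_lessThan_telescope[of "\<lambda>j. W (G n m i j) \<omega>" "Suc m"] by (simp add: GT w_def)
      then have "A' n m i \<omega> = (\<Sum>j<Suc m. k * X (G n m i j) \<omega> * (W (G n m i (Suc j)) \<omega> - W (G n m i j) \<omega>)) / X (T n i) \<omega> - k * w n i \<omega>"
        unfolding A'_def sum_divide_distrib
        by (subst \<open>_ = w n i \<omega>\<close>[symmetric], unfold sum_distrib_left sum_subtractf[symmetric])
          (intro sum.cong refl, simp add: algebra_simps diff_divide_distrib)
      then show ?thesis using p by (simp add: A_def D_def diff_divide_distrib add_divide_distrib)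
    qed
    show "AE \<omega> in M. A' n m i \<omega> - A n i \<omega> = ?Z m \<omega>" for m using eq by (intro AE_I2)
    have "?Z m \<in> borel_measurable M" for m by (rule null_in_prob_measurable[OF Zn])
    then show "(\<lambda>\<omega>. A' n m i \<omega> - A n i \<omega>) \<in> borel_measurable M" for m
      using eq by (subst measurable_cong[where g="?Z m"]) auto
  qed
  have A'm: "A' n m i \<in> borel_measurable M" if "i < Suc n" for n m i
    unfolding A'_def using Gab[OF _ that] Tin[of i n] that
    by (intro borel_measurable_sum borel_measurable_times borel_measurable_diff borel_measurable_divide XM WM) auto
  have Am: "A n i \<in> borel_measurable M" if "i < Suc n" for n i
  proof -
    have "(\<lambda>\<omega>. A' n 0 i \<omega> - (A' n 0 i \<omega> - A n i \<omega>)) \<in> borel_measurable M"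
      by (rule borel_measurable_diff[OF A'm[OF that] null_in_prob_measurable[OF A'_null[OF that]]])
    then show ?thesis by simp
  qed
  have ex: "\<exists>m. expectation (\<lambda>\<omega>. min 1 \<bar>\<Sum>i<Suc n. (A' n m i \<omega> - A n i \<omega>)\<bar>) < 1 / real (Suc n) \<and>
      expectation (\<lambda>\<omega>. min 1 \<bar>\<Sum>i<Suc n. (A' n m i \<omega> - A n i \<omega>)\<^sup>2\<bar>) < 1 / real (Suc n)" for n
  proof -
    have "null_in_prob (\<lambda>m \<omega>. \<Sum>i<Suc n. (A' n m i \<omega> - A n i \<omega>))"
      by (rule null_in_prob_sum) (use A'_null in auto)
    moreover have "null_in_prob (\<lambda>m \<omega>. \<Sum>i<Suc n. (A' n m i \<omega> - A n i \<omega>)\<^sup>2)"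
      by (rule null_in_prob_sum) (use null_in_prob_power2[OF A'_null] in auto)
    ultimately have "eventually (\<lambda>m. expectation (\<lambda>\<omega>. min 1 \<bar>\<Sum>i<Suc n. (A' n m i \<omega> - A n i \<omega>)\<bar>) < 1 / real (Suc n) \<and>
      expectation (\<lambda>\<omega>. min 1 \<bar>\<Sum>i<Suc n. (A' n m i \<omega> - A n i \<omega>)\<^sup>2\<bar>) < 1 / real (Suc n)) sequentially"
      by (intro eventually_conj null_in_prob_choose) auto
    then show ?thesis by (rule eventually_happens'[OF sequentially_bot])
  qed
  \<comment> \<open>Diagonal choice: for the \<open>n\<close>-th coarse grid the inner mesh is so
    fine that the errors of all its cells together, and their squares, are below
    \<open>1 / (n + 1)\<close> in the truncated expectation.\<close>
  define mf where "mf n = (SOME m. expectation (\<lambda>\<omega>. min 1 \<bar>\<Sum>i<Suc n. (A' n m i \<omega> - A n i \<omega>)\<bar>) < 1 / real (Suc n) \<and>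
      expectation (\<lambda>\<omega>. min 1 \<bar>\<Sum>i<Suc n. (A' n m i \<omega> - A n i \<omega>)\<^sup>2\<bar>) < 1 / real (Suc n))" for n
  note mf = someI_ex[OF ex, folded mf_def, THEN conjunct1] someI_ex[OF ex, folded mf_def, THEN conjunct2]
  have inv_lim: "(\<lambda>n. 1 / real (Suc n)) \<longlonglongrightarrow> 0"
    using LIMSEQ_Suc[OF lim_const_over_n[of "1::real"]] by simp
  have d1: "null_in_prob (\<lambda>n \<omega>. \<Sum>i<Suc n. (A' n (mf n) i \<omega> - A n i \<omega>))"
    unfolding null_in_prob_def
  proof (intro conjI allI)
    show "(\<lambda>\<omega>. \<Sum>i<Suc n. (A' n (mf n) i \<omega> - A n i \<omega>)) \<in> borel_measurable M" for n
      using A'm Am by (intro borel_measurable_sum borel_measurable_diff) auto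
    show "(\<lambda>n. expectation (\<lambda>\<omega>. min 1 \<bar>\<Sum>i<Suc n. (A' n (mf n) i \<omega> - A n i \<omega>)\<bar>)) \<longlonglongrightarrow> 0"
      by (rule squeeze_0[OF _ less_imp_le[OF mf(1)] inv_lim]) (rule Bochner_Integration.integral_nonneg, simp)
  qed
  have d2: "null_in_prob (\<lambda>n \<omega>. \<Sum>i<Suc n. (A' n (mf n) i \<omega> - A n i \<omega>)\<^sup>2)"
    unfolding null_in_prob_def
  proof (intro conjI allI)
    show "(\<lambda>\<omega>. \<Sum>i<Suc n. (A' n (mf n) i \<omega> - A n i \<omega>)\<^sup>2) \<in> borel_measurable M" for n
      using A'm Am by (intro borel_measurable_sum borel_measurable_diff borel_measurable_power) auto
    show "(\<lambda>n. expectation (\<lambda>\<omega>. min 1 \<bar>\<Sum>i<Suc n. (A' n (mf n) i \<omega> - A n i \<omega>)\<^sup>2\<bar>)) \<longlonglongrightarrow> 0"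
      by (rule squeeze_0[OF _ less_imp_le[OF mf(2)] inv_lim]) (rule Bochner_Integration.integral_nonneg, simp)
  qed
  \<comment> \<open>Clamping the relative deviation at \<open>d\<close> gives a bounded integrand,
    to which the isometry applies. Outside \<open>V d n\<close> the clamp does nothing, and by
    uniform continuity the probability of \<open>V d n\<close> vanishes for fixed
    \<open>d\<close>.\<close>
  define cl where "cl d x = max (- d) (min d x)" for d x :: real
  define V where "V d n = {\<omega> \<in> space M. \<exists>i\<in>{..<Suc n}. \<exists>j\<in>{..<Suc (mf n)}. d < \<bar>X (G n (mf n) i j) \<omega> / X (T n i) \<omega> - 1\<bar>}" for d n
  have Vpred: "Measurable.pred M (\<lambda>\<omega>. \<exists>i\<in>{..<Suc n}. \<exists>j\<in>{..<Suc (mf n)}. d < \<bar>X (G n (mf n) i j) \<omega> / X (T n i) \<omega> - 1\<bar>)" for d n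
  proof (intro pred_intros_finite finite_lessThan)
    fix i j assume ij: "i \<in> {..<Suc n}" "j \<in> {..<Suc (mf n)}"
    have [measurable]: "X (G n (mf n) i j) \<in> borel_measurable M" "X (T n i) \<in> borel_measurable M"
      using ij Gab[of j "mf n" i n] Tin[of i n] by (auto intro: XM)
    show "Measurable.pred M (\<lambda>\<omega>. d < \<bar>X (G n (mf n) i j) \<omega> / X (T n i) \<omega> - 1\<bar>)" by measurable
  qed
  have Vm: "V d n \<in> events" for d n unfolding V_def using Vpred by (simp add: pred_def)
  have Vlim: "(\<lambda>n. prob (V d n)) \<longlonglongrightarrow> 0" if "0 < d" for d
    unfolding V_def
  proof (rule prob_tendsto_0[OF Vpred])
    fix \<omega> assume \<omega>: "\<omega> \<in> space M"
    have "eventually (\<lambda>n. \<forall>s\<in>{a..b}. \<forall>s'\<in>{a..b}. \<bar>s' - s\<bar> \<le> h n \<longrightarrow> \<bar>X s' \<omega> / X s \<omega> - 1\<bar> \<le> d) sequentially"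
      by (rule uniform_ratio_continuity[OF Xc[OF \<omega>] _ that hlim]) (use Xp[OF \<omega>] in auto)
    then show "eventually (\<lambda>n. \<not> (\<exists>i\<in>{..<Suc n}. \<exists>j\<in>{..<Suc (mf n)}. d < \<bar>X (G n (mf n) i j) \<omega> / X (T n i) \<omega> - 1\<bar>)) sequentially"
    proof eventually_elim
      case (elim n)
      have "\<bar>X (G n (mf n) i j) \<omega> / X (T n i) \<omega> - 1\<bar> \<le> d" if "i < Suc n" "j < Suc (mf n)" for i j
        using elim Gab[of j "mf n" i n] Tin[of i n] Gin[of j "mf n" n i] TS[of n i] that
        by (simp add: abs_le_iff)
      then show ?case by (auto simp: not_less)
    qed
  qed
  define Z where "Z d n i j \<omega> = cl d (X (G n (mf n) i j) \<omega> / X (T n i) \<omega> - 1)" for d n i j \<omega>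
  define Y where "Y d n i \<omega> = (\<Sum>j<Suc (mf n). Z d n i j \<omega> * (W (G n (mf n) i (Suc j)) \<omega> - W (G n (mf n) i j) \<omega>))" for d n i \<omega>
  have YA: "A' n (mf n) i \<omega> = k * Y d n i \<omega>" if "\<omega> \<in> space M" "\<omega> \<notin> V d n" "i < Suc n" for d n i \<omega>
    unfolding A'_def Y_def sum_distrib_left
  proof (rule sum.cong[OF refl])
    fix j assume "j \<in> {..<Suc (mf n)}"
    then have "\<bar>X (G n (mf n) i j) \<omega> / X (T n i) \<omega> - 1\<bar> \<le> d" using that by (auto simp: V_def not_less)
    then have "Z d n i j \<omega> = X (G n (mf n) i j) \<omega> / X (T n i) \<omega> - 1"
      unfolding Z_def cl_def by (simp add: abs_le_iff min_absorb2 max_absorb2)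
    then show "k * (X (G n (mf n) i j) \<omega> / X (T n i) \<omega> - 1) * (W (G n (mf n) i (Suc j)) \<omega> - W (G n (mf n) i j) \<omega>)
       = k * (Z d n i j \<omega> * (W (G n (mf n) i (Suc j)) \<omega> - W (G n (mf n) i j) \<omega>))" by simp
  qed
  have Gstep: "G n m i j < G n m i (Suc j)" for n m i j
  proof -
    define c where "c = h n / real (Suc m)"
    have "c > 0" using h0[of n] by (simp add: c_def)
    then show ?thesis unfolding G_def c_def[symmetric] by (simp add: distrib_right)
  qed
  have Zm: "Z d n i j \<in> borel_measurable (F (G n (mf n) i j))" if "i < Suc n" "j < Suc (mf n)" for d n i j
  proof -
    have [measurable]: "X (G n (mf n) i j) \<in> borel_measurable (F (G n (mf n) i j))" using Gab[of j "mf n" i n] that by (intro Xm) auto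
    have [measurable]: "X (T n i) \<in> borel_measurable (F (G n (mf n) i j))"
      by (rule measurable_F_mono[OF Gin(1) Xm]) (use Tin[of i n] that in auto)
    show ?thesis unfolding Z_def cl_def by measurable
  qed
  have Zb: "\<bar>Z d n i j \<omega>\<bar> \<le> d" if "0 < d" for d n i j \<omega> using that by (simp add: Z_def cl_def)
  have Y2: "integrable M (\<lambda>\<omega>. (Y d n i \<omega>)\<^sup>2) \<and> expectation (\<lambda>\<omega>. (Y d n i \<omega>)\<^sup>2) \<le> d\<^sup>2 * h n" if "i < Suc n" "0 < d" for d n i
  proof -
    have "0 \<le> G n (mf n) i 0" using Tin[of i n] that ab by (simp add: GT)
    from expectation_square_sum_bounded[where T="G n (mf n) i" and n="Suc (mf n)" and \<xi>="Z d n i" and d=d, OF this Gstep Zm[OF that(1)] Zb[OF that(2)]]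
    show ?thesis unfolding Y_def by (simp only: GT TS simp_thms)
  qed
  \<comment> \<open>The inner grids of all coarse cells are read as a single grid. Orthogonality
    then holds across cells as well and gives \<open>d\<^sup>2 * (b - a)\<close>; adding up standard
    deviations cell by cell would diverge with \<open>n\<close>.\<close>
  have S2: "integrable M (\<lambda>\<omega>. (\<Sum>i<Suc n. Y d n i \<omega>)\<^sup>2) \<and> expectation (\<lambda>\<omega>. (\<Sum>i<Suc n. Y d n i \<omega>)\<^sup>2) \<le> d\<^sup>2 * (b - a)" if "0 < d" for d n
  proof -
    define P where "P = Suc (mf n)"
    define g where "g l = a + real l * (h n / real P)" for l
    have P0: "P > 0" by (simp add: P_def)
    have gG: "g (i * P + j) = G n (mf n) i j" for i j
      using P0 by (simp add: g_def G_def T_def P_def[symmetric] algebra_simps add_divide_distrib)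
    have gS: "g (Suc (i * P + j)) = G n (mf n) i (Suc j)" for i j
      using gG[of i "Suc j"] by simp
    define z where "z l = Z d n (l div P) (l mod P)" for l
    have zZ: "z (i * P + j) = Z d n i j" if "j < P" for i j using that by (simp add: z_def)
    have "(\<Sum>i<Suc n. Y d n i \<omega>) = (\<Sum>l<Suc n * P. z l \<omega> * (W (g (Suc l)) \<omega> - W (g l) \<omega>))" for \<omega>
      unfolding sum_block[symmetric] Y_def P_def[symmetric] by (intro sum.cong refl) (simp add: gG gS zZ del: mult_Suc)
    moreover have gstep: "g l < g (Suc l)" for l
    proof -
      define c where "c = h n / real P"
      have "c > 0" using h0[of n] P0 by (simp add: c_def)
      then show ?thesis unfolding g_def c_def[symmetric] by (simp add: distrib_right)
    qed
    moreover have zm: "z l \<in> borel_measurable (F (g l))" if "l < Suc n * P" for l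
    proof -
      have "l div P < Suc n" using that P0 by (simp add: less_mult_imp_div_less)
      moreover have "l mod P < P" using P0 by simp
      ultimately show ?thesis
        using Zm[of "l div P" n "l mod P" d] gG[of "l div P" "l mod P"] unfolding z_def P_def[symmetric]
        by (simp only: div_mult_mod_eq)
    qed
    moreover have "g (Suc n * P) = b" "g 0 = a" using P0 TN(1)[of n] by (simp_all add: g_def T_def of_nat_mult del: of_nat_Suc mult_Suc)
    moreover have zb: "\<bar>z l \<omega>\<bar> \<le> d" for l \<omega> unfolding z_def by (rule Zb[OF that])
    ultimately show ?thesis
      using expectation_square_sum_bounded[where T=g and n="Suc n * P" and \<xi>=z and d=d, OF _ gstep zm zb] ab(1)
      by (simp only: simp_thms)
  qed
  have s1: "null_in_prob (\<lambda>n \<omega>. \<Sum>i<Suc n. A' n (mf n) i \<omega>)"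
    unfolding null_in_prob_def
  proof (intro conjI allI)
    show m: "(\<lambda>\<omega>. \<Sum>i<Suc n. A' n (mf n) i \<omega>) \<in> borel_measurable M" for n
      using A'm by (intro borel_measurable_sum) auto
    show "(\<lambda>n. expectation (\<lambda>\<omega>. min 1 \<bar>\<Sum>i<Suc n. A' n (mf n) i \<omega>\<bar>)) \<longlonglongrightarrow> 0"
    proof (rule tendsto_0_by_slack[where c="1 + k\<^sup>2 * (b - a)"])
      show "0 \<le> expectation (\<lambda>\<omega>. min 1 \<bar>\<Sum>i<Suc n. A' n (mf n) i \<omega>\<bar>)" for n
        by (rule Bochner_Integration.integral_nonneg) simp
      show "0 \<le> 1 + k\<^sup>2 * (b - a)" using ab by simp
      fix d :: real assume d: "0 < d" "d < 1"
      have "expectation (\<lambda>\<omega>. min 1 \<bar>\<Sum>i<Suc n. A' n (mf n) i \<omega>\<bar>) \<le> prob (V d n) + (1 + k\<^sup>2 * (b - a)) * d" for n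
      proof -
        let ?S = "\<lambda>\<omega>. \<Sum>i<Suc n. Y d n i \<omega>"
        have i: "integrable M (\<lambda>\<omega>. indicat_real (V d n) \<omega> + (d + k\<^sup>2 / d * (?S \<omega>)\<^sup>2))"
          using S2[OF d(1)] Vm by (intro Bochner_Integration.integrable_add integrable_real_indicator integrable_mult_right)
            (auto simp: emeasure_eq_measure)
        have "expectation (\<lambda>\<omega>. min 1 \<bar>\<Sum>i<Suc n. A' n (mf n) i \<omega>\<bar>) \<le> expectation (\<lambda>\<omega>. indicat_real (V d n) \<omega> + (d + k\<^sup>2 / d * (?S \<omega>)\<^sup>2))"
        proof (rule integral_mono[OF integrable_min_1[OF m] i])
          fix \<omega> assume \<omega>: "\<omega> \<in> space M"
          show "min 1 \<bar>\<Sum>i<Suc n. A' n (mf n) i \<omega>\<bar> \<le> indicat_real (V d n) \<omega> + (d + k\<^sup>2 / d * (?S \<omega>)\<^sup>2)"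
          proof (cases "\<omega> \<in> V d n")
            case True
            then show ?thesis using d by (simp add: add_nonneg_nonneg min.coboundedI1)
          next
            case False
            have "(\<Sum>i<Suc n. A' n (mf n) i \<omega>) = k * ?S \<omega>"
              unfolding sum_distrib_left using YA[OF \<omega> False] by (intro sum.cong) auto
            \<comment> \<open>Passes from L2 to L1 without a root: the second moment is of order
              \<open>d\<^sup>2\<close>, so after division by \<open>d\<close> both terms are of
              order \<open>d\<close>.\<close>
            moreover have "\<bar>x\<bar> \<le> d + x\<^sup>2 / d" for x :: real
            proof -
              have "0 \<le> (\<bar>x\<bar> - d)\<^sup>2 + \<bar>x\<bar> * d" using d by simp
              then have "\<bar>x\<bar> * d \<le> d * d + x\<^sup>2" by (simp add: power2_eq_square algebra_simps)
              then show ?thesis using d by (simp add: field_simps power2_eq_square)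
            qed
            from this[of "k * ?S \<omega>"] have "\<bar>k * ?S \<omega>\<bar> \<le> d + k\<^sup>2 / d * (?S \<omega>)\<^sup>2" by (simp only: power_mult_distrib times_divide_eq_left)
            ultimately show ?thesis using False by simp
          qed
        qed
        also have "\<dots> = prob (V d n) + (d + k\<^sup>2 / d * expectation (\<lambda>\<omega>. (?S \<omega>)\<^sup>2))"
          using S2[OF d(1)] Vm by (subst Bochner_Integration.integral_add) (auto simp: emeasure_eq_measure prob_space)
        also have "\<dots> \<le> prob (V d n) + (d + k\<^sup>2 / d * (d\<^sup>2 * (b - a)))"
          using S2[OF d(1), of n] d by (intro add_left_mono mult_left_mono) auto
        also have "\<dots> = prob (V d n) + (1 + k\<^sup>2 * (b - a)) * d" using d by (simp add: field_simps power2_eq_square)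
        finally show ?thesis .
      qed
      with Vlim[OF d(1)] show "\<exists>g. g \<longlonglongrightarrow> 0 \<and> (\<forall>n. expectation (\<lambda>\<omega>. min 1 \<bar>\<Sum>i<Suc n. A' n (mf n) i \<omega>\<bar>) \<le> g n + (1 + k\<^sup>2 * (b - a)) * d)"
        by blast
    qed
  qed
  have s2: "null_in_prob (\<lambda>n \<omega>. \<Sum>i<Suc n. (A' n (mf n) i \<omega>)\<^sup>2)"
    unfolding null_in_prob_def
  proof (intro conjI allI)
    show m: "(\<lambda>\<omega>. \<Sum>i<Suc n. (A' n (mf n) i \<omega>)\<^sup>2) \<in> borel_measurable M" for n
      using A'm by (intro borel_measurable_sum borel_measurable_power) auto
    show "(\<lambda>n. expectation (\<lambda>\<omega>. min 1 \<bar>\<Sum>i<Suc n. (A' n (mf n) i \<omega>)\<^sup>2\<bar>)) \<longlonglongrightarrow> 0"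
    proof (rule tendsto_0_by_slack[where c="k\<^sup>2 * (b - a)"])
      show "0 \<le> expectation (\<lambda>\<omega>. min 1 \<bar>\<Sum>i<Suc n. (A' n (mf n) i \<omega>)\<^sup>2\<bar>)" for n
        by (rule Bochner_Integration.integral_nonneg) simp
      show "0 \<le> k\<^sup>2 * (b - a)" using ab by simp
      fix d :: real assume d: "0 < d" "d < 1"
      have "expectation (\<lambda>\<omega>. min 1 \<bar>\<Sum>i<Suc n. (A' n (mf n) i \<omega>)\<^sup>2\<bar>) \<le> prob (V d n) + k\<^sup>2 * (b - a) * d" for n
      proof -
        have i: "integrable M (\<lambda>\<omega>. indicat_real (V d n) \<omega> + (\<Sum>i<Suc n. k\<^sup>2 * (Y d n i \<omega>)\<^sup>2))"
          using Y2[OF _ d(1)] Vm by (intro Bochner_Integration.integrable_add integrable_real_indicator integrable_mult_right Bochner_Integration.integrable_sum)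
            (auto simp: emeasure_eq_measure)
        have "expectation (\<lambda>\<omega>. min 1 \<bar>\<Sum>i<Suc n. (A' n (mf n) i \<omega>)\<^sup>2\<bar>) \<le> expectation (\<lambda>\<omega>. indicat_real (V d n) \<omega> + (\<Sum>i<Suc n. k\<^sup>2 * (Y d n i \<omega>)\<^sup>2))"
        proof (rule integral_mono[OF integrable_min_1[OF m] i])
          fix \<omega> assume \<omega>: "\<omega> \<in> space M"
          have s0: "0 \<le> (\<Sum>i<Suc n. k\<^sup>2 * (Y d n i \<omega>)\<^sup>2)" by (intro sum_nonneg) simp
          show "min 1 \<bar>\<Sum>i<Suc n. (A' n (mf n) i \<omega>)\<^sup>2\<bar> \<le> indicat_real (V d n) \<omega> + (\<Sum>i<Suc n. k\<^sup>2 * (Y d n i \<omega>)\<^sup>2)"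
          proof (cases "\<omega> \<in> V d n")
            case True
            then show ?thesis using s0 by (simp add: min.coboundedI1 del: sum.lessThan_Suc)
          next
            case False
            have "(\<Sum>i<Suc n. (A' n (mf n) i \<omega>)\<^sup>2) = (\<Sum>i<Suc n. k\<^sup>2 * (Y d n i \<omega>)\<^sup>2)"
              using YA[OF \<omega> False] by (intro sum.cong) (auto simp: power_mult_distrib)
            then show ?thesis using s0 False by (simp del: sum.lessThan_Suc)
          qed
        qed
        also have "\<dots> = prob (V d n) + (\<Sum>i<Suc n. k\<^sup>2 * expectation (\<lambda>\<omega>. (Y d n i \<omega>)\<^sup>2))"
        proof -
          have "integrable M (\<lambda>\<omega>. \<Sum>i<Suc n. k\<^sup>2 * (Y d n i \<omega>)\<^sup>2)"
            using Y2[OF _ d(1)] by (intro Bochner_Integration.integrable_sum integrable_mult_right) auto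
          moreover have "expectation (\<lambda>\<omega>. \<Sum>i<Suc n. k\<^sup>2 * (Y d n i \<omega>)\<^sup>2) = (\<Sum>i<Suc n. k\<^sup>2 * expectation (\<lambda>\<omega>. (Y d n i \<omega>)\<^sup>2))"
            using Y2[OF _ d(1)] by (subst Bochner_Integration.integral_sum) auto
          ultimately show ?thesis
            using Vm by (subst Bochner_Integration.integral_add) (auto simp: emeasure_eq_measure simp del: sum.lessThan_Suc)
        qed
        also have "(\<Sum>i<Suc n. k\<^sup>2 * expectation (\<lambda>\<omega>. (Y d n i \<omega>)\<^sup>2)) \<le> (\<Sum>i<Suc n. k\<^sup>2 * (d\<^sup>2 * h n))"
          using Y2[OF _ d(1)] by (intro sum_mono mult_left_mono) auto
        also have "\<dots> = k\<^sup>2 * d\<^sup>2 * (b - a)"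
          using ab by (simp only: sum_constant card_lessThan h_def) simp
        also have "\<dots> \<le> k\<^sup>2 * (b - a) * d"
        proof -
          have "d\<^sup>2 \<le> d" using mult_left_le[of d d] d by (simp add: power2_eq_square)
          then have "k\<^sup>2 * (b - a) * d\<^sup>2 \<le> k\<^sup>2 * (b - a) * d" using ab by (intro mult_left_mono) auto
          then show ?thesis by (simp only: mult_ac)
        qed
        finally show ?thesis by simp
      qed
      with Vlim[OF d(1)] show "\<exists>g. g \<longlonglongrightarrow> 0 \<and> (\<forall>n. expectation (\<lambda>\<omega>. min 1 \<bar>\<Sum>i<Suc n. (A' n (mf n) i \<omega>)\<^sup>2\<bar>) \<le> g n + k\<^sup>2 * (b - a) * d)"
        by blast
    qed
  qed
  have a1: "null_in_prob (\<lambda>n \<omega>. \<Sum>i<Suc n. A n i \<omega>)"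
    using null_in_prob_diff[OF s1 d1] by (simp only: sum_subtractf diff_diff_eq2 add_diff_cancel_left')
  have a2: "null_in_prob (\<lambda>n \<omega>. \<Sum>i<Suc n. (A n i \<omega>)\<^sup>2)"
  proof (rule null_in_prob_bound)
    show "null_in_prob (\<lambda>n \<omega>. 2 * ((\<Sum>i<Suc n. (A' n (mf n) i \<omega>)\<^sup>2) + (\<Sum>i<Suc n. (A' n (mf n) i \<omega> - A n i \<omega>)\<^sup>2)))"
      by (rule null_in_prob_mult[OF null_in_prob_add[OF s2 d2]]) simp
    show "(\<lambda>\<omega>. \<Sum>i<Suc n. (A n i \<omega>)\<^sup>2) \<in> borel_measurable M" for n
      using Am by (intro borel_measurable_sum borel_measurable_power) auto
    show "AE \<omega> in M. \<bar>\<Sum>i<Suc n. (A n i \<omega>)\<^sup>2\<bar> \<le> \<bar>2 * ((\<Sum>i<Suc n. (A' n (mf n) i \<omega>)\<^sup>2) + (\<Sum>i<Suc n. (A' n (mf n) i \<omega> - A n i \<omega>)\<^sup>2))\<bar>" for n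
    proof (rule AE_I2)
      fix \<omega>
      have sq: "x\<^sup>2 \<le> 2 * (y\<^sup>2 + (y - x)\<^sup>2)" for x y :: real
        using zero_le_power2[of "x - 2 * y"] by (simp add: power2_eq_square algebra_simps)
      have "(\<Sum>i<Suc n. (A n i \<omega>)\<^sup>2) \<le> (\<Sum>i<Suc n. 2 * ((A' n (mf n) i \<omega>)\<^sup>2 + (A' n (mf n) i \<omega> - A n i \<omega>)\<^sup>2))"
        by (intro sum_mono sq)
      also have "\<dots> = 2 * ((\<Sum>i<Suc n. (A' n (mf n) i \<omega>)\<^sup>2) + (\<Sum>i<Suc n. (A' n (mf n) i \<omega> - A n i \<omega>)\<^sup>2))"
        by (simp only: sum_distrib_left sum.distrib distrib_left)
      moreover have "0 \<le> (\<Sum>i<Suc n. (A n i \<omega>)\<^sup>2)" by (intro sum_nonneg) simp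
      ultimately show "\<bar>\<Sum>i<Suc n. (A n i \<omega>)\<^sup>2\<bar> \<le> \<bar>2 * ((\<Sum>i<Suc n. (A' n (mf n) i \<omega>)\<^sup>2) + (\<Sum>i<Suc n. (A' n (mf n) i \<omega> - A n i \<omega>)\<^sup>2))\<bar>"
        by linarith
    qed
  qed
  have qv: "null_in_prob (\<lambda>n \<omega>. (\<Sum>i<Suc n. (w n i \<omega>)\<^sup>2) - (b - a))"
    using quadratic_variation_null[OF ab] by (simp only: w_def T_def h_def)
  \<comment> \<open>Three sequences that are null in probability become null almost surely along a
    common subsequence, obtained by thinning out three times.\<close>
  obtain r1 where r1: "strict_mono (r1 :: nat \<Rightarrow> nat)" "AE \<omega> in M. (\<lambda>n. \<Sum>i<Suc (r1 n). A (r1 n) i \<omega>) \<longlonglongrightarrow> 0"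
    using null_in_prob_AE_subseq[OF a1] by blast
  obtain r2 where r2: "strict_mono (r2 :: nat \<Rightarrow> nat)" "AE \<omega> in M. (\<lambda>n. \<Sum>i<Suc (r1 (r2 n)). (A (r1 (r2 n)) i \<omega>)\<^sup>2) \<longlonglongrightarrow> 0"
    using null_in_prob_AE_subseq[OF null_in_prob_subseq[OF a2 r1(1)]] by blast
  have r12: "strict_mono (\<lambda>n. r1 (r2 n))" using strict_mono_o[OF r1(1) r2(1)] by (simp add: comp_def)
  obtain r3 where r3: "strict_mono (r3 :: nat \<Rightarrow> nat)" "AE \<omega> in M. (\<lambda>n. (\<Sum>i<Suc (r1 (r2 (r3 n))). (w (r1 (r2 (r3 n))) i \<omega>)\<^sup>2) - (b - a)) \<longlonglongrightarrow> 0"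
    using null_in_prob_AE_subseq[OF null_in_prob_subseq[OF qv r12]] by blast
  define r where "r n = r1 (r2 (r3 n))" for n
  have r: "strict_mono r" using strict_mono_o[OF r12 r3(1)] by (simp add: comp_def r_def[abs_def])
  show ?thesis
    using r1(2) r2(2) r3(2) AE_space
  proof eventually_elim
    case (elim \<omega>)
    note \<omega> = elim(4)
    have A1: "(\<lambda>n. \<Sum>i<Suc (r n). A (r n) i \<omega>) \<longlonglongrightarrow> 0"
      using LIMSEQ_subseq_LIMSEQ[OF elim(1) strict_mono_o[OF r2(1) r3(1)]] by (simp add: comp_def r_def)
    have A2: "(\<lambda>n. \<Sum>i<Suc (r n). (A (r n) i \<omega>)\<^sup>2) \<longlonglongrightarrow> 0"
      using LIMSEQ_subseq_LIMSEQ[OF elim(2) r3(1)] by (simp add: comp_def r_def)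
    have Q: "(\<lambda>n. \<Sum>i<Suc (r n). (w (r n) i \<omega>)\<^sup>2) \<longlonglongrightarrow> b - a"
      using tendsto_add[OF elim(3) tendsto_const[of "b - a"]] by (simp add: r_def)
    have hr: "(\<lambda>n. h (r n)) \<longlonglongrightarrow> 0" using LIMSEQ_subseq_LIMSEQ[OF hlim r] by (simp add: comp_def)
    have cont: "eventually (\<lambda>n. \<forall>s\<in>{a..b}. \<forall>s'\<in>{a..b}. \<bar>s' - s\<bar> \<le> h (r n) \<longrightarrow> \<bar>X s' \<omega> / X s \<omega> - 1\<bar> \<le> d) sequentially" if "0 < d" for d
      by (rule uniform_ratio_continuity[OF Xc[OF \<omega>] _ that hr]) (use Xp[OF \<omega>] in auto)
    have \<rho>: "k * w n i \<omega> + \<mu> * h n + A n i \<omega> + B n i \<omega> = D n i \<omega>" for n i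
      by (simp add: A_def B_def algebra_simps)
    \<comment> \<open>In contrast to \<open>A\<close>, the drift error is small on each path: the
      time average of \<open>X / X (T n i)\<close> over a cell is uniformly close to 1.\<close>
    have B0: "(\<lambda>n. \<Sum>i<Suc (r n). \<bar>B (r n) i \<omega>\<bar>) \<longlonglongrightarrow> 0"
    proof (rule LIMSEQ_I)
      fix \<epsilon> :: real assume \<epsilon>: "0 < \<epsilon>"
      define q where "q = (\<bar>\<mu>\<bar> + 1) * (b - a)"
      have q: "0 < q" using ab by (simp add: q_def add_nonneg_pos)
      define d where "d = \<epsilon> / (2 * q)"
      have d: "0 < d" using \<epsilon> q by (simp add: d_def)
      from cont[OF d] have "eventually (\<lambda>n. norm ((\<Sum>i<Suc (r n). \<bar>B (r n) i \<omega>\<bar>) - 0) < \<epsilon>) sequentially"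
      proof eventually_elim
        case (elim n)
        have "(\<Sum>i<Suc (r n). \<bar>B (r n) i \<omega>\<bar>) \<le> (\<Sum>i<Suc (r n). \<bar>\<mu>\<bar> * (d * h (r n)))"
        proof (rule sum_mono)
          fix i assume i: "i \<in> {..<Suc (r n)}"
          let ?t = "T (r n) i" and ?t' = "T (r n) (Suc i)"
          have t: "a \<le> ?t" "?t' \<le> b" "?t' - ?t = h (r n)" "?t \<le> ?t'"
            using Tin[of i "r n"] Tin[of "Suc i" "r n"] i TS[of "r n" i] h0[of "r n"] by auto
          have p: "X ?t \<omega> > 0" using Xp[OF \<omega>, of ?t] t by auto
          have "\<bar>I (r n) i \<omega> - X ?t \<omega> * (?t' - ?t)\<bar> \<le> (d * X ?t \<omega>) * (?t' - ?t)"
            unfolding I_def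
          proof (rule set_integral_approx_const)
            show "continuous_on {?t..?t'} (\<lambda>s. X s \<omega>)"
              by (rule continuous_on_subset[OF Xc[OF \<omega>]]) (use t in auto)
            fix s assume s: "s \<in> {?t..?t'}"
            then have "\<bar>X s \<omega> / X ?t \<omega> - 1\<bar> \<le> d" using elim t by simp
            moreover have "X s \<omega> - X ?t \<omega> = X ?t \<omega> * (X s \<omega> / X ?t \<omega> - 1)" using p by (simp add: field_simps)
            ultimately show "\<bar>X s \<omega> - X ?t \<omega>\<bar> \<le> d * X ?t \<omega>" using p by (simp add: abs_mult mult.commute)
          qed (use t in simp)
          moreover have "I (r n) i \<omega> / X ?t \<omega> - h (r n) = (I (r n) i \<omega> - X ?t \<omega> * h (r n)) / X ?t \<omega>" using p by (simp add: field_simps)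
          ultimately have "\<bar>I (r n) i \<omega> / X ?t \<omega> - h (r n)\<bar> \<le> d * h (r n)"
            using p t by (simp add: abs_divide field_simps)
          then show "\<bar>B (r n) i \<omega>\<bar> \<le> \<bar>\<mu>\<bar> * (d * h (r n))" by (simp add: B_def abs_mult mult_left_mono)
        qed
        also have "\<dots> = \<bar>\<mu>\<bar> * d * (b - a)" by (simp only: sum_constant card_lessThan h_def) simp
        also have "\<dots> \<le> (\<bar>\<mu>\<bar> + 1) * d * (b - a)" using d ab by (intro mult_right_mono) auto
        also have "\<dots> = q * d" by (simp add: q_def mult_ac)
        also have "\<dots> = \<epsilon> / 2" using q by (simp add: d_def)
        finally have "(\<Sum>i<Suc (r n). \<bar>B (r n) i \<omega>\<bar>) < \<epsilon>" using \<epsilon> by simp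
        moreover have "0 \<le> (\<Sum>i<Suc (r n). \<bar>B (r n) i \<omega>\<bar>)" by (intro sum_nonneg) simp
        ultimately show ?case by (simp only: real_norm_def diff_zero abs_of_nonneg)
      qed
      then show "\<exists>no. \<forall>n\<ge>no. norm ((\<Sum>i<Suc (r n). \<bar>B (r n) i \<omega>\<bar>) - 0) < \<epsilon>" by (simp only: eventually_sequentially)
    qed
    have "(\<lambda>n. \<Sum>i<Suc (r n). ln (1 + (k * w (r n) i \<omega> + \<mu> * h (r n) + A (r n) i \<omega> + B (r n) i \<omega>)))
      \<longlonglongrightarrow> k * (W b \<omega> - W a \<omega>) + \<mu> * (b - a) - k\<^sup>2 * (b - a) / 2"
    proof (rule sum_ln_increments_tendsto[where N="\<lambda>n. Suc (r n)" and w="\<lambda>n i. w (r n) i \<omega>" and A="\<lambda>n i. A (r n) i \<omega>" and B="\<lambda>n i. B (r n) i \<omega>" and h="\<lambda>n. h (r n)",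
          OF _ _ hr A1 A2 B0 Q])
      show "real (Suc (r n)) * h (r n) = b - a" for n by (simp add: h_def)
      show "0 \<le> b - a" using ab by simp
      show "(\<Sum>i<Suc (r n). w (r n) i \<omega>) = W b \<omega> - W a \<omega>" for n
        unfolding w_def using sum_lessThan_telescope[of "\<lambda>i. W (T (r n) i) \<omega>" "Suc (r n)"] by (simp only: TN)
      fix d :: real assume "0 < d"
      from cont[OF this] show "eventually (\<lambda>n. \<forall>i<Suc (r n). \<bar>k * w (r n) i \<omega> + \<mu> * h (r n) + A (r n) i \<omega> + B (r n) i \<omega>\<bar> \<le> d) sequentially"
      proof eventually_elim
        case (elim n)
        show ?case
        proof (intro allI impI)
          fix i assume i: "i < Suc (r n)"
          show "\<bar>k * w (r n) i \<omega> + \<mu> * h (r n) + A (r n) i \<omega> + B (r n) i \<omega>\<bar> \<le> d"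
            unfolding \<rho> D_def
            using elim Tin[of i "r n"] Tin[of "Suc i" "r n"] i TS[of "r n" i] h0[of "r n"] by simp
        qed
      qed
    qed
    moreover have "(\<Sum>i<Suc (r n). ln (1 + (k * w (r n) i \<omega> + \<mu> * h (r n) + A (r n) i \<omega> + B (r n) i \<omega>))) = ln (X b \<omega>) - ln (X a \<omega>)" for n
    proof -
      have "(\<Sum>i<Suc (r n). ln (1 + D (r n) i \<omega>)) = (\<Sum>i<Suc (r n). ln (X (T (r n) (Suc i)) \<omega>) - ln (X (T (r n) i) \<omega>))"
      proof (rule sum.cong[OF refl])
        fix i assume i: "i \<in> {..<Suc (r n)}"
        have "0 < X (T (r n) (Suc i)) \<omega>" "0 < X (T (r n) i) \<omega>"
          using Xp[OF \<omega>] Tin[of i "r n"] Tin[of "Suc i" "r n"] i by auto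
        then show "ln (1 + D (r n) i \<omega>) = ln (X (T (r n) (Suc i)) \<omega>) - ln (X (T (r n) i) \<omega>)"
          by (simp add: D_def ln_div)
      qed
      also have "\<dots> = ln (X b \<omega>) - ln (X a \<omega>)"
        using sum_lessThan_telescope[of "\<lambda>i. ln (X (T (r n) i) \<omega>)" "Suc (r n)"] by (simp only: TN)
      finally show ?thesis unfolding \<rho> .
    qed
    ultimately have "(\<lambda>n::nat. ln (X b \<omega>) - ln (X a \<omega>)) \<longlonglongrightarrow> k * (W b \<omega> - W a \<omega>) + \<mu> * (b - a) - k\<^sup>2 * (b - a) / 2"
      by (simp only:)
    then show ?case by (simp only: LIMSEQ_const_iff)
  qed
qed

end

section \<open>The logarithm of the wealth as Brownian motion with drift\<close>

lemma continuous_eq_0_by_rationals: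
  fixes f :: "real \<Rightarrow> real"
  assumes "a < b" "continuous_on {a..b} f" "\<And>q. q \<in> \<rat> \<Longrightarrow> a < q \<Longrightarrow> q < b \<Longrightarrow> f q = 0" "r \<in> {a..b}"
  shows "f r = 0"
proof -
  have cl: "closure ({a<..<b} \<inter> \<rat>) = {a..b}"
    using closure_open_Int_superset[of "{a<..<b}" \<rat>] assms(1) by (simp add: Rats_closure_real)
  show ?thesis
    by (rule continuous_constant_on_closure[of "{a<..<b} \<inter> \<rat>" f]) (use assms cl in auto)
qed

context brownian_motion begin

text \<open>While the control is the constant \<open>c\<close>, the equation is linear with
  coefficients \<open>\<mu> * c\<close> and \<open>\<sigma> * c\<close>. Constancy is demanded on
  the half-open interval only, because the perturbed control switches exactly at the end of its
  window; left-end Riemann sums do not use the right end.\<close>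

lemma wealth_log_increment:
  assumes wp: "wealth_process M F W \<mu> \<sigma> u t x X" and t: "0 \<le> t" "t \<le> a" "a < b"
    and u: "\<And>s y. a \<le> s \<Longrightarrow> s < b \<Longrightarrow> u s y = c" and pos: "0 < \<sigma>" "0 < c"
  shows "AE \<omega> in M. ln (X b \<omega>) - ln (X a \<omega>) = \<sigma> * c * (W b \<omega> - W a \<omega>) + (\<mu> * c - (\<sigma> * c)\<^sup>2 / 2) * (b - a)"
proof -
  let ?H = "\<lambda>s \<omega>. \<sigma> * u s (X s \<omega>) * X s \<omega>"
  have Xm: "X r \<in> borel_measurable (F r)" if "t \<le> r" for r
    using wp that unfolding wealth_process_def by blast
  have XM: "X r \<in> borel_measurable M" if "t \<le> r" for r
    using measurable_F_M[OF _ Xm[OF that]] t that by simp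
  have Xc: "continuous_on {t..} (\<lambda>r. X r \<omega>)" and Xp: "\<And>r. t \<le> r \<Longrightarrow> 0 < X r \<omega>" if "\<omega> \<in> space M" for \<omega>
    using wp that unfolding wealth_process_def by blast+
  have ito: "\<exists>I. has_ito_integral M F W ?H t r I \<and> (AE \<omega> in M. set_integrable lborel {t..r} (\<lambda>s. \<mu> * u s (X s \<omega>) * X s \<omega>) \<and>
        X r \<omega> = x + (LBINT s:{t..r}. \<mu> * u s (X s \<omega>) * X s \<omega>) + I \<omega>)" if "t \<le> r" for r
    using wp that unfolding wealth_process_def by blast
  have "AE \<omega> in M. ln (X b \<omega>) - ln (X a \<omega>) = \<sigma> * c * (W b \<omega> - W a \<omega>) + \<mu> * c * (b - a) - (\<sigma> * c)\<^sup>2 * (b - a) / 2"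
  proof (rule log_increment_of_linear_sde)
    show "0 \<le> a" "a < b" using t by auto
    show "X r \<in> borel_measurable (F r)" if "a \<le> r" for r using Xm[of r] t that by simp
    show "continuous_on {a..b} (\<lambda>r. X r \<omega>)" if "\<omega> \<in> space M" for \<omega>
      by (rule continuous_on_subset[OF Xc[OF that]]) (use t in auto)
    show "0 < X r \<omega>" if "\<omega> \<in> space M" "a \<le> r" for r \<omega> using Xp[OF that(1), of r] t that by simp
    fix s s' assume s: "a \<le> s" "s < s'" "s' \<le> b"
    have ts: "t \<le> s" "t \<le> s'" using s t by auto
    obtain I where I: "has_ito_integral M F W ?H t s I" "AE \<omega> in M. set_integrable lborel {t..s} (\<lambda>s. \<mu> * u s (X s \<omega>) * X s \<omega>) \<and>
        X s \<omega> = x + (LBINT s:{t..s}. \<mu> * u s (X s \<omega>) * X s \<omega>) + I \<omega>" using ito[OF ts(1)] by blast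
    obtain I' where I': "has_ito_integral M F W ?H t s' I'" "AE \<omega> in M. set_integrable lborel {t..s'} (\<lambda>s. \<mu> * u s (X s \<omega>) * X s \<omega>) \<and>
        X s' \<omega> = x + (LBINT s:{t..s'}. \<mu> * u s (X s \<omega>) * X s \<omega>) + I' \<omega>" using ito[OF ts(2)] by blast
    have Xss: "continuous_on {s..s'} (\<lambda>r. X r \<omega>)" if "\<omega> \<in> space M" for \<omega>
      by (rule continuous_on_subset[OF Xc[OF that]]) (use ts in auto)
    have iX: "set_integrable lborel {s..s'} (\<lambda>r. X r \<omega>)" if "\<omega> \<in> space M" for \<omega>
      by (rule borel_integrable_atLeastAtMost'[OF Xss[OF that]])
    \<comment> \<open>At \<open>s'\<close> the control may already have switched; time integrals
      ignore this single point.\<close>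
    have ae_ne: "AE r in lborel. r \<noteq> s'" by (rule AE_lborel_singleton)
    have null: "null_in_prob (\<lambda>m \<omega>. (\<Sum>j<Suc m. (\<sigma> * c * X (s + real j * ((s' - s) / real (Suc m))) \<omega>) *
      (W (s + real (Suc j) * ((s' - s) / real (Suc m))) \<omega> - W (s + real j * ((s' - s) / real (Suc m))) \<omega>)) - (I' \<omega> - I \<omega>))"
    proof (rule ito_integral_Riemann_sums[OF t(1) ts(1) s(2) I(1) I'(1), where Y="\<lambda>r \<omega>. \<sigma> * c * X r \<omega>"])
      show "(\<lambda>\<omega>. \<sigma> * c * X r \<omega>) \<in> borel_measurable (F r)" if "s \<le> r" for r
        using Xm[of r] ts that by simp
      show "continuous_on {s..s'} (\<lambda>r. \<sigma> * c * X r \<omega>)" if "\<omega> \<in> space M" for \<omega>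
        by (intro continuous_on_mult_left Xss that)
      show "\<sigma> * u r (X r \<omega>) * X r \<omega> = \<sigma> * c * X r \<omega>" if "s \<le> r" "r < s'" for r \<omega>
        using u[of r] that s by simp
    qed
    \<comment> \<open>The joint measurability of time and \<open>\<omega>\<close> is taken from the
      integrand of the Ito integral, which is \<open>\<sigma> * c * X\<close> here, and divided by
      \<open>\<sigma> * c\<close>.\<close>
    have LM: "(\<lambda>\<omega>. LBINT r:{s..s'}. X r \<omega>) \<in> borel_measurable M"
    proof -
      have Hm: "(\<lambda>(s, \<omega>). ?H s \<omega>) \<in> borel_measurable (restrict_space borel {t..s'} \<Otimes>\<^sub>M F s')"
        using I'(1) ts unfolding has_ito_integral_def by auto
      let ?c = "\<lambda>r. max t (min s' r)"
      have Hc: "(\<lambda>z. ?H (?c (snd z)) (fst z)) \<in> borel_measurable (M \<Otimes>\<^sub>M lborel)"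
        by (rule measurable_clamped_integrand[OF t(1) ts(2) Hm])
      let ?f = "\<lambda>z. indicat_real {s..<s'} (snd z) * (?H (?c (snd z)) (fst z) / (\<sigma> * c))"
      have "?f \<in> borel_measurable (M \<Otimes>\<^sub>M lborel)"
        using Hc by measurable
      then have fm: "(\<lambda>(\<omega>, r). ?f (\<omega>, r)) \<in> borel_measurable (M \<Otimes>\<^sub>M lborel)" by (simp add: case_prod_unfold)
      from lborel.borel_measurable_lebesgue_integral[OF this]
      have "(\<lambda>\<omega>. \<integral>r. ?f (\<omega>, r) \<partial>lborel) \<in> borel_measurable M" .
      moreover have "(\<integral>r. ?f (\<omega>, r) \<partial>lborel) = (LBINT r:{s..s'}. X r \<omega>)" if \<omega>: "\<omega> \<in> space M" for \<omega>
        unfolding set_lebesgue_integral_def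
      proof (rule integral_cong_AE)
        show "(\<lambda>r. ?f (\<omega>, r)) \<in> borel_measurable lborel"
          using measurable_compose_Pair1[OF \<omega> \<open>?f \<in> borel_measurable (M \<Otimes>\<^sub>M lborel)\<close>] .
        show "(\<lambda>r. indicat_real {s..s'} r *\<^sub>R X r \<omega>) \<in> borel_measurable lborel"
          using iX[OF \<omega>] unfolding set_integrable_def by (rule borel_measurable_integrable)
        show "AE r in lborel. ?f (\<omega>, r) = indicat_real {s..s'} r *\<^sub>R X r \<omega>"
          using ae_ne
        proof eventually_elim
          case (elim r)
          show ?case
          proof (cases "s \<le> r \<and> r < s'")
            case True
            then have "?c r = r" "u r (X r \<omega>) = c" using ts s u[of r] by auto
            then show ?thesis using True pos by (simp add: indicator_def)
          next
            case False
            then show ?thesis using elim by (auto simp: indicator_def)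
          qed
        qed
      qed
      ultimately show ?thesis by (subst measurable_cong[where g="\<lambda>\<omega>. \<integral>r. ?f (\<omega>, r) \<partial>lborel"]) auto
    qed
    show "null_in_prob (\<lambda>m \<omega>. (\<Sum>j<Suc m. \<sigma> * c * X (s + real j * ((s' - s) / real (Suc m))) \<omega> *
      (W (s + real (Suc j) * ((s' - s) / real (Suc m))) \<omega> - W (s + real j * ((s' - s) / real (Suc m))) \<omega>))
      + \<mu> * c * (LBINT r:{s..s'}. X r \<omega>) - (X s' \<omega> - X s \<omega>))"
    proof (rule null_in_prob_cong_AE[OF null])
      fix m
      have W': "W (s + real j * ((s' - s) / real (Suc m))) \<in> borel_measurable M" for j
        using s t by (intro W_measurable) auto
      have X': "X (s + real j * ((s' - s) / real (Suc m))) \<in> borel_measurable M" for j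
        using s t by (intro XM) (auto intro!: order_trans[OF ts(1)])
      show "(\<lambda>\<omega>. (\<Sum>j<Suc m. \<sigma> * c * X (s + real j * ((s' - s) / real (Suc m))) \<omega> *
        (W (s + real (Suc j) * ((s' - s) / real (Suc m))) \<omega> - W (s + real j * ((s' - s) / real (Suc m))) \<omega>))
        + \<mu> * c * (LBINT r:{s..s'}. X r \<omega>) - (X s' \<omega> - X s \<omega>)) \<in> borel_measurable M"
        using LM XM[OF ts(1)] XM[OF ts(2)]
        by (intro borel_measurable_diff borel_measurable_add borel_measurable_sum borel_measurable_times W' X') auto
      have eq: "\<mu> * c * (LBINT r:{s..s'}. X r \<omega>) - (X s' \<omega> - X s \<omega>) = - (I' \<omega> - I \<omega>)"
        if \<omega>: "\<omega> \<in> space M" and int: "set_integrable lborel {t..s'} (\<lambda>s. \<mu> * u s (X s \<omega>) * X s \<omega>)"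
          and X1: "X s \<omega> = x + (LBINT s:{t..s}. \<mu> * u s (X s \<omega>) * X s \<omega>) + I \<omega>"
          and X2: "X s' \<omega> = x + (LBINT s:{t..s'}. \<mu> * u s (X s \<omega>) * X s \<omega>) + I' \<omega>" for \<omega>
      proof -
        have i1: "set_integrable lborel {t..s} (\<lambda>s. \<mu> * u s (X s \<omega>) * X s \<omega>)"
          by (rule set_integrable_subset[OF int]) (use s in auto)
        have i2: "set_integrable lborel {s..s'} (\<lambda>s. \<mu> * u s (X s \<omega>) * X s \<omega>)"
          by (rule set_integrable_subset[OF int]) (use ts in auto)
        have "{t..s'} = {t..s} \<union> {s..s'}" using s ts by auto
        then have "(LBINT s:{t..s'}. \<mu> * u s (X s \<omega>) * X s \<omega>) = (LBINT s:{t..s} \<union> {s..s'}. \<mu> * u s (X s \<omega>) * X s \<omega>)" by (rule arg_cong)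
        also have "\<dots> = (LBINT s:{t..s}. \<mu> * u s (X s \<omega>) * X s \<omega>) + (LBINT s:{s..s'}. \<mu> * u s (X s \<omega>) * X s \<omega>)"
        proof (rule set_integral_Un_AE[OF _ _ _ i1 i2])
          have "AE r in lborel. r \<noteq> s" by (rule AE_lborel_singleton)
          then show "AE r in lborel. \<not> (r \<in> {t..s} \<and> r \<in> {s..s'})" by eventually_elim auto
        qed auto
        also have "(LBINT s:{s..s'}. \<mu> * u s (X s \<omega>) * X s \<omega>) = (LBINT r:{s..s'}. \<mu> * c * X r \<omega>)"
          unfolding set_lebesgue_integral_def
        proof (rule integral_cong_AE)
          show "(\<lambda>r. indicat_real {s..s'} r *\<^sub>R (\<mu> * u r (X r \<omega>) * X r \<omega>)) \<in> borel_measurable lborel"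
            using i2 unfolding set_integrable_def by (rule borel_measurable_integrable)
          show "(\<lambda>r. indicat_real {s..s'} r *\<^sub>R (\<mu> * c * X r \<omega>)) \<in> borel_measurable lborel"
            using set_integrable_mult_right[OF iX[OF \<omega>], of "\<mu> * c"] unfolding set_integrable_def by (rule borel_measurable_integrable)
          show "AE r in lborel. indicat_real {s..s'} r *\<^sub>R (\<mu> * u r (X r \<omega>) * X r \<omega>) = indicat_real {s..s'} r *\<^sub>R (\<mu> * c * X r \<omega>)"
            using ae_ne by eventually_elim (use u s in \<open>auto simp: indicator_def\<close>)
        qed
        also have "\<dots> = \<mu> * c * (LBINT r:{s..s'}. X r \<omega>)" by (rule set_integral_mult_right)
        finally show ?thesis using X1 X2 by linarith
      qed
      show "AE \<omega> in M. (\<Sum>j<Suc m. \<sigma> * c * X (s + real j * ((s' - s) / real (Suc m))) \<omega> *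
        (W (s + real (Suc j) * ((s' - s) / real (Suc m))) \<omega> - W (s + real j * ((s' - s) / real (Suc m))) \<omega>))
        + \<mu> * c * (LBINT r:{s..s'}. X r \<omega>) - (X s' \<omega> - X s \<omega>) =
        (\<Sum>j<Suc m. \<sigma> * c * X (s + real j * ((s' - s) / real (Suc m))) \<omega> *
        (W (s + real (Suc j) * ((s' - s) / real (Suc m))) \<omega> - W (s + real j * ((s' - s) / real (Suc m))) \<omega>)) - (I' \<omega> - I \<omega>)"
        using I(2) I'(2) AE_space
      proof eventually_elim
        case (elim \<omega>)
        from eq[of \<omega>] elim show ?case by linarith
      qed
    qed
  qed
  then show ?thesis by eventually_elim (simp add: algebra_simps)
qed

text \<open>The identity holds at all rational times off one common null set, and continuity of the
  path extends it to all times. Exit times, being random, need it for all times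
  simultaneously.\<close>

lemma wealth_log_path_interval:
  assumes wp: "wealth_process M F W \<mu> \<sigma> u t x X" and t: "0 \<le> t" "t \<le> a" "a < b"
    and u: "\<And>s y. a \<le> s \<Longrightarrow> s < b \<Longrightarrow> u s y = c" and pos: "0 < \<sigma>" "0 < c"
  shows "AE \<omega> in M. \<forall>r\<in>{a..b}. ln (X r \<omega>) = ln (X a \<omega>) + (\<mu> * c - (\<sigma> * c)\<^sup>2 / 2) * (r - a) + \<sigma> * c * (W r \<omega> - W a \<omega>)"
proof -
  have "AE \<omega> in M. \<forall>q\<in>\<rat> \<inter> {a<..<b}. ln (X q \<omega>) - ln (X a \<omega>) = \<sigma> * c * (W q \<omega> - W a \<omega>) + (\<mu> * c - (\<sigma> * c)\<^sup>2 / 2) * (q - a)"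
  proof (subst AE_ball_countable)
    show "countable (\<rat> \<inter> {a<..<b})" by (intro countable_Int1 countable_rat)
    show "\<forall>q\<in>\<rat> \<inter> {a<..<b}. AE \<omega> in M. ln (X q \<omega>) - ln (X a \<omega>) = \<sigma> * c * (W q \<omega> - W a \<omega>) + (\<mu> * c - (\<sigma> * c)\<^sup>2 / 2) * (q - a)"
      by (intro ballI wealth_log_increment[OF wp t(1,2) _ u pos]) auto
  qed
  with AE_space show ?thesis
  proof eventually_elim
    case (elim \<omega>)
    have Xc: "continuous_on {t..} (\<lambda>r. X r \<omega>)" and Xp: "\<And>r. t \<le> r \<Longrightarrow> 0 < X r \<omega>"
      using wp elim(1) unfolding wealth_process_def by blast+
    have "continuous_on {a..b} (\<lambda>r. X r \<omega>)" "continuous_on {a..b} (\<lambda>r. W r \<omega>)"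
      using t by (auto intro: continuous_on_subset[OF Xc] continuous_on_subset[OF continuous_W[OF elim(1)]])
    moreover have "\<And>r. r \<in> {a..b} \<Longrightarrow> X r \<omega> \<noteq> 0" using Xp t by (metis atLeastAtMost_iff less_irrefl order_trans)
    ultimately have c: "continuous_on {a..b} (\<lambda>r. ln (X r \<omega>) - ln (X a \<omega>) - (\<sigma> * c * (W r \<omega> - W a \<omega>) + (\<mu> * c - (\<sigma> * c)\<^sup>2 / 2) * (r - a)))"
      by (intro continuous_intros) auto
    have "ln (X r \<omega>) - ln (X a \<omega>) - (\<sigma> * c * (W r \<omega> - W a \<omega>) + (\<mu> * c - (\<sigma> * c)\<^sup>2 / 2) * (r - a)) = 0" if "r \<in> {a..b}" for r
      by (rule continuous_eq_0_by_rationals[OF t(3) c _ that]) (use elim(2) in auto)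
    then show ?case by (simp add: algebra_simps)
  qed
qed

lemma wealth_log_path:
  assumes wp: "wealth_process M F W \<mu> \<sigma> u t x X" and t: "0 \<le> t" "t \<le> a"
    and u: "\<And>s y. a \<le> s \<Longrightarrow> u s y = c" and pos: "0 < \<sigma>" "0 < c"
  shows "AE \<omega> in M. \<forall>r\<ge>a. ln (X r \<omega>) = ln (X a \<omega>) + (\<mu> * c - (\<sigma> * c)\<^sup>2 / 2) * (r - a) + \<sigma> * c * (W r \<omega> - W a \<omega>)"
proof -
  have "AE \<omega> in M. \<forall>n. \<forall>r\<in>{a..a + real (Suc n)}. ln (X r \<omega>) = ln (X a \<omega>) + (\<mu> * c - (\<sigma> * c)\<^sup>2 / 2) * (r - a) + \<sigma> * c * (W r \<omega> - W a \<omega>)"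
    unfolding AE_all_countable by (intro allI wealth_log_path_interval[OF wp t _ u pos]) auto
  then show ?thesis
  proof eventually_elim
    case (elim \<omega>)
    show ?case
    proof (intro allI impI)
      fix r assume r: "a \<le> r"
      obtain n where "r - a \<le> real n" using real_arch_simple by blast
      then have "r \<in> {a..a + real (Suc n)}" using r by simp
      then show "ln (X r \<omega>) = ln (X a \<omega>) + (\<mu> * c - (\<sigma> * c)\<^sup>2 / 2) * (r - a) + \<sigma> * c * (W r \<omega> - W a \<omega>)"
        using elim by blast
    qed
  qed
qed

end

section \<open>Exit times and optional stopping\<close>

text \<open>For a continuous path and open \<open>C\<close> the times spent outside \<open>C\<close>
  form a closed set, so a finite infimum is attained and the path is outside \<open>C\<close> at
  that very time.\<close>

lemma exit_time_cases:
  assumes c: "continuous_on {s..} (\<lambda>r. X r \<omega>)" and C: "open C"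
  obtains (exits) T where "s \<le> T" "exit_time X C s \<omega> = ereal T" "X T \<omega> \<notin> C" "\<And>r. s \<le> r \<Longrightarrow> r < T \<Longrightarrow> X r \<omega> \<in> C"
    | (stays) "exit_time X C s \<omega> = \<infinity>" "\<And>r. s \<le> r \<Longrightarrow> X r \<omega> \<in> C"
proof (cases "\<exists>r\<ge>s. X r \<omega> \<notin> C")
  case True
  define A where "A = {r \<in> {s..}. X r \<omega> \<in> - C}"
  have "closed A" unfolding A_def using c C by (intro continuous_closed_preimage[unfolded vimage_def Int_def mem_Collect_eq, simplified] | simp add: closed_Compl)+
  moreover have ne: "A \<noteq> {}" using True by (auto simp: A_def)
  moreover have bdd: "bdd_below A" by (auto simp: A_def)
  ultimately have Inf: "Inf A \<in> A" by (intro closed_contains_Inf)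
  have le: "Inf A \<le> r" if "r \<in> A" for r using cInf_lower[OF that bdd] .
  have "exit_time X C s \<omega> = ereal (Inf A)"
    unfolding exit_time_def
  proof (rule antisym)
    show "Inf {ereal r |r. s \<le> r \<and> X r \<omega> \<notin> C} \<le> ereal (Inf A)"
      using Inf by (intro Inf_lower) (auto simp: A_def)
    show "ereal (Inf A) \<le> Inf {ereal r |r. s \<le> r \<and> X r \<omega> \<notin> C}"
      using le by (intro Inf_greatest) (auto simp: A_def)
  qed
  moreover have "X r \<omega> \<in> C" if "s \<le> r" "r < Inf A" for r
    using le[of r] that by (auto simp: A_def)
  ultimately show ?thesis using Inf exits[of "Inf A"] by (auto simp: A_def)
next
  case False
  then have "{ereal r |r. s \<le> r \<and> X r \<omega> \<notin> C} = {}" by auto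
  then have "exit_time X C s \<omega> = \<infinity>" unfolding exit_time_def by (simp only: Inf_empty top_ereal_def)
  then show ?thesis using stays False by blast
qed

lemma exit_time_le_iff:
  assumes "continuous_on {s..} (\<lambda>r. X r \<omega>)" "open C"
  shows "exit_time X C s \<omega> \<le> ereal r \<longleftrightarrow> (\<exists>q\<in>{s..r}. X q \<omega> \<notin> C)"
  using assms
proof (cases rule: exit_time_cases)
  case (exits T)
  have "T \<le> q" if "s \<le> q" "X q \<omega> \<notin> C" for q using exits(4)[of q] that by (meson not_le)
  then have "T \<le> r \<longleftrightarrow> (\<exists>q\<in>{s..r}. X q \<omega> \<notin> C)" using exits(1,3) by fastforce
  then show ?thesis using exits(2) by simp
qed auto

lemma exit_time_ge: "ereal s \<le> exit_time X C s \<omega>"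
  unfolding exit_time_def by (intro Inf_greatest) auto

text \<open>On a compact time interval a path inside \<open>C\<close> keeps a positive distance from
  the complement. This makes the condition countable, over thresholds \<open>1 / (n + 1)\<close> and
  over rational times with the two end points. \<open>C \<noteq> UNIV\<close> is assumed because
  \<open>infdist\<close> to the empty set is 0 by convention.\<close>

lemma stays_in_open_iff:
  fixes f :: "real \<Rightarrow> real"
  assumes "s \<le> r" "continuous_on {s..r} f" "open C" "C \<noteq> UNIV"
  shows "(\<forall>q\<in>{s..r}. f q \<in> C) \<longleftrightarrow>
    (\<exists>n::nat. \<forall>q\<in>insert s (insert r (\<rat> \<inter> {s<..<r})). 1 / real (Suc n) \<le> infdist (f q) (- C))"
proof -
  have c: "continuous_on {s..r} (\<lambda>q. infdist (f q) (- C))"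
    using assms(2) by (intro continuous_on_infdist)
  have zero: "infdist y (- C) = 0 \<longleftrightarrow> y \<notin> C" for y :: real
    using in_closed_iff_infdist_zero[of "- C" y] assms(3,4) by (auto simp: closed_Compl)
  show ?thesis
  proof
    assume *: "\<forall>q\<in>{s..r}. f q \<in> C"
    obtain q0 where q0: "q0 \<in> {s..r}" "\<And>q. q \<in> {s..r} \<Longrightarrow> infdist (f q0) (- C) \<le> infdist (f q) (- C)"
      using continuous_attains_inf[OF _ _ c] assms(1) by (metis atLeastAtMost_iff compact_Icc empty_iff order_refl)
    have "infdist (f q0) (- C) \<noteq> 0" using * q0(1) zero by blast
    then have "0 < infdist (f q0) (- C)" using infdist_nonneg[of "f q0" "- C"] by linarith
    then obtain n where "inverse (real (Suc n)) < infdist (f q0) (- C)" using reals_Archimedean by blast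
    then have "1 / real (Suc n) \<le> infdist (f q) (- C)" if "q \<in> {s..r}" for q
      using q0(2)[OF that] by (simp add: inverse_eq_divide)
    then show "\<exists>n::nat. \<forall>q\<in>insert s (insert r (\<rat> \<inter> {s<..<r})). 1 / real (Suc n) \<le> infdist (f q) (- C)"
      using assms(1) by (intro exI[of _ n]) auto
  next
    assume "\<exists>n::nat. \<forall>q\<in>insert s (insert r (\<rat> \<inter> {s<..<r})). 1 / real (Suc n) \<le> infdist (f q) (- C)"
    then obtain n :: nat where n: "\<And>q. q \<in> insert s (insert r (\<rat> \<inter> {s<..<r})) \<Longrightarrow> 1 / real (Suc n) \<le> infdist (f q) (- C)" by blast
    have "1 / real (Suc n) \<le> infdist (f q) (- C)" if q: "q \<in> {s..r}" for q
    proof (cases "s < r")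
      case True
      \<comment> \<open>Capping the distance at the threshold rewrites the inequality as the
        vanishing of a continuous function, the form that the extension from rationals
        handles.\<close>
      have "min (1 / real (Suc n)) (infdist (f q) (- C)) - 1 / real (Suc n) = 0"
      proof (rule continuous_eq_0_by_rationals[OF True _ _ q])
        show "continuous_on {s..r} (\<lambda>q. min (1 / real (Suc n)) (infdist (f q) (- C)) - 1 / real (Suc n))"
          by (intro continuous_intros c)
        show "min (1 / real (Suc n)) (infdist (f q) (- C)) - 1 / real (Suc n) = 0" if "q \<in> \<rat>" "s < q" "q < r" for q
        proof -
          have "1 / real (Suc n) \<le> infdist (f q) (- C)" using that by (intro n) simp
          then show ?thesis by (simp only: min_absorb1 diff_self)
        qed
      qed
      then show ?thesis by (metis eq_iff_diff_eq_0 min.cobounded2)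
    next
      case False
      then have "q = s" using q assms(1) by simp
      then show ?thesis using n by blast
    qed
    moreover have "0 < 1 / real (Suc n)" by simp
    ultimately show "\<forall>q\<in>{s..r}. f q \<in> C" using zero by (metis linorder_not_le order_refl)
  qed
qed

text \<open>Boundedness in L2 implies uniform integrability: clamping at \<open>K\<close> costs at
  most \<open>C / K\<close> in each integral, for the limit too since Fatou's lemma gives it the
  same bound, and clamped functions converge by dominated convergence.\<close>

lemma (in finite_measure) integral_tendsto_L2_bounded:
  fixes f :: "nat \<Rightarrow> 'a \<Rightarrow> real"
  assumes m: "\<And>n. f n \<in> borel_measurable M" and g: "g \<in> borel_measurable M"
    and lim: "\<And>x. x \<in> space M \<Longrightarrow> (\<lambda>n. f n x) \<longlonglongrightarrow> g x"
    and i: "\<And>n. integrable M (\<lambda>x. (f n x)\<^sup>2)" and C: "\<And>n. (\<integral>x. (f n x)\<^sup>2 \<partial>M) \<le> C"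
  shows "integrable M g" "(\<lambda>n. \<integral>x. f n x \<partial>M) \<longlonglongrightarrow> (\<integral>x. g x \<partial>M)"
proof -
  have "0 \<le> (\<integral>x. (f 0 x)\<^sup>2 \<partial>M)" by (rule Bochner_Integration.integral_nonneg) simp
  then have C0: "0 \<le> C" using C[of 0] by (rule order_trans)
  have nn: "(\<integral>\<^sup>+x. ennreal ((f n x)\<^sup>2) \<partial>M) \<le> ennreal C" for n
    using nn_integral_eq_integral[OF i[of n]] C[of n] by (simp add: ennreal_leI)
  have "(\<integral>\<^sup>+x. ennreal ((g x)\<^sup>2) \<partial>M) = (\<integral>\<^sup>+x. liminf (\<lambda>n. ennreal ((f n x)\<^sup>2)) \<partial>M)"
  proof (rule nn_integral_cong)
    fix x assume "x \<in> space M"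
    then have "(\<lambda>n. ennreal ((f n x)\<^sup>2)) \<longlonglongrightarrow> ennreal ((g x)\<^sup>2)"
      by (intro tendsto_ennrealI tendsto_power lim)
    then show "ennreal ((g x)\<^sup>2) = liminf (\<lambda>n. ennreal ((f n x)\<^sup>2))"
      using lim_imp_Liminf[OF sequentially_bot] by metis
  qed
  also have "\<dots> \<le> liminf (\<lambda>n. \<integral>\<^sup>+x. ennreal ((f n x)\<^sup>2) \<partial>M)"
    using m by (intro nn_integral_liminf) auto
  also have "\<dots> \<le> ennreal C"
    using Liminf_mono[OF always_eventually, of "\<lambda>n. \<integral>\<^sup>+x. ennreal ((f n x)\<^sup>2) \<partial>M" "\<lambda>_. ennreal C" sequentially] nn
    by (simp add: Liminf_const)
  finally have gC: "(\<integral>\<^sup>+x. ennreal ((g x)\<^sup>2) \<partial>M) \<le> ennreal C" .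
  have g2: "integrable M (\<lambda>x. (g x)\<^sup>2)"
    using g le_less_trans[OF gC] by (intro integrableI_nonneg) auto
  have g2C: "(\<integral>x. (g x)\<^sup>2 \<partial>M) \<le> C"
    using gC nn_integral_eq_integral[OF g2] C0 by simp
  show ig: "integrable M g" by (rule square_integrable_imp_integrable[OF g g2])
  have if': "integrable M (f n)" for n by (rule square_integrable_imp_integrable[OF m i])
  define cl where "cl K x = max (- K) (min K x)" for K x :: real
  have clm: "(\<lambda>x. cl K (h x)) \<in> borel_measurable M" if "h \<in> borel_measurable M" for K h
    using that unfolding cl_def by measurable
  have icl: "integrable M (\<lambda>x. cl K (h x))" if "h \<in> borel_measurable M" "0 < K" for K h
    by (rule integrable_const_bound[of _ K]) (use clm[OF that(1)] that in \<open>auto simp: cl_def\<close>)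
  have clK: "\<bar>x - cl K x\<bar> \<le> x\<^sup>2 / K" if "0 < K" for x K :: real
  proof -
    have "K * \<bar>x - cl K x\<bar> \<le> x * x"
    proof (cases "\<bar>x\<bar> \<le> K")
      case True
      then show ?thesis by (simp add: cl_def abs_le_iff)
    next
      case False
      then have "\<bar>x - cl K x\<bar> \<le> \<bar>x\<bar>" using that by (auto simp: cl_def max_def min_def)
      then have "K * \<bar>x - cl K x\<bar> \<le> \<bar>x\<bar> * \<bar>x\<bar>" using False that by (intro mult_mono) auto
      then show ?thesis by simp
    qed
    then show ?thesis using that by (simp add: field_simps power2_eq_square)
  qed
  have clE: "\<bar>(\<integral>x. h x \<partial>M) - (\<integral>x. cl K (h x) \<partial>M)\<bar> \<le> C / K"
    if "h \<in> borel_measurable M" "integrable M h" "integrable M (\<lambda>x. (h x)\<^sup>2)" "(\<integral>x. (h x)\<^sup>2 \<partial>M) \<le> C" "0 < K" for h K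
  proof -
    have "\<bar>\<integral>x. (h x - cl K (h x)) \<partial>M\<bar> \<le> (\<integral>x. \<bar>h x - cl K (h x)\<bar> \<partial>M)" by (rule integral_abs_bound)
    also have "\<dots> \<le> (\<integral>x. (h x)\<^sup>2 / K \<partial>M)"
      using that icl[OF that(1,5)] clK[OF that(5)]
      by (intro integral_mono integrable_abs Bochner_Integration.integrable_diff integrable_divide) auto
    also have "\<dots> \<le> C / K" using that by (simp add: divide_right_mono)
    finally show ?thesis using that icl[OF that(1,5)] by simp
  qed
  show "(\<lambda>n. \<integral>x. f n x \<partial>M) \<longlonglongrightarrow> (\<integral>x. g x \<partial>M)"
  proof (rule LIMSEQ_I)
    fix \<epsilon> :: real assume \<epsilon>: "0 < \<epsilon>"
    define K where "K = 3 * (C + 1) / \<epsilon>"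
    have K: "0 < K" using C0 \<epsilon> by (simp add: K_def)
    have CK: "C / K < \<epsilon> / 3" using C0 \<epsilon> by (simp add: K_def field_simps)
    have "(\<lambda>n. \<integral>x. cl K (f n x) \<partial>M) \<longlonglongrightarrow> (\<integral>x. cl K (g x) \<partial>M)"
    proof (rule integral_dominated_convergence[where w="\<lambda>_. K"])
      show "AE x in M. (\<lambda>n. cl K (f n x)) \<longlonglongrightarrow> cl K (g x)"
        unfolding cl_def by (intro AE_I2 tendsto_max tendsto_min tendsto_const lim)
      show "AE x in M. norm (cl K (f n x)) \<le> K" for n using K by (intro AE_I2) (auto simp: cl_def)
    qed (use clm m g in auto)
    then have "eventually (\<lambda>n. dist (\<integral>x. cl K (f n x) \<partial>M) (\<integral>x. cl K (g x) \<partial>M) < \<epsilon> / 3) sequentially"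
      using \<epsilon> by (intro tendstoD) auto
    then have "eventually (\<lambda>n. norm ((\<integral>x. f n x \<partial>M) - (\<integral>x. g x \<partial>M)) < \<epsilon>) sequentially"
    proof eventually_elim
      case (elim n)
      then show ?case
        using clE[OF m if' i C K, of n] clE[OF g ig g2 g2C K] CK
        unfolding dist_real_def real_norm_def by linarith
    qed
    then show "\<exists>no. \<forall>n\<ge>no. norm ((\<integral>x. f n x \<partial>M) - (\<integral>x. g x \<partial>M)) < \<epsilon>" by (simp add: eventually_sequentially)
  qed
qed

lemma sets_Collect_ball_countable:
  assumes "countable Q" "\<And>q. q \<in> Q \<Longrightarrow> {x \<in> space N. P q x} \<in> sets N"
  shows "{x \<in> space N. \<forall>q\<in>Q. P q x} \<in> sets N"
proof (cases "Q = {}")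
  case False
  then have "{x \<in> space N. \<forall>q\<in>Q. P q x} = (\<Inter>q\<in>Q. {x \<in> space N. P q x})" by auto
  also have "\<dots> \<in> sets N" using assms False by (intro sets.countable_INT') auto
  finally show ?thesis .
qed simp

text \<open>The random time is rounded up to a countable grid. There \<open>X\<close> is pieced
  together from countably many measurable functions, and continuity of the paths gives the
  limit.\<close>

lemma measurable_at_random_time:
  fixes X :: "real \<Rightarrow> 'a \<Rightarrow> real"
  assumes X: "\<And>r. s \<le> r \<Longrightarrow> X r \<in> borel_measurable M" "\<And>\<omega>. \<omega> \<in> space M \<Longrightarrow> continuous_on {s..} (\<lambda>r. X r \<omega>)"
    and \<rho>: "\<rho> \<in> borel_measurable M" "\<And>\<omega>. \<omega> \<in> space M \<Longrightarrow> s \<le> \<rho> \<omega>"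
  shows "(\<lambda>\<omega>. X (\<rho> \<omega>) \<omega>) \<in> borel_measurable M"
proof (rule borel_measurable_LIMSEQ_real)
  let ?k = "\<lambda>n \<omega>. nat \<lceil>(\<rho> \<omega> - s) * real (Suc n)\<rceil>"
  let ?r = "\<lambda>n \<omega>. s + real (?k n \<omega>) / real (Suc n)"
  show "(\<lambda>\<omega>. X (?r n \<omega>) \<omega>) \<in> borel_measurable M" for n
  proof (rule measurable_compose_countable[where f="\<lambda>k \<omega>. X (s + real k / real (Suc n)) \<omega>" and g="?k n"])
    show "(\<lambda>\<omega>. X (s + real k / real (Suc n)) \<omega>) \<in> borel_measurable M" for k by (rule X(1)) simp
    show "?k n \<in> measurable M (count_space UNIV)" using \<rho>(1) by measurable
  qed
  fix \<omega> assume \<omega>: "\<omega> \<in> space M"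
  have b: "\<rho> \<omega> \<le> ?r n \<omega>" "?r n \<omega> \<le> \<rho> \<omega> + 1 / real (Suc n)" for n
  proof -
    have "0 \<le> (\<rho> \<omega> - s) * real (Suc n)" using \<rho>(2)[OF \<omega>] by simp
    then have "(\<rho> \<omega> - s) * real (Suc n) \<le> real (?k n \<omega>)" "real (?k n \<omega>) \<le> (\<rho> \<omega> - s) * real (Suc n) + 1"
      by (simp_all add: of_nat_nat del: of_nat_Suc)
    then have "\<rho> \<omega> - s \<le> real (?k n \<omega>) / real (Suc n)" "real (?k n \<omega>) / real (Suc n) \<le> ((\<rho> \<omega> - s) * real (Suc n) + 1) / real (Suc n)"
      using divide_right_mono[of "real (?k n \<omega>)" "(\<rho> \<omega> - s) * real (Suc n) + 1" "real (Suc n)"]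
      by (simp_all only: pos_le_divide_eq of_nat_0_less_iff zero_less_Suc of_nat_0_le_iff)
    moreover have "((\<rho> \<omega> - s) * real (Suc n) + 1) / real (Suc n) = \<rho> \<omega> - s + 1 / real (Suc n)"
      by (simp only: add_divide_distrib nonzero_mult_div_cancel_right of_nat_eq_0_iff nat.simps simp_thms)
    ultimately show "\<rho> \<omega> \<le> ?r n \<omega>" "?r n \<omega> \<le> \<rho> \<omega> + 1 / real (Suc n)"
      by linarith+
  qed
  have "(\<lambda>n. ?r n \<omega>) \<longlonglongrightarrow> \<rho> \<omega>"
  proof (rule tendsto_sandwich[of "\<lambda>_. \<rho> \<omega>" _ _ "\<lambda>n. \<rho> \<omega> + 1 / real (Suc n)"])
    show "(\<lambda>n. \<rho> \<omega> + 1 / real (Suc n)) \<longlonglongrightarrow> \<rho> \<omega>"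
      using tendsto_add[OF tendsto_const LIMSEQ_Suc[OF lim_const_over_n[of "1::real"]], of "\<rho> \<omega>"] by simp
  qed (use b in \<open>auto simp del: of_nat_Suc\<close>)
  moreover have "eventually (\<lambda>n. ?r n \<omega> \<in> {s..}) sequentially" by (intro always_eventually) simp
  ultimately show "(\<lambda>n. X (?r n \<omega>) \<omega>) \<longlonglongrightarrow> X (\<rho> \<omega>) \<omega>"
    using continuous_on_tendsto_compose[OF X(2)[OF \<omega>], of "\<lambda>n. ?r n \<omega>" "\<rho> \<omega>" sequentially] \<rho>(2)[OF \<omega>] by simp
qed

context brownian_motion begin

text \<open>Staying in the open set up to time \<open>r\<close> is a countable condition on the path
  up to \<open>r\<close>, so the event belongs to \<open>F r\<close> itself and not only to later
  sigma-algebras.\<close>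

lemma exit_time_le_sets:
  assumes s: "0 \<le> s" "s \<le> r" and X: "\<And>r. s \<le> r \<Longrightarrow> X r \<in> borel_measurable (F r)"
    "\<And>\<omega>. \<omega> \<in> space M \<Longrightarrow> continuous_on {s..} (\<lambda>r. X r \<omega>)" and C: "open C"
  shows "{\<omega> \<in> space M. exit_time X C s \<omega> \<le> ereal r} \<in> sets (F r)"
proof (cases "C = UNIV")
  case True
  then have "\<not> exit_time X C s \<omega> \<le> ereal r" if "\<omega> \<in> space M" for \<omega>
    using exit_time_le_iff[where X=X and \<omega>=\<omega> and r=r, OF X(2)[OF that] C] by simp
  then have "{\<omega> \<in> space M. exit_time X C s \<omega> \<le> ereal r} = {}" by auto
  then show ?thesis by (simp only: sets.empty_sets)
next
  case False
  let ?Q = "insert s (insert r (\<rat> \<inter> {s<..<r}))"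
  have Q: "countable ?Q" by (intro countable_insert countable_Int1 countable_rat)
  have "{\<omega> \<in> space M. exit_time X C s \<omega> \<le> ereal r} =
    space (F r) - {\<omega> \<in> space (F r). \<exists>n::nat. \<forall>q\<in>?Q. 1 / real (Suc n) \<le> infdist (X q \<omega>) (- C)}"
  proof -
    have "exit_time X C s \<omega> \<le> ereal r \<longleftrightarrow> \<not> (\<exists>n::nat. \<forall>q\<in>?Q. 1 / real (Suc n) \<le> infdist (X q \<omega>) (- C))"
      if \<omega>: "\<omega> \<in> space M" for \<omega>
    proof -
      have "continuous_on {s..r} (\<lambda>q. X q \<omega>)" by (rule continuous_on_subset[OF X(2)[OF \<omega>]]) auto
      from stays_in_open_iff[OF s(2) this C False] exit_time_le_iff[where X=X and \<omega>=\<omega> and r=r, OF X(2)[OF \<omega>] C]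
      show ?thesis by blast
    qed
    then show ?thesis unfolding space_F by blast
  qed
  moreover have "{\<omega> \<in> space (F r). \<exists>n::nat. \<forall>q\<in>?Q. 1 / real (Suc n) \<le> infdist (X q \<omega>) (- C)} \<in> sets (F r)"
  proof -
    have "{\<omega> \<in> space (F r). \<forall>q\<in>?Q. 1 / real (Suc n) \<le> infdist (X q \<omega>) (- C)} \<in> sets (F r)" for n :: nat
    proof (rule sets_Collect_ball_countable[OF Q])
      fix q assume q: "q \<in> ?Q"
      have "X q \<in> borel_measurable (F r)"
        by (rule measurable_F_mono[OF _ X(1)]) (use q s in auto)
      moreover have "(\<lambda>x. infdist x (- C)) \<in> borel_measurable borel"
        by (intro borel_measurable_continuous_onI continuous_on_infdist continuous_on_id)
      ultimately have [measurable]: "(\<lambda>\<omega>. infdist (X q \<omega>) (- C)) \<in> borel_measurable (F r)"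
        by (rule measurable_compose)
      show "{\<omega> \<in> space (F r). 1 / real (Suc n) \<le> infdist (X q \<omega>) (- C)} \<in> sets (F r)" by measurable
    qed
    then show ?thesis by (rule sets.sets_Collect_countable_Ex)
  qed
  ultimately show ?thesis by simp
qed

text \<open>Rounding up makes the decision to run through cell \<open>k\<close> depend on
  \<open>t k < \<rho>\<close>, an event of \<open>F (t k)\<close>. The stopped exponential is thus
  \<open>\<xi>\<close> plus a sum of terms known at the start of a cell times centred increments,
  and only \<open>\<xi>\<close> contributes to the expectation.\<close>

lemma optional_stopping_grid:
  fixes \<rho> :: "'a \<Rightarrow> real" and l :: real and n :: nat
  assumes s: "0 \<le> s" "s < T" and \<rho>: "\<And>r. s \<le> r \<Longrightarrow> r < T \<Longrightarrow> {\<omega> \<in> space M. \<rho> \<omega> \<le> r} \<in> sets (F r)"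
      "\<And>\<omega>. \<omega> \<in> space M \<Longrightarrow> s \<le> \<rho> \<omega>" "\<And>\<omega>. \<omega> \<in> space M \<Longrightarrow> \<rho> \<omega> \<le> T"
    and \<xi>: "\<xi> \<in> borel_measurable (F s)" "\<And>\<omega>. \<omega> \<in> space M \<Longrightarrow> \<bar>\<xi> \<omega>\<bar> \<le> K"
  defines "h \<equiv> (T - s) / real (Suc n)"
  defines "R \<equiv> \<lambda>\<omega>. s + real (nat \<lceil>(\<rho> \<omega> - s) / h\<rceil>) * h"
  shows "has_bochner_integral M (\<lambda>\<omega>. \<xi> \<omega> * exp (l * (W (R \<omega>) \<omega> - W s \<omega>) - l\<^sup>2 * (R \<omega> - s) / 2)) (expectation \<xi>)"
    and "\<And>\<omega>. \<omega> \<in> space M \<Longrightarrow> \<rho> \<omega> \<le> R \<omega> \<and> R \<omega> \<le> T \<and> R \<omega> \<le> \<rho> \<omega> + h"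
proof -
  have h: "0 < h" "real (Suc n) * h = T - s" using s by (simp_all add: h_def)
  define t where "t k = s + real k * h" for k :: nat
  have tS: "t (Suc k) - t k = h" for k by (simp add: t_def distrib_right)
  have ts: "s \<le> t k" for k using h by (simp add: t_def)
  have tlt: "t k < t (Suc k)" for k using tS[of k] h(1) by linarith
  have t0: "t 0 = s" by (simp add: t_def)
  have tT: "t k < T" if "k < Suc n" for k
  proof -
    have "real k * h < real (Suc n) * h" using that h(1) by (intro mult_strict_right_mono) auto
    then show ?thesis using h(2) by (simp add: t_def)
  qed
  define E where "E k \<omega> = exp (l * (W (t k) \<omega> - W s \<omega>) - l\<^sup>2 * (t k - s) / 2)" for k \<omega>
  define \<kappa> where "\<kappa> \<omega> = nat \<lceil>(\<rho> \<omega> - s) / h\<rceil>" for \<omega>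
  have Rt: "R \<omega> = t (\<kappa> \<omega>)" for \<omega> by (simp add: R_def t_def \<kappa>_def)
  have \<kappa>: "k < \<kappa> \<omega> \<longleftrightarrow> t k < \<rho> \<omega>" for k \<omega>
  proof -
    have "k < \<kappa> \<omega> \<longleftrightarrow> int k < \<lceil>(\<rho> \<omega> - s) / h\<rceil>" unfolding \<kappa>_def by linarith
    also have "\<dots> \<longleftrightarrow> real k < (\<rho> \<omega> - s) / h" by (simp add: less_ceiling_iff)
    also have "\<dots> \<longleftrightarrow> t k < \<rho> \<omega>" using h(1) by (simp add: t_def field_simps)
    finally show ?thesis .
  qed
  have \<kappa>n: "\<kappa> \<omega> \<le> Suc n" if "\<omega> \<in> space M" for \<omega>
  proof (rule ccontr)
    assume "\<not> \<kappa> \<omega> \<le> Suc n"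
    then have "t (Suc n) < \<rho> \<omega>" using \<kappa>[of "Suc n" \<omega>] by simp
    then show False using \<rho>(3)[OF that] h(2) by (simp add: t_def del: of_nat_Suc)
  qed
  have Em: "E k \<in> borel_measurable (F (t k))" for k
  proof -
    have [measurable]: "W (t k) \<in> borel_measurable (F (t k))" using ts[of k] s by (intro adapted_W) simp
    have [measurable]: "W s \<in> borel_measurable (F (t k))" by (rule measurable_F_mono[OF ts adapted_W[OF s(1)]])
    show ?thesis unfolding E_def by measurable
  qed
  have Ei: "integrable M (E k)" for k
  proof (cases k)
    case 0
    then have "E k = (\<lambda>_. 1)" by (simp add: E_def t0 fun_eq_iff)
    then show ?thesis by simp
  next
    case (Suc k')
    then have "s < t k" using tlt[of k'] ts[of k'] by simp
    from increment_moments(4)[OF s(1) this, of l]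
    have "integrable M (\<lambda>\<omega>. exp (l * (W (t k) \<omega> - W s \<omega>)) * exp (- (l\<^sup>2 * (t k - s) / 2)))"
      by (intro integrable_mult_left) (simp add: has_bochner_integral_iff)
    then show ?thesis by (simp add: E_def[abs_def] exp_add[symmetric])
  qed
  \<comment> \<open>Multiplied by the relative increment of the exponential over cell
    \<open>k\<close>, this gives the increment of the stopped exponential.\<close>
  define \<zeta> where "\<zeta> k \<omega> = \<xi> \<omega> * indicat_real {\<omega> \<in> space M. t k < \<rho> \<omega>} \<omega> * E k \<omega>" for k \<omega>
  have st: "0 \<le> t k" for k using ts[of k] s by simp
  have K0: "0 \<le> K" using \<xi>(2) not_empty by (meson abs_ge_zero ex_in_conv order_trans)
  have \<zeta>m: "\<zeta> k \<in> borel_measurable (F (t k))" if "k < Suc n" for k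
  proof -
    have "{\<omega> \<in> space M. t k < \<rho> \<omega>} = space (F (t k)) - {\<omega> \<in> space M. \<rho> \<omega> \<le> t k}" by (auto simp: space_F)
    then have [measurable]: "{\<omega> \<in> space M. t k < \<rho> \<omega>} \<in> sets (F (t k))"
      using \<rho>(1)[OF ts tT[OF that]] by simp
    note [measurable] = measurable_F_mono[OF ts \<xi>(1)] Em
    show ?thesis unfolding \<zeta>_def by measurable
  qed
  have \<zeta>i: "integrable M (\<zeta> k)" if "k < Suc n" for k
  proof (rule Bochner_Integration.integrable_bound[where f="\<lambda>\<omega>. K * E k \<omega>"])
    show "integrable M (\<lambda>\<omega>. K * E k \<omega>)" using Ei by simp
    show "\<zeta> k \<in> borel_measurable M" by (rule measurable_F_M[OF st \<zeta>m[OF that]])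
    show "AE \<omega> in M. norm (\<zeta> k \<omega>) \<le> norm (K * E k \<omega>)"
    proof (rule AE_I2)
      fix \<omega> assume "\<omega> \<in> space M"
      then have "\<bar>\<xi> \<omega>\<bar> * E k \<omega> \<le> K * E k \<omega>" using \<xi>(2) by (intro mult_right_mono) (auto simp: E_def)
      then show "norm (\<zeta> k \<omega>) \<le> norm (K * E k \<omega>)"
        using K0 by (auto simp: \<zeta>_def abs_mult E_def indicator_def)
    qed
  qed
  have inc: "has_bochner_integral M (\<lambda>\<omega>. exp (l * (W (t (Suc k)) \<omega> - W (t k) \<omega>) - l\<^sup>2 * h / 2) - 1) 0" for k
  proof -
    have "has_bochner_integral M (\<lambda>\<omega>. exp (- (l\<^sup>2 * h / 2)) * exp (l * (W (t (Suc k)) \<omega> - W (t k) \<omega>)) - 1) (exp (- (l\<^sup>2 * h / 2)) * exp (l\<^sup>2 * (t (Suc k) - t k) / 2) - 1)"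
      by (intro has_bochner_integral_diff has_bochner_integral_mult_right increment_moments(4) st tlt)
        (simp add: has_bochner_integral_iff prob_space)
    then show ?thesis by (simp add: tS exp_add[symmetric])
  qed
  have sum0: "has_bochner_integral M (\<lambda>\<omega>. \<Sum>k<Suc n. \<zeta> k \<omega> * (exp (l * (W (t (Suc k)) \<omega> - W (t k) \<omega>) - l\<^sup>2 * h / 2) - 1)) (\<Sum>k<Suc n. 0)"
  proof (rule has_bochner_integral_sum)
    fix k assume "k \<in> {..<Suc n}"
    then have k: "k < Suc n" by simp
    have f: "(\<lambda>x. exp (l * x - l\<^sup>2 * h / 2) - 1) \<in> borel_measurable borel" by measurable
    from expectation_mult_increment'[OF st less_imp_le[OF tlt] \<zeta>m[OF k] f \<zeta>i[OF k]] inc[of k]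
    show "has_bochner_integral M (\<lambda>\<omega>. \<zeta> k \<omega> * (exp (l * (W (t (Suc k)) \<omega> - W (t k) \<omega>) - l\<^sup>2 * h / 2) - 1)) 0"
      by (simp add: has_bochner_integral_iff)
  qed
  have "integrable M \<xi>"
    by (rule integrable_const_bound[of _ K]) (use \<xi> measurable_F_M[OF s(1)] in auto)
  then have "has_bochner_integral M \<xi> (expectation \<xi>)" by (simp add: has_bochner_integral_iff)
  from has_bochner_integral_add[OF this sum0]
  have *: "has_bochner_integral M (\<lambda>\<omega>. \<xi> \<omega> + (\<Sum>k<Suc n. \<zeta> k \<omega> * (exp (l * (W (t (Suc k)) \<omega> - W (t k) \<omega>) - l\<^sup>2 * h / 2) - 1))) (expectation \<xi>)" by simp
  have eq: "\<xi> \<omega> + (\<Sum>k<Suc n. \<zeta> k \<omega> * (exp (l * (W (t (Suc k)) \<omega> - W (t k) \<omega>) - l\<^sup>2 * h / 2) - 1))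
     = \<xi> \<omega> * exp (l * (W (R \<omega>) \<omega> - W s \<omega>) - l\<^sup>2 * (R \<omega> - s) / 2)" if \<omega>: "\<omega> \<in> space M" for \<omega>
  proof -
    have ES: "E k \<omega> * (exp (l * (W (t (Suc k)) \<omega> - W (t k) \<omega>) - l\<^sup>2 * h / 2) - 1) = E (Suc k) \<omega> - E k \<omega>" for k
      unfolding E_def right_diff_distrib exp_add[symmetric] tS[of k, symmetric] by (simp add: algebra_simps diff_divide_distrib add_divide_distrib)
    have "(\<Sum>k<Suc n. \<zeta> k \<omega> * (exp (l * (W (t (Suc k)) \<omega> - W (t k) \<omega>) - l\<^sup>2 * h / 2) - 1))
       = (\<Sum>k<Suc n. if k < \<kappa> \<omega> then \<xi> \<omega> * (E (Suc k) \<omega> - E k \<omega>) else 0)"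
      by (intro sum.cong refl) (simp add: \<zeta>_def mult.assoc ES \<omega> \<kappa> indicator_def)
    also have "\<dots> = (\<Sum>k<\<kappa> \<omega>. \<xi> \<omega> * (E (Suc k) \<omega> - E k \<omega>))"
      using \<kappa>n[OF \<omega>] by (intro sum.mono_neutral_cong_right) auto
    also have "\<dots> = \<xi> \<omega> * (E (\<kappa> \<omega>) \<omega> - E 0 \<omega>)" 
      using sum_lessThan_telescope[of "\<lambda>k. E k \<omega>" "\<kappa> \<omega>"] by (simp only: sum_distrib_left[symmetric])
    finally show ?thesis by (simp add: Rt E_def t0 algebra_simps)
  qed
  show "has_bochner_integral M (\<lambda>\<omega>. \<xi> \<omega> * exp (l * (W (R \<omega>) \<omega> - W s \<omega>) - l\<^sup>2 * (R \<omega> - s) / 2)) (expectation \<xi>)"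
    by (rule iffD1[OF has_bochner_integral_cong[OF refl eq refl] *])
  show "\<rho> \<omega> \<le> R \<omega> \<and> R \<omega> \<le> T \<and> R \<omega> \<le> \<rho> \<omega> + h" if \<omega>: "\<omega> \<in> space M" for \<omega>
  proof (intro conjI)
    show "\<rho> \<omega> \<le> R \<omega>" using \<kappa>[of "\<kappa> \<omega>" \<omega>] by (simp add: Rt not_less)
    have "real (\<kappa> \<omega>) * h \<le> real (Suc n) * h" using \<kappa>n[OF \<omega>] h(1) by (intro mult_right_mono) auto
    then show "R \<omega> \<le> T" using h(2) by (simp add: Rt t_def)
    show "R \<omega> \<le> \<rho> \<omega> + h"
    proof (cases "\<kappa> \<omega>")
      case 0
      then show ?thesis using \<rho>(2)[OF \<omega>] h(1) by (simp add: Rt t0)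
    next
      case (Suc k)
      then have "t k < \<rho> \<omega>" using \<kappa>[of k \<omega>] by simp
      then show ?thesis using tS[of k] by (simp add: Rt Suc)
    qed
  qed
qed

text \<open>Passes from the rounded times to \<open>\<rho>\<close> as the mesh vanishes; the needed
  uniform integrability comes from the L2 bound \<open>C\<close>.\<close>

lemma optional_stopping:
  fixes \<rho> :: "'a \<Rightarrow> real" and l :: real
  assumes s: "0 \<le> s" "s < T" and \<rho>: "\<And>r. s \<le> r \<Longrightarrow> r < T \<Longrightarrow> {\<omega> \<in> space M. \<rho> \<omega> \<le> r} \<in> sets (F r)"
      "\<And>\<omega>. \<omega> \<in> space M \<Longrightarrow> s \<le> \<rho> \<omega>" "\<And>\<omega>. \<omega> \<in> space M \<Longrightarrow> \<rho> \<omega> \<le> T"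
    and \<xi>: "\<xi> \<in> borel_measurable (F s)" "\<And>\<omega>. \<omega> \<in> space M \<Longrightarrow> \<bar>\<xi> \<omega>\<bar> \<le> K"
  shows "has_bochner_integral M (\<lambda>\<omega>. \<xi> \<omega> * exp (l * (W (\<rho> \<omega>) \<omega> - W s \<omega>) - l\<^sup>2 * (\<rho> \<omega> - s) / 2)) (expectation \<xi>)"
proof -
  define h where "h n = (T - s) / real (Suc n)" for n
  define R where "R n \<omega> = s + real (nat \<lceil>(\<rho> \<omega> - s) / h n\<rceil>) * h n" for n \<omega>
  define E where "E l r \<omega> = exp (l * (W r \<omega> - W s \<omega>) - l\<^sup>2 * (r - s) / 2)" for l r \<omega>
  have g: "has_bochner_integral M (\<lambda>\<omega>. \<xi> \<omega> * E l (R n \<omega>) \<omega>) (expectation \<xi>)" for n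
    unfolding E_def R_def h_def by (rule optional_stopping_grid(1)[OF s \<rho> \<xi>]) auto
  have g1: "has_bochner_integral M (\<lambda>\<omega>. E l (R n \<omega>) \<omega>) 1" for n l
    using optional_stopping_grid(1)[where \<xi>="\<lambda>_. 1" and K=1 and n=n and l=l, OF s \<rho>] unfolding E_def R_def h_def by (simp add: prob_space)
  have R: "\<rho> \<omega> \<le> R n \<omega>" "R n \<omega> \<le> T" "R n \<omega> \<le> \<rho> \<omega> + h n" if "\<omega> \<in> space M" for \<omega> n
    using optional_stopping_grid(2)[where n=n and \<omega>=\<omega>, OF s \<rho> \<xi>] that unfolding R_def h_def by auto
  have \<rho>m: "\<rho> \<in> borel_measurable M"
  proof (rule borel_measurableI_le)
    fix r
    consider "r < s" | "s \<le> r" "r < T" | "T \<le> r" by linarith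
    then show "{\<omega> \<in> space M. \<rho> \<omega> \<le> r} \<in> events"
    proof cases
      case 1
      then have "{\<omega> \<in> space M. \<rho> \<omega> \<le> r} = {}" using \<rho>(2) by fastforce
      then show ?thesis by (simp only: sets.empty_sets)
    next
      case 2
      then show ?thesis using \<rho>(1)[OF 2] subalgebra_F[of r] s by (auto simp: subalgebra_def)
    next
      case 3
      then have "{\<omega> \<in> space M. \<rho> \<omega> \<le> r} = space M" using \<rho>(3) by fastforce
      then show ?thesis by simp
    qed
  qed
  have Wc: "continuous_on {s..} (\<lambda>r. W r \<omega>)" if "\<omega> \<in> space M" for \<omega>
    by (rule continuous_on_subset[OF continuous_W[OF that]]) (use s in auto)
  have WM: "W r \<in> borel_measurable M" if "s \<le> r" for r using W_measurable[of r] s that by simp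
  have WR: "(\<lambda>\<omega>. W (\<rho> \<omega>) \<omega>) \<in> borel_measurable M"
    by (rule measurable_at_random_time[OF WM Wc \<rho>m \<rho>(2)])
  note \<xi>M = measurable_F_M[OF s(1) \<xi>(1)]
  have K0: "0 \<le> K" using \<xi>(2) not_empty by (meson abs_ge_zero ex_in_conv order_trans)
  define C where "C = K\<^sup>2 * exp (l\<^sup>2 * (T - s))"
  have m: "(\<lambda>\<omega>. \<xi> \<omega> * E l (R n \<omega>) \<omega>) \<in> borel_measurable M" for n
    using g[of n] by (auto simp: has_bochner_integral_iff)
  \<comment> \<open>The square of the exponential with parameter \<open>l\<close> is the one with
    parameter \<open>2 * l\<close>, whose stopped expectation is 1, times a factor that is bounded
    because the times are.\<close>
  have sq: "(\<xi> \<omega> * E l (R n \<omega>) \<omega>)\<^sup>2 \<le> C * E (2 * l) (R n \<omega>) \<omega>" if \<omega>: "\<omega> \<in> space M" for n \<omega>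
  proof -
    have "(E l (R n \<omega>) \<omega>)\<^sup>2 = E (2 * l) (R n \<omega>) \<omega> * exp (l\<^sup>2 * (R n \<omega> - s))"
      unfolding E_def exp_add[symmetric] exp_double[symmetric] by (simp add: algebra_simps power2_eq_square diff_divide_distrib)
    also have "\<dots> \<le> E (2 * l) (R n \<omega>) \<omega> * exp (l\<^sup>2 * (T - s))"
      using R(2)[OF \<omega>] by (intro mult_left_mono) (auto simp: E_def mult_left_mono)
    finally have "(\<xi> \<omega>)\<^sup>2 * (E l (R n \<omega>) \<omega>)\<^sup>2 \<le> K\<^sup>2 * (E (2 * l) (R n \<omega>) \<omega> * exp (l\<^sup>2 * (T - s)))"
      using power_mono[OF \<xi>(2)[OF \<omega>] abs_ge_zero, of 2] by (intro mult_mono) (auto simp: E_def)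
    then show ?thesis by (simp add: C_def power_mult_distrib mult_ac)
  qed
  have i2: "integrable M (\<lambda>\<omega>. (\<xi> \<omega> * E l (R n \<omega>) \<omega>)\<^sup>2)" for n
  proof (rule Bochner_Integration.integrable_bound[where f="\<lambda>\<omega>. C * E (2 * l) (R n \<omega>) \<omega>"])
    show "integrable M (\<lambda>\<omega>. C * E (2 * l) (R n \<omega>) \<omega>)" using g1[of "2 * l" n] by (auto simp: has_bochner_integral_iff)
    show "AE \<omega> in M. norm ((\<xi> \<omega> * E l (R n \<omega>) \<omega>)\<^sup>2) \<le> norm (C * E (2 * l) (R n \<omega>) \<omega>)"
      using sq by (intro AE_I2) (simp add: order_trans[OF _ abs_ge_self])
  qed (use m[of n] in simp)
  have e2: "expectation (\<lambda>\<omega>. (\<xi> \<omega> * E l (R n \<omega>) \<omega>)\<^sup>2) \<le> C" for n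
  proof -
    have "expectation (\<lambda>\<omega>. (\<xi> \<omega> * E l (R n \<omega>) \<omega>)\<^sup>2) \<le> expectation (\<lambda>\<omega>. C * E (2 * l) (R n \<omega>) \<omega>)"
      using g1[of "2 * l" n] sq by (intro integral_mono i2) (auto simp: has_bochner_integral_iff)
    also have "\<dots> = C" using g1[of "2 * l" n] by (auto simp: has_bochner_integral_iff)
    finally show ?thesis .
  qed
  have lim: "(\<lambda>n. \<xi> \<omega> * E l (R n \<omega>) \<omega>) \<longlonglongrightarrow> \<xi> \<omega> * E l (\<rho> \<omega>) \<omega>" if \<omega>: "\<omega> \<in> space M" for \<omega>
  proof -
    have "(\<lambda>n. R n \<omega>) \<longlonglongrightarrow> \<rho> \<omega>"
    proof (rule tendsto_sandwich[of "\<lambda>_. \<rho> \<omega>" _ _ "\<lambda>n. \<rho> \<omega> + h n"])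
      show "(\<lambda>n. \<rho> \<omega> + h n) \<longlonglongrightarrow> \<rho> \<omega>"
        using tendsto_add[OF tendsto_const LIMSEQ_Suc[OF lim_const_over_n[of "T - s"]], of "\<rho> \<omega>"] by (simp add: h_def)
    qed (use R[OF \<omega>] in auto)
    moreover have "\<rho> \<omega> \<in> {s..}" "eventually (\<lambda>n. R n \<omega> \<in> {s..}) sequentially"
      using R(1)[OF \<omega>] \<rho>(2)[OF \<omega>] by (auto intro!: always_eventually intro: order_trans)
    ultimately have "(\<lambda>n. W (R n \<omega>) \<omega>) \<longlonglongrightarrow> W (\<rho> \<omega>) \<omega>"
      by (intro continuous_on_tendsto_compose[OF Wc[OF \<omega>]])
    with \<open>(\<lambda>n. R n \<omega>) \<longlonglongrightarrow> \<rho> \<omega>\<close> show ?thesis unfolding E_def by (intro tendsto_intros) auto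
  qed
  have gm: "(\<lambda>\<omega>. \<xi> \<omega> * E l (\<rho> \<omega>) \<omega>) \<in> borel_measurable M"
    unfolding E_def using \<xi>M WR \<rho>m WM[OF order_refl] by measurable
  note conv = integral_tendsto_L2_bounded[OF m gm lim i2 e2]
  have "(\<lambda>n. expectation (\<lambda>\<omega>. \<xi> \<omega> * E l (R n \<omega>) \<omega>)) = (\<lambda>n. expectation \<xi>)"
    using g by (auto simp: has_bochner_integral_iff)
  with conv(2) have "(\<lambda>n::nat. expectation \<xi>) \<longlonglongrightarrow> expectation (\<lambda>\<omega>. \<xi> \<omega> * E l (\<rho> \<omega>) \<omega>)" by simp
  then have "expectation \<xi> = expectation (\<lambda>\<omega>. \<xi> \<omega> * E l (\<rho> \<omega>) \<omega>)" by (simp add: LIMSEQ_const_iff)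
  with conv(1) show ?thesis by (simp add: has_bochner_integral_iff E_def)
qed

end

section \<open>Laplace transforms and small-time tails of exit times\<close>

context brownian_motion begin

lemma exit_time_measurable:
  assumes s: "0 \<le> s" and X: "\<And>r. s \<le> r \<Longrightarrow> X r \<in> borel_measurable (F r)"
    "\<And>\<omega>. \<omega> \<in> space M \<Longrightarrow> continuous_on {s..} (\<lambda>r. X r \<omega>)" and C: "open C"
  shows "exit_time X C s \<in> borel_measurable M"
    and "(\<lambda>\<omega>. X (real_of_ereal (if exit_time X C s \<omega> < \<infinity> then exit_time X C s \<omega> else ereal s)) \<omega>) \<in> borel_measurable M"
proof -
  show \<tau>: "exit_time X C s \<in> borel_measurable M"
  proof (rule borel_measurableI_le)
    fix y :: ereal
    have ge: "ereal s \<le> exit_time X C s \<omega>" for \<omega> by (rule exit_time_ge)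
    show "{\<omega> \<in> space M. exit_time X C s \<omega> \<le> y} \<in> events"
    proof (cases y)
      case (real r)
      show ?thesis
      proof (cases "s \<le> r")
        case True
        show ?thesis using exit_time_le_sets[OF s True X C] subalgebra_F[of r] s True
          unfolding real by (auto simp: subalgebra_def)
      next
        case False
        then have "\<not> exit_time X C s \<omega> \<le> y" for \<omega>
          using order_trans[OF ge[of \<omega>], of y] by (auto simp: real)
        then show ?thesis by simp
      qed
    next
      case MInf
      then have "\<not> exit_time X C s \<omega> \<le> y" for \<omega> using order_trans[OF ge[of \<omega>], of y] by auto
      then show ?thesis by simp
    qed simp
  qed
  have ge: "s \<le> real_of_ereal (if exit_time X C s \<omega> < \<infinity> then exit_time X C s \<omega> else ereal s)" for \<omega>
    using exit_time_ge[of s X C \<omega>] by (cases "exit_time X C s \<omega>") auto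
  show "(\<lambda>\<omega>. X (real_of_ereal (if exit_time X C s \<omega> < \<infinity> then exit_time X C s \<omega> else ereal s)) \<omega>) \<in> borel_measurable M"
    by (rule measurable_at_random_time[where s=s and X=X, OF _ X(2) _ ge])
      (use \<tau> measurable_F_M[OF _ X(1)] s in \<open>auto intro!: borel_measurable_real_of_ereal\<close>)
qed

text \<open>Capping at \<open>T\<close> gives a bounded real time, as optional stopping demands;
  below \<open>T\<close> its level sets are those of the exit time.\<close>

lemma capped_exit_time:
  fixes X :: "real \<Rightarrow> 'b \<Rightarrow> real" and C :: "real set"
  assumes "s < T"
  defines "\<rho> \<equiv> \<lambda>\<omega>. real_of_ereal (min (exit_time X C s \<omega>) (ereal T))"
  shows "s \<le> \<rho> \<omega>" "\<rho> \<omega> \<le> T" "r < T \<Longrightarrow> \<rho> \<omega> \<le> r \<longleftrightarrow> exit_time X C s \<omega> \<le> ereal r"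
    and "ereal (\<rho> \<omega>) \<le> exit_time X C s \<omega>"
    and "exit_time X C s \<omega> = ereal q \<Longrightarrow> q \<le> T \<Longrightarrow> \<rho> \<omega> = q" and "exit_time X C s \<omega> = \<infinity> \<Longrightarrow> \<rho> \<omega> = T"
  using exit_time_ge[of s X C \<omega>] assms(1) unfolding \<rho>_def
  by (cases "exit_time X C s \<omega>"; auto simp: min_def)+

text \<open>The horizon is an extended real so that one predicate serves both the perturbation
  window, with finite \<open>T\<close>, and the time after it, with \<open>T = \<infinity>\<close>.
  The value at \<open>s\<close> may be random, which allows a restart at the end of the
  window.\<close>

definition log_brownian :: "(real \<Rightarrow> 'a \<Rightarrow> real) \<Rightarrow> real \<Rightarrow> ereal \<Rightarrow> real \<Rightarrow> real \<Rightarrow> bool" where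
  "log_brownian X s T m k \<longleftrightarrow> (\<forall>r\<ge>s. X r \<in> borel_measurable (F r)) \<and>
    (\<forall>\<omega>\<in>space M. continuous_on {s..} (\<lambda>r. X r \<omega>) \<and> (\<forall>r\<ge>s. 0 < X r \<omega>)) \<and>
    (AE \<omega> in M. \<forall>r\<ge>s. ereal r \<le> T \<longrightarrow> ln (X r \<omega>) = ln (X s \<omega>) + m * (r - s) + k * (W r \<omega> - W s \<omega>))"

lemma log_brownianD:
  assumes "log_brownian X s T m k"
  shows "\<And>r. s \<le> r \<Longrightarrow> X r \<in> borel_measurable (F r)"
    and "\<And>\<omega>. \<omega> \<in> space M \<Longrightarrow> continuous_on {s..} (\<lambda>r. X r \<omega>)"
    and "\<And>\<omega> r. \<omega> \<in> space M \<Longrightarrow> s \<le> r \<Longrightarrow> 0 < X r \<omega>"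
    and "AE \<omega> in M. \<forall>r\<ge>s. ereal r \<le> T \<longrightarrow> ln (X r \<omega>) = ln (X s \<omega>) + m * (r - s) + k * (W r \<omega> - W s \<omega>)"
  using assms unfolding log_brownian_def by blast+

text \<open>The exponential martingale with parameter \<open>l * k\<close>, rewritten in terms of
  \<open>ln X\<close>; \<open>k\<^sup>2 * l\<^sup>2 / 2 + m * l\<close> is the Laplace exponent of
  Brownian motion with drift \<open>m\<close> and volatility \<open>k\<close>.\<close>

lemma capped_exit_expectation:
  fixes X :: "real \<Rightarrow> 'a \<Rightarrow> real" and C :: "real set"
  assumes lb: "log_brownian X s T' m k" and s: "0 \<le> s" "s < T" "ereal T \<le> T'" and C: "open C"
    and \<xi>: "\<xi> \<in> borel_measurable (F s)" "\<And>\<omega>. \<omega> \<in> space M \<Longrightarrow> \<bar>\<xi> \<omega>\<bar> \<le> K"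
  defines "\<rho> \<equiv> \<lambda>\<omega>. real_of_ereal (min (exit_time X C s \<omega>) (ereal T))"
  shows "has_bochner_integral M (\<lambda>\<omega>. \<xi> \<omega> * exp (l * (ln (X (\<rho> \<omega>) \<omega>) - ln (X s \<omega>)) - (k\<^sup>2 * l\<^sup>2 / 2 + m * l) * (\<rho> \<omega> - s)))
    (expectation \<xi>)"
    and "(\<lambda>\<omega>. X (\<rho> \<omega>) \<omega>) \<in> borel_measurable M" and "\<rho> \<in> borel_measurable M"
proof -
  note X = log_brownianD[OF lb]
  have \<rho>_eq: "\<rho> \<omega> = real_of_ereal (min (exit_time X C s \<omega>) (ereal T))" for \<omega> by (simp add: \<rho>_def)
  note \<rho> = capped_exit_time[where X=X and C=C, OF s(2), folded \<rho>_eq]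
  have os: "has_bochner_integral M (\<lambda>\<omega>. \<xi> \<omega> * exp ((l * k) * (W (\<rho> \<omega>) \<omega> - W s \<omega>) - (l * k)\<^sup>2 * (\<rho> \<omega> - s) / 2)) (expectation \<xi>)"
  proof (rule optional_stopping[OF s(1,2) _ _ _ \<xi>])
    fix r assume r: "s \<le> r" "r < T"
    show "{\<omega> \<in> space M. \<rho> \<omega> \<le> r} \<in> sets (F r)"
      unfolding \<rho>(3)[OF r(2)] by (rule exit_time_le_sets[OF s(1) r(1) X(1,2) C])
  qed (use \<rho> in auto)
  show \<rho>m: "\<rho> \<in> borel_measurable M"
    unfolding \<rho>_def using exit_time_measurable(1)[OF s(1) X(1,2) C]
    by (intro borel_measurable_real_of_ereal borel_measurable_min) auto
  show X\<rho>: "(\<lambda>\<omega>. X (\<rho> \<omega>) \<omega>) \<in> borel_measurable M"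
    by (rule measurable_at_random_time[where s=s and X=X, OF _ X(2) \<rho>m \<rho>(1)]) (use measurable_F_M[OF _ X(1)] s in auto)
  have Xs: "X s \<in> borel_measurable M" using measurable_F_M[OF s(1) X(1)] by simp
  show "has_bochner_integral M (\<lambda>\<omega>. \<xi> \<omega> * exp (l * (ln (X (\<rho> \<omega>) \<omega>) - ln (X s \<omega>)) - (k\<^sup>2 * l\<^sup>2 / 2 + m * l) * (\<rho> \<omega> - s))) (expectation \<xi>)"
  proof (rule has_bochner_integralI_AE[OF os])
    show "(\<lambda>\<omega>. \<xi> \<omega> * exp (l * (ln (X (\<rho> \<omega>) \<omega>) - ln (X s \<omega>)) - (k\<^sup>2 * l\<^sup>2 / 2 + m * l) * (\<rho> \<omega> - s))) \<in> borel_measurable M"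
      using \<rho>m X\<rho> Xs measurable_F_M[OF s(1) \<xi>(1)] by measurable
    show "AE \<omega> in M. \<xi> \<omega> * exp ((l * k) * (W (\<rho> \<omega>) \<omega> - W s \<omega>) - (l * k)\<^sup>2 * (\<rho> \<omega> - s) / 2) =
      \<xi> \<omega> * exp (l * (ln (X (\<rho> \<omega>) \<omega>) - ln (X s \<omega>)) - (k\<^sup>2 * l\<^sup>2 / 2 + m * l) * (\<rho> \<omega> - s))"
      using X(4)
    proof eventually_elim
      case (elim \<omega>)
      have "ereal (\<rho> \<omega>) \<le> T'" using \<rho>(2)[of \<omega>] s(3) by (meson ereal_less_eq(3) order_trans)
      then have "ln (X (\<rho> \<omega>) \<omega>) - ln (X s \<omega>) = m * (\<rho> \<omega> - s) + k * (W (\<rho> \<omega>) \<omega> - W s \<omega>)"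
        using elim \<rho>(1)[of \<omega>] by simp
      then have "l * (ln (X (\<rho> \<omega>) \<omega>) - ln (X s \<omega>)) - (k\<^sup>2 * l\<^sup>2 / 2 + m * l) * (\<rho> \<omega> - s)
        = (l * k) * (W (\<rho> \<omega>) \<omega> - W s \<omega>) - (l * k)\<^sup>2 * (\<rho> \<omega> - s) / 2"
        by (simp only:) (simp add: algebra_simps power_mult_distrib)
      then show ?case by simp
    qed
  qed
qed

text \<open>If \<open>l\<close> is a root of the Laplace exponent at level \<open>\<beta>\<close>,
  the martingale carries exactly the discount factor. The cap is removed by dominated convergence:
  \<open>bd\<close> bounds the exponentials before the exit, and paths that never leave contribute 0
  in the limit since \<open>0 < \<beta>\<close>. The event \<open>A\<close> known at time
  \<open>s\<close> takes the place of conditioning.\<close>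

lemma exit_exponential:
  assumes lb: "log_brownian X s \<infinity> m k" and s: "0 \<le> s" and C: "open C" and A: "A \<in> sets (F s)"
    and \<beta>: "\<beta> = k\<^sup>2 * l\<^sup>2 / 2 + m * l" "0 < \<beta>"
    and bd: "\<And>\<omega> r. \<omega> \<in> A \<Longrightarrow> s \<le> r \<Longrightarrow> ereal r \<le> exit_time X C s \<omega> \<Longrightarrow> l * ln (X r \<omega>) \<le> K"
  shows "has_bochner_integral M (\<lambda>\<omega>. indicator A \<omega> * (if exit_time X C s \<omega> < \<infinity>
      then exp (- \<beta> * (real_of_ereal (exit_time X C s \<omega>) - s) + l * ln (X (real_of_ereal (exit_time X C s \<omega>)) \<omega>)) else 0))
    (expectation (\<lambda>\<omega>. indicator A \<omega> * exp (l * ln (X s \<omega>))))"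
proof -
  note X = log_brownianD[OF lb]
  define \<tau> where "\<tau> = exit_time X C s"
  define \<rho> where "\<rho> n \<omega> = real_of_ereal (min (\<tau> \<omega>) (ereal (s + real (Suc n))))" for n \<omega>
  define \<xi> where "\<xi> \<omega> = indicat_real A \<omega> * exp (l * ln (X s \<omega>))" for \<omega>
  have AM: "A \<subseteq> space M" using sets.sets_into_space[OF A] by (simp add: space_F)
  have sT: "s < s + real (Suc n)" for n by simp
  note \<rho> = capped_exit_time[where X=X and C=C, OF sT, folded \<tau>_def, folded \<rho>_def]
  have bd\<rho>: "l * ln (X (\<rho> n \<omega>) \<omega>) \<le> K" if "\<omega> \<in> A" for n \<omega>
    using bd[OF that \<rho>(1), of n \<omega>] \<rho>(4)[of n \<omega>] by (simp add: \<tau>_def)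
  have \<xi>m: "\<xi> \<in> borel_measurable (F s)"
    unfolding \<xi>_def using A X(1)[OF order_refl] by measurable
  have \<xi>b: "\<bar>\<xi> \<omega>\<bar> \<le> exp K" for \<omega>
    using bd[of \<omega> s] exit_time_ge[of s X C \<omega>] by (auto simp: \<xi>_def indicator_def)
  define f where "f n \<omega> = indicat_real A \<omega> * exp (l * ln (X (\<rho> n \<omega>) \<omega>) - \<beta> * (\<rho> n \<omega> - s))" for n \<omega>
  define g where "g \<omega> = indicat_real A \<omega> * (if \<tau> \<omega> < \<infinity> then exp (- \<beta> * (real_of_ereal (\<tau> \<omega>) - s) + l * ln (X (real_of_ereal (\<tau> \<omega>)) \<omega>)) else 0)" for \<omega>
  have f: "has_bochner_integral M (f n) (expectation \<xi>)" for n
  proof -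
    have "\<xi> \<omega> * exp (l * (ln (X (\<rho> n \<omega>) \<omega>) - ln (X s \<omega>)) - (k\<^sup>2 * l\<^sup>2 / 2 + m * l) * (\<rho> n \<omega> - s)) = f n \<omega>" for \<omega>
      unfolding \<xi>_def f_def \<beta>(1)[symmetric] mult.assoc exp_add[symmetric] by (simp add: algebra_simps)
    then show ?thesis
      using capped_exit_expectation(1)[OF lb s sT _ C \<xi>m \<xi>b, of n l, folded \<tau>_def, folded \<rho>_def] by simp
  qed
  have fm: "f n \<in> borel_measurable M" for n using f[of n] by (auto simp: has_bochner_integral_iff)
  have fb: "\<bar>f n \<omega>\<bar> \<le> exp (K - \<beta> * (\<rho> n \<omega> - s))" for n \<omega>
    using bd\<rho>[of \<omega> n] by (auto simp: f_def indicator_def)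
  have lim: "(\<lambda>n. f n \<omega>) \<longlonglongrightarrow> g \<omega>" if \<omega>: "\<omega> \<in> space M" for \<omega>
  proof (cases "\<tau> \<omega> < \<infinity>")
    case True
    then obtain q where q: "\<tau> \<omega> = ereal q" using exit_time_ge[of s X C \<omega>] by (cases "\<tau> \<omega>") (auto simp: \<tau>_def)
    obtain n0 where n0: "q - s \<le> real n0" using real_arch_simple by blast
    have "eventually (\<lambda>n. f n \<omega> = g \<omega>) sequentially"
      using eventually_ge_at_top[of n0]
    proof eventually_elim
      case (elim n)
      then have "\<rho> n \<omega> = q" using \<rho>(5)[OF q, of n] n0 by simp
      then show ?case using q by (simp add: f_def g_def algebra_simps)
    qed
    then show ?thesis by (rule tendsto_eventually)
  next
    case False
    then have \<tau>: "\<tau> \<omega> = \<infinity>" by simp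
    have "(\<lambda>n. exp (K - \<beta> * real (Suc n))) \<longlonglongrightarrow> 0"
    proof -
      have "exp (K - \<beta> * real (Suc n)) = exp K * exp (- \<beta>) ^ Suc n" for n
        by (simp only: exp_of_nat_mult[symmetric] exp_add[symmetric]) (simp add: algebra_simps)
      moreover have "(\<lambda>n. exp K * exp (- \<beta>) ^ Suc n) \<longlonglongrightarrow> 0"
        using \<beta>(2) by (intro tendsto_mult_right_zero LIMSEQ_Suc LIMSEQ_power_zero) simp
      ultimately show ?thesis by (simp only:)
    qed
    then have "(\<lambda>n. f n \<omega>) \<longlonglongrightarrow> 0"
      by (rule Lim_null_comparison[rotated]) (use fb[of _ \<omega>] \<rho>(6)[OF \<tau>] in \<open>auto intro!: always_eventually\<close>)
    then show ?thesis using False by (simp add: g_def)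
  qed
  have gm: "g \<in> borel_measurable M" by (rule borel_measurable_LIMSEQ_real[OF lim fm])
  have dom: "AE \<omega> in M. norm (f n \<omega>) \<le> exp K" for n
  proof (rule AE_I2)
    fix \<omega>
    have "K - \<beta> * (\<rho> n \<omega> - s) \<le> K" using \<rho>(1)[of n \<omega>] \<beta>(2) by simp
    then have "exp (K - \<beta> * (\<rho> n \<omega> - s)) \<le> exp K" by (simp only: exp_le_cancel_iff)
    then show "norm (f n \<omega>) \<le> exp K" using fb[of n \<omega>] by (simp only: real_norm_def)
  qed
  have "integrable M (\<lambda>\<omega>. exp K)" by simp
  note dc = integral_dominated_convergence[OF gm fm this AE_I2[OF lim] dom] integrable_dominated_convergence[OF gm fm this AE_I2[OF lim] dom]
  have "(\<lambda>n. expectation (f n)) = (\<lambda>n. expectation \<xi>)" using f by (auto simp: has_bochner_integral_iff)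
  with dc(1) have "expectation g = expectation \<xi>" by (simp add: LIMSEQ_const_iff)
  with dc(2) show ?thesis unfolding has_bochner_integral_iff g_def \<tau>_def \<xi>_def by simp
qed

text \<open>An exponential Chebyshev bound at \<open>l = 1 / sqrt e\<close> and its negative, one
  for either side of the window. It yields decay like \<open>exp (- d / sqrt e)\<close>, of which
  only the order \<open>e\<^sup>2\<close> is kept; this is negligible against the order
  \<open>e\<close> of the expansion.\<close>

lemma exit_before_prob:
  assumes lb: "log_brownian X s (ereal (s + e)) m k" and s: "0 \<le> s" and e: "0 < e" "e \<le> 1" and d: "0 < d"
    and X0: "\<And>\<omega>. \<omega> \<in> space M \<Longrightarrow> X s \<omega> = exp z"
  shows "prob {\<omega> \<in> space M. exit_time X {exp (z - d)<..<exp (z + d)} s \<omega> \<le> ereal (s + e)}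
    \<le> 48 * exp (\<bar>m\<bar> + k\<^sup>2 / 2) / d ^ 4 * e\<^sup>2"
proof -
  let ?C = "{exp (z - d)<..<exp (z + d)}"
  note X = log_brownianD[OF lb]
  define \<rho> where "\<rho> \<omega> = real_of_ereal (min (exit_time X ?C s \<omega>) (ereal (s + e)))" for \<omega>
  have sT: "s < s + e" using e by simp
  note \<rho> = capped_exit_time[where X=X and C="?C", OF sT, folded \<rho>_def]
  define V where "V = {\<omega> \<in> space M. exit_time X ?C s \<omega> \<le> ereal (s + e)}"
  \<comment> \<open>At this scale the compensator of the martingale stays bounded: up to time
    \<open>e \<le> 1\<close> it is at most \<open>c\<close>, for both signs of
    \<open>L\<close>.\<close>
  define L where "L = 1 / sqrt e"
  define c where "c = \<bar>m\<bar> + k\<^sup>2 / 2"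
  have Vm: "V \<in> events"
    unfolding V_def using exit_time_measurable(1)[OF s X(1,2), of ?C] by measurable
  have E: "has_bochner_integral M (\<lambda>\<omega>. exp (l * (ln (X (\<rho> \<omega>) \<omega>) - ln (X s \<omega>)) - (k\<^sup>2 * l\<^sup>2 / 2 + m * l) * (\<rho> \<omega> - s))) 1" for l
    using capped_exit_expectation(1)[where \<xi>="\<lambda>_. 1" and K=1 and l=l and C="?C", OF lb s sT] unfolding \<rho>_def by (simp add: prob_space)
  let ?E = "\<lambda>l \<omega>. exp (l * (ln (X (\<rho> \<omega>) \<omega>) - ln (X s \<omega>)) - (k\<^sup>2 * l\<^sup>2 / 2 + m * l) * (\<rho> \<omega> - s))"
  have E2: "has_bochner_integral M (\<lambda>\<omega>. ?E L \<omega> + ?E (- L) \<omega>) (1 + 1)"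
    by (rule has_bochner_integral_add[OF E E])
  have le: "indicat_real V \<omega> * exp (L * d - c) \<le> ?E L \<omega> + ?E (- L) \<omega>" if \<omega>: "\<omega> \<in> space M" for \<omega>
  proof (cases "\<omega> \<in> V")
    case True
    then have "exit_time X ?C s \<omega> \<le> ereal (s + e)" by (simp add: V_def)
    moreover have "open ?C" by simp
    ultimately obtain q where q: "s \<le> q" "exit_time X ?C s \<omega> = ereal q" "X q \<omega> \<notin> ?C" "q \<le> s + e"
      by (cases rule: exit_time_cases[where X=X and \<omega>=\<omega> and s=s and C="?C", OF X(2)[OF \<omega>]]) auto
    have \<rho>q: "\<rho> \<omega> = q" by (rule \<rho>(5)[OF q(2,4)])
    have p: "0 < X q \<omega>" using X(3)[OF \<omega> q(1)] .
    have "d \<le> \<bar>ln (X q \<omega>) - z\<bar>"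
    proof (rule ccontr)
      assume "\<not> d \<le> \<bar>ln (X q \<omega>) - z\<bar>"
      then have "z - d < ln (X q \<omega>)" "ln (X q \<omega>) < z + d" by linarith+
      then have "exp (z - d) < exp (ln (X q \<omega>))" "exp (ln (X q \<omega>)) < exp (z + d)" by simp_all
      then show False using q(3) p by simp
    qed
    moreover have L0: "0 < L" using e by (simp add: L_def)
    ultimately have "L * d \<le> L * \<bar>ln (X q \<omega>) - z\<bar>" by (intro mult_left_mono) auto
    moreover have "(k\<^sup>2 * L\<^sup>2 / 2 + m * l) * (q - s) \<le> c" if "\<bar>l\<bar> = L" for l
    proof -
      have qe: "0 \<le> q - s" "q - s \<le> e" using q by auto
      have "(k\<^sup>2 * L\<^sup>2 / 2 + m * l) * (q - s) \<le> (k\<^sup>2 * L\<^sup>2 / 2 + \<bar>m\<bar> * L) * (q - s)"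
        using that abs_ge_self[of "m * l"] by (intro mult_right_mono add_left_mono qe) (simp add: abs_mult)
      also have "\<dots> \<le> (k\<^sup>2 * L\<^sup>2 / 2 + \<bar>m\<bar> * L) * e" using L0 by (intro mult_left_mono qe) auto
      also have "\<dots> = k\<^sup>2 / 2 + \<bar>m\<bar> * (e / sqrt e)" using e by (simp add: L_def power_divide distrib_right)
      also have "e / sqrt e = sqrt e" using e by (simp add: real_div_sqrt)
      also have "k\<^sup>2 / 2 + \<bar>m\<bar> * sqrt e \<le> k\<^sup>2 / 2 + \<bar>m\<bar> * 1" using e by (intro add_left_mono mult_left_mono) auto
      finally show ?thesis by (simp add: c_def)
    qed
    note b = this
    have "exp (L * d - c) \<le> ?E L \<omega> \<or> exp (L * d - c) \<le> ?E (- L) \<omega>"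
    proof (cases "0 \<le> ln (X q \<omega>) - z")
      case True
      then have "L * d \<le> L * (ln (X q \<omega>) - z)" using \<open>L * d \<le> L * \<bar>ln (X q \<omega>) - z\<bar>\<close> by simp
      moreover have "(k\<^sup>2 * L\<^sup>2 / 2 + m * L) * (q - s) \<le> c" using b[of L] L0 by simp
      ultimately have "L * d - c \<le> L * (ln (X q \<omega>) - z) - (k\<^sup>2 * L\<^sup>2 / 2 + m * L) * (q - s)" by linarith
      then have "exp (L * d - c) \<le> ?E L \<omega>" unfolding \<rho>q X0[OF \<omega>] ln_exp by (simp only: exp_le_cancel_iff)
      then show ?thesis ..
    next
      case False
      then have "L * d \<le> - L * (ln (X q \<omega>) - z)" using \<open>L * d \<le> L * \<bar>ln (X q \<omega>) - z\<bar>\<close> by (simp add: algebra_simps)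
      moreover have "(k\<^sup>2 * (- L)\<^sup>2 / 2 + m * (- L)) * (q - s) \<le> c" using b[of "- L"] L0 by simp
      ultimately have "L * d - c \<le> - L * (ln (X q \<omega>) - z) - (k\<^sup>2 * (- L)\<^sup>2 / 2 + m * (- L)) * (q - s)" by linarith
      then have "exp (L * d - c) \<le> ?E (- L) \<omega>" unfolding \<rho>q X0[OF \<omega>] ln_exp by (simp only: exp_le_cancel_iff)
      then show ?thesis ..
    qed
    then show ?thesis using True by (auto intro: order_trans add_increasing add_increasing2)
  qed simp
  have "prob V * exp (L * d - c) = expectation (\<lambda>\<omega>. indicat_real V \<omega> * exp (L * d - c))"
    using Vm by simp
  also have "\<dots> \<le> expectation (\<lambda>\<omega>. ?E L \<omega> + ?E (- L) \<omega>)"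
    using E2 le Vm by (intro integral_mono) (auto simp: has_bochner_integral_iff emeasure_eq_measure)
  also have "\<dots> = 2" using E2 by (simp add: has_bochner_integral_iff)
  finally have 1: "prob V * exp (L * d - c) \<le> 2" .
  have Ld: "0 \<le> L * d" using e d by (simp add: L_def)
  \<comment> \<open>The fourth power turns \<open>1 / sqrt e\<close> into
    \<open>1 / e\<^sup>2\<close>. Its coefficient 24, with the factor 2 from the two exponentials,
    makes the constant 48.\<close>
  have "(L * d) ^ 4 / 24 \<le> exp (L * d)"
  proof -
    have "(\<Sum>n<5. (L * d) ^ n / fact n) \<le> exp (L * d)"
      using sum_le_suminf[OF summable_exp_generic[of "L * d"], of "{..<5}"] Ld
      by (simp add: exp_def scaleR_conv_of_real divide_inverse mult.commute)
    moreover have "(L * d) ^ 4 / 24 \<le> (\<Sum>n<5. (L * d) ^ n / fact n)"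
      using Ld member_le_sum[of 4 "{..<5}" "\<lambda>n. (L * d) ^ n / fact n"] by (simp add: fact_numeral)
    ultimately show ?thesis by simp
  qed
  moreover have "(L * d) ^ 4 = d ^ 4 / e\<^sup>2"
  proof -
    have "sqrt e ^ 4 = (sqrt e ^ 2) ^ 2" by (simp add: power_mult[symmetric])
    then have "sqrt e ^ 4 = e\<^sup>2" using e by simp
    then show ?thesis by (simp add: L_def power_mult_distrib power_divide)
  qed
  ultimately have 2: "d ^ 4 / e\<^sup>2 / 24 \<le> exp (L * d)" by simp
  have "prob V * (d ^ 4 / e\<^sup>2 / 24) \<le> prob V * exp (L * d)" using 2 by (intro mult_left_mono) auto
  also have "\<dots> = prob V * exp (L * d - c) * exp c" by (simp add: mult.assoc exp_add[symmetric])
  also have "\<dots> \<le> 2 * exp c" using 1 by (intro mult_right_mono) auto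
  finally have "prob V * (d ^ 4 / e\<^sup>2 / 24) \<le> 2 * exp c" .
  then have "prob V \<le> 48 * exp c / d ^ 4 * e\<^sup>2" using d e by (simp add: field_simps)
  then show ?thesis by (simp add: V_def c_def)
qed

end

section \<open>Mixtures over the discount rate and their moments\<close>

lemma power_div_fact_le_exp:
  fixes y :: real
  assumes "0 \<le> y"
  shows "y ^ p / fact p \<le> exp y"
proof -
  have "(\<Sum>n\<in>{p}. y ^ n /\<^sub>R fact n) \<le> (\<Sum>n. y ^ n /\<^sub>R fact n)"
    using assms by (intro sum_le_suminf summable_exp_generic) auto
  then show ?thesis by (simp add: exp_def divide_inverse mult.commute)
qed

lemma power_mult_exp_le:
  fixes x c :: real
  assumes "0 \<le> x" "0 < c"
  shows "x ^ p * exp (- (c * x)) \<le> fact p / c ^ p"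
proof -
  have "(c * x) ^ p / fact p \<le> exp (c * x)" using assms by (intro power_div_fact_le_exp) simp
  then have "x ^ p * c ^ p \<le> fact p * exp (c * x)" by (simp add: field_simps power_mult_distrib)
  then have "x ^ p \<le> fact p / c ^ p * exp (c * x)" using assms by (simp add: field_simps)
  then show ?thesis by (simp add: exp_minus field_simps)
qed

lemma sum_less_two: "(\<Sum>m<2. f m) = f 0 + f 1" for f :: "nat \<Rightarrow> real"
proof -
  have "{..<2::nat} = {0, 1}" by auto
  then show ?thesis by simp
qed

lemma sum_less_three: "(\<Sum>m<3. f m) = f 0 + f 1 + f 2" for f :: "nat \<Rightarrow> real"
proof -
  have "{..<3::nat} = {0, 1, 2}" by auto
  then show ?thesis by simp
qed

text \<open>Here \<open>v j \<beta>\<close> is the \<open>j\<close>-th derivative in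
  \<open>y\<close> of the value for the fixed rate \<open>\<beta>\<close>.
  \<open>locally_bounded\<close> replaces moment assumptions on \<open>P\<close>: powers of
  \<open>\<beta>\<close> are absorbed by the decay of \<open>v\<close> in \<open>\<beta>\<close>
  away from the boundary, so mixtures can be differentiated and weighted with
  \<open>\<beta> ^ n\<close> to any order.\<close>

locale smooth_family = prob_space P for P :: "real measure" +
  fixes v :: "nat \<Rightarrow> real \<Rightarrow> real \<Rightarrow> real" and S :: "real set"
  assumes sets_P: "sets P = sets borel" and AE_pos: "AE \<beta> in P. 0 < \<beta>"
    and open_S: "open S"
    and deriv_v: "0 < \<beta> \<Longrightarrow> (v j \<beta> has_real_derivative v (Suc j) \<beta> y) (at y)"
    and v_measurable: "(\<lambda>\<beta>. v j \<beta> y) \<in> borel_measurable borel"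
    and locally_bounded: "y \<in> S \<Longrightarrow> \<exists>d>0. {y - d..y + d} \<subseteq> S \<and>
      (\<forall>n j. \<exists>K. \<forall>\<beta>>0. \<forall>y'\<in>{y - d..y + d}. \<bar>\<beta> ^ n * v j \<beta> y'\<bar> \<le> K)"
begin

definition moment :: "nat \<Rightarrow> nat \<Rightarrow> real \<Rightarrow> real" where
  "moment n j y = (\<integral>\<beta>. \<beta> ^ n * v j \<beta> y \<partial>P)"

lemma measurable_v [measurable]: "(\<lambda>\<beta>. v j \<beta> y) \<in> borel_measurable P"
  unfolding measurable_cong_sets[OF sets_P refl] by (rule v_measurable)

lemma measurable_P_ident [measurable]: "(\<lambda>\<beta>. \<beta>) \<in> borel_measurable P"
  by (rule measurable_ident_sets[OF sets_P])

lemma integrable_moment: "y \<in> S \<Longrightarrow> integrable P (\<lambda>\<beta>. \<beta> ^ n * v j \<beta> y)"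
proof -
  assume "y \<in> S"
  from locally_bounded[OF this] obtain d K where d: "d > 0" and K: "\<And>\<beta> y'. 0 < \<beta> \<Longrightarrow> y' \<in> {y - d..y + d} \<Longrightarrow> \<bar>\<beta> ^ n * v j \<beta> y'\<bar> \<le> K" by metis
  show ?thesis
  proof (rule integrable_const_bound[where B=K])
    show "AE \<beta> in P. norm (\<beta> ^ n * v j \<beta> y) \<le> K"
      using AE_pos by eventually_elim (use K[of _ y] d in simp)
  qed measurable
qed

lemma taylor_bound:
  assumes \<beta>: "0 < \<beta>" and d: "0 < d" "\<And>y'. y' \<in> {z - d..z + d} \<Longrightarrow> \<bar>c * v (j + N) \<beta> y'\<bar> \<le> K" and y: "y \<in> {z - d..z + d}" and N: "0 < N"
  shows "\<bar>c * v j \<beta> y - (\<Sum>m<N. c * v (j + m) \<beta> z / fact m * (y - z) ^ m)\<bar> \<le> K * \<bar>y - z\<bar> ^ N"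
proof (cases "y = z")
  case True
  \<comment> \<open>The rule \<open>Taylor\<close> wants two distinct points. Here all powers but
    the zeroth vanish, and \<open>0 ^ 0 = 1\<close> leaves the leading term.\<close>
  have "(\<Sum>m<N. c * v (j + m) \<beta> z / fact m * (y - z) ^ m) = (\<Sum>m<N. if m = 0 then c * v j \<beta> z else 0)"
    unfolding True by (intro sum.cong) auto
  then show ?thesis using N True by (simp add: zero_power)
next
  case False
  have "\<exists>t. (if y < z then y < t \<and> t < z else z < t \<and> t < y) \<and>
    c * v j \<beta> y = (\<Sum>m<N. (c * v (j + m) \<beta> z) / fact m * (y - z) ^ m) + c * v (j + N) \<beta> t / fact N * (y - z) ^ N"
  proof (rule Taylor[where diff="\<lambda>m t. c * v (j + m) \<beta> t" and a="z - d" and b="z + d", OF N])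
    show "\<forall>m t. m < N \<and> z - d \<le> t \<and> t \<le> z + d \<longrightarrow> ((\<lambda>t. c * v (j + m) \<beta> t) has_real_derivative c * v (j + Suc m) \<beta> t) (at t)"
      using deriv_v[OF \<beta>] by (auto intro!: DERIV_cmult)
  qed (use d y False in auto)
  then obtain t where t: "if y < z then y < t \<and> t < z else z < t \<and> t < y"
    "c * v j \<beta> y = (\<Sum>m<N. (c * v (j + m) \<beta> z) / fact m * (y - z) ^ m) + c * v (j + N) \<beta> t / fact N * (y - z) ^ N" by blast
  have "\<bar>c * v (j + N) \<beta> t\<bar> \<le> K" using t(1) y d(1) by (intro d(2)) (auto split: if_splits)
  moreover have "(1::real) \<le> fact N" by simp
  ultimately have "\<bar>c * v (j + N) \<beta> t\<bar> / fact N \<le> K / 1" by (intro frac_le) auto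
  then have "\<bar>c * v (j + N) \<beta> t\<bar> / fact N * \<bar>y - z\<bar> ^ N \<le> K * \<bar>y - z\<bar> ^ N"
    by (intro mult_right_mono) auto
  then have "\<bar>c * v (j + N) \<beta> t / fact N * (y - z) ^ N\<bar> \<le> K * \<bar>y - z\<bar> ^ N"
    by (simp only: abs_mult abs_divide power_abs abs_of_nonneg[OF fact_ge_zero])
  then show ?thesis using t(2) by simp
qed

text \<open>Differentiation under the integral: the bound on \<open>\<beta> ^ n * v (j + 2)\<close>
  makes the first-order Taylor error at most \<open>K * h\<^sup>2\<close> uniformly in
  \<open>\<beta>\<close>, so it survives integration.\<close>

lemma deriv_moment:
  assumes z: "z \<in> S"
  shows "(moment n j has_real_derivative moment n (Suc j) z) (at z)"
proof -
  obtain d where d: "d > 0" "{z - d..z + d} \<subseteq> S"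
    and ex: "\<And>n j. \<exists>K. \<forall>\<beta>>0. \<forall>y'\<in>{z - d..z + d}. \<bar>\<beta> ^ n * v j \<beta> y'\<bar> \<le> K"
    using locally_bounded[OF z] by blast
  obtain K where K: "\<And>\<beta> y'. 0 < \<beta> \<Longrightarrow> y' \<in> {z - d..z + d} \<Longrightarrow> \<bar>\<beta> ^ n * v (j + 2) \<beta> y'\<bar> \<le> K"
    using ex[of n "j + 2"] by blast
  have est: "\<bar>moment n j (z + h) - moment n j z - h * moment n (Suc j) z\<bar> \<le> K * h\<^sup>2" if h: "\<bar>h\<bar> \<le> d" for h
  proof -
    have zh: "z + h \<in> {z - d..z + d}" using h by auto
    have i: "integrable P (\<lambda>\<beta>. \<beta> ^ n * v j \<beta> (z + h))" "integrable P (\<lambda>\<beta>. \<beta> ^ n * v j \<beta> z)" "integrable P (\<lambda>\<beta>. \<beta> ^ n * v (Suc j) \<beta> z)"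
      using z zh d by (auto intro!: integrable_moment)
    have eq: "moment n j (z + h) - moment n j z - h * moment n (Suc j) z =
      (\<integral>\<beta>. \<beta> ^ n * v j \<beta> (z + h) - \<beta> ^ n * v j \<beta> z - h * (\<beta> ^ n * v (Suc j) \<beta> z) \<partial>P)"
      using i by (simp add: moment_def)
    have "\<bar>moment n j (z + h) - moment n j z - h * moment n (Suc j) z\<bar>
      \<le> (\<integral>\<beta>. \<bar>\<beta> ^ n * v j \<beta> (z + h) - \<beta> ^ n * v j \<beta> z - h * (\<beta> ^ n * v (Suc j) \<beta> z)\<bar> \<partial>P)"
      unfolding eq by (rule integral_abs_bound)
    also have "\<dots> \<le> (\<integral>\<beta>. K * h\<^sup>2 \<partial>P)"
    proof (rule integral_mono_AE)
      show "AE \<beta> in P. \<bar>\<beta> ^ n * v j \<beta> (z + h) - \<beta> ^ n * v j \<beta> z - h * (\<beta> ^ n * v (Suc j) \<beta> z)\<bar> \<le> K * h\<^sup>2"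
        using AE_pos
      proof eventually_elim
        case (elim \<beta>)
        have "\<bar>\<beta> ^ n * v j \<beta> (z + h) - (\<Sum>m<2. \<beta> ^ n * v (j + m) \<beta> z / fact m * (z + h - z) ^ m)\<bar> \<le> K * \<bar>z + h - z\<bar> ^ 2"
          by (rule taylor_bound[OF elim d(1) K[OF elim] zh]) simp_all
        moreover have "(\<Sum>m<2. \<beta> ^ n * v (j + m) \<beta> z / fact m * (z + h - z) ^ m) = \<beta> ^ n * v j \<beta> z + h * (\<beta> ^ n * v (Suc j) \<beta> z)"
          by (simp add: sum_less_two)
        ultimately show ?case by (simp only: diff_diff_eq add_diff_cancel_left' power2_abs)
      qed
      show "integrable P (\<lambda>\<beta>. \<bar>\<beta> ^ n * v j \<beta> (z + h) - \<beta> ^ n * v j \<beta> z - h * (\<beta> ^ n * v (Suc j) \<beta> z)\<bar>)"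
        using i by (intro integrable_abs Bochner_Integration.integrable_diff integrable_mult_right)
    qed simp
    also have "\<dots> = K * h\<^sup>2" by (simp add: prob_space)
    finally show ?thesis .
  qed
  have "((\<lambda>h. (moment n j (z + h) - moment n j z) / h - moment n (Suc j) z) \<longlongrightarrow> 0) (at 0)"
  proof (rule Lim_null_comparison)
    show "eventually (\<lambda>h. norm ((moment n j (z + h) - moment n j z) / h - moment n (Suc j) z) \<le> K * \<bar>h\<bar>) (at 0)"
      unfolding eventually_at
    proof (intro exI[of _ d] conjI ballI impI d(1))
      fix h :: real assume h: "h \<noteq> 0 \<and> dist h 0 < d"
      have cancel: "K * (x * x) / x = K * x" if "x \<noteq> 0" for x :: real using that by simp
      have "(moment n j (z + h) - moment n j z) / h - moment n (Suc j) z = (moment n j (z + h) - moment n j z - h * moment n (Suc j) z) / h"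
        using h by (simp add: field_simps)
      also have "norm \<dots> \<le> K * h\<^sup>2 / \<bar>h\<bar>"
        using est[of h] h by (simp only: real_norm_def abs_divide) (intro divide_right_mono; simp add: dist_real_def)
      also have "K * h\<^sup>2 / \<bar>h\<bar> = K * (\<bar>h\<bar> * \<bar>h\<bar>) / \<bar>h\<bar>" by (simp only: abs_mult_self_eq power2_eq_square)
      also have "\<dots> = K * \<bar>h\<bar>" by (rule cancel) (use h in simp)
      finally show "norm ((moment n j (z + h) - moment n j z) / h - moment n (Suc j) z) \<le> K * \<bar>h\<bar>" .
    qed
    show "((\<lambda>h. K * \<bar>h\<bar>) \<longlongrightarrow> 0) (at (0::real))" by (auto intro!: tendsto_eq_intros)
  qed
  then show ?thesis unfolding DERIV_def by (simp add: Lim_null[symmetric] LIM_zero_iff)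
qed

text \<open>A proportionality of moments that holds on all of the open set \<open>S\<close> may be
  differentiated; this is how one first-order condition propagates through all moments.\<close>

lemma moment_transfer:
  assumes "\<And>y. y \<in> S \<Longrightarrow> moment n j y = c * moment n' j' y" "y \<in> S"
  shows "moment n (Suc j) y = c * moment n' (Suc j') y"
proof (rule DERIV_unique[OF deriv_moment[OF assms(2)]])
  have "((\<lambda>y. c * moment n' j' y) has_real_derivative c * moment n' (Suc j') y) (at y)"
    by (intro DERIV_cmult deriv_moment assms)
  then show "(moment n j has_real_derivative c * moment n' (Suc j') y) (at y)"
    by (rule has_field_derivative_transform_within_open[OF _ open_S assms(2)]) (simp add: assms(1))
qed

lemma moment_ode:
  assumes ode: "\<And>\<beta> y. 0 < \<beta> \<Longrightarrow> D * v 2 \<beta> y + a * v 1 \<beta> y = \<beta> * v 0 \<beta> y" and y: "y \<in> S"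
  shows "D * moment n 2 y + a * moment n 1 y = moment (Suc n) 0 y"
proof -
  have "D * moment n 2 y + a * moment n 1 y = (\<integral>\<beta>. D * (\<beta> ^ n * v 2 \<beta> y) + a * (\<beta> ^ n * v 1 \<beta> y) \<partial>P)"
    using integrable_moment[OF y] by (simp add: moment_def)
  also have "\<dots> = moment (Suc n) 0 y"
    unfolding moment_def
  proof (rule integral_cong_AE)
    show "AE \<beta> in P. D * (\<beta> ^ n * v 2 \<beta> y) + a * (\<beta> ^ n * v 1 \<beta> y) = \<beta> ^ Suc n * v 0 \<beta> y"
      using AE_pos
    proof eventually_elim
      case (elim \<beta>)
      have "D * (\<beta> ^ n * v 2 \<beta> y) + a * (\<beta> ^ n * v 1 \<beta> y) = \<beta> ^ n * (D * v 2 \<beta> y + a * v 1 \<beta> y)" by (simp add: algebra_simps)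
      then show ?case using ode[OF elim, of y] by simp
    qed
  qed measurable
  finally show ?thesis .
qed

text \<open>If the mixture \<open>J\<close> of the \<open>v\<^sub>\<beta>\<close> solves \<open>J'' = \<kappa>\<^sub>0 J'\<close>, the equations \<open>G v\<^sub>\<beta> = \<beta> v\<^sub>\<beta>\<close> force the moments
  \<open>\<integral> \<beta>\<^sup>n v\<^sub>\<beta> dP\<close>, \<open>n = 1, 2, 3\<close>, to be in geometric progression, so that \<open>\<integral> \<beta> (\<beta> - \<kappa>)\<^sup>2 v\<^sub>\<beta> dP = 0\<close>.\<close>

lemma degenerate:
  assumes ode: "\<And>\<beta> y. 0 < \<beta> \<Longrightarrow> D * v 2 \<beta> y + a * v 1 \<beta> y = \<beta> * v 0 \<beta> y"
    and foc: "\<And>y. y \<in> S \<Longrightarrow> moment 0 2 y = \<kappa>\<^sub>0 * moment 0 1 y"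
    and y0: "y0 \<in> S" and sgn: "(\<forall>\<beta>>0. 0 < v 0 \<beta> y0) \<or> (\<forall>\<beta>>0. v 0 \<beta> y0 < 0)"
  shows "\<exists>\<kappa>. AE \<beta> in P. \<beta> = \<kappa>"
proof -
  have ode': "D * moment n 2 y + a * moment n 1 y = moment (Suc n) 0 y" if "y \<in> S" for n y
    by (rule moment_ode[OF _ that]) (rule ode)
  \<comment> \<open>Inserting \<open>foc\<close> into the equation for \<open>n = 0\<close> gives
    \<open>moment 1 0 = q * moment 0 1\<close>. Differentiating that and inserting it into the next
    equation gives the ratio \<open>\<kappa>\<^sub>0 * q\<close> of consecutive moments.\<close>
  define q where "q = D * \<kappa>\<^sub>0 + a"
  define \<kappa> where "\<kappa> = \<kappa>\<^sub>0 * q"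
  note one = One_nat_def[symmetric]
  have m10: "moment 1 0 y = q * moment 0 1 y" if "y \<in> S" for y
  proof -
    have "D * moment 0 2 y + a * moment 0 1 y = moment 1 0 y" using ode'[OF that, of 0] unfolding one .
    then show ?thesis using foc[OF that] by (simp add: q_def distrib_right mult.assoc del: One_nat_def)
  qed
  have m11: "moment 1 1 y = \<kappa>\<^sub>0 * moment 1 0 y" if "y \<in> S" for y
    using moment_transfer[OF m10 that] foc[OF that] m10[OF that] unfolding Suc_1 one
    by (simp add: mult.left_commute del: One_nat_def)
  have m12: "moment 1 2 y = \<kappa>\<^sub>0 * moment 1 1 y" if "y \<in> S" for y
    using moment_transfer[OF m11 that] unfolding Suc_1 one .
  have D1: "D * moment 1 2 y + a * moment 1 1 y = moment 2 0 y" if "y \<in> S" for y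
    using ode'[OF that, of 1] unfolding Suc_1 .
  have m20: "moment 2 0 y = \<kappa> * moment 1 0 y" if "y \<in> S" for y
    unfolding D1[OF that, symmetric] m12[OF that] m11[OF that] q_def \<kappa>_def by (simp add: algebra_simps)
  have m21: "moment 2 1 y = \<kappa> * moment 1 1 y" if "y \<in> S" for y
    using moment_transfer[OF m20 that] unfolding one .
  have m22: "moment 2 2 y = \<kappa> * moment 1 2 y" if "y \<in> S" for y
    using moment_transfer[OF m21 that] unfolding Suc_1 .
  have m30: "moment 3 0 y = \<kappa> * moment 2 0 y" if "y \<in> S" for y
  proof -
    have "Suc 2 = 3" by simp
    then have "moment 3 0 y = D * moment 2 2 y + a * moment 2 1 y" using ode'[OF that, of 2] by (simp only:)
    also have "\<dots> = \<kappa> * (D * moment 1 2 y + a * moment 1 1 y)"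
      unfolding m22[OF that] m21[OF that] by (simp add: algebra_simps)
    finally show ?thesis unfolding D1[OF that] .
  qed
  \<comment> \<open>Geometric moments of order 1 to 3 make the integral
    \<open>\<kappa>\<^sup>2 - 2 * \<kappa>\<^sup>2 + \<kappa>\<^sup>2\<close> times the first one.
    The factor \<open>\<beta>\<close> is there because the progression starts at order 1; it is
    positive almost surely and does not spoil the sign.\<close>
  let ?g = "\<lambda>\<beta>. \<beta> * (\<beta> - \<kappa>)\<^sup>2 * v 0 \<beta> y0"
  note i = integrable_moment[OF y0, of 3 0] integrable_moment[OF y0, of 2 0] integrable_moment[OF y0, of 1 0]
  have g: "?g = (\<lambda>\<beta>. \<beta> ^ 3 * v 0 \<beta> y0 - 2 * \<kappa> * (\<beta> ^ 2 * v 0 \<beta> y0) + \<kappa>\<^sup>2 * (\<beta> ^ 1 * v 0 \<beta> y0))"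
    by (simp add: fun_eq_iff power2_eq_square power3_eq_cube algebra_simps)
  have ig: "integrable P ?g" unfolding g using i by auto
  have "(\<integral>\<beta>. ?g \<beta> \<partial>P) = moment 3 0 y0 - 2 * \<kappa> * moment 2 0 y0 + \<kappa>\<^sup>2 * moment 1 0 y0"
    unfolding g moment_def using i by simp
  also have "\<dots> = 0" using m30[OF y0] m20[OF y0] by (simp add: power2_eq_square)
  finally have g0: "(\<integral>\<beta>. ?g \<beta> \<partial>P) = 0" .
  have "AE \<beta> in P. ?g \<beta> = 0"
    using sgn
  proof
    assume s: "\<forall>\<beta>>0. 0 < v 0 \<beta> y0"
    have "AE \<beta> in P. 0 \<le> ?g \<beta>" using AE_pos 
      by eventually_elim (intro mult_nonneg_nonneg, use s in \<open>auto intro: less_imp_le\<close>)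
    then show ?thesis using integral_nonneg_eq_0_iff_AE[OF ig] g0 by simp
  next
    assume s: "\<forall>\<beta>>0. v 0 \<beta> y0 < 0"
    have "AE \<beta> in P. ?g \<beta> \<le> 0" using AE_pos
      by eventually_elim (intro mult_nonneg_nonpos mult_nonneg_nonneg, use s in \<open>auto intro: less_imp_le\<close>)
    then have "AE \<beta> in P. 0 \<le> - ?g \<beta>" by eventually_elim simp
    then have "AE \<beta> in P. - ?g \<beta> = 0" using integral_nonneg_eq_0_iff_AE[of P "\<lambda>\<beta>. - ?g \<beta>"] ig g0 by simp
    then show ?thesis by simp
  qed
  then have "AE \<beta> in P. \<beta> = \<kappa>"
    using AE_pos
  proof eventually_elim
    case (elim \<beta>)
    moreover have "v 0 \<beta> y0 \<noteq> 0" using sgn elim(2) by (auto dest!: spec[of _ \<beta>])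
    ultimately show ?case by auto
  qed
  then show ?thesis by blast
qed

text \<open>Space-time Taylor expansion of the mixture, to second order in \<open>y\<close> and
  first order in the elapsed time \<open>e\<close>. The three error terms use the uniform bounds on
  the third derivative, on \<open>\<beta>\<close> times the first derivative and on
  \<open>\<beta>\<^sup>2\<close> times the value.\<close>

lemma discounted_expansion:
  assumes z: "z \<in> S"
  shows "\<exists>d>0. {z - d..z + d} \<subseteq> S \<and> (\<exists>K\<ge>0. \<forall>e y. 0 \<le> e \<longrightarrow> y \<in> {z - d..z + d} \<longrightarrow>
    integrable P (\<lambda>\<beta>. exp (- \<beta> * e) * v 0 \<beta> y) \<and>
    \<bar>(\<integral>\<beta>. exp (- \<beta> * e) * v 0 \<beta> y \<partial>P) - (moment 0 0 z + moment 0 1 z * (y - z) + moment 0 2 z / 2 * (y - z)\<^sup>2 - e * moment 1 0 z)\<bar>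
      \<le> K * (\<bar>y - z\<bar> ^ 3 + e * \<bar>y - z\<bar> + e\<^sup>2))"
proof -
  obtain d where d: "d > 0" "{z - d..z + d} \<subseteq> S"
    and ex: "\<And>n j. \<exists>K. \<forall>\<beta>>0. \<forall>y'\<in>{z - d..z + d}. \<bar>\<beta> ^ n * v j \<beta> y'\<bar> \<le> K"
    using locally_bounded[OF z] by blast
  obtain K1 where K1: "\<And>\<beta> y'. 0 < \<beta> \<Longrightarrow> y' \<in> {z - d..z + d} \<Longrightarrow> \<bar>\<beta> ^ 2 * v 0 \<beta> y'\<bar> \<le> K1" using ex[of 2 0] by blast
  obtain K2 where K2: "\<And>\<beta> y'. 0 < \<beta> \<Longrightarrow> y' \<in> {z - d..z + d} \<Longrightarrow> \<bar>\<beta> ^ 1 * v 1 \<beta> y'\<bar> \<le> K2" using ex[of 1 1] by blast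
  obtain K3 where K3: "\<And>\<beta> y'. 0 < \<beta> \<Longrightarrow> y' \<in> {z - d..z + d} \<Longrightarrow> \<bar>\<beta> ^ 0 * v 3 \<beta> y'\<bar> \<le> K3" using ex[of 0 3] by blast
  define K where "K = max 0 K1 + max 0 K2 + max 0 K3"
  have K: "0 \<le> K" "K1 \<le> K" "K2 \<le> K" "K3 \<le> K" by (auto simp: K_def)
  have main: "integrable P (\<lambda>\<beta>. exp (- \<beta> * e) * v 0 \<beta> y) \<and>
    \<bar>(\<integral>\<beta>. exp (- \<beta> * e) * v 0 \<beta> y \<partial>P) - (moment 0 0 z + moment 0 1 z * (y - z) + moment 0 2 z / 2 * (y - z)\<^sup>2 - e * moment 1 0 z)\<bar>
      \<le> K * (\<bar>y - z\<bar> ^ 3 + e * \<bar>y - z\<bar> + e\<^sup>2)" if e: "0 \<le> e" and y: "y \<in> {z - d..z + d}" for e y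
  proof -
    let ?u = "y - z"
    have yS: "y \<in> S" using y d by auto
    have i: "integrable P (\<lambda>\<beta>. v 0 \<beta> y)" "integrable P (\<lambda>\<beta>. v j \<beta> z)" "integrable P (\<lambda>\<beta>. \<beta> * v 0 \<beta> z)" for j
      using integrable_moment[OF yS, of 0 0] integrable_moment[OF z, of 0 j] integrable_moment[OF z, of 1 0] by simp_all
    have ie: "integrable P (\<lambda>\<beta>. exp (- \<beta> * e) * v 0 \<beta> y)"
    proof (rule Bochner_Integration.integrable_bound[OF i(1)])
      show "AE \<beta> in P. norm (exp (- \<beta> * e) * v 0 \<beta> y) \<le> norm (v 0 \<beta> y)"
        using AE_pos
      proof eventually_elim
        case (elim \<beta>)
        then have "exp (- \<beta> * e) \<le> 1" using e by simp
        then show ?case by (simp add: abs_mult mult_left_le_one_le)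
      qed
    qed measurable
    let ?f = "\<lambda>\<beta>. exp (- \<beta> * e) * v 0 \<beta> y - (v 0 \<beta> z + ?u * v 1 \<beta> z + ?u\<^sup>2 / 2 * v 2 \<beta> z - e * (\<beta> * v 0 \<beta> z))"
    have if': "integrable P ?f" using ie i by auto
    have eq: "(\<integral>\<beta>. exp (- \<beta> * e) * v 0 \<beta> y \<partial>P) - (moment 0 0 z + moment 0 1 z * ?u + moment 0 2 z / 2 * ?u\<^sup>2 - e * moment 1 0 z) = (\<integral>\<beta>. ?f \<beta> \<partial>P)"
      unfolding moment_def using ie i by (simp add: mult.commute)
    have "\<bar>(\<integral>\<beta>. exp (- \<beta> * e) * v 0 \<beta> y \<partial>P) - (moment 0 0 z + moment 0 1 z * ?u + moment 0 2 z / 2 * ?u\<^sup>2 - e * moment 1 0 z)\<bar>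
      \<le> (\<integral>\<beta>. \<bar>?f \<beta>\<bar> \<partial>P)" unfolding eq by (rule integral_abs_bound)
    also have "\<dots> \<le> (\<integral>\<beta>. K * (\<bar>?u\<bar> ^ 3 + e * \<bar>?u\<bar> + e\<^sup>2) \<partial>P)"
    proof (rule integral_mono_AE)
      show "AE \<beta> in P. \<bar>?f \<beta>\<bar> \<le> K * (\<bar>?u\<bar> ^ 3 + e * \<bar>?u\<bar> + e\<^sup>2)"
        using AE_pos
      proof eventually_elim
        case (elim \<beta>)
        have "\<bar>1 * v 0 \<beta> y - (\<Sum>m<3. 1 * v (0 + m) \<beta> z / fact m * ?u ^ m)\<bar> \<le> K3 * \<bar>?u\<bar> ^ 3"
          by (rule taylor_bound[OF elim d(1) _ y]) (use K3[OF elim] in simp_all)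
        moreover have "K3 * \<bar>?u\<bar> ^ 3 \<le> K * \<bar>?u\<bar> ^ 3" by (intro mult_right_mono K) simp
        moreover have "(\<Sum>m<3. 1 * v (0 + m) \<beta> z / fact m * ?u ^ m) = v 0 \<beta> z + ?u * v 1 \<beta> z + ?u\<^sup>2 / 2 * v 2 \<beta> z"
          unfolding sum_less_three add_0 fact_2 by (simp del: One_nat_def)
        ultimately have t3: "\<bar>v 0 \<beta> y - (v 0 \<beta> z + ?u * v 1 \<beta> z + ?u\<^sup>2 / 2 * v 2 \<beta> z)\<bar> \<le> K * \<bar>?u\<bar> ^ 3"
          by (simp only: mult_1)
        have "\<bar>\<beta> * v 0 \<beta> y - (\<Sum>m<1. \<beta> * v (0 + m) \<beta> z / fact m * ?u ^ m)\<bar> \<le> K2 * \<bar>?u\<bar> ^ 1"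
          by (rule taylor_bound[OF elim d(1) _ y]) (use K2[OF elim] in simp_all)
        moreover have "K2 * \<bar>?u\<bar> \<le> K * \<bar>?u\<bar>" by (intro mult_right_mono K) simp
        ultimately have t1: "\<bar>\<beta> * v 0 \<beta> y - \<beta> * v 0 \<beta> z\<bar> \<le> K * \<bar>?u\<bar>" by simp
        \<comment> \<open>With \<open>x = \<beta> * e\<close>: for \<open>x \<le> 1\<close> use
          \<open>exp (- x) \<le> 1 / (1 + x) \<le> 1 - x + x\<^sup>2\<close>, otherwise
          \<open>exp (- x) \<le> 1 \<le> 1 - x + x\<^sup>2\<close>.\<close>
        have ex: "\<bar>exp (- \<beta> * e) - 1 + \<beta> * e\<bar> \<le> \<beta>\<^sup>2 * e\<^sup>2"
        proof -
          have be: "0 \<le> \<beta> * e" using elim e by simp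
          have "1 + (- \<beta> * e) \<le> exp (- \<beta> * e)" by (rule exp_ge_add_one_self)
          moreover have "exp (- \<beta> * e) \<le> 1 - \<beta> * e + (\<beta> * e)\<^sup>2"
          proof (cases "\<beta> * e \<le> 1")
            case True
            have "exp (- \<beta> * e) * (1 + \<beta> * e) \<le> exp (- \<beta> * e) * exp (\<beta> * e)"
              using exp_ge_add_one_self[of "\<beta> * e"] by (intro mult_left_mono) auto
            also have "\<dots> = 1" by (simp add: exp_add[symmetric])
            finally have "exp (- \<beta> * e) \<le> 1 / (1 + \<beta> * e)" using be by (simp add: field_simps)
            also have "\<dots> \<le> 1 - \<beta> * e + (\<beta> * e)\<^sup>2"
            proof -
              have "1 \<le> (1 - \<beta> * e + (\<beta> * e)\<^sup>2) * (1 + \<beta> * e)"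
              proof -
                have "(1 - x + x\<^sup>2) * (1 + x) = 1 + x ^ 3" for x :: real by (simp add: power2_eq_square power3_eq_cube algebra_simps)
                then show ?thesis using be by simp
              qed
              then show ?thesis using be by (simp add: pos_divide_le_eq)
            qed
            finally show ?thesis .
          next
            case False
            have "exp (- \<beta> * e) \<le> 1" using be by simp
            moreover have "\<beta> * e \<le> (\<beta> * e)\<^sup>2" 
              using mult_left_mono[of 1 "\<beta> * e" "\<beta> * e"] False be by (simp add: power2_eq_square)
            ultimately show ?thesis by linarith
          qed
          ultimately show ?thesis by (simp add: power_mult_distrib abs_le_iff)
        qed
        have t2: "\<bar>(exp (- \<beta> * e) - 1 + \<beta> * e) * v 0 \<beta> y\<bar> \<le> K * e\<^sup>2"
        proof -
          have "\<bar>(exp (- \<beta> * e) - 1 + \<beta> * e) * v 0 \<beta> y\<bar> \<le> (\<beta>\<^sup>2 * e\<^sup>2) * \<bar>v 0 \<beta> y\<bar>"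
            unfolding abs_mult by (intro mult_right_mono ex) simp
          also have "\<dots> = \<bar>\<beta>\<^sup>2 * v 0 \<beta> y\<bar> * e\<^sup>2" by (simp add: abs_mult)
          also have "\<dots> \<le> K * e\<^sup>2" using K1[OF elim y] K(2) by (intro mult_right_mono) auto
          finally show ?thesis .
        qed
        \<comment> \<open>Pure time error, mixed error and pure space error.\<close>
        have feq: "?f \<beta> = (exp (- \<beta> * e) - 1 + \<beta> * e) * v 0 \<beta> y - e * (\<beta> * v 0 \<beta> y - \<beta> * v 0 \<beta> z)
          + (v 0 \<beta> y - (v 0 \<beta> z + ?u * v 1 \<beta> z + ?u\<^sup>2 / 2 * v 2 \<beta> z))" by (simp add: algebra_simps)
        have tB: "\<bar>e * (\<beta> * v 0 \<beta> y - \<beta> * v 0 \<beta> z)\<bar> \<le> e * (K * \<bar>?u\<bar>)"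
          unfolding abs_mult[of e] using e t1 by (simp add: mult_left_mono)
        have tri: "\<bar>p - q + r\<bar> \<le> \<bar>p\<bar> + \<bar>q\<bar> + \<bar>r\<bar>" for p q r :: real by linarith
        have "\<bar>?f \<beta>\<bar> \<le> K * e\<^sup>2 + e * (K * \<bar>?u\<bar>) + K * \<bar>?u\<bar> ^ 3"
          unfolding feq by (rule order_trans[OF tri add_mono[OF add_mono[OF t2 tB] t3]])
        also have "\<dots> = K * (\<bar>?u\<bar> ^ 3 + e * \<bar>?u\<bar> + e\<^sup>2)" by (simp add: algebra_simps)
        finally show ?case .
      qed
      show "integrable P (\<lambda>\<beta>. \<bar>?f \<beta>\<bar>)" using if' by (rule integrable_abs)
    qed simp
    also have "\<dots> = K * (\<bar>?u\<bar> ^ 3 + e * \<bar>?u\<bar> + e\<^sup>2)" by (simp add: prob_space)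
    finally show ?thesis using ie by blast
  qed
  then show ?thesis using d K(1) by blast
qed

end

section \<open>Explicit solutions for a fixed discount rate\<close>

text \<open>With \<open>root_neg\<close>, the two roots of
  \<open>D * r\<^sup>2 + a * r = \<beta>\<close>: exponentials with these rates solve
  \<open>D v'' + a v' = \<beta> v\<close>.\<close>

definition root_pos :: "real \<Rightarrow> real \<Rightarrow> real \<Rightarrow> real" where
  "root_pos a D \<beta> = (- a + sqrt (a\<^sup>2 + 4 * D * \<beta>)) / (2 * D)"

definition root_neg :: "real \<Rightarrow> real \<Rightarrow> real \<Rightarrow> real" where
  "root_neg a D \<beta> = (- a - sqrt (a\<^sup>2 + 4 * D * \<beta>)) / (2 * D)"

lemma root_props:
  assumes D: "0 < D" and \<beta>: "0 < \<beta>"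
  shows "D * (root_pos a D \<beta>)\<^sup>2 + a * root_pos a D \<beta> = \<beta>"
    and "D * (root_neg a D \<beta>)\<^sup>2 + a * root_neg a D \<beta> = \<beta>"
    and "0 < root_pos a D \<beta>" and "root_neg a D \<beta> < 0"
    and "root_pos a D \<beta> + root_neg a D \<beta> = - a / D"
    and "\<beta> = D * (root_pos a D \<beta> * (- root_neg a D \<beta>))"
proof -
  define s where "s = sqrt (a\<^sup>2 + 4 * D * \<beta>)"
  have s2: "s\<^sup>2 = a\<^sup>2 + 4 * D * \<beta>" using D \<beta> by (simp add: s_def)
  have "sqrt (a\<^sup>2) < s" unfolding s_def using D \<beta> by (intro real_sqrt_less_mono) simp
  then have as: "\<bar>a\<bar> < s" by simp
  have p: "2 * D * root_pos a D \<beta> = s - a" "2 * D * root_neg a D \<beta> = - s - a"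
    using D by (simp_all add: root_pos_def root_neg_def s_def)
  have gen: "D * r\<^sup>2 + a * r = \<beta>" if "(2 * D * r + a)\<^sup>2 = s\<^sup>2" for r
  proof -
    have "4 * D * (D * r\<^sup>2 + a * r) = (2 * D * r + a)\<^sup>2 - a\<^sup>2" by (simp add: power2_eq_square algebra_simps)
    also have "\<dots> = 4 * D * \<beta>" using that s2 by simp
    finally show ?thesis using D by simp
  qed
  show "D * (root_pos a D \<beta>)\<^sup>2 + a * root_pos a D \<beta> = \<beta>" by (rule gen) (simp add: p)
  show "D * (root_neg a D \<beta>)\<^sup>2 + a * root_neg a D \<beta> = \<beta>" by (rule gen) (simp add: p power2_eq_square)
  show "0 < root_pos a D \<beta>" using as D by (simp add: root_pos_def s_def[symmetric])
  show "root_neg a D \<beta> < 0" using as D by (simp add: root_neg_def s_def[symmetric] divide_neg_pos)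
  show "root_pos a D \<beta> + root_neg a D \<beta> = - a / D"
    using D by (simp add: root_pos_def root_neg_def add_divide_distrib[symmetric])
  have "4 * D * (D * (root_pos a D \<beta> * (- root_neg a D \<beta>))) = (2 * D * root_pos a D \<beta>) * (- (2 * D * root_neg a D \<beta>))"
    by (simp add: algebra_simps)
  also have "\<dots> = s\<^sup>2 - a\<^sup>2" unfolding p by (simp add: power2_eq_square algebra_simps)
  also have "\<dots> = 4 * D * \<beta>" using s2 by simp
  finally have "4 * D * (D * (root_pos a D \<beta> * (- root_neg a D \<beta>))) = 4 * D * \<beta>" .
  moreover have "4 * D \<noteq> 0" using D by simp
  ultimately have "D * (root_pos a D \<beta> * (- root_neg a D \<beta>)) = \<beta>" using mult_left_cancel by blast
  then show "\<beta> = D * (root_pos a D \<beta> * (- root_neg a D \<beta>))" by (rule sym)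
qed

text \<open>The general solution of that equation together with its derivatives: each derivative,
  counted by \<open>j\<close>, brings down one factor of the root. The coefficients are functions of
  \<open>\<beta>\<close> because they will encode the boundary values.\<close>

definition exp_pair :: "(real \<Rightarrow> real) \<Rightarrow> (real \<Rightarrow> real) \<Rightarrow> real \<Rightarrow> real \<Rightarrow> nat \<Rightarrow> real \<Rightarrow> real \<Rightarrow> real" where
  "exp_pair c1 c2 a D j \<beta> y = c1 \<beta> * root_pos a D \<beta> ^ j * exp (root_pos a D \<beta> * y)
    + c2 \<beta> * root_neg a D \<beta> ^ j * exp (root_neg a D \<beta> * y)"

lemma deriv_exp_pair: "(exp_pair c1 c2 a D j \<beta> has_real_derivative exp_pair c1 c2 a D (Suc j) \<beta> y) (at y)"
  unfolding exp_pair_def[abs_def] by (auto intro!: derivative_eq_intros simp: algebra_simps)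

lemma exp_pair_ode:
  assumes "0 < D" "0 < \<beta>"
  shows "D * exp_pair c1 c2 a D 2 \<beta> y + a * exp_pair c1 c2 a D 1 \<beta> y = \<beta> * exp_pair c1 c2 a D 0 \<beta> y"
proof -
  have "D * exp_pair c1 c2 a D 2 \<beta> y + a * exp_pair c1 c2 a D 1 \<beta> y
    = c1 \<beta> * exp (root_pos a D \<beta> * y) * (D * (root_pos a D \<beta>)\<^sup>2 + a * root_pos a D \<beta>)
    + c2 \<beta> * exp (root_neg a D \<beta> * y) * (D * (root_neg a D \<beta>)\<^sup>2 + a * root_neg a D \<beta>)"
    by (simp add: exp_pair_def algebra_simps)
  also have "\<dots> = \<beta> * exp_pair c1 c2 a D 0 \<beta> y"
    unfolding root_props(1,2)[OF assms] by (simp add: exp_pair_def algebra_simps)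
  finally show ?thesis .
qed

lemma exp_pair_measurable:
  assumes [measurable]: "c1 \<in> borel_measurable borel" "c2 \<in> borel_measurable borel"
  shows "(\<lambda>\<beta>. exp_pair c1 c2 a D j \<beta> y) \<in> borel_measurable borel"
  unfolding exp_pair_def root_pos_def root_neg_def by measurable

text \<open>Terms decaying like \<open>exp (- x d / 2)\<close> in \<open>x = \<lambda>\<^sub>+ - \<lambda>\<^sub>-\<close> beat every polynomial in \<open>\<beta>\<close> and the roots, even with
  the factor \<open>1 / (1 - exp (- x l))\<close>, which is singular as \<open>x \<rightarrow> 0\<close>.\<close>

lemma root_decay_bound:
  assumes D: "0 < D" and d: "0 < d" and l: "0 < l" and M: "0 \<le> M" and nj: "0 < n + j"
  shows "\<exists>K. \<forall>\<beta>>0. \<forall>r f. \<bar>r\<bar> \<le> root_pos a D \<beta> - root_neg a D \<beta> \<longrightarrow>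
    \<bar>f\<bar> \<le> M * exp (- (d * (root_pos a D \<beta> - root_neg a D \<beta>))) / (1 - exp (- (l * (root_pos a D \<beta> - root_neg a D \<beta>)))) \<longrightarrow>
    \<bar>\<beta> ^ n * (r ^ j * f)\<bar> \<le> K"
proof -
  \<comment> \<open>\<open>\<beta>\<close> is at most \<open>D * x\<^sup>2\<close> and
    \<open>r\<close> at most \<open>x\<close>, so this is the total power of \<open>x\<close> that
    the exponential has to beat.\<close>
  define p where "p = 2 * n + j"
  have p: "0 < p" using nj by (simp add: p_def)
  define K where "K = D ^ n * M * (fact p / d ^ p + fact (p - 1) / d ^ (p - 1) / l)"
  have "\<bar>\<beta> ^ n * (r ^ j * f)\<bar> \<le> K"
    if \<beta>: "0 < \<beta>" and r: "\<bar>r\<bar> \<le> root_pos a D \<beta> - root_neg a D \<beta>"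
      and f: "\<bar>f\<bar> \<le> M * exp (- (d * (root_pos a D \<beta> - root_neg a D \<beta>))) / (1 - exp (- (l * (root_pos a D \<beta> - root_neg a D \<beta>))))" for \<beta> r f
  proof -
    define x where "x = root_pos a D \<beta> - root_neg a D \<beta>"
    have rp: "0 < root_pos a D \<beta>" "root_neg a D \<beta> < 0" using root_props[OF D \<beta>] by auto
    have x: "0 < x" using rp by (simp add: x_def)
    have "root_pos a D \<beta> * (- root_neg a D \<beta>) \<le> x * x" using rp by (intro mult_mono) (auto simp: x_def)
    then have "D * (root_pos a D \<beta> * (- root_neg a D \<beta>)) \<le> D * x\<^sup>2"
      unfolding power2_eq_square using D by (intro mult_left_mono) auto
    then have \<beta>x: "\<beta> \<le> D * x\<^sup>2" using root_props(6)[OF D \<beta>, of a] by simp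
    \<comment> \<open>The singular factor costs at most one power of \<open>x\<close>. At least one
      is present since \<open>0 < n + j\<close>; the values themselves, with
      \<open>n = j = 0\<close>, get a direct bound elsewhere.\<close>
    have e1: "1 / (1 - exp (- (l * x))) \<le> 1 + 1 / (l * x)"
    proof -
      have lx: "0 < l * x" using l x by simp
      have "exp (- (l * x)) * (1 + l * x) \<le> exp (- (l * x)) * exp (l * x)"
        using exp_ge_add_one_self[of "l * x"] by (intro mult_left_mono) auto
      then have "exp (- (l * x)) * (1 + l * x) \<le> 1" by (simp add: exp_add[symmetric])
      then have "l * x \<le> (1 - exp (- (l * x))) * (1 + l * x)" by (simp add: algebra_simps)
      moreover have "0 < 1 - exp (- (l * x))" using lx by simp
      ultimately show ?thesis using lx by (simp add: field_simps)
    qed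
    have "\<bar>\<beta> ^ n * (r ^ j * f)\<bar> = \<beta> ^ n * \<bar>r\<bar> ^ j * \<bar>f\<bar>" using \<beta> by (simp add: abs_mult power_abs)
    also have "\<dots> \<le> (D * x\<^sup>2) ^ n * x ^ j * (M * exp (- (d * x)) * (1 + 1 / (l * x)))"
    proof (intro mult_mono)
      show "\<beta> ^ n \<le> (D * x\<^sup>2) ^ n" using \<beta>x \<beta> by (intro power_mono) auto
      show "\<bar>r\<bar> ^ j \<le> x ^ j" using r by (intro power_mono) (auto simp: x_def)
      have "\<bar>f\<bar> \<le> M * exp (- (d * x)) * (1 / (1 - exp (- (l * x))))" using f by (simp add: x_def)
      also have "\<dots> \<le> M * exp (- (d * x)) * (1 + 1 / (l * x))" using M e1 by (intro mult_left_mono) auto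
      finally show "\<bar>f\<bar> \<le> M * exp (- (d * x)) * (1 + 1 / (l * x))" .
    qed (use \<beta> D x in auto)
    also have "\<dots> = D ^ n * M * (x ^ p * exp (- (d * x)) + x ^ (p - 1) * exp (- (d * x)) / l)"
    proof -
      have "x ^ p = x ^ (p - 1) * x" using p by (cases p) auto
      then have xp: "x ^ (p - 1) = x ^ p / x" using x by simp
      have "(D * x\<^sup>2) ^ n * x ^ j = D ^ n * x ^ p" by (simp add: p_def power_mult_distrib power_mult power_add mult.assoc)
      then show ?thesis unfolding \<open>(D * x\<^sup>2) ^ n * x ^ j = D ^ n * x ^ p\<close> xp using x l by (simp add: field_simps)
    qed
    also have "\<dots> \<le> D ^ n * M * (fact p / d ^ p + fact (p - 1) / d ^ (p - 1) / l)"
      using D M l x d by (intro mult_left_mono add_mono divide_right_mono power_mult_exp_le) auto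
    finally show ?thesis by (simp add: K_def)
  qed
  then show ?thesis by blast
qed

text \<open>\<open>root_pos\<close> and \<open>- root_neg\<close> differ from half of
  \<open>x = root_pos - root_neg\<close> only by the constant \<open>a / (2 * D)\<close>. Decay in
  either root is therefore decay in \<open>x\<close> at half the rate, and the constant goes into
  \<open>M'\<close>.\<close>

lemma exp_pair_bound:
  assumes D: "0 < D" and d: "0 < d" and l: "0 < l" and M: "0 \<le> M" and nj: "0 < n + j"
    and c1: "\<And>\<beta> y. 0 < \<beta> \<Longrightarrow> y \<in> Y \<Longrightarrow> \<bar>c1 \<beta> * exp (root_pos a D \<beta> * y)\<bar> \<le> M * exp (- (d * root_pos a D \<beta>)) / (1 - exp (- (l * (root_pos a D \<beta> - root_neg a D \<beta>))))"
    and c2: "\<And>\<beta> y. 0 < \<beta> \<Longrightarrow> y \<in> Y \<Longrightarrow> \<bar>c2 \<beta> * exp (root_neg a D \<beta> * y)\<bar> \<le> M * exp (d * root_neg a D \<beta>) / (1 - exp (- (l * (root_pos a D \<beta> - root_neg a D \<beta>))))"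
  shows "\<exists>K. \<forall>\<beta>>0. \<forall>y\<in>Y. \<bar>\<beta> ^ n * exp_pair c1 c2 a D j \<beta> y\<bar> \<le> K"
proof -
  define A where "A = a / (2 * D)"
  define M' where "M' = M * exp (d * \<bar>A\<bar>)"
  have M': "0 \<le> M'" using M by (simp add: M'_def)
  have d2: "0 < d / 2" using d by simp
  obtain K where K: "\<And>\<beta> r f. 0 < \<beta> \<Longrightarrow> \<bar>r\<bar> \<le> root_pos a D \<beta> - root_neg a D \<beta> \<Longrightarrow>
    \<bar>f\<bar> \<le> M' * exp (- (d / 2 * (root_pos a D \<beta> - root_neg a D \<beta>))) / (1 - exp (- (l * (root_pos a D \<beta> - root_neg a D \<beta>)))) \<Longrightarrow>
    \<bar>\<beta> ^ n * (r ^ j * f)\<bar> \<le> K"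
    using root_decay_bound[OF D d2 l M' nj, of a] by blast
  have "\<bar>\<beta> ^ n * exp_pair c1 c2 a D j \<beta> y\<bar> \<le> K + K" if \<beta>: "0 < \<beta>" and y: "y \<in> Y" for \<beta> y
  proof -
    let ?p = "root_pos a D \<beta>" and ?q = "root_neg a D \<beta>"
    note rp = root_props[OF D \<beta>, of a]
    have den: "0 < 1 - exp (- (l * (?p - ?q)))" using rp l by simp
    have "?p + ?q = - 2 * A" using rp(5) by (simp add: A_def)
    then have s: "?p = (?p - ?q) / 2 - A" "- ?q = (?p - ?q) / 2 + A" by (simp_all add: field_simps)
    have b1: "exp (- (d * ?p)) \<le> exp (d * \<bar>A\<bar>) * exp (- (d / 2 * (?p - ?q)))"
    proof -
      have "(?p - ?q) / 2 \<le> ?p + \<bar>A\<bar>" using s(1) by linarith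
      then have "d * ((?p - ?q) / 2) \<le> d * (?p + \<bar>A\<bar>)" using d by (intro mult_left_mono) auto
      then show ?thesis unfolding exp_add[symmetric] by (simp add: algebra_simps)
    qed
    have b2: "exp (d * ?q) \<le> exp (d * \<bar>A\<bar>) * exp (- (d / 2 * (?p - ?q)))"
    proof -
      have "(?p - ?q) / 2 \<le> - ?q + \<bar>A\<bar>" using s(2) by linarith
      then have "d * ((?p - ?q) / 2) \<le> d * (- ?q + \<bar>A\<bar>)" using d by (intro mult_left_mono) auto
      moreover have "d * ((?p - ?q) / 2) = d / 2 * (?p - ?q)" "d * (- ?q + \<bar>A\<bar>) = d * \<bar>A\<bar> - d * ?q" by (simp_all add: right_diff_distrib)
      ultimately have "d * ?q \<le> d * \<bar>A\<bar> + - (d / 2 * (?p - ?q))" by linarith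
      then show ?thesis unfolding exp_add[symmetric] by (simp only: exp_le_cancel_iff)
    qed
    have "\<bar>\<beta> ^ n * (?p ^ j * (c1 \<beta> * exp (?p * y)))\<bar> \<le> K"
    proof (rule K[OF \<beta>])
      show "\<bar>?p\<bar> \<le> ?p - ?q" using rp by simp
      have "\<bar>c1 \<beta> * exp (?p * y)\<bar> \<le> M * exp (- (d * ?p)) / (1 - exp (- (l * (?p - ?q))))" by (rule c1[OF \<beta> y])
      also have "\<dots> \<le> M * (exp (d * \<bar>A\<bar>) * exp (- (d / 2 * (?p - ?q)))) / (1 - exp (- (l * (?p - ?q))))"
        using b1 M den by (intro divide_right_mono mult_left_mono) auto
      finally show "\<bar>c1 \<beta> * exp (?p * y)\<bar> \<le> M' * exp (- (d / 2 * (?p - ?q))) / (1 - exp (- (l * (?p - ?q))))"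
        by (simp only: M'_def mult.assoc)
    qed
    moreover have "\<bar>\<beta> ^ n * (?q ^ j * (c2 \<beta> * exp (?q * y)))\<bar> \<le> K"
    proof (rule K[OF \<beta>])
      show "\<bar>?q\<bar> \<le> ?p - ?q" using rp by simp
      have "\<bar>c2 \<beta> * exp (?q * y)\<bar> \<le> M * exp (d * ?q) / (1 - exp (- (l * (?p - ?q))))" by (rule c2[OF \<beta> y])
      also have "\<dots> \<le> M * (exp (d * \<bar>A\<bar>) * exp (- (d / 2 * (?p - ?q)))) / (1 - exp (- (l * (?p - ?q))))"
        using b2 M den by (intro divide_right_mono mult_left_mono) auto
      finally show "\<bar>c2 \<beta> * exp (?q * y)\<bar> \<le> M' * exp (- (d / 2 * (?p - ?q))) / (1 - exp (- (l * (?p - ?q))))"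
        by (simp only: M'_def mult.assoc)
    qed
    moreover have "\<beta> ^ n * exp_pair c1 c2 a D j \<beta> y = \<beta> ^ n * (?p ^ j * (c1 \<beta> * exp (?p * y))) + \<beta> ^ n * (?q ^ j * (c2 \<beta> * exp (?q * y)))"
      by (simp add: exp_pair_def algebra_simps)
    ultimately show ?thesis by linarith
  qed
  then show ?thesis by blast
qed

text \<open>\<open>v\<^sub>\<beta>(y) = E[exp (- \<beta> \<tau>) Z\<^sub>\<tau>]\<close> for a Brownian motion \<open>Z\<close> with drift \<open>a\<close> and variance rate \<open>2 D\<close> started
  at \<open>y\<close> and stopped when it leaves \<open>(L, H)\<close> or, in the one-sided case, \<open>(-\<infinity>, H)\<close>.\<close>

definition coeff_pos :: "real \<Rightarrow> real \<Rightarrow> real \<Rightarrow> real \<Rightarrow> real \<Rightarrow> real" where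
  "coeff_pos a D L H \<beta> = (H * exp (root_neg a D \<beta> * L) - L * exp (root_neg a D \<beta> * H)) /
    (exp (root_pos a D \<beta> * H + root_neg a D \<beta> * L) - exp (root_pos a D \<beta> * L + root_neg a D \<beta> * H))"

definition coeff_neg :: "real \<Rightarrow> real \<Rightarrow> real \<Rightarrow> real \<Rightarrow> real \<Rightarrow> real" where
  "coeff_neg a D L H \<beta> = (L * exp (root_pos a D \<beta> * H) - H * exp (root_pos a D \<beta> * L)) /
    (exp (root_pos a D \<beta> * H + root_neg a D \<beta> * L) - exp (root_pos a D \<beta> * L + root_neg a D \<beta> * H))"

lemma coeff_measurable:
  "coeff_pos a D L H \<in> borel_measurable borel" "coeff_neg a D L H \<in> borel_measurable borel"
  unfolding coeff_pos_def[abs_def] coeff_neg_def[abs_def] root_pos_def root_neg_def by measurable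

text \<open>Numerator and denominator are divided by the dominant exponential
  \<open>exp (p * H + q * L)\<close>. For \<open>y\<close> between \<open>L\<close> and
  \<open>H\<close> all remaining exponents are nonpositive, which displays the decay in the
  roots.\<close>

lemma two_sided_terms:
  fixes a :: real
  assumes D: "0 < D" and \<beta>: "0 < \<beta>" and LH: "L < H"
  defines "p \<equiv> root_pos a D \<beta>" and "q \<equiv> root_neg a D \<beta>"
  shows "coeff_pos a D L H \<beta> * exp (p * y) = (H * exp (- (p * (H - y))) - L * exp (q * (H - L) - p * (H - y))) / (1 - exp (- ((H - L) * (p - q))))"
    and "coeff_neg a D L H \<beta> * exp (q * y) = (L * exp (q * (y - L)) - H * exp (q * (y - L) - p * (H - L))) / (1 - exp (- ((H - L) * (p - q))))"
    and "0 < 1 - exp (- ((H - L) * (p - q)))"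
proof -
  let ?d = "1 - exp (- ((H - L) * (p - q)))"
  have pq: "0 < p" "q < 0" using root_props[OF D \<beta>] by (auto simp: p_def q_def)
  show d: "0 < ?d" using pq LH by simp
  let ?E = "exp (p * H + q * L)"
  have \<Delta>: "exp (p * H + q * L) - exp (p * L + q * H) = ?E * ?d"
    unfolding right_diff_distrib exp_add[symmetric] by (simp add: algebra_simps)
  have "coeff_pos a D L H \<beta> * exp (p * y) = ?E * (H * exp (- (p * (H - y))) - L * exp (q * (H - L) - p * (H - y))) / (?E * ?d)"
    unfolding coeff_pos_def p_def[symmetric] q_def[symmetric] \<Delta>
    by (simp add: algebra_simps exp_add[symmetric])
  then show "coeff_pos a D L H \<beta> * exp (p * y) = (H * exp (- (p * (H - y))) - L * exp (q * (H - L) - p * (H - y))) / ?d" by simp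
  have "coeff_neg a D L H \<beta> * exp (q * y) = ?E * (L * exp (q * (y - L)) - H * exp (q * (y - L) - p * (H - L))) / (?E * ?d)"
    unfolding coeff_neg_def p_def[symmetric] q_def[symmetric] \<Delta>
    by (simp add: algebra_simps exp_add[symmetric])
  then show "coeff_neg a D L H \<beta> * exp (q * y) = (L * exp (q * (y - L)) - H * exp (q * (y - L) - p * (H - L))) / ?d" by simp
qed

text \<open>Regrouped by boundary value: the weights of \<open>H\<close> and \<open>L\<close> are
  nonnegative on the interval, being the discounted masses of the exits at either end. Signs and the
  bound without powers of \<open>\<beta>\<close> are read off here.\<close>

lemma two_sided_eq:
  fixes a :: real
  assumes D: "0 < D" and \<beta>: "0 < \<beta>" and LH: "L < H"
  defines "p \<equiv> root_pos a D \<beta>" and "q \<equiv> root_neg a D \<beta>"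
  shows "exp_pair (coeff_pos a D L H) (coeff_neg a D L H) a D 0 \<beta> y =
    (H * (exp (- (p * (H - y))) * (1 - exp (- ((p - q) * (y - L))))) + L * (exp (q * (y - L)) * (1 - exp (- ((p - q) * (H - y)))))) /
      (1 - exp (- ((H - L) * (p - q))))"
proof -
  have "exp_pair (coeff_pos a D L H) (coeff_neg a D L H) a D 0 \<beta> y = coeff_pos a D L H \<beta> * exp (p * y) + coeff_neg a D L H \<beta> * exp (q * y)"
    by (simp add: exp_pair_def p_def q_def)
  also have "\<dots> = ((H * exp (- (p * (H - y))) - L * exp (q * (H - L) - p * (H - y))) + (L * exp (q * (y - L)) - H * exp (q * (y - L) - p * (H - L)))) / (1 - exp (- ((H - L) * (p - q))))"
    using two_sided_terms(1,2)[OF D \<beta> LH, where a=a and y=y] by (simp only: p_def q_def add_divide_distrib)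
  also have "(H * exp (- (p * (H - y))) - L * exp (q * (H - L) - p * (H - y))) + (L * exp (q * (y - L)) - H * exp (q * (y - L) - p * (H - L)))
    = H * (exp (- (p * (H - y))) * (1 - exp (- ((p - q) * (y - L))))) + L * (exp (q * (y - L)) * (1 - exp (- ((p - q) * (H - y)))))"
    by (simp add: right_diff_distrib exp_add[symmetric]) (simp add: algebra_simps)
  finally show ?thesis .
qed

lemma two_sided_boundary:
  assumes "0 < D" "0 < \<beta>" "L < H"
  shows "exp_pair (coeff_pos a D L H) (coeff_neg a D L H) a D 0 \<beta> H = H"
    and "exp_pair (coeff_pos a D L H) (coeff_neg a D L H) a D 0 \<beta> L = L"
  using two_sided_terms(3)[OF assms, of a] root_props(3,4)[OF assms(1,2), of a] assms(3)
  unfolding two_sided_eq[OF assms] by (auto simp: mult.commute)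

text \<open>By the addition theorem and \<open>cosh \<ge> 1\<close>. It compares the weights of the
  two ends uniformly in \<open>\<beta>\<close> when the distances to them are in integer
  ratio.\<close>

lemma sinh_multiple_ge:
  fixes u :: real
  assumes "0 \<le> u"
  shows "real N * sinh u \<le> sinh (real N * u)"
proof (induction N)
  case (Suc N)
  have "real (Suc N) * sinh u = real N * sinh u + sinh u" by (simp add: distrib_right)
  also have "\<dots> \<le> sinh (real N * u) + sinh u" using Suc by simp
  also have "\<dots> \<le> sinh (real N * u) * cosh u + cosh (real N * u) * sinh u"
    using assms mult_left_mono[OF cosh_real_ge_1[of u], of "sinh (real N * u)"] mult_right_mono[OF cosh_real_ge_1[of "real N * u"], of "sinh u"]
    by simp
  also have "\<dots> = sinh (real (Suc N) * u)" 
  proof -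
    have "real (Suc N) * u = real N * u + u" by (simp add: distrib_right)
    then show ?thesis by (simp only: sinh_add)
  qed
  finally show ?case .
qed simp

text \<open>For \<open>H \<le> 0\<close> both boundary values are nonpositive and \<open>L\<close>
  is negative. For \<open>0 < H\<close> the lower value may be negative, and \<open>y\<close> is
  moved close to \<open>H\<close>: up to a common factor the two weights are
  \<open>sinh (N * u)\<close> and \<open>exp (- (\<rho> * (H - L))) * sinh u\<close>, where only
  \<open>u\<close> depends on \<open>\<beta>\<close>, so a large \<open>N\<close> makes the upper
  end win for all \<open>\<beta>\<close> at once.\<close>

lemma two_sided_sign:
  assumes D: "0 < D" and LH: "L < H"
  shows "\<exists>y. L < y \<and> y < H \<and> ((\<forall>\<beta>>0. 0 < exp_pair (coeff_pos a D L H) (coeff_neg a D L H) a D 0 \<beta> y)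
    \<or> (\<forall>\<beta>>0. exp_pair (coeff_pos a D L H) (coeff_neg a D L H) a D 0 \<beta> y < 0))"
proof (cases "H \<le> 0")
  case True
  let ?y = "(L + H) / 2"
  have y: "L < ?y" "?y < H" using LH by auto
  have "exp_pair (coeff_pos a D L H) (coeff_neg a D L H) a D 0 \<beta> ?y < 0" if \<beta>: "0 < \<beta>" for \<beta>
  proof -
    have pq: "0 < root_pos a D \<beta> - root_neg a D \<beta>" using root_props(3,4)[OF D \<beta>, of a] by simp
    have "H * (exp (- (root_pos a D \<beta> * (H - ?y))) * (1 - exp (- ((root_pos a D \<beta> - root_neg a D \<beta>) * (?y - L))))) \<le> 0"
      using True y pq by (intro mult_nonpos_nonneg mult_nonneg_nonneg) auto
    moreover have "L * (exp (root_neg a D \<beta> * (?y - L)) * (1 - exp (- ((root_pos a D \<beta> - root_neg a D \<beta>) * (H - ?y))))) < 0"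
      using True LH y pq by (intro mult_neg_pos mult_pos_pos) auto
    ultimately show ?thesis
      unfolding two_sided_eq[OF D \<beta> LH] using two_sided_terms(3)[OF D \<beta> LH, of a] by (intro divide_neg_pos) auto
  qed
  then show ?thesis using y by blast
next
  case False
  then have H: "0 < H" by simp
  define \<rho> where "\<rho> = a / (2 * D)"
  \<comment> \<open>Just what makes \<open>H * N\<close> exceed \<open>\<bar>L\<bar>\<close> times
    the drift factor.\<close>
  obtain N :: nat where N: "\<bar>L\<bar> * exp (- (\<rho> * (H - L))) / H < real N" using reals_Archimedean2 by blast
  then have N0: "0 < real N" using H by (smt (verit) divide_nonneg_pos exp_ge_zero mult_nonneg_nonneg abs_ge_zero)
  \<comment> \<open>The distances of \<open>H - h\<close> to the two ends are \<open>h\<close> and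
    \<open>N * h\<close>.\<close>
  define h where "h = (H - L) / (real N + 1)"
  have h: "0 < h" "real N * h + h = H - L" 
  proof -
    show "0 < h" using LH N0 by (simp add: h_def)
    have "(real N + 1) * h = H - L" using N0 by (simp add: h_def)
    then show "real N * h + h = H - L" by (simp add: distrib_right)
  qed
  let ?y = "H - h"
  have "0 < real N * h" using h(1) N0 by simp
  then have y: "L < ?y" "?y < H" using h by linarith+
  have "0 < exp_pair (coeff_pos a D L H) (coeff_neg a D L H) a D 0 \<beta> ?y" if \<beta>: "0 < \<beta>" for \<beta>
  proof -
    define x where "x = root_pos a D \<beta> - root_neg a D \<beta>"
    have x: "0 < x" using root_props(3,4)[OF D \<beta>, of a] by (simp add: x_def)
    have p: "root_pos a D \<beta> = x / 2 - \<rho>" "root_neg a D \<beta> = - x / 2 - \<rho>"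
      using root_props(5)[OF D \<beta>, of a] by (simp_all add: x_def \<rho>_def field_simps)
    have sh: "1 - exp (- (x * t)) = exp (- (x * t / 2)) * (2 * sinh (x * t / 2))" for t
      by (simp add: sinh_def right_diff_distrib exp_add[symmetric])
    have yL: "?y - L = real N * h" using h(2) by simp
    have Hy: "H - ?y = h" by simp
    have e1: "- (root_pos a D \<beta> * h) + - (x * (real N * h) / 2) = \<rho> * h - x * (H - L) / 2"
      unfolding p h(2)[symmetric] by (simp add: algebra_simps add_divide_distrib)
    have e2: "root_neg a D \<beta> * (real N * h) + - (x * h / 2) = - (\<rho> * (real N * h)) - x * (H - L) / 2"
      unfolding p h(2)[symmetric] by (simp add: algebra_simps add_divide_distrib)
    have xN: "x * (real N * h) / 2 = real N * (x * h / 2)" by simp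
    have t1: "exp (- (root_pos a D \<beta> * (H - ?y))) * (1 - exp (- (x * (?y - L)))) = exp (\<rho> * h - x * (H - L) / 2) * (2 * sinh (real N * (x * h / 2)))"
      unfolding yL Hy sh e1[symmetric] exp_add xN by (simp only: mult.assoc)
    have t2: "exp (root_neg a D \<beta> * (?y - L)) * (1 - exp (- (x * (H - ?y)))) = exp (- (\<rho> * (real N * h)) - x * (H - L) / 2) * (2 * sinh (x * h / 2))"
      unfolding yL Hy sh e2[symmetric] exp_add by (simp only: mult.assoc)
    have u: "0 < x * h / 2" using x h by simp
    have "\<bar>L\<bar> * exp (- (\<rho> * (H - L))) < H * real N" using N H by (simp add: field_simps)
    then have "\<bar>L\<bar> * exp (- (\<rho> * (H - L))) * sinh (x * h / 2) < H * real N * sinh (x * h / 2)"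
      using u by (intro mult_strict_right_mono) auto
    also have "\<dots> \<le> H * sinh (real N * (x * h / 2))"
      using sinh_multiple_ge[of "x * h / 2" N] u H by (simp add: mult.assoc)
    finally have key: "\<bar>L\<bar> * exp (- (\<rho> * (H - L))) * sinh (x * h / 2) < H * sinh (real N * (x * h / 2))" .
    have ee: "exp (- (\<rho> * (real N * h)) - x * (H - L) / 2) = exp (\<rho> * h - x * (H - L) / 2) * exp (- (\<rho> * (H - L)))"
      unfolding exp_add[symmetric] h(2)[symmetric] by (simp add: algebra_simps)
    let ?C = "exp (\<rho> * h - x * (H - L) / 2)"
    have "0 < ?C * (2 * (H * sinh (real N * (x * h / 2)) - \<bar>L\<bar> * exp (- (\<rho> * (H - L))) * sinh (x * h / 2)))"
      using key by (intro mult_pos_pos) auto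
    also have "\<dots> \<le> ?C * (2 * (H * sinh (real N * (x * h / 2)) + L * exp (- (\<rho> * (H - L))) * sinh (x * h / 2)))"
    proof -
      have "- (\<bar>L\<bar> * (exp (- (\<rho> * (H - L))) * sinh (x * h / 2))) \<le> L * (exp (- (\<rho> * (H - L))) * sinh (x * h / 2))"
        using u mult_right_mono[of "- \<bar>L\<bar>" L "exp (- (\<rho> * (H - L))) * sinh (x * h / 2)"] by simp
      then show ?thesis by (intro mult_left_mono) (auto simp: mult.assoc)
    qed
    also have "\<dots> = H * (?C * (2 * sinh (real N * (x * h / 2)))) + L * (exp (- (\<rho> * (real N * h)) - x * (H - L) / 2) * (2 * sinh (x * h / 2)))"
      unfolding ee by (simp add: algebra_simps)
    finally have "0 < H * (?C * (2 * sinh (real N * (x * h / 2)))) + L * (exp (- (\<rho> * (real N * h)) - x * (H - L) / 2) * (2 * sinh (x * h / 2)))" .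
    then show ?thesis
      unfolding two_sided_eq[OF D \<beta> LH] x_def[symmetric] t1 t2
      using two_sided_terms(3)[OF D \<beta> LH, of a] by (intro divide_pos_pos) (auto simp: x_def)
  qed
  then show ?thesis using y by blast
qed

lemma two_sided_family:
  assumes P: "prob_space P" "sets P = sets borel" "AE \<beta> in P. 0 < \<beta>" and D: "0 < D" and LH: "L < H"
  shows "smooth_family P (exp_pair (coeff_pos a D L H) (coeff_neg a D L H) a D) {L<..<H}"
proof -
  interpret prob_space P by fact
  show ?thesis
  proof (unfold_locales)
    show "sets P = sets borel" "AE \<beta> in P. 0 < \<beta>" "open {L<..<H}" using P by auto
    show "(exp_pair (coeff_pos a D L H) (coeff_neg a D L H) a D j \<beta> has_real_derivative exp_pair (coeff_pos a D L H) (coeff_neg a D L H) a D (Suc j) \<beta> y) (at y)" for j \<beta> y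
      by (rule deriv_exp_pair)
    show "(\<lambda>\<beta>. exp_pair (coeff_pos a D L H) (coeff_neg a D L H) a D j \<beta> y) \<in> borel_measurable borel" for j y
      by (intro exp_pair_measurable coeff_measurable)
    fix y assume y: "y \<in> {L<..<H}"
    \<comment> \<open>Half the distance to the boundary: the whole neighbourhood keeps distance
      \<open>d\<close> from both ends, and \<open>d\<close> is the decay rate handed to
      \<open>exp_pair_bound\<close>.\<close>
    define d where "d = min (y - L) (H - y) / 2"
    have d: "0 < d" "\<And>y'. y' \<in> {y - d..y + d} \<Longrightarrow> d \<le> y' - L \<and> d \<le> H - y'"
    proof -
      show "0 < d" using y by (simp add: d_def)
      have "2 * d \<le> y - L" "2 * d \<le> H - y" by (simp_all add: d_def)
      then show "d \<le> y' - L \<and> d \<le> H - y'" if "y' \<in> {y - d..y + d}" for y' using that by auto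
    qed
    have "\<exists>K. \<forall>\<beta>>0. \<forall>y'\<in>{y - d..y + d}. \<bar>\<beta> ^ n * exp_pair (coeff_pos a D L H) (coeff_neg a D L H) a D j \<beta> y'\<bar> \<le> K" for n j
    proof (cases "0 < n + j")
      case True
      show ?thesis
      proof (rule exp_pair_bound[OF D d(1) _ _ True, where l="H - L" and M="\<bar>L\<bar> + \<bar>H\<bar>"])
        fix \<beta> y' :: real assume \<beta>: "0 < \<beta>" and y': "y' \<in> {y - d..y + d}"
        let ?p = "root_pos a D \<beta>" and ?q = "root_neg a D \<beta>"
        note t = two_sided_terms[OF D \<beta> LH, of a]
        have pq: "0 < ?p" "?q < 0" using root_props[OF D \<beta>] by auto
        have e: "exp (- (?p * (H - y'))) \<le> exp (- (d * ?p))" "exp (?q * (y' - L)) \<le> exp (d * ?q)"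
          using d(2)[OF y'] pq by (auto simp: mult.commute)
        have e': "exp (?q * (H - L) - ?p * (H - y')) \<le> exp (- (?p * (H - y')))" "exp (?q * (y' - L) - ?p * (H - L)) \<le> exp (?q * (y' - L))"
          using pq LH by (auto simp: mult_nonpos_nonneg)
        have "\<bar>H * exp (- (?p * (H - y'))) - L * exp (?q * (H - L) - ?p * (H - y'))\<bar> \<le> \<bar>H\<bar> * exp (- (d * ?p)) + \<bar>L\<bar> * exp (- (d * ?p))"
          using e(1) order_trans[OF e'(1) e(1)]
          by (intro order_trans[OF abs_triangle_ineq4] add_mono) (auto simp: abs_mult intro!: mult_left_mono)
        then show "\<bar>coeff_pos a D L H \<beta> * exp (?p * y')\<bar> \<le> (\<bar>L\<bar> + \<bar>H\<bar>) * exp (- (d * ?p)) / (1 - exp (- ((H - L) * (?p - ?q))))"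
          unfolding t(1) using t(3) by (simp add: abs_divide divide_right_mono algebra_simps)
        have "\<bar>L * exp (?q * (y' - L)) - H * exp (?q * (y' - L) - ?p * (H - L))\<bar> \<le> \<bar>L\<bar> * exp (d * ?q) + \<bar>H\<bar> * exp (d * ?q)"
          using e(2) order_trans[OF e'(2) e(2)]
          by (intro order_trans[OF abs_triangle_ineq4] add_mono) (auto simp: abs_mult intro!: mult_left_mono)
        then show "\<bar>coeff_neg a D L H \<beta> * exp (?q * y')\<bar> \<le> (\<bar>L\<bar> + \<bar>H\<bar>) * exp (d * ?q) / (1 - exp (- ((H - L) * (?p - ?q))))"
          unfolding t(2) using t(3) by (simp add: abs_divide divide_right_mono algebra_simps)
      qed (use LH in auto)
    next
      case False
      \<comment> \<open>No power of the roots is left to cancel the singularity of the denominator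
        as the roots come together. Instead, the normalised weights of \<open>H\<close> and
        \<open>L\<close> lie between 0 and 1.\<close>
      then have nj: "n = 0" "j = 0" by auto
      have "\<bar>exp_pair (coeff_pos a D L H) (coeff_neg a D L H) a D 0 \<beta> y'\<bar> \<le> \<bar>H\<bar> + \<bar>L\<bar>" if \<beta>: "0 < \<beta>" and y': "y' \<in> {y - d..y + d}" for \<beta> y' :: real
      proof -
        let ?p = "root_pos a D \<beta>" and ?q = "root_neg a D \<beta>"
        let ?d = "1 - exp (- ((H - L) * (?p - ?q)))"
        have pq: "0 < ?p" "?q < 0" using root_props[OF D \<beta>] by auto
        have dd: "0 < ?d" by (rule two_sided_terms(3)[OF D \<beta> LH])
        have yy: "0 \<le> y' - L" "0 \<le> H - y'" using d(1) d(2)[OF y'] by linarith+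
        have f: "0 \<le> exp s * (1 - exp (- ((?p - ?q) * t))) \<and> exp s * (1 - exp (- ((?p - ?q) * t))) \<le> ?d" if "s \<le> 0" "0 \<le> t" "t \<le> H - L" for s t
        proof -
          have "(?p - ?q) * t \<le> (?p - ?q) * (H - L)" using that pq by (intro mult_left_mono) auto
          then have "1 - exp (- ((?p - ?q) * t)) \<le> ?d" by (simp add: mult.commute)
          moreover have "0 \<le> 1 - exp (- ((?p - ?q) * t))" using that pq by simp
          moreover have "exp s \<le> 1" using that by simp
          ultimately show ?thesis using mult_mono[of "exp s" 1 "1 - exp (- ((?p - ?q) * t))" ?d] by simp
        qed
        note f1 = f[of "- (?p * (H - y'))" "y' - L"] and f2 = f[of "?q * (y' - L)" "H - y'"]
        have "\<bar>H * (exp (- (?p * (H - y'))) * (1 - exp (- ((?p - ?q) * (y' - L))))) + L * (exp (?q * (y' - L)) * (1 - exp (- ((?p - ?q) * (H - y')))))\<bar>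
          \<le> \<bar>H\<bar> * ?d + \<bar>L\<bar> * ?d"
          using f1 f2 pq yy
          by (intro order_trans[OF abs_triangle_ineq] add_mono; simp only: abs_mult; intro mult_left_mono) (auto simp: mult_nonpos_nonneg abs_mult)
        then show ?thesis
          unfolding two_sided_eq[OF D \<beta> LH] using dd by (simp add: abs_divide divide_le_eq distrib_right)
      qed
      then show ?thesis unfolding nj by (intro exI[of _ "\<bar>H\<bar> + \<bar>L\<bar>"]) simp
    qed
    moreover have "{y - d..y + d} \<subseteq> {L<..<H}"
    proof
      fix y' assume "y' \<in> {y - d..y + d}"
      from d(2)[OF this] d(1) show "y' \<in> {L<..<H}" by simp
    qed
    ultimately show "\<exists>d>0. {y - d..y + d} \<subseteq> {L<..<H} \<and>
      (\<forall>n j. \<exists>K. \<forall>\<beta>>0. \<forall>y'\<in>{y - d..y + d}. \<bar>\<beta> ^ n * exp_pair (coeff_pos a D L H) (coeff_neg a D L H) a D j \<beta> y'\<bar> \<le> K)"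
      using d(1) by blast
  qed
qed

text \<open>For the component \<open>(0, h)\<close> the lower end is minus infinity on the
  logarithmic scale and is never reached. Only the solution that decays there remains, normalised to
  \<open>H\<close> at \<open>H\<close>.\<close>

lemma one_sided_family:
  assumes P: "prob_space P" "sets P = sets borel" "AE \<beta> in P. 0 < \<beta>" and D: "0 < D"
  shows "smooth_family P (exp_pair (\<lambda>\<beta>. H * exp (- (root_pos a D \<beta> * H))) (\<lambda>_. 0) a D) {..<H}"
proof -
  interpret prob_space P by fact
  let ?v = "exp_pair (\<lambda>\<beta>. H * exp (- (root_pos a D \<beta> * H))) (\<lambda>_. 0) a D"
  have eq: "H * exp (- (root_pos a D \<beta> * H)) * exp (root_pos a D \<beta> * y) = H * exp (- (root_pos a D \<beta> * (H - y)))" for \<beta> y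
    by (simp add: mult.assoc exp_add[symmetric] algebra_simps)
  show ?thesis
  proof (unfold_locales)
    show "sets P = sets borel" "AE \<beta> in P. 0 < \<beta>" "open {..<H}" using P by auto
    show "(?v j \<beta> has_real_derivative ?v (Suc j) \<beta> y) (at y)" for j \<beta> y
      by (rule deriv_exp_pair)
    show "(\<lambda>\<beta>. ?v j \<beta> y) \<in> borel_measurable borel" for j y
      by (intro exp_pair_measurable) (unfold root_pos_def, measurable)
    fix y assume y: "y \<in> {..<H}"
    define d where "d = (H - y) / 2"
    have d: "0 < d" "\<And>y'. y' \<in> {y - d..y + d} \<Longrightarrow> d \<le> H - y'" using y by (auto simp: d_def field_simps)
    have "\<exists>K. \<forall>\<beta>>0. \<forall>y'\<in>{y - d..y + d}. \<bar>\<beta> ^ n * ?v j \<beta> y'\<bar> \<le> K" for n j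
    proof (cases "0 < n + j")
      case True
      show ?thesis
      proof (rule exp_pair_bound[OF D d(1) zero_less_one _ True, where M="\<bar>H\<bar>"])
        fix \<beta> y' :: real assume \<beta>: "0 < \<beta>" and y': "y' \<in> {y - d..y + d}"
        let ?p = "root_pos a D \<beta>" and ?q = "root_neg a D \<beta>"
        have pq: "0 < ?p" "?q < 0" using root_props[OF D \<beta>] by auto
        then have den: "0 < 1 - exp (- (1 * (?p - ?q)))" "1 - exp (- (1 * (?p - ?q))) \<le> 1" by auto
        have "\<bar>H\<bar> * exp (- (?p * (H - y'))) \<le> \<bar>H\<bar> * exp (- (d * ?p))"
          using d(2)[OF y'] pq by (intro mult_left_mono) (auto simp: mult.commute)
        \<comment> \<open>There is no denominator in this case; dividing by a number below 1 only
          enlarges the bound and gives it the shape that \<open>exp_pair_bound\<close>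
          expects.\<close>
        also have "\<dots> \<le> \<bar>H\<bar> * exp (- (d * ?p)) / (1 - exp (- (1 * (?p - ?q))))"
          using den by (simp only: le_divide_eq if_True) (intro mult_left_le; simp)
        finally show "\<bar>H * exp (- (?p * H)) * exp (?p * y')\<bar> \<le> \<bar>H\<bar> * exp (- (d * ?p)) / (1 - exp (- (1 * (?p - ?q))))"
          unfolding eq by (simp add: abs_mult)
        show "\<bar>0 * exp (?q * y')\<bar> \<le> \<bar>H\<bar> * exp (d * ?q) / (1 - exp (- (1 * (?p - ?q))))" using den by simp
      qed simp
    next
      case False
      then have nj: "n = 0" "j = 0" by auto
      have "\<bar>?v 0 \<beta> y'\<bar> \<le> \<bar>H\<bar>" if \<beta>: "0 < \<beta>" and y': "y' \<in> {y - d..y + d}" for \<beta> y' :: real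
      proof -
        have "0 \<le> root_pos a D \<beta> * (H - y')" using d(1) d(2)[OF y'] root_props(3)[OF D \<beta>, of a] by simp
        then show ?thesis by (simp add: exp_pair_def eq abs_mult mult_left_le)
      qed
      then show ?thesis unfolding nj by (intro exI[of _ "\<bar>H\<bar>"]) simp
    qed
    moreover have "{y - d..y + d} \<subseteq> {..<H}"
    proof
      fix y' assume "y' \<in> {y - d..y + d}"
      from d(2)[OF this] d(1) show "y' \<in> {..<H}" by simp
    qed
    ultimately show "\<exists>d>0. {y - d..y + d} \<subseteq> {..<H} \<and> (\<forall>n j. \<exists>K. \<forall>\<beta>>0. \<forall>y'\<in>{y - d..y + d}. \<bar>\<beta> ^ n * ?v j \<beta> y'\<bar> \<le> K)"
      using d(1) by blast
  qed
qed

section \<open>Expansion over a short window and values at the exit\<close>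

text \<open>To get past \<open>l\<close> or \<open>h\<close> a continuous path has to take that
  value, which is not in \<open>C\<close>.\<close>

lemma path_in_component:
  fixes X :: "real \<Rightarrow> 'a \<Rightarrow> real"
  assumes c: "continuous_on {s..} (\<lambda>r. X r \<omega>)" and lh: "l < h" "l \<notin> C" "h \<notin> C"
    and X0: "X s \<omega> \<in> {l<..<h}" and stay: "\<And>q. s \<le> q \<Longrightarrow> q < r \<Longrightarrow> X q \<omega> \<in> C" and r: "s \<le> r"
  shows "X r \<omega> \<in> {l..h}" and "X r \<omega> \<in> C \<Longrightarrow> X r \<omega> \<in> {l<..<h}"
proof -
  have cr: "continuous_on {s..r} (\<lambda>r. X r \<omega>)" by (rule continuous_on_subset[OF c]) auto
  show *: "X r \<omega> \<in> {l..h}"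
  proof (rule ccontr)
    assume "X r \<omega> \<notin> {l..h}"
    then consider "X r \<omega> < l" | "h < X r \<omega>" by fastforce
    then show False
    proof cases
      case 1
      then obtain q where q: "s \<le> q" "q \<le> r" "X q \<omega> = l" using IVT2'[of "\<lambda>r. X r \<omega>" r l s] X0 r cr by auto
      then have "q < r" using 1 by (cases "q = r") auto
      then show False using stay[of q] q lh by auto
    next
      case 2
      then obtain q where q: "s \<le> q" "q \<le> r" "X q \<omega> = h" using IVT'[of "\<lambda>r. X r \<omega>" s h r] X0 r cr by auto
      then have "q < r" using 2 by (cases "q = r") auto
      then show False using stay[of q] q lh by auto
    qed
  qed
  show "X r \<omega> \<in> {l<..<h}" if "X r \<omega> \<in> C" using * that lh by (cases "X r \<omega> = l"; cases "X r \<omega> = h") auto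
qed

text \<open>Allows a restart: if the path has stayed in \<open>C\<close> until \<open>s'\<close>,
  watching for the exit may begin there.\<close>

lemma exit_time_shift:
  assumes "s \<le> s'" "\<And>r. s \<le> r \<Longrightarrow> r < s' \<Longrightarrow> X r \<omega> \<in> C"
  shows "exit_time X C s \<omega> = exit_time X C s' \<omega>"
proof -
  have "{ereal r |r. s \<le> r \<and> X r \<omega> \<notin> C} = {ereal r |r. s' \<le> r \<and> X r \<omega> \<notin> C}"
    using assms by (metis (no_types, opaque_lifting) not_less order_trans)
  then show ?thesis by (simp only: exit_time_def)
qed

text \<open>\<open>r\<close> is the square root of the elapsed time and \<open>U\<close> the
  log-increment, of order \<open>r\<close>. The bound involves only even powers of \<open>U\<close>,
  whose expectations are explicit, weighted so that each term has expectation of order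
  \<open>r ^ 3\<close>. The case \<open>\<not> g\<close> is the event of an early exit.\<close>

lemma second_order_pointwise:
  fixes r U j0 j1 j2 i1 K \<Psi> :: real
  assumes r: "0 < r" "r \<le> 1" and K: "0 \<le> K"
    and good: "g \<Longrightarrow> \<bar>\<Psi> - (j0 + j1 * U + j2 / 2 * U\<^sup>2 - r\<^sup>2 * i1)\<bar> \<le> K * (\<bar>U\<bar> ^ 3 + r\<^sup>2 * \<bar>U\<bar> + (r\<^sup>2)\<^sup>2)"
    and bad: "\<not> g \<Longrightarrow> \<bar>\<Psi>\<bar> \<le> K"
  shows "\<bar>\<Psi> - (j0 + j1 * U + j2 / 2 * U\<^sup>2 - r\<^sup>2 * i1)\<bar> \<le>
    2 * (K + \<bar>j0\<bar> + \<bar>j1\<bar> + \<bar>j2\<bar> + \<bar>i1\<bar>) * (r * U\<^sup>2 + U ^ 4 / r + r ^ 3 + (if g then 0 else 1))"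
proof -
  define B where "B = r * U\<^sup>2 + U ^ 4 / r + r ^ 3"
  have B0: "0 \<le> r * U\<^sup>2" "0 \<le> U ^ 4 / r" "0 \<le> r ^ 3" using r by auto
  define c where "c = K + \<bar>j0\<bar> + \<bar>j1\<bar> + \<bar>j2\<bar> + \<bar>i1\<bar>"
  have U4: "U ^ 4 = U\<^sup>2 * U\<^sup>2" by (simp add: power4_eq_xxxx power2_eq_square)
  show ?thesis
  proof (cases g)
    case True
    \<comment> \<open>The odd powers of \<open>\<bar>U\<bar>\<close> are split by the
      arithmetic-geometric mean inequality with the weight natural for \<open>U\<close> of order
      \<open>r\<close>.\<close>
    have "0 \<le> (r * \<bar>U\<bar> - U\<^sup>2)\<^sup>2 / r" using r by simp
    also have "\<dots> = r * U\<^sup>2 + U ^ 4 / r - 2 * \<bar>U\<bar> ^ 3"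
      using r by (simp add: power2_diff field_simps power2_eq_square power3_eq_cube power4_eq_xxxx)
    finally have 1: "2 * \<bar>U\<bar> ^ 3 \<le> r * U\<^sup>2 + U ^ 4 / r" by simp
    have "0 \<le> r * (r - \<bar>U\<bar>)\<^sup>2" using r by simp
    also have "\<dots> = r ^ 3 + r * U\<^sup>2 - 2 * (r\<^sup>2 * \<bar>U\<bar>)" by (simp add: power2_diff algebra_simps power2_eq_square power3_eq_cube)
    finally have 2: "2 * (r\<^sup>2 * \<bar>U\<bar>) \<le> r ^ 3 + r * U\<^sup>2" by simp
    have "(r\<^sup>2)\<^sup>2 = r ^ 3 * r" by (simp add: power2_eq_square power3_eq_cube)
    also have "\<dots> \<le> r ^ 3 * 1" using r by (intro mult_left_mono) auto
    finally have 3: "(r\<^sup>2)\<^sup>2 \<le> r ^ 3" by simp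
    have "2 * (\<bar>U\<bar> ^ 3 + r\<^sup>2 * \<bar>U\<bar> + (r\<^sup>2)\<^sup>2) \<le> (r * U\<^sup>2 + U ^ 4 / r) + (r ^ 3 + r * U\<^sup>2) + 2 * r ^ 3"
      unfolding distrib_left by (intro add_mono 1 2 mult_left_mono 3) simp
    also have "\<dots> \<le> 4 * B"
    proof -
      have "x + y + (z + x) + 2 * z \<le> 4 * (x + y + z)" if "0 \<le> x" "0 \<le> y" "0 \<le> z" for x y z :: real
        using that by argo
      from this[OF B0] show ?thesis unfolding B_def .
    qed
    finally have "\<bar>U\<bar> ^ 3 + r\<^sup>2 * \<bar>U\<bar> + (r\<^sup>2)\<^sup>2 \<le> 2 * B" by simp
    then have "K * (\<bar>U\<bar> ^ 3 + r\<^sup>2 * \<bar>U\<bar> + (r\<^sup>2)\<^sup>2) \<le> K * (2 * B)" by (rule mult_left_mono[OF _ K])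
    also have "\<dots> \<le> c * (2 * B)" using B0 by (intro mult_right_mono) (auto simp: c_def B_def)
    also have "\<dots> = 2 * c * (B + (if g then 0 else 1))" using True by simp
    finally show ?thesis unfolding c_def B_def by (rule order_trans[OF good[OF True]])
  next
    case False
    \<comment> \<open>Only boundedness of \<open>\<Psi>\<close> is known here, so the quadratic
      polynomial is estimated crudely by \<open>E\<close>; its additive constant is paid for by the
      small probability of the event.\<close>
    have "0 \<le> (1 - U\<^sup>2)\<^sup>2" by simp
    then have "2 * U\<^sup>2 \<le> 1 + U ^ 4" unfolding U4 by (simp add: power2_diff power2_eq_square algebra_simps)
    moreover have "U ^ 4 * 1 \<le> U ^ 4 * (1 / r)" using r by (intro mult_left_mono) auto
    ultimately have "2 * U\<^sup>2 \<le> 1 + U ^ 4 / r" by simp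
    then have U2: "U\<^sup>2 \<le> 1 + U ^ 4 / r" using B0(2) zero_le_power2[of U] by linarith
    have "0 \<le> (1 - \<bar>U\<bar>)\<^sup>2" by simp
    then have U1: "\<bar>U\<bar> \<le> 1 + U\<^sup>2" by (simp add: power2_diff)
    define E where "E = 2 * (B + 1)"
    have E: "1 \<le> E" "\<bar>U\<bar> \<le> E" "U\<^sup>2 \<le> E" using U1 U2 B0 unfolding E_def B_def by argo+
    have "\<bar>\<Psi> - (j0 + j1 * U + j2 / 2 * U\<^sup>2 - r\<^sup>2 * i1)\<bar> \<le> \<bar>\<Psi>\<bar> + \<bar>j0\<bar> + \<bar>j1 * U\<bar> + \<bar>j2 / 2 * U\<^sup>2\<bar> + \<bar>r\<^sup>2 * i1\<bar>" by linarith
    also have "\<dots> \<le> K * E + \<bar>j0\<bar> * E + \<bar>j1\<bar> * E + \<bar>j2\<bar> * E + \<bar>i1\<bar> * E"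
    proof (intro add_mono)
      show "\<bar>\<Psi>\<bar> \<le> K * E" using bad[OF False] mult_left_mono[OF E(1) K] by simp
      show "\<bar>j0\<bar> \<le> \<bar>j0\<bar> * E" using mult_left_mono[OF E(1), of "\<bar>j0\<bar>"] by simp
      show "\<bar>j1 * U\<bar> \<le> \<bar>j1\<bar> * E" unfolding abs_mult by (intro mult_left_mono E) simp
      have "\<bar>j2 / 2 * U\<^sup>2\<bar> = \<bar>j2\<bar> * (U\<^sup>2 / 2)" by (simp add: abs_mult)
      also have "\<dots> \<le> \<bar>j2\<bar> * E" using order_trans[of "U\<^sup>2 / 2" "U\<^sup>2" E] E(3) by (intro mult_left_mono) auto
      finally show "\<bar>j2 / 2 * U\<^sup>2\<bar> \<le> \<bar>j2\<bar> * E" .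
      have "r\<^sup>2 \<le> 1" using r by (simp add: power_le_one)
      then have "\<bar>i1\<bar> * r\<^sup>2 \<le> \<bar>i1\<bar> * E" using E(1) by (intro mult_left_mono) auto
      then show "\<bar>r\<^sup>2 * i1\<bar> \<le> \<bar>i1\<bar> * E" by (simp add: abs_mult mult.commute)
    qed
    also have "\<dots> = 2 * c * (B + (if g then 0 else 1))" using False by (simp add: c_def E_def algebra_simps)
    finally show ?thesis unfolding c_def B_def .
  qed
qed

context brownian_motion begin

text \<open>The bracket is the generator of the log-wealth applied to the mixture, minus the
  discounting term. Moments of \<open>U\<close> enter up to order four; the square of its mean goes
  into the error, which is of order \<open>r ^ 3\<close>, that is, time to the power 3/2.\<close>

lemma second_order_expansion:
  assumes s: "0 \<le> s" and r: "0 < r" "r \<le> 1" and K: "0 \<le> K"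
    and G: "G \<in> events" "prob (space M - G) \<le> c * (r\<^sup>2)\<^sup>2" and c: "0 \<le> c" and \<Psi>: "\<Psi> \<in> borel_measurable M"
    and good: "AE \<omega> in M. \<omega> \<in> G \<longrightarrow> (let U = m * r\<^sup>2 + k * (W (s + r\<^sup>2) \<omega> - W s \<omega>) in
      \<bar>\<Psi> \<omega> - (j0 + j1 * U + j2 / 2 * U\<^sup>2 - r\<^sup>2 * i1)\<bar> \<le> K * (\<bar>U\<bar> ^ 3 + r\<^sup>2 * \<bar>U\<bar> + (r\<^sup>2)\<^sup>2))"
    and bad: "\<And>\<omega>. \<omega> \<in> space M \<Longrightarrow> \<omega> \<notin> G \<Longrightarrow> \<bar>\<Psi> \<omega>\<bar> \<le> K"
    and int\<Psi>: "integrable M \<Psi>"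
  shows "\<bar>expectation \<Psi> - j0 - r\<^sup>2 * (m * j1 + k\<^sup>2 / 2 * j2 - i1)\<bar> \<le>
    (2 * (K + \<bar>j0\<bar> + \<bar>j1\<bar> + \<bar>j2\<bar> + \<bar>i1\<bar>) * (m\<^sup>2 + k\<^sup>2 + 8 * (m ^ 4 + 3 * k ^ 4) + 1 + c) + \<bar>j2\<bar> * m\<^sup>2) * r ^ 3"
proof -
  define D where "D \<omega> = W (s + r\<^sup>2) \<omega> - W s \<omega>" for \<omega>
  define U where "U \<omega> = m * r\<^sup>2 + k * D \<omega>" for \<omega>
  define b where "b = 2 * (K + \<bar>j0\<bar> + \<bar>j1\<bar> + \<bar>j2\<bar> + \<bar>i1\<bar>)"
  have b0: "0 \<le> b" using K by (simp add: b_def)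
  have r2: "0 < r\<^sup>2" using r by simp
  have ss: "s < s + r\<^sup>2" using r by simp
  have hc: "has_bochner_integral M (\<lambda>_. x) x" for x :: real by (simp add: has_bochner_integral_iff prob_space)
  have D1: "has_bochner_integral M D 0" and D2: "has_bochner_integral M (\<lambda>\<omega>. (D \<omega>)\<^sup>2) (r\<^sup>2)"
    and D4: "has_bochner_integral M (\<lambda>\<omega>. D \<omega> ^ 4) (3 * (r\<^sup>2)\<^sup>2)"
    using increment_moments(1,2,3)[OF s ss] by (simp_all add: D_def[abs_def])
  have Dm: "D \<in> borel_measurable M" using D1 by (auto simp: has_bochner_integral_iff)
  have Um: "U \<in> borel_measurable M" unfolding U_def using Dm by measurable
  have U1: "has_bochner_integral M U (m * r\<^sup>2)"
    using has_bochner_integral_add[OF hc[of "m * r\<^sup>2"] has_bochner_integral_mult_right[OF D1, of k]] by (simp add: U_def[abs_def])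
  have U2: "has_bochner_integral M (\<lambda>\<omega>. (U \<omega>)\<^sup>2) (m\<^sup>2 * (r\<^sup>2)\<^sup>2 + k\<^sup>2 * r\<^sup>2)"
  proof -
    have "has_bochner_integral M (\<lambda>\<omega>. (m * r\<^sup>2)\<^sup>2 + (2 * (m * r\<^sup>2) * k) * D \<omega> + k\<^sup>2 * (D \<omega>)\<^sup>2) ((m * r\<^sup>2)\<^sup>2 + (2 * (m * r\<^sup>2) * k) * 0 + k\<^sup>2 * r\<^sup>2)"
      by (intro has_bochner_integral_add has_bochner_integral_mult_right hc D1 D2)
    moreover have "(m * r\<^sup>2)\<^sup>2 + (2 * (m * r\<^sup>2) * k) * D \<omega> + k\<^sup>2 * (D \<omega>)\<^sup>2 = (U \<omega>)\<^sup>2" for \<omega>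
      by (simp add: U_def power2_sum power_mult_distrib)
    ultimately show ?thesis by (simp add: power_mult_distrib)
  qed
  have p4: "(x + y) ^ 4 \<le> 8 * (x ^ 4 + y ^ 4)" for x y :: real
  proof -
    have sq: "(p + q)\<^sup>2 \<le> 2 * (p\<^sup>2 + q\<^sup>2)" for p q :: real using zero_le_power2[of "p - q"] by (simp add: power2_sum power2_diff)
    have "(x + y) ^ 4 = ((x + y)\<^sup>2)\<^sup>2" by (simp add: power_mult[symmetric])
    also have "\<dots> \<le> (2 * (x\<^sup>2 + y\<^sup>2))\<^sup>2" by (intro power_mono sq) simp
    also have "\<dots> = 4 * (x\<^sup>2 + y\<^sup>2)\<^sup>2" unfolding power_mult_distrib by simp
    also have "\<dots> \<le> 4 * (2 * ((x\<^sup>2)\<^sup>2 + (y\<^sup>2)\<^sup>2))" by (intro mult_left_mono sq) simp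
    finally show ?thesis by (simp add: power_mult[symmetric])
  qed
  let ?V = "\<lambda>\<omega>. 8 * (m ^ 4 * (r\<^sup>2) ^ 4 + k ^ 4 * D \<omega> ^ 4)"
  have V: "has_bochner_integral M ?V (8 * (m ^ 4 * (r\<^sup>2) ^ 4 + k ^ 4 * (3 * (r\<^sup>2)\<^sup>2)))"
    by (intro has_bochner_integral_add has_bochner_integral_mult_right hc D4)
  have UV: "U \<omega> ^ 4 \<le> ?V \<omega>" for \<omega> using p4[of "m * r\<^sup>2" "k * D \<omega>"] by (simp add: U_def power_mult_distrib)
  let ?I = "\<lambda>\<omega>. indicat_real (space M - G) \<omega>"
  have I: "has_bochner_integral M ?I (prob (space M - G))"
    using G(1) by (simp add: has_bochner_integral_iff emeasure_eq_measure)
  let ?B = "\<lambda>\<omega>. b * (r * (U \<omega>)\<^sup>2 + ?V \<omega> / r + r ^ 3 + ?I \<omega>)"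
  have Bint: "has_bochner_integral M ?B (b * (r * (m\<^sup>2 * (r\<^sup>2)\<^sup>2 + k\<^sup>2 * r\<^sup>2) + 8 * (m ^ 4 * (r\<^sup>2) ^ 4 + k ^ 4 * (3 * (r\<^sup>2)\<^sup>2)) / r + r ^ 3 + prob (space M - G)))"
    by (intro has_bochner_integral_mult_right has_bochner_integral_add U2 hc I has_bochner_integral_divide_zero V)
  let ?Q = "\<lambda>\<omega>. j0 + j1 * U \<omega> + j2 / 2 * (U \<omega>)\<^sup>2 - r\<^sup>2 * i1"
  have Q: "has_bochner_integral M ?Q (j0 + j1 * (m * r\<^sup>2) + j2 / 2 * (m\<^sup>2 * (r\<^sup>2)\<^sup>2 + k\<^sup>2 * r\<^sup>2) - r\<^sup>2 * i1)"
    by (intro has_bochner_integral_diff has_bochner_integral_add has_bochner_integral_mult_right hc U1 U2)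
  have pt: "AE \<omega> in M. \<bar>\<Psi> \<omega> - ?Q \<omega>\<bar> \<le> ?B \<omega>"
    using good AE_space
  proof eventually_elim
    case (elim \<omega>)
    have "\<bar>\<Psi> \<omega> - ?Q \<omega>\<bar> \<le> b * (r * (U \<omega>)\<^sup>2 + U \<omega> ^ 4 / r + r ^ 3 + (if \<omega> \<in> G then 0 else 1))"
      unfolding b_def
      by (rule second_order_pointwise[OF r K]) (use elim bad in \<open>auto simp: Let_def U_def D_def\<close>)
    also have "\<dots> \<le> ?B \<omega>"
      using UV[of \<omega>] r elim(2) by (intro mult_left_mono[OF _ b0] add_mono divide_right_mono) (auto simp: indicator_def)
    finally show ?case .
  qed
  have "\<bar>expectation \<Psi> - expectation ?Q\<bar> = \<bar>expectation (\<lambda>\<omega>. \<Psi> \<omega> - ?Q \<omega>)\<bar>"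
    by (subst Bochner_Integration.integral_diff[OF int\<Psi> integrable.intros[OF Q]]) simp
  also have "\<dots> \<le> expectation (\<lambda>\<omega>. \<bar>\<Psi> \<omega> - ?Q \<omega>\<bar>)" by (rule integral_abs_bound)
  also have "\<dots> \<le> expectation ?B"
    by (rule integral_mono_AE[OF integrable_abs[OF Bochner_Integration.integrable_diff[OF int\<Psi> integrable.intros[OF Q]]] integrable.intros[OF Bint] pt])
  also have "\<dots> \<le> b * ((m\<^sup>2 + k\<^sup>2 + 8 * (m ^ 4 + 3 * k ^ 4) + 1 + c) * r ^ 3)"
  proof -
    have le1: "r ^ (3 + n) \<le> r ^ 3" for n using r by (intro power_decreasing) auto
    have "expectation ?B = b * (r * (m\<^sup>2 * (r\<^sup>2)\<^sup>2 + k\<^sup>2 * r\<^sup>2) + 8 * (m ^ 4 * (r\<^sup>2) ^ 4 + k ^ 4 * (3 * (r\<^sup>2)\<^sup>2)) / r + r ^ 3 + prob (space M - G))"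
      using Bint by (rule has_bochner_integral_integral_eq)
    also have "\<dots> \<le> b * ((m\<^sup>2 + k\<^sup>2 + 8 * (m ^ 4 + 3 * k ^ 4) + 1 + c) * r ^ 3)"
    proof (rule mult_left_mono[OF _ b0])
      have e1: "r * (m\<^sup>2 * (r\<^sup>2)\<^sup>2 + k\<^sup>2 * r\<^sup>2) = m\<^sup>2 * r ^ (3 + 2) + k\<^sup>2 * r ^ 3"
        unfolding distrib_left power_add power2_eq_square power3_eq_cube by (simp only: mult_ac)
      have e2: "8 * (m ^ 4 * (r\<^sup>2) ^ 4 + k ^ 4 * (3 * (r\<^sup>2)\<^sup>2)) / r = 8 * (m ^ 4 * r ^ (3 + 4) + 3 * k ^ 4 * r ^ 3)"
      proof -
        have "(r\<^sup>2) ^ 4 = r ^ (3 + 4) * r" "(r\<^sup>2)\<^sup>2 = r ^ 3 * r" by (simp_all add: power_mult[symmetric] power_add[symmetric] flip: power_Suc2)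
        then show ?thesis using r by (simp add: field_simps)
      qed
      have "prob (space M - G) \<le> c * r ^ (3 + 1)" using G(2) by (simp add: power_mult[symmetric])
      also have "\<dots> \<le> c * r ^ 3" by (intro mult_left_mono le1 c)
      finally have e3: "prob (space M - G) \<le> c * r ^ 3" .
      have e4: "m\<^sup>2 * r ^ (3 + 2) \<le> m\<^sup>2 * r ^ 3" "m ^ 4 * r ^ (3 + 4) \<le> m ^ 4 * r ^ 3"
        by (intro mult_left_mono le1; simp)+
      show "r * (m\<^sup>2 * (r\<^sup>2)\<^sup>2 + k\<^sup>2 * r\<^sup>2) + 8 * (m ^ 4 * (r\<^sup>2) ^ 4 + k ^ 4 * (3 * (r\<^sup>2)\<^sup>2)) / r + r ^ 3 + prob (space M - G)
        \<le> (m\<^sup>2 + k\<^sup>2 + 8 * (m ^ 4 + 3 * k ^ 4) + 1 + c) * r ^ 3"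
        unfolding e1 e2 using e3 e4 by (simp add: algebra_simps)
    qed
    finally show ?thesis .
  qed
  finally have 1: "\<bar>expectation \<Psi> - expectation ?Q\<bar> \<le> b * ((m\<^sup>2 + k\<^sup>2 + 8 * (m ^ 4 + 3 * k ^ 4) + 1 + c) * r ^ 3)" .
  have "expectation ?Q = j0 + j1 * (m * r\<^sup>2) + j2 / 2 * (m\<^sup>2 * (r\<^sup>2)\<^sup>2 + k\<^sup>2 * r\<^sup>2) - r\<^sup>2 * i1"
    using Q by (rule has_bochner_integral_integral_eq)
  then have 2: "expectation ?Q = j0 + r\<^sup>2 * (m * j1 + k\<^sup>2 / 2 * j2 - i1) + j2 / 2 * m\<^sup>2 * (r\<^sup>2)\<^sup>2"
    by (simp add: algebra_simps)
  have 3: "\<bar>j2 / 2 * m\<^sup>2 * (r\<^sup>2)\<^sup>2\<bar> \<le> \<bar>j2\<bar> * m\<^sup>2 * r ^ 3"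
  proof -
    have "(r\<^sup>2)\<^sup>2 = r ^ 3 * r" by (simp add: power2_eq_square power3_eq_cube)
    also have "\<dots> \<le> r ^ 3 * 1" using r by (intro mult_left_mono) auto
    finally have "\<bar>j2\<bar> / 2 * m\<^sup>2 * (r\<^sup>2)\<^sup>2 \<le> \<bar>j2\<bar> / 2 * m\<^sup>2 * r ^ 3" by (intro mult_left_mono) auto
    also have "\<dots> \<le> \<bar>j2\<bar> * m\<^sup>2 * r ^ 3" using r by (intro mult_right_mono) auto
    finally show ?thesis by (simp add: abs_mult)
  qed
  have tri: "\<bar>x - j0 - y\<bar> \<le> \<bar>x - z\<bar> + \<bar>w\<bar>" if "z = j0 + y + w" for x y z w :: real using that by linarith
  have "\<bar>expectation \<Psi> - j0 - r\<^sup>2 * (m * j1 + k\<^sup>2 / 2 * j2 - i1)\<bar> \<le> \<bar>expectation \<Psi> - expectation ?Q\<bar> + \<bar>j2 / 2 * m\<^sup>2 * (r\<^sup>2)\<^sup>2\<bar>"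
    by (rule tri[OF 2])
  also have "\<dots> \<le> b * ((m\<^sup>2 + k\<^sup>2 + 8 * (m ^ 4 + 3 * k ^ 4) + 1 + c) * r ^ 3) + \<bar>j2\<bar> * m\<^sup>2 * r ^ 3"
    by (rule add_mono[OF 1 3])
  finally show ?thesis by (simp add: b_def algebra_simps)
qed

text \<open>A linear combination of \<open>exit_exponential\<close> for the two roots: at the exit
  \<open>ln X\<close> is \<open>ln l\<close> or \<open>ln h\<close>, where \<open>v\<close> takes
  the same value. The positive root needs the path bounded above by \<open>h\<close>, the negative
  one needs it bounded below by \<open>l\<close>; for \<open>l = 0\<close> the latter fails and the
  coefficient is 0.\<close>

lemma exit_value_representation:
  fixes c1 c2 :: "real \<Rightarrow> real" and m k :: real
  assumes lb: "log_brownian X s \<infinity> m k" and s: "0 \<le> s" and k: "k \<noteq> 0" and C: "open C"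
    and lh: "0 \<le> l" "l < h" "{l<..<h} \<subseteq> C" "l \<notin> C" "h \<notin> C"
    and A: "A \<in> sets (F s)" "\<And>\<omega>. \<omega> \<in> A \<Longrightarrow> X s \<omega> \<in> {l<..<h}" and \<beta>: "0 < \<beta>"
  defines "v \<equiv> exp_pair c1 c2 m (k\<^sup>2 / 2) 0"
  assumes vh: "v \<beta> (ln h) = ln h" and vl: "0 < l \<Longrightarrow> v \<beta> (ln l) = ln l" and c2: "l = 0 \<Longrightarrow> c2 \<beta> = 0"
  shows "has_bochner_integral M (\<lambda>\<omega>. indicator A \<omega> * (if exit_time X C s \<omega> < \<infinity>
      then exp (- \<beta> * (real_of_ereal (exit_time X C s \<omega>) - s)) * ln (X (real_of_ereal (exit_time X C s \<omega>)) \<omega>) else 0))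
    (expectation (\<lambda>\<omega>. indicator A \<omega> * v \<beta> (ln (X s \<omega>))))"
proof -
  note X = log_brownianD[OF lb]
  let ?D = "k\<^sup>2 / 2"
  let ?p = "root_pos m ?D \<beta>" and ?q = "root_neg m ?D \<beta>"
  have D: "0 < ?D" using k by simp
  note roots = root_props[OF D \<beta>, of m]
  have AM: "\<omega> \<in> space M" if "\<omega> \<in> A" for \<omega> using sets.sets_into_space[OF A(1)] that by (auto simp: space_F)
  have in_lh: "X r \<omega> \<in> {l..h}" if "\<omega> \<in> A" "s \<le> r" "ereal r \<le> exit_time X C s \<omega>" for \<omega> r
  proof (rule path_in_component(1)[where X=X and \<omega>=\<omega> and C=C and s=s, OF X(2)[OF AM[OF that(1)]] lh(2,4,5) A(2)[OF that(1)] _ that(2)])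
    fix q assume q: "s \<le> q" "q < r"
    show "X q \<omega> \<in> C"
    proof (rule ccontr)
      assume "X q \<omega> \<notin> C"
      then have "exit_time X C s \<omega> \<le> ereal q" using q unfolding exit_time_def by (intro Inf_lower) auto
      then show False using that(3) q by (meson ereal_less_eq(3) not_le order_trans)
    qed
  qed
  have pos: "0 < X r \<omega>" if "\<omega> \<in> A" "s \<le> r" for \<omega> r using X(3)[OF AM[OF that(1)] that(2)] .
  \<comment> \<open>The path is in \<open>{l..h}\<close> but outside \<open>C\<close> at the exit.
    If \<open>l = 0\<close>, positivity of \<open>X\<close> leaves only \<open>h\<close>.\<close>
  have ends: "X T \<omega> = h \<or> (0 < l \<and> X T \<omega> = l)" if "\<omega> \<in> A" "exit_time X C s \<omega> = ereal T" for \<omega> T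
  proof -
    have "s \<le> T" using exit_time_ge[of s X C \<omega>] that(2) by simp
    moreover have "X T \<omega> \<notin> C"
      by (rule exit_time_cases[where X=X and \<omega>=\<omega>, OF X(2)[OF AM[OF that(1)]] C]) (use that(2) in auto)
    ultimately have "X T \<omega> \<in> {l..h}" "X T \<omega> \<notin> {l<..<h}" using in_lh[OF that(1), of T] that(2) lh(3) by auto
    then show ?thesis using pos[OF that(1) \<open>s \<le> T\<close>] lh(2) by force
  qed
  let ?f = "\<lambda>a \<omega>. indicat_real A \<omega> * (if exit_time X C s \<omega> < \<infinity>
      then exp (- \<beta> * (real_of_ereal (exit_time X C s \<omega>) - s) + a * ln (X (real_of_ereal (exit_time X C s \<omega>)) \<omega>)) else 0)"
  let ?g = "\<lambda>a \<omega>. indicat_real A \<omega> * exp (a * ln (X s \<omega>))"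
  have Xs: "X s \<in> borel_measurable M" using measurable_F_M[OF s X(1)] by simp
  have AE_: "A \<in> events" using A(1) subalgebra_F[OF s] by (auto simp: subalgebra_def)
  have gi: "integrable M (?g a)" if "\<And>\<omega>. \<omega> \<in> A \<Longrightarrow> a * ln (X s \<omega>) \<le> b" for a b
  proof (rule integrable_const_bound[of _ "exp b"])
    show "AE \<omega> in M. norm (?g a \<omega>) \<le> exp b" using that by (intro AE_I2) (auto simp: indicator_def)
    show "?g a \<in> borel_measurable M"
      by (intro borel_measurable_times borel_measurable_indicator AE_ measurable_compose[OF _ borel_measurable_exp] borel_measurable_const borel_measurable_ln Xs)
  qed
  have p_bd: "?p * ln (X r \<omega>) \<le> ?p * ln h" if "\<omega> \<in> A" "s \<le> r" "ereal r \<le> exit_time X C s \<omega>" for \<omega> r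
    using in_lh[OF that] pos[OF that(1,2)] roots(3) by (intro mult_left_mono) auto
  have p: "has_bochner_integral M (?f ?p) (expectation (?g ?p))" "integrable M (?g ?p)"
  proof -
    show "has_bochner_integral M (?f ?p) (expectation (?g ?p))"
      by (rule exit_exponential[OF lb s C A(1) _ \<beta> p_bd]) (use roots(1) in auto)
    show "integrable M (?g ?p)" by (rule gi[of ?p "?p * ln h", OF p_bd[OF _ order_refl exit_time_ge]])
  qed
  have q: "has_bochner_integral M (\<lambda>\<omega>. c2 \<beta> * ?f ?q \<omega>) (c2 \<beta> * expectation (?g ?q)) \<and> integrable M (\<lambda>\<omega>. c2 \<beta> * ?g ?q \<omega>)"
  proof (cases "l = 0")
    case True
    then show ?thesis using c2 by (simp add: has_bochner_integral_zero)
  next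
    case False
    then have l0: "0 < l" using lh by simp
    have q_bd: "?q * ln (X r \<omega>) \<le> ?q * ln l" if "\<omega> \<in> A" "s \<le> r" "ereal r \<le> exit_time X C s \<omega>" for \<omega> r
      using in_lh[OF that] pos[OF that(1,2)] roots(4) l0 by (intro mult_left_mono_neg) auto
    have "has_bochner_integral M (?f ?q) (expectation (?g ?q))"
      by (rule exit_exponential[OF lb s C A(1) _ \<beta> q_bd]) (use roots(2) in auto)
    moreover have "integrable M (?g ?q)" by (rule gi[of ?q "?q * ln l", OF q_bd[OF _ order_refl exit_time_ge]])
    ultimately show ?thesis by (auto intro: has_bochner_integral_mult_right)
  qed
  have sum: "has_bochner_integral M (\<lambda>\<omega>. c1 \<beta> * ?f ?p \<omega> + c2 \<beta> * ?f ?q \<omega>) (c1 \<beta> * expectation (?g ?p) + c2 \<beta> * expectation (?g ?q))"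
    using has_bochner_integral_add[OF has_bochner_integral_mult_right[OF p(1), of "c1 \<beta>"] conjunct1[OF q]] by simp
  have "expectation (\<lambda>\<omega>. indicator A \<omega> * v \<beta> (ln (X s \<omega>))) = expectation (\<lambda>\<omega>. c1 \<beta> * ?g ?p \<omega> + c2 \<beta> * ?g ?q \<omega>)"
    by (intro Bochner_Integration.integral_cong refl) (simp add: v_def exp_pair_def algebra_simps)
  also have "\<dots> = c1 \<beta> * expectation (?g ?p) + c2 \<beta> * expectation (?g ?q)"
    using p(2) conjunct2[OF q] by (subst Bochner_Integration.integral_add) auto
  finally have rhs: "expectation (\<lambda>\<omega>. indicator A \<omega> * v \<beta> (ln (X s \<omega>))) = c1 \<beta> * expectation (?g ?p) + c2 \<beta> * expectation (?g ?q)" .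
  have "c1 \<beta> * ?f ?p \<omega> + c2 \<beta> * ?f ?q \<omega> = indicator A \<omega> * (if exit_time X C s \<omega> < \<infinity>
      then exp (- \<beta> * (real_of_ereal (exit_time X C s \<omega>) - s)) * ln (X (real_of_ereal (exit_time X C s \<omega>)) \<omega>) else 0)" for \<omega>
  proof (cases "\<omega> \<in> A \<and> exit_time X C s \<omega> < \<infinity>")
    case True
    then obtain T where T: "exit_time X C s \<omega> = ereal T" using exit_time_ge[of s X C \<omega>] by (cases "exit_time X C s \<omega>") auto
    have "v \<beta> (ln (X T \<omega>)) = ln (X T \<omega>)" using ends[of \<omega> T] True T vh vl by auto
    then have eq: "c1 \<beta> * exp (?p * ln (X T \<omega>)) + c2 \<beta> * exp (?q * ln (X T \<omega>)) = ln (X T \<omega>)" by (simp add: v_def exp_pair_def)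
    have "c1 \<beta> * exp (- \<beta> * (T - s) + ?p * ln (X T \<omega>)) + c2 \<beta> * exp (- \<beta> * (T - s) + ?q * ln (X T \<omega>))
      = exp (- \<beta> * (T - s)) * (c1 \<beta> * exp (?p * ln (X T \<omega>)) + c2 \<beta> * exp (?q * ln (X T \<omega>)))"
      unfolding exp_add by (simp add: algebra_simps)
    then show ?thesis using True T by (simp add: eq)
  qed auto
  then show ?thesis using sum unfolding rhs by simp
qed

end

section \<open>Components, supports, discounting and stopped rewards\<close>

lemma component_lower:
  fixes C :: "real set"
  assumes "open C" "x \<in> C" "y \<notin> C" "y < x"
  shows "\<exists>l. y \<le> l \<and> l < x \<and> l \<notin> C \<and> {l<..x} \<subseteq> C"
proof -
  have "closed (- C)" using assms(1) by (simp add: closed_Compl)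
  then have "compact ({y..x} \<inter> - C)" by (intro compact_Int_closed) auto
  moreover have "y \<in> {y..x} \<inter> - C" using assms by auto
  ultimately obtain l where l: "l \<in> {y..x} \<inter> - C" "\<And>t. t \<in> {y..x} \<inter> - C \<Longrightarrow> t \<le> l"
    using compact_attains_sup[of "{y..x} \<inter> - C"] by blast
  have "l \<noteq> x" using l(1) assms(2) by auto
  moreover have "t \<in> C" if "l < t" "t \<le> x" for t using l(2)[of t] l(1) that by force
  ultimately show ?thesis using l(1) by (intro exI[of _ l]) auto
qed

lemma component_upper:
  fixes C :: "real set"
  assumes "open C" "x \<in> C" "y \<notin> C" "x < y"
  shows "\<exists>h. x < h \<and> h \<le> y \<and> h \<notin> C \<and> {x..<h} \<subseteq> C"
proof -
  have "closed (- C)" using assms(1) by (simp add: closed_Compl)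
  then have "compact ({x..y} \<inter> - C)" by (intro compact_Int_closed) auto
  moreover have "y \<in> {x..y} \<inter> - C" using assms by auto
  ultimately obtain h where h: "h \<in> {x..y} \<inter> - C" "\<And>t. t \<in> {x..y} \<inter> - C \<Longrightarrow> h \<le> t"
    using compact_attains_inf[of "{x..y} \<inter> - C"] by blast
  have "h \<noteq> x" using h(1) assms(2) by auto
  moreover have "t \<in> C" if "x \<le> t" "t < h" for t using h(2)[of t] h(1) that by force
  ultimately show ?thesis using h(1) by (intro exI[of _ h]) auto
qed

lemma singleton_measure_support:
  assumes P: "weighting_distribution P" and \<kappa>: "AE \<beta> in P. \<beta> = \<kappa>"
  shows "is_singleton (measure_support P)"
proof -
  interpret prob_space P using P by (simp add: weighting_distribution_def)
  have sets: "sets P = sets borel" using P by (simp add: weighting_distribution_def)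
  have "measure_support P = {\<kappa>}"
  proof (intro equalityI subsetI)
    fix \<beta> assume \<beta>: "\<beta> \<in> measure_support P"
    show "\<beta> \<in> {\<kappa>}"
    proof (rule ccontr)
      assume "\<beta> \<notin> {\<kappa>}"
      then have "0 < emeasure P (- {\<kappa>})" using \<beta> by (auto simp: measure_support_def open_Compl)
      moreover have "emeasure P (- {\<kappa>}) = emeasure P {}"
        by (rule emeasure_eq_AE) (use \<kappa> sets in auto)
      ultimately show False by simp
    qed
  next
    fix \<beta> assume \<beta>: "\<beta> \<in> {\<kappa>}"
    have "emeasure P U = 1" if "open U" "\<kappa> \<in> U" for U
    proof -
      have "emeasure P U = emeasure P (space P)"
        by (rule emeasure_eq_AE) (use \<kappa> sets that in \<open>auto elim: eventually_mono\<close>)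
      then show ?thesis by (simp add: emeasure_space_1)
    qed
    then show "\<beta> \<in> measure_support P" using \<beta> by (auto simp: measure_support_def)
  qed
  then show ?thesis by (simp add: is_singleton_def)
qed

text \<open>No measurability is assumed: the Bochner integral of a non-integrable function is 0 and
  obeys the bound as well.\<close>

lemma (in prob_space) abs_expectation_le:
  fixes f :: "'a \<Rightarrow> real"
  assumes "\<And>\<omega>. \<omega> \<in> space M \<Longrightarrow> \<bar>f \<omega>\<bar> \<le> L" "0 \<le> L"
  shows "\<bar>expectation f\<bar> \<le> L"
proof (cases "integrable M f")
  case True
  have "\<bar>expectation f\<bar> \<le> expectation (\<lambda>\<omega>. \<bar>f \<omega>\<bar>)" by (rule integral_abs_bound)
  also have "\<dots> \<le> L" using True assms by (intro integral_le_const) auto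
  finally show ?thesis .
qed (simp add: not_integrable_integral_eq assms)

lemma weighting_exp_integrable:
  assumes "weighting_distribution P" "0 \<le> s"
  shows "integrable P (\<lambda>\<beta>. exp (- \<beta> * s))"
proof -
  interpret prob_space P using assms by (simp add: weighting_distribution_def)
  have sets: "sets P = sets borel" and pos: "AE \<beta> in P. 0 < \<beta>" using assms by (simp_all add: weighting_distribution_def)
  show ?thesis
  proof (rule integrable_const_bound[where B=1])
    show "AE \<beta> in P. norm (exp (- \<beta> * s)) \<le> 1"
      using pos assms(2) by (auto elim!: eventually_mono)
    show "(\<lambda>\<beta>. exp (- \<beta> * s)) \<in> borel_measurable P" unfolding measurable_cong_sets[OF sets refl] by measurable
  qed
qed

lemma discount_props:
  assumes P: "weighting_distribution P"
  shows "0 \<le> s \<Longrightarrow> \<bar>discount P s\<bar> \<le> 1" and "0 \<le> s \<Longrightarrow> s \<le> s' \<Longrightarrow> discount P s' \<le> discount P s" and "0 \<le> s \<Longrightarrow> 0 < discount P s"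
proof -
  interpret prob_space P using P by (simp add: weighting_distribution_def)
  have pos: "AE \<beta> in P. 0 < \<beta>" using P by (simp_all add: weighting_distribution_def)
  note int = weighting_exp_integrable[OF P]
  show mono: "discount P s' \<le> discount P s" if s: "0 \<le> s" "s \<le> s'" for s s'
    unfolding discount_def
  proof (rule integral_mono_AE[OF int int])
    show "AE \<beta> in P. exp (- \<beta> * s') \<le> exp (- \<beta> * s)" using pos
      by eventually_elim (use s in \<open>auto intro: mult_left_mono\<close>)
  qed (use s in auto)
  have nn: "0 \<le> discount P s" for s unfolding discount_def by (rule Bochner_Integration.integral_nonneg) auto
  show "\<bar>discount P s\<bar> \<le> 1" if "0 \<le> s" using mono[OF order_refl that] nn[of s] by (simp add: discount_def prob_space)
  show "0 < discount P s" if s: "0 \<le> s"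
  proof (rule ccontr)
    assume "\<not> 0 < discount P s"
    then have "(\<integral>\<beta>. exp (- \<beta> * s) \<partial>P) = 0" using nn[of s] unfolding discount_def by linarith
    then have "AE \<beta> in P. exp (- \<beta> * s) = 0"
      by (subst (asm) integral_nonneg_eq_0_iff_AE[OF int[OF s]]) auto
    then show False by simp
  qed
qed

text \<open>Discounting starts at \<open>t\<close>, watching for the exit at \<open>s\<close>. They
  differ in condition (ii) and after a restart at the end of the perturbation window.\<close>

definition stopped_reward :: "real measure \<Rightarrow> (real \<Rightarrow> 'a \<Rightarrow> real) \<Rightarrow> real set \<Rightarrow> real \<Rightarrow> real \<Rightarrow> 'a \<Rightarrow> real" where
  "stopped_reward P X C t s \<omega> = (if exit_time X C s \<omega> < \<infinity>
    then reward P t (real_of_ereal (exit_time X C s \<omega>)) (X (real_of_ereal (exit_time X C s \<omega>)) \<omega>) else 0)"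

lemma payoff_eq: "payoff M P X t (exit_time X C s) = (\<integral>\<omega>. stopped_reward P X C t s \<omega> \<partial>M)"
  by (simp add: payoff_def stopped_reward_def)

lemma stopped_reward_shift:
  assumes "s \<le> s'" "\<And>r. s \<le> r \<Longrightarrow> r < s' \<Longrightarrow> X r \<omega> \<in> C"
  shows "stopped_reward P X C t s \<omega> = stopped_reward P X C t s' \<omega>"
proof -
  have "exit_time X C s \<omega> = exit_time X C s' \<omega>" by (rule exit_time_shift) (use assms in auto)
  then show ?thesis by (simp only: stopped_reward_def)
qed

lemma stopped_reward_eq:
  assumes "exit_time X C s \<omega> = ereal T"
  shows "stopped_reward P X C t s \<omega> = discount P (T - t) * ln (X T \<omega>)"
  using assms by (simp add: stopped_reward_def reward_def)

lemma exit_position: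
  fixes X :: "real \<Rightarrow> 'a \<Rightarrow> real"
  assumes c: "continuous_on {s..} (\<lambda>r. X r \<omega>)" and C: "open C" and lh: "l < h" "{l<..<h} \<subseteq> C" "l \<notin> C" "h \<notin> C"
    and X0: "X s \<omega> \<in> {l<..<h}" and T: "exit_time X C s \<omega> = ereal T"
  shows "s \<le> T" "X T \<omega> = l \<or> X T \<omega> = h"
proof -
  obtain "s \<le> T" and out: "X T \<omega> \<notin> C" and stay: "\<And>r. s \<le> r \<Longrightarrow> r < T \<Longrightarrow> X r \<omega> \<in> C"
    by (rule exit_time_cases[where X=X and \<omega>=\<omega>, OF c C]) (use T in auto)
  then show "s \<le> T" by simp
  have "X T \<omega> \<in> {l..h}"
    by (rule path_in_component(1)[where X=X and \<omega>=\<omega> and C=C, OF c lh(1,3,4) X0 stay \<open>s \<le> T\<close>])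
  then show "X T \<omega> = l \<or> X T \<omega> = h" using out lh(2) by force
qed

section \<open>The pay-off as a mixture of values for fixed rates\<close>

context brownian_motion begin

text \<open>The discounted reward before integration over \<open>\<beta>\<close>, prepared for
  Fubini. \<open>P\<close> charges only positive rates but lives on all reals;
  \<open>max \<beta> 0\<close> agrees with \<open>\<beta>\<close> almost everywhere and keeps the
  kernel bounded everywhere.\<close>

lemma stopped_reward_kernel:
  fixes X :: "real \<Rightarrow> 'a \<Rightarrow> real"
  assumes P: "weighting_distribution P" and s: "0 \<le> s" "t \<le> s" and X: "\<And>r. s \<le> r \<Longrightarrow> X r \<in> borel_measurable (F r)"
    "\<And>\<omega>. \<omega> \<in> space M \<Longrightarrow> continuous_on {s..} (\<lambda>r. X r \<omega>)" "\<And>\<omega> r. \<omega> \<in> space M \<Longrightarrow> s \<le> r \<Longrightarrow> 0 < X r \<omega>"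
    and C: "open C" and lh: "0 \<le> l" "l < h" "{l<..<h} \<subseteq> C" "l \<notin> C" "h \<notin> C"
    and A: "A \<in> events" "\<And>\<omega>. \<omega> \<in> A \<Longrightarrow> X s \<omega> \<in> {l<..<h}"
  defines "f \<equiv> \<lambda>\<omega> \<beta>. indicator A \<omega> * (if exit_time X C s \<omega> < \<infinity>
    then exp (- max \<beta> 0 * (real_of_ereal (exit_time X C s \<omega>) - t)) * ln (X (real_of_ereal (exit_time X C s \<omega>)) \<omega>) else 0)"
  shows "integrable (M \<Otimes>\<^sub>M P) (case_prod f)"
    and "\<And>\<omega>. \<omega> \<in> space M \<Longrightarrow> (\<integral>\<beta>. f \<omega> \<beta> \<partial>P) = indicator A \<omega> * stopped_reward P X C t s \<omega>"
    and "\<And>\<omega>. \<omega> \<in> A \<Longrightarrow> \<bar>stopped_reward P X C t s \<omega>\<bar> \<le> \<bar>ln l\<bar> + \<bar>ln h\<bar>"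
    and "(\<lambda>\<omega>. indicator A \<omega> * stopped_reward P X C t s \<omega>) \<in> borel_measurable M"
proof -
  interpret Q: prob_space P using P by (simp add: weighting_distribution_def)
  interpret pair: pair_prob_space M P ..
  have sets [measurable_cong]: "sets P = sets borel" and pos: "AE \<beta> in P. 0 < \<beta>" using P by (simp_all add: weighting_distribution_def)
  let ?\<tau> = "exit_time X C s"
  \<comment> \<open>Evaluated at \<open>s\<close> on paths without exit, so that it is measurable
    everywhere; the kernel is 0 on those paths.\<close>
  let ?Y = "\<lambda>\<omega>. X (real_of_ereal (if ?\<tau> \<omega> < \<infinity> then ?\<tau> \<omega> else ereal s)) \<omega>"
  let ?L = "\<bar>ln l\<bar> + \<bar>ln h\<bar>"
  have AM: "A \<subseteq> space M" using A(1) by (rule sets.sets_into_space)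
  have [measurable]: "?\<tau> \<in> borel_measurable M" "?Y \<in> borel_measurable M"
    using exit_time_measurable[OF s(1) X(1,2) C] by auto
  note [measurable] = A(1)
  have f_eq: "f \<omega> \<beta> = indicator A \<omega> * (if ?\<tau> \<omega> < \<infinity> then exp (- max \<beta> 0 * (real_of_ereal (?\<tau> \<omega>) - t)) * ln (?Y \<omega>) else 0)" for \<omega> \<beta>
    by (simp add: f_def)
  have "(\<lambda>z. f (fst z) (snd z)) \<in> borel_measurable (M \<Otimes>\<^sub>M P)" unfolding f_eq by measurable
  then have fm: "case_prod f \<in> borel_measurable (M \<Otimes>\<^sub>M P)" by (simp add: case_prod_beta')
  have exits: "t \<le> T \<and> \<bar>ln (X T \<omega>)\<bar> \<le> ?L" if "\<omega> \<in> A" "?\<tau> \<omega> = ereal T" for \<omega> T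
  proof -
    have "\<omega> \<in> space M" using that AM by auto
    from exit_position[where X=X and \<omega>=\<omega>, OF X(2)[OF this] C lh(2,3,4,5) A(2)[OF that(1)] that(2)] s(2)
    show ?thesis by auto
  qed
  have fin: "\<exists>T. ?\<tau> \<omega> = ereal T" if "?\<tau> \<omega> < \<infinity>" for \<omega>
    using that exit_time_ge[of s X C \<omega>] by (cases "?\<tau> \<omega>") auto
  have f_bd: "\<bar>f \<omega> \<beta>\<bar> \<le> ?L" for \<omega> \<beta>
  proof (cases "\<omega> \<in> A \<and> ?\<tau> \<omega> < \<infinity>")
    case True
    then obtain T where T: "?\<tau> \<omega> = ereal T" using fin by blast
    have "\<bar>f \<omega> \<beta>\<bar> = exp (- max \<beta> 0 * (T - t)) * \<bar>ln (X T \<omega>)\<bar>" using True T by (simp add: f_def abs_mult)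
    also have "\<dots> \<le> 1 * ?L" using exits[of \<omega> T] True T by (intro mult_mono) auto
    finally show ?thesis by simp
  qed (auto simp: f_def)
  show "integrable (M \<Otimes>\<^sub>M P) (case_prod f)"
    by (rule pair.P.integrable_const_bound[where B="?L"]) (use f_bd fm in auto)
  have f_int: "(\<integral>\<beta>. f \<omega> \<beta> \<partial>P) = indicator A \<omega> * stopped_reward P X C t s \<omega>" for \<omega>
  proof (cases "?\<tau> \<omega> < \<infinity>")
    case True
    then obtain T where T: "?\<tau> \<omega> = ereal T" using fin by blast
    have "(\<integral>\<beta>. f \<omega> \<beta> \<partial>P) = (\<integral>\<beta>. exp (- \<beta> * (T - t)) * (indicator A \<omega> * ln (X T \<omega>)) \<partial>P)"
    proof (rule integral_cong_AE)
      show "f \<omega> \<in> borel_measurable P" unfolding f_def by measurable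
      show "AE \<beta> in P. f \<omega> \<beta> = exp (- \<beta> * (T - t)) * (indicator A \<omega> * ln (X T \<omega>))"
        using pos by eventually_elim (simp add: f_def T max_def)
    qed measurable
    also have "\<dots> = discount P (T - t) * (indicator A \<omega> * ln (X T \<omega>))" by (simp add: discount_def)
    finally show ?thesis using stopped_reward_eq[where X=X and \<omega>=\<omega>, OF T, of P t] by simp
  qed (simp add: f_def stopped_reward_def)
  then show "\<And>\<omega>. \<omega> \<in> space M \<Longrightarrow> (\<integral>\<beta>. f \<omega> \<beta> \<partial>P) = indicator A \<omega> * stopped_reward P X C t s \<omega>" .
  show "\<bar>stopped_reward P X C t s \<omega>\<bar> \<le> ?L" if "\<omega> \<in> A" for \<omega>
  proof -
    have "\<bar>\<integral>\<beta>. f \<omega> \<beta> \<partial>P\<bar> \<le> ?L" by (rule Q.abs_expectation_le) (use f_bd in auto)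
    then show ?thesis unfolding f_int using that by simp
  qed
  show "(\<lambda>\<omega>. indicator A \<omega> * stopped_reward P X C t s \<omega>) \<in> borel_measurable M"
    unfolding f_int[symmetric] using Q.borel_measurable_lebesgue_integral[OF fm] .
qed

text \<open>Does the work of the Markov property at time \<open>s\<close>: for each rate the
  identity comes from stopping on the event \<open>A\<close>, and Fubini, applied on both sides,
  mixes the rates.\<close>

lemma stopped_reward_representation:
  fixes c1 c2 :: "real \<Rightarrow> real" and m k :: real and X :: "real \<Rightarrow> 'a \<Rightarrow> real"
  assumes P: "weighting_distribution P" and lb: "log_brownian X s \<infinity> m k" and s: "0 \<le> s" "t \<le> s" and k: "k \<noteq> 0" and C: "open C"
    and lh: "0 \<le> l" "l < h" "{l<..<h} \<subseteq> C" "l \<notin> C" "h \<notin> C"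
    and A: "A \<in> sets (F s)" "\<And>\<omega>. \<omega> \<in> A \<Longrightarrow> X s \<omega> \<in> {l<..<h}"
    and c: "c1 \<in> borel_measurable borel" "c2 \<in> borel_measurable borel"
  defines "v \<equiv> exp_pair c1 c2 m (k\<^sup>2 / 2) 0"
  assumes vh: "\<And>\<beta>. 0 < \<beta> \<Longrightarrow> v \<beta> (ln h) = ln h" and vl: "\<And>\<beta>. 0 < \<beta> \<Longrightarrow> 0 < l \<Longrightarrow> v \<beta> (ln l) = ln l"
    and c2: "\<And>\<beta>. l = 0 \<Longrightarrow> c2 \<beta> = 0"
    and bd: "\<And>\<omega> \<beta>. \<omega> \<in> A \<Longrightarrow> 0 < \<beta> \<Longrightarrow> \<bar>v \<beta> (ln (X s \<omega>))\<bar> \<le> K" and K: "0 \<le> K"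
  shows "integrable M (\<lambda>\<omega>. indicator A \<omega> * stopped_reward P X C t s \<omega>)"
    and "integrable M (\<lambda>\<omega>. indicator A \<omega> * (\<integral>\<beta>. exp (- \<beta> * (s - t)) * v \<beta> (ln (X s \<omega>)) \<partial>P))"
    and "expectation (\<lambda>\<omega>. indicator A \<omega> * stopped_reward P X C t s \<omega>) =
      expectation (\<lambda>\<omega>. indicator A \<omega> * (\<integral>\<beta>. exp (- \<beta> * (s - t)) * v \<beta> (ln (X s \<omega>)) \<partial>P))"
proof -
  note X = log_brownianD[OF lb]
  interpret Q: prob_space P using P by (simp add: weighting_distribution_def)
  interpret pair: pair_prob_space M P ..
  have sets [measurable_cong]: "sets P = sets borel" and pos: "AE \<beta> in P. 0 < \<beta>" using P by (simp_all add: weighting_distribution_def)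
  have AE_ [measurable]: "A \<in> events" using A(1) subalgebra_F[OF s(1)] by (auto simp: subalgebra_def)
  note [measurable] = c
  have [measurable]: "X s \<in> borel_measurable M" using measurable_F_M[OF s(1) X(1)] by simp
  define f where "f = (\<lambda>\<omega> \<beta>. indicator A \<omega> * (if exit_time X C s \<omega> < \<infinity>
    then exp (- max \<beta> 0 * (real_of_ereal (exit_time X C s \<omega>) - t)) * ln (X (real_of_ereal (exit_time X C s \<omega>)) \<omega>) else 0))"
  have kern1: "integrable (M \<Otimes>\<^sub>M P) (case_prod f)"
    unfolding f_def by (rule stopped_reward_kernel(1)[OF P s X(1-3) C lh AE_ A(2)])
  have kern2: "(\<integral>\<beta>. f \<omega> \<beta> \<partial>P) = indicator A \<omega> * stopped_reward P X C t s \<omega>" if "\<omega> \<in> space M" for \<omega>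
    unfolding f_def by (rule stopped_reward_kernel(2)[OF P s X(1-3) C lh AE_ A(2) that])
  \<comment> \<open>The indicator removes nonpositive rates, for which \<open>v\<close> need not
    obey the bound; they form a null set of \<open>P\<close>.\<close>
  define g where "g = (\<lambda>\<omega> \<beta>. indicator A \<omega> * (indicator {0<..} \<beta> * (exp (- \<beta> * (s - t)) * v \<beta> (ln (X s \<omega>)))))"
  have "(\<lambda>z. g (fst z) (snd z)) \<in> borel_measurable (M \<Otimes>\<^sub>M P)"
    unfolding g_def v_def exp_pair_def root_pos_def root_neg_def by measurable
  then have gm: "case_prod g \<in> borel_measurable (M \<Otimes>\<^sub>M P)" by (simp add: case_prod_beta')
  have g_bd: "\<bar>g \<omega> \<beta>\<bar> \<le> K" for \<omega> \<beta>
  proof (cases "\<omega> \<in> A \<and> 0 < \<beta>")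
    case True
    then have "\<bar>g \<omega> \<beta>\<bar> = exp (- \<beta> * (s - t)) * \<bar>v \<beta> (ln (X s \<omega>))\<bar>" by (simp add: g_def abs_mult)
    also have "\<dots> \<le> 1 * K" using bd[of \<omega> \<beta>] True s(2) by (intro mult_mono) auto
    finally show ?thesis by simp
  qed (auto simp: g_def K)
  have gi: "integrable (M \<Otimes>\<^sub>M P) (case_prod g)"
    by (rule pair.P.integrable_const_bound[where B=K]) (use g_bd gm in auto)
  have g_int: "(\<integral>\<beta>. g \<omega> \<beta> \<partial>P) = indicator A \<omega> * (\<integral>\<beta>. exp (- \<beta> * (s - t)) * v \<beta> (ln (X s \<omega>)) \<partial>P)" for \<omega>
  proof -
    have "(\<integral>\<beta>. indicator {0<..} \<beta> * (exp (- \<beta> * (s - t)) * v \<beta> (ln (X s \<omega>))) \<partial>P) = (\<integral>\<beta>. exp (- \<beta> * (s - t)) * v \<beta> (ln (X s \<omega>)) \<partial>P)"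
    proof (rule integral_cong_AE)
      show "AE \<beta> in P. indicator {0<..} \<beta> * (exp (- \<beta> * (s - t)) * v \<beta> (ln (X s \<omega>))) = exp (- \<beta> * (s - t)) * v \<beta> (ln (X s \<omega>))"
        using pos by eventually_elim simp
    qed (unfold v_def exp_pair_def root_pos_def root_neg_def, measurable)
    then show ?thesis by (simp add: g_def)
  qed
  have inner: "expectation (\<lambda>\<omega>. f \<omega> \<beta>) = expectation (\<lambda>\<omega>. g \<omega> \<beta>)" if \<beta>: "0 < \<beta>" for \<beta>
  proof -
    have "has_bochner_integral M (\<lambda>\<omega>. indicator A \<omega> * (if exit_time X C s \<omega> < \<infinity>
      then exp (- \<beta> * (real_of_ereal (exit_time X C s \<omega>) - s)) * ln (X (real_of_ereal (exit_time X C s \<omega>)) \<omega>) else 0))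
      (expectation (\<lambda>\<omega>. indicator A \<omega> * v \<beta> (ln (X s \<omega>))))" (is "has_bochner_integral M ?h _")
      unfolding v_def
      by (rule exit_value_representation[OF lb s(1) k C lh A \<beta>, where ?c1.0=c1 and ?c2.0=c2]) (use vh vl c2 \<beta> in \<open>auto simp: v_def\<close>)
    then have h: "expectation ?h = expectation (\<lambda>\<omega>. indicator A \<omega> * v \<beta> (ln (X s \<omega>)))" by (rule has_bochner_integral_integral_eq)
    have "f \<omega> \<beta> = exp (- \<beta> * (s - t)) * ?h \<omega>" for \<omega>
    proof -
      \<comment> \<open>For a single rate discounting is multiplicative in time. For the mixture it
        is not, hence the identity is proved before integrating over \<open>\<beta>\<close>.\<close>
      have e: "exp (- \<beta> * (T - t)) = exp (- \<beta> * (s - t)) * exp (- \<beta> * (T - s))" for T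
        unfolding exp_add[symmetric] by (simp add: algebra_simps)
      have "max \<beta> 0 = \<beta>" using \<beta> by simp
      then show ?thesis unfolding f_def
        by (cases "exit_time X C s \<omega> < \<infinity>")
          (simp_all only: e[of "real_of_ereal (exit_time X C s \<omega>)"] if_True if_False mult_ac mult_zero_right)
    qed
    then have "expectation (\<lambda>\<omega>. f \<omega> \<beta>) = exp (- \<beta> * (s - t)) * expectation ?h" by simp
    also have "\<dots> = expectation (\<lambda>\<omega>. exp (- \<beta> * (s - t)) * (indicator A \<omega> * v \<beta> (ln (X s \<omega>))))" unfolding h by simp
    also have "\<dots> = expectation (\<lambda>\<omega>. g \<omega> \<beta>)"
      by (rule Bochner_Integration.integral_cong) (use \<beta> in \<open>auto simp: g_def\<close>)
    finally show ?thesis .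
  qed
  have fE: "expectation (\<lambda>\<omega>. \<integral>\<beta>. f \<omega> \<beta> \<partial>P) = expectation (\<lambda>\<omega>. indicator A \<omega> * stopped_reward P X C t s \<omega>)"
    by (rule Bochner_Integration.integral_cong[OF refl kern2])
  have "integrable M (\<lambda>\<omega>. \<integral>\<beta>. f \<omega> \<beta> \<partial>P)" using pair.integrable_fst'[OF kern1] by simp
  then show "integrable M (\<lambda>\<omega>. indicator A \<omega> * stopped_reward P X C t s \<omega>)"
    using Bochner_Integration.integrable_cong[OF refl, of M "\<lambda>\<omega>. \<integral>\<beta>. f \<omega> \<beta> \<partial>P", OF kern2] by simp
  show "integrable M (\<lambda>\<omega>. indicator A \<omega> * (\<integral>\<beta>. exp (- \<beta> * (s - t)) * v \<beta> (ln (X s \<omega>)) \<partial>P))"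
    using pair.integrable_fst'[OF gi] by (simp add: g_int)
  have "expectation (\<lambda>\<omega>. \<integral>\<beta>. f \<omega> \<beta> \<partial>P) = (\<integral>\<beta>. expectation (\<lambda>\<omega>. f \<omega> \<beta>) \<partial>P)"
    by (rule pair.Fubini_integral[symmetric, OF kern1])
  also have "\<dots> = (\<integral>\<beta>. expectation (\<lambda>\<omega>. g \<omega> \<beta>) \<partial>P)"
  proof (rule integral_cong_AE)
    show "AE \<beta> in P. expectation (\<lambda>\<omega>. f \<omega> \<beta>) = expectation (\<lambda>\<omega>. g \<omega> \<beta>)" using pos by eventually_elim (rule inner)
    show "(\<lambda>\<beta>. expectation (\<lambda>\<omega>. f \<omega> \<beta>)) \<in> borel_measurable P" "(\<lambda>\<beta>. expectation (\<lambda>\<omega>. g \<omega> \<beta>)) \<in> borel_measurable P"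
      using pair.integrable_snd[OF kern1] pair.integrable_snd[OF gi] by auto
  qed
  also have "\<dots> = expectation (\<lambda>\<omega>. \<integral>\<beta>. g \<omega> \<beta> \<partial>P)" by (rule pair.Fubini_integral[OF gi])
  finally show "expectation (\<lambda>\<omega>. indicator A \<omega> * stopped_reward P X C t s \<omega>) =
      expectation (\<lambda>\<omega>. indicator A \<omega> * (\<integral>\<beta>. exp (- \<beta> * (s - t)) * v \<beta> (ln (X s \<omega>)) \<partial>P))"
    unfolding fE g_int .
qed

end

section \<open>The perturbed pay-off and the first-order condition\<close>

context brownian_motion begin

lemma wealth_log_brownian:
  assumes wp: "wealth_process M F W \<mu> \<sigma> u t x X" and t: "0 \<le> t" "t \<le> a" and pos: "0 < \<sigma>" "0 < c"
  shows "(\<And>s y. a \<le> s \<Longrightarrow> u s y = c) \<Longrightarrow> log_brownian X a \<infinity> (\<mu> * c - (\<sigma> * c)\<^sup>2 / 2) (\<sigma> * c)"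
    and "a < b \<Longrightarrow> (\<And>s y. a \<le> s \<Longrightarrow> s < b \<Longrightarrow> u s y = c) \<Longrightarrow> log_brownian X a (ereal b) (\<mu> * c - (\<sigma> * c)\<^sup>2 / 2) (\<sigma> * c)"
proof -
  have 1: "\<forall>r\<ge>a. X r \<in> borel_measurable (F r)"
    and 2: "\<forall>\<omega>\<in>space M. continuous_on {a..} (\<lambda>r. X r \<omega>) \<and> (\<forall>r\<ge>a. 0 < X r \<omega>)"
    using wp t(2) by (auto simp: wealth_process_def intro: continuous_on_subset)
  show "log_brownian X a \<infinity> (\<mu> * c - (\<sigma> * c)\<^sup>2 / 2) (\<sigma> * c)" if u: "\<And>s y. a \<le> s \<Longrightarrow> u s y = c"
  proof -
    have "AE \<omega> in M. \<forall>r\<ge>a. ln (X r \<omega>) = ln (X a \<omega>) + (\<mu> * c - (\<sigma> * c)\<^sup>2 / 2) * (r - a) + \<sigma> * c * (W r \<omega> - W a \<omega>)"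
      by (rule wealth_log_path[OF wp t _ pos]) (rule u)
    then have "AE \<omega> in M. \<forall>r\<ge>a. ereal r \<le> \<infinity> \<longrightarrow>
        ln (X r \<omega>) = ln (X a \<omega>) + (\<mu> * c - (\<sigma> * c)\<^sup>2 / 2) * (r - a) + \<sigma> * c * (W r \<omega> - W a \<omega>)"
      by (rule eventually_mono) (intro allI impI, drule spec, erule mp)
    then show ?thesis unfolding log_brownian_def using 1 2 by blast
  qed
  show "log_brownian X a (ereal b) (\<mu> * c - (\<sigma> * c)\<^sup>2 / 2) (\<sigma> * c)"
    if u: "a < b" "\<And>s y. a \<le> s \<Longrightarrow> s < b \<Longrightarrow> u s y = c"
  proof -
    have "AE \<omega> in M. \<forall>r\<in>{a..b}. ln (X r \<omega>) = ln (X a \<omega>) + (\<mu> * c - (\<sigma> * c)\<^sup>2 / 2) * (r - a) + \<sigma> * c * (W r \<omega> - W a \<omega>)"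
      by (rule wealth_log_path_interval[OF wp t u(1) _ pos]) (rule u(2))
    then have "AE \<omega> in M. \<forall>r\<ge>a. ereal r \<le> ereal b \<longrightarrow>
        ln (X r \<omega>) = ln (X a \<omega>) + (\<mu> * c - (\<sigma> * c)\<^sup>2 / 2) * (r - a) + \<sigma> * c * (W r \<omega> - W a \<omega>)"
      by (rule eventually_mono) (intro allI impI, erule bspec, simp)
    then show ?thesis unfolding log_brownian_def using 1 2 by blast
  qed
qed

text \<open>\<open>r\<^sup>2\<close> is the length of the window with coefficients \<open>m'\<close>
  and \<open>k'\<close>; \<open>m\<close> and \<open>k\<close> rule afterwards. If the log-path
  stays near \<open>z\<close> during the window, the pay-off restarts at \<open>r\<^sup>2\<close>
  and is replaced by the mixture at that time, to which \<open>discounted_expansion\<close> applies.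
  Otherwise it is merely bounded. The constant is the same for all \<open>r\<close> and
  \<open>X\<close>, as each window length comes with its own process.\<close>

lemma payoff_expansion:
  fixes c1 c2 :: "real \<Rightarrow> real" and l h z \<epsilon> :: real
  assumes fam: "smooth_family P (exp_pair c1 c2 m (k\<^sup>2 / 2)) S" and P: "weighting_distribution P" and k: "k \<noteq> 0"
    and C: "open C" and lh: "0 \<le> l" "l < h" "{l<..<h} \<subseteq> C" "l \<notin> C" "h \<notin> C"
    and c: "c1 \<in> borel_measurable borel" "c2 \<in> borel_measurable borel"
    and vh: "\<And>\<beta>. 0 < \<beta> \<Longrightarrow> exp_pair c1 c2 m (k\<^sup>2 / 2) 0 \<beta> (ln h) = ln h"
    and vl: "\<And>\<beta>. 0 < \<beta> \<Longrightarrow> 0 < l \<Longrightarrow> exp_pair c1 c2 m (k\<^sup>2 / 2) 0 \<beta> (ln l) = ln l"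
    and c2: "\<And>\<beta>. l = 0 \<Longrightarrow> c2 \<beta> = 0"
    and S: "\<And>y. y \<in> S \<Longrightarrow> exp y \<in> {l<..<h}" and z: "z \<in> S"
  defines "mom \<equiv> smooth_family.moment P (exp_pair c1 c2 m (k\<^sup>2 / 2))"
  shows "\<exists>B. \<forall>r X. 0 < r \<longrightarrow> r \<le> 1 \<longrightarrow> log_brownian X 0 (ereal (r\<^sup>2)) m' k' \<longrightarrow> log_brownian X (r\<^sup>2) \<infinity> m k \<longrightarrow>
    (\<forall>\<omega>\<in>space M. X 0 \<omega> = exp z) \<longrightarrow>
    \<bar>payoff M P X 0 (exit_time X C 0) - mom 0 0 z - r\<^sup>2 * (m' * mom 0 1 z + k'\<^sup>2 / 2 * mom 0 2 z - mom 1 0 z)\<bar> \<le> B * r ^ 3"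
proof -
  interpret fam: smooth_family P "exp_pair c1 c2 m (k\<^sup>2 / 2)" S by (rule fam)
  have mom: "mom = fam.moment" by (simp add: mom_def)
  obtain d1 K1 where d1: "d1 > 0" "{z - d1..z + d1} \<subseteq> S" and K1: "0 \<le> K1"
    and ex: "\<And>e y. 0 \<le> e \<Longrightarrow> y \<in> {z - d1..z + d1} \<Longrightarrow>
      \<bar>(\<integral>\<beta>. exp (- \<beta> * e) * exp_pair c1 c2 m (k\<^sup>2 / 2) 0 \<beta> y \<partial>P) - (fam.moment 0 0 z + fam.moment 0 1 z * (y - z) + fam.moment 0 2 z / 2 * (y - z)\<^sup>2 - e * fam.moment 1 0 z)\<bar>
      \<le> K1 * (\<bar>y - z\<bar> ^ 3 + e * \<bar>y - z\<bar> + e\<^sup>2)"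
    using fam.discounted_expansion[OF z] by auto
  obtain d2 where d2: "d2 > 0" and bd: "\<And>n j. \<exists>K. \<forall>\<beta>>0. \<forall>y'\<in>{z - d2..z + d2}. \<bar>\<beta> ^ n * exp_pair c1 c2 m (k\<^sup>2 / 2) j \<beta> y'\<bar> \<le> K"
    using fam.locally_bounded[OF z] by auto
  obtain K2 where K2: "\<And>\<beta> y'. 0 < \<beta> \<Longrightarrow> y' \<in> {z - d2..z + d2} \<Longrightarrow> \<bar>exp_pair c1 c2 m (k\<^sup>2 / 2) 0 \<beta> y'\<bar> \<le> K2"
    using bd[of 0 0] by (simp del: atLeastAtMost_iff) blast
  have K2': "\<bar>exp_pair c1 c2 m (k\<^sup>2 / 2) 0 \<beta> y'\<bar> \<le> \<bar>K2\<bar>" if "0 < \<beta>" "y' \<in> {z - d2..z + d2}" for \<beta> y'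
    using K2[OF that] by linarith
  \<comment> \<open>Within \<open>d1\<close> the expansion is valid, within \<open>d2\<close> the
    values are bounded uniformly in the rate.\<close>
  define d where "d = min d1 d2"
  have d: "0 < d" "d \<le> d1" "d \<le> d2" using d1 d2 by (auto simp: d_def)
  define K where "K = K1 + (\<bar>ln l\<bar> + \<bar>ln h\<bar>)"
  have K: "0 \<le> K" "K1 \<le> K" "\<bar>ln l\<bar> + \<bar>ln h\<bar> \<le> K" using K1 by (auto simp: K_def)
  define cc where "cc = 48 * exp (\<bar>m'\<bar> + k'\<^sup>2 / 2) / d ^ 4"
  have cc: "0 \<le> cc" by (simp add: cc_def)
  let ?E = "{exp (z - d)<..<exp (z + d)}"
  define B where "B = 2 * (K + \<bar>mom 0 0 z\<bar> + \<bar>mom 0 1 z\<bar> + \<bar>mom 0 2 z\<bar> + \<bar>mom 1 0 z\<bar>) * (m'\<^sup>2 + k'\<^sup>2 + 8 * (m' ^ 4 + 3 * k' ^ 4) + 1 + cc) + \<bar>mom 0 2 z\<bar> * m'\<^sup>2"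
  show ?thesis
  proof (intro exI[of _ B] allI impI)
    fix r X assume r: "0 < r" "r \<le> 1" and lb1: "log_brownian X 0 (ereal (r\<^sup>2)) m' k'" and lb2: "log_brownian X (r\<^sup>2) \<infinity> m k"
      and X0: "\<forall>\<omega>\<in>space M. X 0 \<omega> = exp z"
    note X = log_brownianD[OF lb1] and X' = log_brownianD[OF lb2]
    have r2: "0 < r\<^sup>2" "r\<^sup>2 \<le> 1" using r by (auto simp: power_le_one)
    \<comment> \<open>Decided at time \<open>r\<^sup>2\<close>, so its complement can serve as the
      event \<open>A\<close> in the representation from that time on.\<close>
    define bad where "bad = {\<omega> \<in> space M. exit_time X ?E 0 \<omega> \<le> ereal (r\<^sup>2)}"
    define G where "G = space M - bad"
    have badF: "bad \<in> sets (F (r\<^sup>2))"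
      unfolding bad_def by (rule exit_time_le_sets[OF _ _ X(1,2)]) (use r2 in auto)
    have GF: "G \<in> sets (F (r\<^sup>2))" using sets.compl_sets[OF badF] by (simp add: G_def space_F)
    have Gev [measurable]: "G \<in> events" using GF subalgebra_F[of "r\<^sup>2"] r2 by (auto simp: subalgebra_def)
    have "space M - G = bad" by (auto simp: G_def bad_def)
    moreover have "prob bad \<le> cc * (r\<^sup>2)\<^sup>2"
      unfolding bad_def cc_def using exit_before_prob[where X=X and s=0 and e="r\<^sup>2" and m=m' and k=k' and z=z, OF _ order_refl r2 d(1)] lb1 X0 by simp
    ultimately have pG: "prob (space M - G) \<le> cc * (r\<^sup>2)\<^sup>2" by simp
    have inE: "X q \<omega> \<in> ?E" if "\<omega> \<in> G" "0 \<le> q" "q \<le> r\<^sup>2" for \<omega> q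
    proof -
      have "\<omega> \<in> space M" "\<not> exit_time X ?E 0 \<omega> \<le> ereal (r\<^sup>2)" using that by (auto simp: G_def bad_def)
      then show ?thesis using exit_time_le_iff[where X=X and \<omega>=\<omega> and s=0 and r="r\<^sup>2" and C="?E", OF X(2)] that by auto
    qed
    have lnE: "ln (X q \<omega>) \<in> {z - d..z + d}" "X q \<omega> \<in> {l<..<h}" if "\<omega> \<in> G" "0 \<le> q" "q \<le> r\<^sup>2" for \<omega> q
    proof -
      have p: "0 < X q \<omega>" using inE[OF that] by (auto intro: less_trans[OF exp_gt_zero])
      have "exp (z - d) < exp (ln (X q \<omega>))" "exp (ln (X q \<omega>)) < exp (z + d)" using inE[OF that] p by auto
      then show *: "ln (X q \<omega>) \<in> {z - d..z + d}" by simp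
      then have "ln (X q \<omega>) \<in> S" using d1 d by auto
      from S[OF this] show "X q \<omega> \<in> {l<..<h}" using p by simp
    qed
    define \<phi> where "\<phi> = stopped_reward P X C 0 0"
    have \<phi>G: "\<phi> \<omega> = stopped_reward P X C 0 (r\<^sup>2) \<omega>" if "\<omega> \<in> G" for \<omega>
      unfolding \<phi>_def by (rule stopped_reward_shift) (use r2 lnE(2)[OF that] lh(3) in auto)
    define V where "V \<omega> = (\<integral>\<beta>. exp (- \<beta> * (r\<^sup>2 - 0)) * exp_pair c1 c2 m (k\<^sup>2 / 2) 0 \<beta> (ln (X (r\<^sup>2) \<omega>)) \<partial>P)" for \<omega>
    have rbd: "\<bar>exp_pair c1 c2 m (k\<^sup>2 / 2) 0 \<beta> (ln (X (r\<^sup>2) \<omega>))\<bar> \<le> \<bar>K2\<bar>" if "\<omega> \<in> G" "0 < \<beta>" for \<omega> \<beta>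
      by (rule K2'[OF that(2)]) (use lnE(1)[OF that(1), of "r\<^sup>2"] d r2 in auto)
    have Gin: "X (r\<^sup>2) \<omega> \<in> {l<..<h}" if "\<omega> \<in> G" for \<omega> using lnE(2)[OF that, of "r\<^sup>2"] r2 by auto
    note rep = stopped_reward_representation[where X=X and s="r\<^sup>2" and t=0 and A=G and K="\<bar>K2\<bar>", OF P lb2 _ _ k C lh GF Gin c vh vl c2 rbd abs_ge_zero,
      folded V_def]
    have rep1: "integrable M (\<lambda>\<omega>. indicator G \<omega> * stopped_reward P X C 0 (r\<^sup>2) \<omega>)"
      and rep2: "integrable M (\<lambda>\<omega>. indicator G \<omega> * V \<omega>)"
      and rep3: "expectation (\<lambda>\<omega>. indicator G \<omega> * stopped_reward P X C 0 (r\<^sup>2) \<omega>) = expectation (\<lambda>\<omega>. indicator G \<omega> * V \<omega>)"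
      using rep r2 by simp_all
    have ind_eq: "indicator G \<omega> * stopped_reward P X C 0 (r\<^sup>2) \<omega> = indicator G \<omega> * \<phi> \<omega>" for \<omega>
      using \<phi>G by (cases "\<omega> \<in> G") auto
    have zlh: "exp z \<in> {l<..<h}" by (rule S[OF z])
    have \<phi>k: "(\<lambda>\<omega>. indicator (space M) \<omega> * \<phi> \<omega>) \<in> borel_measurable M" "\<And>\<omega>. \<omega> \<in> space M \<Longrightarrow> \<bar>\<phi> \<omega>\<bar> \<le> \<bar>ln l\<bar> + \<bar>ln h\<bar>"
      unfolding \<phi>_def
      using stopped_reward_kernel(3,4)[where X=X and t=0 and s=0 and A="space M", OF P order_refl order_refl X(1-3) C lh sets.top] X0 zlh by auto
    have \<phi>m [measurable]: "\<phi> \<in> borel_measurable M"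
      using \<phi>k(1) by (rule measurable_cong[THEN iffD1, rotated]) simp
    have \<phi>i: "integrable M (\<lambda>\<omega>. indicator A \<omega> * \<phi> \<omega>)" if [measurable]: "A \<in> events" for A
      by (rule integrable_const_bound[where B="\<bar>ln l\<bar> + \<bar>ln h\<bar>"]) (use \<phi>k(2) in \<open>auto simp: indicator_def\<close>)
    \<comment> \<open>Same expectation as the pay-off, but on \<open>G\<close> it is an explicit
      function of the log-wealth at time \<open>r\<^sup>2\<close>.\<close>
    define \<Psi> where "\<Psi> \<omega> = indicator G \<omega> * V \<omega> + indicator (space M - G) \<omega> * \<phi> \<omega>" for \<omega>
    have int\<Psi>: "integrable M \<Psi>" unfolding \<Psi>_def by (intro Bochner_Integration.integrable_add rep2 \<phi>i) simp
    have E\<Psi>: "payoff M P X 0 (exit_time X C 0) = expectation \<Psi>"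
    proof -
      have "payoff M P X 0 (exit_time X C 0) = expectation \<phi>" by (simp add: payoff_eq \<phi>_def)
      also have "\<dots> = expectation (\<lambda>\<omega>. indicator G \<omega> * \<phi> \<omega> + indicator (space M - G) \<omega> * \<phi> \<omega>)"
        by (rule Bochner_Integration.integral_cong) (auto simp: indicator_def)
      also have "\<dots> = expectation (\<lambda>\<omega>. indicator G \<omega> * \<phi> \<omega>) + expectation (\<lambda>\<omega>. indicator (space M - G) \<omega> * \<phi> \<omega>)"
        by (intro Bochner_Integration.integral_add \<phi>i) simp_all
      also have "\<dots> = expectation (\<lambda>\<omega>. indicator G \<omega> * V \<omega>) + expectation (\<lambda>\<omega>. indicator (space M - G) \<omega> * \<phi> \<omega>)"
        using rep3 unfolding ind_eq by simp
      also have "\<dots> = expectation \<Psi>" unfolding \<Psi>_def by (intro Bochner_Integration.integral_add[symmetric] rep2 \<phi>i) simp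
      finally show ?thesis .
    qed
    have good: "AE \<omega> in M. \<omega> \<in> G \<longrightarrow> (let U = m' * r\<^sup>2 + k' * (W (0 + r\<^sup>2) \<omega> - W 0 \<omega>) in
      \<bar>\<Psi> \<omega> - (mom 0 0 z + mom 0 1 z * U + mom 0 2 z / 2 * U\<^sup>2 - r\<^sup>2 * mom 1 0 z)\<bar> \<le> K * (\<bar>U\<bar> ^ 3 + r\<^sup>2 * \<bar>U\<bar> + (r\<^sup>2)\<^sup>2))"
      using X(4) AE_space
    proof eventually_elim
      case (elim \<omega>)
      show ?case
      proof
        assume G: "\<omega> \<in> G"
        define U where "U = m' * r\<^sup>2 + k' * (W (0 + r\<^sup>2) \<omega> - W 0 \<omega>)"
        have "ln (X (r\<^sup>2) \<omega>) = z + U" using elim r2 X0 by (simp add: U_def)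
        then have U: "ln (X (r\<^sup>2) \<omega>) - z = U" by simp
        have \<Psi>V: "\<Psi> \<omega> = (\<integral>\<beta>. exp (- \<beta> * r\<^sup>2) * exp_pair c1 c2 m (k\<^sup>2 / 2) 0 \<beta> (ln (X (r\<^sup>2) \<omega>)) \<partial>P)"
          using G by (simp add: \<Psi>_def V_def)
        have "ln (X (r\<^sup>2) \<omega>) \<in> {z - d1..z + d1}" using lnE(1)[OF G, of "r\<^sup>2"] r2 d by auto
        from ex[OF _ this, of "r\<^sup>2"] r2
        have "\<bar>\<Psi> \<omega> - (mom 0 0 z + mom 0 1 z * U + mom 0 2 z / 2 * U\<^sup>2 - r\<^sup>2 * mom 1 0 z)\<bar> \<le> K1 * (\<bar>U\<bar> ^ 3 + r\<^sup>2 * \<bar>U\<bar> + (r\<^sup>2)\<^sup>2)"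
          unfolding U \<Psi>V mom by simp
        also have "\<dots> \<le> K * (\<bar>U\<bar> ^ 3 + r\<^sup>2 * \<bar>U\<bar> + (r\<^sup>2)\<^sup>2)" by (intro mult_right_mono K) simp
        finally show "let U = m' * r\<^sup>2 + k' * (W (0 + r\<^sup>2) \<omega> - W 0 \<omega>) in
          \<bar>\<Psi> \<omega> - (mom 0 0 z + mom 0 1 z * U + mom 0 2 z / 2 * U\<^sup>2 - r\<^sup>2 * mom 1 0 z)\<bar> \<le> K * (\<bar>U\<bar> ^ 3 + r\<^sup>2 * \<bar>U\<bar> + (r\<^sup>2)\<^sup>2)"
          unfolding Let_def U_def .
      qed
    qed
    have bad': "\<bar>\<Psi> \<omega>\<bar> \<le> K" if "\<omega> \<in> space M" "\<omega> \<notin> G" for \<omega>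
      using \<phi>k(2)[OF that(1)] K that by (simp add: \<Psi>_def)
    show "\<bar>payoff M P X 0 (exit_time X C 0) - mom 0 0 z - r\<^sup>2 * (m' * mom 0 1 z + k'\<^sup>2 / 2 * mom 0 2 z - mom 1 0 z)\<bar> \<le> B * r ^ 3"
      unfolding E\<Psi> B_def
      by (rule second_order_expansion[OF order_refl r K(1) Gev pG cc borel_measurable_integrable[OF int\<Psi>] good bad' int\<Psi>])
  qed
qed

lemma payoff_value:
  fixes c1 c2 :: "real \<Rightarrow> real" and l h z :: real and X :: "real \<Rightarrow> 'a \<Rightarrow> real"
  assumes fam: "smooth_family P (exp_pair c1 c2 m (k\<^sup>2 / 2)) S" and P: "weighting_distribution P" and k: "k \<noteq> 0"
    and C: "open C" and lh: "0 \<le> l" "l < h" "{l<..<h} \<subseteq> C" "l \<notin> C" "h \<notin> C"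
    and c: "c1 \<in> borel_measurable borel" "c2 \<in> borel_measurable borel"
    and vh: "\<And>\<beta>. 0 < \<beta> \<Longrightarrow> exp_pair c1 c2 m (k\<^sup>2 / 2) 0 \<beta> (ln h) = ln h"
    and vl: "\<And>\<beta>. 0 < \<beta> \<Longrightarrow> 0 < l \<Longrightarrow> exp_pair c1 c2 m (k\<^sup>2 / 2) 0 \<beta> (ln l) = ln l"
    and c2: "\<And>\<beta>. l = 0 \<Longrightarrow> c2 \<beta> = 0"
    and S: "\<And>y. y \<in> S \<Longrightarrow> exp y \<in> {l<..<h}" and z: "z \<in> S"
    and lb: "log_brownian X 0 \<infinity> m k" and X0: "\<And>\<omega>. \<omega> \<in> space M \<Longrightarrow> X 0 \<omega> = exp z"
  shows "payoff M P X 0 (exit_time X C 0) = smooth_family.moment P (exp_pair c1 c2 m (k\<^sup>2 / 2)) 0 0 z"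
proof -
  interpret fam: smooth_family P "exp_pair c1 c2 m (k\<^sup>2 / 2)" S by (rule fam)
  obtain d2 where d2: "d2 > 0" and bd: "\<And>n j. \<exists>K. \<forall>\<beta>>0. \<forall>y'\<in>{z - d2..z + d2}. \<bar>\<beta> ^ n * exp_pair c1 c2 m (k\<^sup>2 / 2) j \<beta> y'\<bar> \<le> K"
    using fam.locally_bounded[OF z] by auto
  obtain K2 where K2: "\<And>\<beta> y'. 0 < \<beta> \<Longrightarrow> y' \<in> {z - d2..z + d2} \<Longrightarrow> \<bar>exp_pair c1 c2 m (k\<^sup>2 / 2) 0 \<beta> y'\<bar> \<le> K2"
    using bd[of 0 0] by (simp del: atLeastAtMost_iff) blast
  have rbd: "\<bar>exp_pair c1 c2 m (k\<^sup>2 / 2) 0 \<beta> (ln (X 0 \<omega>))\<bar> \<le> \<bar>K2\<bar>" if "\<omega> \<in> space M" "0 < \<beta>" for \<omega> \<beta>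
    using K2[OF that(2), of z] X0[OF that(1)] d2 by simp
  have in_lh: "X 0 \<omega> \<in> {l<..<h}" if "\<omega> \<in> space M" for \<omega> using X0[OF that] S[OF z] by simp
  have A: "space M \<in> sets (F 0)" using sets.top[of "F 0"] by (simp add: space_F)
  have "payoff M P X 0 (exit_time X C 0) = expectation (\<lambda>\<omega>. indicator (space M) \<omega> * stopped_reward P X C 0 0 \<omega>)"
    unfolding payoff_eq by (rule Bochner_Integration.integral_cong) auto
  also have "\<dots> = expectation (\<lambda>\<omega>. indicator (space M) \<omega> * (\<integral>\<beta>. exp (- \<beta> * (0 - 0)) * exp_pair c1 c2 m (k\<^sup>2 / 2) 0 \<beta> (ln (X 0 \<omega>)) \<partial>P))"
    by (rule stopped_reward_representation(3)[where X=X and s=0 and t=0 and A="space M" and K="\<bar>K2\<bar>",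
      OF P lb order_refl order_refl k C lh A in_lh c vh vl c2 rbd abs_ge_zero])
  also have "\<dots> = expectation (\<lambda>\<omega>. fam.moment 0 0 z)"
    by (rule Bochner_Integration.integral_cong) (auto simp: fam.moment_def X0)
  finally show ?thesis by (simp add: prob_space)
qed

lemma first_order_condition:
  fixes p q i t :: real
  assumes "0 < t" "\<And>\<eta>. 0 < \<eta> \<Longrightarrow> p * \<eta> + q * \<eta>\<^sup>2 - i \<le> 0" "p * t + q * t\<^sup>2 - i = 0"
  shows "p + 2 * q * t = 0"
proof (rule DERIV_local_max)
  show "((\<lambda>\<eta>. p * \<eta> + q * \<eta>\<^sup>2 - i) has_real_derivative p + 2 * q * t) (at t)"
    by (auto intro!: derivative_eq_intros)
  show "0 < t" by fact
  show "\<forall>\<eta>. \<bar>t - \<eta>\<bar> < t \<longrightarrow> p * \<eta> + q * \<eta>\<^sup>2 - i \<le> p * t + q * t\<^sup>2 - i"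
    using assms(2,3) by (auto simp: abs_less_iff)
qed

text \<open>Abstracts from the shape of the component: two-sided with \<open>0 < l\<close>, or
  one-sided with \<open>l = 0\<close> and \<open>c2\<close> vanishing. Both give a family
  \<open>v\<close> that is smooth on \<open>S\<close> and has one sign at some point.\<close>

lemma not_equilibrium_of_family:
  fixes c1 c2 :: "real \<Rightarrow> real" and l h y0 \<mu> \<sigma> \<theta> :: real
    and X :: "(real \<Rightarrow> real \<Rightarrow> real) \<Rightarrow> real \<Rightarrow> real \<Rightarrow> real \<Rightarrow> 'a \<Rightarrow> real"
  assumes pos: "0 < \<sigma>" "0 < \<theta>" and wf: "wealth_family M F W \<mu> \<sigma> (\<lambda>x. \<theta>) X"
    and P: "weighting_distribution P" "\<not> is_singleton (measure_support P)"
    and C: "open C" and lh: "0 \<le> l" "l < h" "{l<..<h} \<subseteq> C" "l \<notin> C" "h \<notin> C"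
    and c: "c1 \<in> borel_measurable borel" "c2 \<in> borel_measurable borel"
  defines "m \<equiv> \<mu> * \<theta> - (\<sigma> * \<theta>)\<^sup>2 / 2" and "k \<equiv> \<sigma> * \<theta>"
  defines "v \<equiv> exp_pair c1 c2 m (k\<^sup>2 / 2)"
  assumes fam: "smooth_family P v S"
    and vh: "\<And>\<beta>. 0 < \<beta> \<Longrightarrow> v 0 \<beta> (ln h) = ln h"
    and vl: "\<And>\<beta>. 0 < \<beta> \<Longrightarrow> 0 < l \<Longrightarrow> v 0 \<beta> (ln l) = ln l"
    and c2: "\<And>\<beta>. l = 0 \<Longrightarrow> c2 \<beta> = 0"
    and S: "\<And>y. y \<in> S \<Longrightarrow> exp y \<in> {l<..<h}"
    and y0: "y0 \<in> S" "(\<forall>\<beta>>0. 0 < v 0 \<beta> y0) \<or> (\<forall>\<beta>>0. v 0 \<beta> y0 < 0)"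
  shows "\<not> equilibrium M P X (\<lambda>x. \<theta>) C"
proof
  assume eq: "equilibrium M P X (\<lambda>x. \<theta>) C"
  interpret fam: smooth_family P v S by (rule fam)
  have k: "k \<noteq> 0" using pos by (simp add: k_def)
  have D: "0 < k\<^sup>2 / 2" using k by simp
  have ode: "k\<^sup>2 / 2 * v 2 \<beta> y + m * v 1 \<beta> y = \<beta> * v 0 \<beta> y" if "0 < \<beta>" for \<beta> y
    unfolding v_def by (rule exp_pair_ode[OF D that])
  note setting = fam[unfolded v_def] P(1) k C lh c vh[unfolded v_def] vl[unfolded v_def] c2 S
  have le0: "(\<mu> * \<eta> - (\<sigma> * \<eta>)\<^sup>2 / 2) * fam.moment 0 1 z + (\<sigma> * \<eta>)\<^sup>2 / 2 * fam.moment 0 2 z - fam.moment 1 0 z \<le> 0"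
    if z: "z \<in> S" and \<eta>: "0 < \<eta>" for z \<eta>
  proof -
    define L where "L = (\<mu> * \<eta> - (\<sigma> * \<eta>)\<^sup>2 / 2) * fam.moment 0 1 z + (\<sigma> * \<eta>)\<^sup>2 / 2 * fam.moment 0 2 z - fam.moment 1 0 z"
    define J where "J u = payoff M P (X u 0 (exp z)) 0 (exit_time (X u 0 (exp z)) C 0)" for u
    have wp: "wealth_process M F W \<mu> \<sigma> (\<lambda>s x. \<theta>) 0 (exp z) (X (\<lambda>s x. \<theta>) 0 (exp z))"
      using wf by (simp add: wealth_family_def)
    have J0: "J (\<lambda>s x. \<theta>) = fam.moment 0 0 z"
      unfolding J_def v_def
    proof (rule payoff_value[OF setting z])
      show "log_brownian (X (\<lambda>s x. \<theta>) 0 (exp z)) 0 \<infinity> m k"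
        unfolding m_def k_def by (rule wealth_log_brownian(1)[OF wp order_refl order_refl pos]) simp
      show "X (\<lambda>s x. \<theta>) 0 (exp z) 0 \<omega> = exp z" if "\<omega> \<in> space M" for \<omega>
        using wp that by (simp add: wealth_process_def)
    qed
    obtain B where B: "\<And>r Y. 0 < r \<Longrightarrow> r \<le> 1 \<Longrightarrow> log_brownian Y 0 (ereal (r\<^sup>2)) (\<mu> * \<eta> - (\<sigma> * \<eta>)\<^sup>2 / 2) (\<sigma> * \<eta>) \<Longrightarrow>
      log_brownian Y (r\<^sup>2) \<infinity> m k \<Longrightarrow> (\<forall>\<omega>\<in>space M. Y 0 \<omega> = exp z) \<Longrightarrow>
      \<bar>payoff M P Y 0 (exit_time Y C 0) - fam.moment 0 0 z - r\<^sup>2 * L\<bar> \<le> B * r ^ 3"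
      using payoff_expansion[OF setting z, folded v_def, of "\<mu> * \<eta> - (\<sigma> * \<eta>)\<^sup>2 / 2" "\<sigma> * \<eta>"] unfolding L_def by blast
    define Q where "Q \<epsilon> = (J (perturbed (\<lambda>x. \<theta>) 0 \<epsilon> \<eta>) - J (\<lambda>s x. \<theta>)) / \<epsilon>" for \<epsilon>
    have Q: "\<bar>Q \<epsilon> - L\<bar> \<le> B * sqrt \<epsilon>" if \<epsilon>: "0 < \<epsilon>" "\<epsilon> \<le> 1" for \<epsilon>
    proof -
      let ?u = "perturbed (\<lambda>x. \<theta>) 0 \<epsilon> \<eta>" and ?r = "sqrt \<epsilon>"
      have wp: "wealth_process M F W \<mu> \<sigma> ?u 0 (exp z) (X ?u 0 (exp z))"
        using wf \<epsilon> \<eta> unfolding wealth_family_def by (metis (mono_tags, lifting) exp_gt_zero insertI2 mem_Collect_eq order_refl)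
      have r: "0 < ?r" "?r \<le> 1" "?r\<^sup>2 = \<epsilon>" using \<epsilon> by auto
      have "\<bar>J ?u - fam.moment 0 0 z - ?r\<^sup>2 * L\<bar> \<le> B * ?r ^ 3"
        unfolding J_def
      proof (rule B[OF r(1,2)])
        show "log_brownian (X ?u 0 (exp z)) 0 (ereal (?r\<^sup>2)) (\<mu> * \<eta> - (\<sigma> * \<eta>)\<^sup>2 / 2) (\<sigma> * \<eta>)"
          unfolding r(3) by (rule wealth_log_brownian(2)[OF wp order_refl order_refl pos(1) \<eta>]) (use \<epsilon> in \<open>auto simp: perturbed_def\<close>)
        show "log_brownian (X ?u 0 (exp z)) (?r\<^sup>2) \<infinity> m k"
          unfolding r(3) m_def k_def by (rule wealth_log_brownian(1)[OF wp order_refl _ pos]) (use \<epsilon> in \<open>auto simp: perturbed_def\<close>)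
        show "\<forall>\<omega>\<in>space M. X ?u 0 (exp z) 0 \<omega> = exp z" using wp by (simp add: wealth_process_def)
      qed
      \<comment> \<open>\<open>r ^ 3 = \<epsilon> * sqrt \<epsilon>\<close>, so after division by
        \<open>\<epsilon>\<close> the error is of order \<open>sqrt \<epsilon>\<close> and
        \<open>L\<close> is the limit of the quotient in condition (iii).\<close>
      then have "\<bar>J ?u - J (\<lambda>s x. \<theta>) - \<epsilon> * L\<bar> \<le> B * (\<epsilon> * ?r)" using r by (simp add: J0 power3_eq_cube mult.assoc)
      moreover have "J ?u - J (\<lambda>s x. \<theta>) - \<epsilon> * L = (Q \<epsilon> - L) * \<epsilon>"
      proof -
        have "Q \<epsilon> * \<epsilon> = J ?u - J (\<lambda>s x. \<theta>)" using \<epsilon> by (simp add: Q_def)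
        then show ?thesis unfolding left_diff_distrib by (simp only: mult.commute[of L])
      qed
      ultimately have "\<bar>Q \<epsilon> - L\<bar> * \<epsilon> \<le> B * ?r * \<epsilon>" using \<epsilon> by (simp add: abs_mult mult_ac)
      then show ?thesis using \<epsilon>(1) by (rule mult_right_le_imp_le)
    qed
    have "((\<lambda>\<epsilon>. Q \<epsilon> - L) \<longlongrightarrow> 0) (at_right 0)"
    proof (rule Lim_null_comparison)
      show "\<forall>\<^sub>F \<epsilon> in at_right 0. norm (Q \<epsilon> - L) \<le> B * sqrt \<epsilon>"
        unfolding eventually_at_right_field using Q by (intro exI[of _ 1]) auto
      have "((\<lambda>\<epsilon>. B * sqrt \<epsilon>) \<longlongrightarrow> B * sqrt 0) (at_right 0)" by (intro tendsto_intros)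
      then show "((\<lambda>\<epsilon>. B * sqrt \<epsilon>) \<longlongrightarrow> 0) (at_right 0)" by simp
    qed
    then have "(Q \<longlongrightarrow> L) (at_right 0)" by (simp add: LIM_zero_iff)
    then have "Limsup (at_right 0) (\<lambda>\<epsilon>. ereal (Q \<epsilon>)) = ereal L"
      by (intro lim_imp_Limsup) auto
    moreover have "Limsup (at_right 0) (\<lambda>\<epsilon>. ereal (Q \<epsilon>)) \<le> 0"
    proof -
      have "exp z \<in> C" using S[OF z] lh(3) by auto
      then show ?thesis using eq \<eta> unfolding equilibrium_def Let_def Q_def J_def by auto
    qed
    ultimately show ?thesis by (simp add: L_def)
  qed
  \<comment> \<open>The quadratic in \<open>\<eta>\<close> vanishes at \<open>\<theta>\<close> by
    the mixed equation for \<open>n = 0\<close>, so \<open>\<theta>\<close> is an interior maximum;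
    solving the stationarity condition gives this constant, which does not depend on
    \<open>z\<close>.\<close>
  have foc: "fam.moment 0 2 z = (1 - \<mu> / (\<sigma>\<^sup>2 * \<theta>)) * fam.moment 0 1 z" if z: "z \<in> S" for z
  proof -
    let ?p = "\<mu> * fam.moment 0 1 z" and ?q = "\<sigma>\<^sup>2 / 2 * (fam.moment 0 2 z - fam.moment 0 1 z)"
    have form: "(\<mu> * \<eta> - (\<sigma> * \<eta>)\<^sup>2 / 2) * fam.moment 0 1 z + (\<sigma> * \<eta>)\<^sup>2 / 2 * fam.moment 0 2 z - fam.moment 1 0 z
      = ?p * \<eta> + ?q * \<eta>\<^sup>2 - fam.moment 1 0 z" for \<eta> by (simp add: power_mult_distrib algebra_simps)
    have "?p + 2 * ?q * \<theta> = 0"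
    proof (rule first_order_condition[OF pos(2)])
      show "?p * \<eta> + ?q * \<eta>\<^sup>2 - fam.moment 1 0 z \<le> 0" if "0 < \<eta>" for \<eta> using le0[OF z that] unfolding form .
      have "k\<^sup>2 / 2 * fam.moment 0 2 z + m * fam.moment 0 1 z = fam.moment 1 0 z"
        using fam.moment_ode[OF ode z, of 0] by simp
      then show "?p * \<theta> + ?q * \<theta>\<^sup>2 - fam.moment 1 0 z = 0" unfolding form[symmetric] m_def k_def by simp
    qed
    then have "\<sigma>\<^sup>2 * \<theta> * fam.moment 0 2 z = (\<sigma>\<^sup>2 * \<theta> - \<mu>) * fam.moment 0 1 z" by (simp add: algebra_simps)
    then show ?thesis using pos by (simp add: field_simps)
  qed
  obtain \<kappa> where "AE \<beta> in P. \<beta> = \<kappa>" using fam.degenerate[OF ode foc y0] by auto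
  then show False using singleton_measure_support[OF P(1)] P(2) by blast
qed

end

section \<open>The two exceptional shapes of the continuation region\<close>

text \<open>Bounds the first absolute moment of a Brownian increment from below using only its
  second and fourth moments.\<close>

lemma abs_ge_even_polynomial:
  fixes w r :: real
  assumes r: "0 < r"
  shows "w\<^sup>2 / r - w ^ 4 / (4 * r ^ 3) \<le> \<bar>w\<bar>"
proof -
  define x where "x = \<bar>w\<bar> / r"
  have x: "0 \<le> x" "\<bar>w\<bar> = r * x" using r by (auto simp: x_def)
  have w2: "w\<^sup>2 = r\<^sup>2 * x\<^sup>2" using x(2) by (metis power2_abs power_mult_distrib)
  have "w ^ 4 = (w\<^sup>2)\<^sup>2" by (simp add: power_mult[symmetric])
  also have "\<dots> = r ^ 4 * x ^ 4" unfolding w2 power_mult_distrib by (simp add: power_mult[symmetric])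
  finally have w4: "w ^ 4 = r ^ 4 * x ^ 4" .
  have "w\<^sup>2 / r = r * x\<^sup>2" unfolding w2 using r by (simp add: power2_eq_square)
  moreover have "w ^ 4 / (4 * r ^ 3) = r * (x ^ 4 / 4)" unfolding w4 using r by (simp add: power3_eq_cube power4_eq_xxxx)
  moreover have "x\<^sup>2 - x ^ 4 / 4 \<le> x"
  proof -
    \<comment> \<open>A positivity certificate for \<open>x ^ 3 - 4 * x + 4\<close> on
      \<open>0 \<le> x\<close>, whose minimum lies at 2 divided by the root of 3. The numbers are
      chosen near it so that the quadratic terms cancel and the linear coefficient is -4; the
      constant that remains is below 4.\<close>
    have "0 \<le> x * (x - 6 / 5)\<^sup>2 + 12 / 5 * (x - 17 / 15)\<^sup>2" using x by (intro add_nonneg_nonneg mult_nonneg_nonneg) auto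
    also have "\<dots> = x ^ 3 - 4 * x + 1156 / 375" by (simp add: power2_eq_square power3_eq_cube algebra_simps)
    finally have "0 \<le> x ^ 3 - 4 * x + 4" by simp
    then have "0 \<le> x * (x ^ 3 - 4 * x + 4)" using x by simp
    also have "\<dots> = 4 * (x - (x\<^sup>2 - x ^ 4 / 4))" by (simp add: power2_eq_square power3_eq_cube power4_eq_xxxx algebra_simps)
    finally show ?thesis by simp
  qed
  then have "r * (x\<^sup>2 - x ^ 4 / 4) \<le> r * x" using r by (intro mult_left_mono) auto
  ultimately show ?thesis unfolding x(2) by (simp add: right_diff_distrib)
qed

context brownian_motion begin

lemma not_equilibrium_of_ray:
  fixes X :: "(real \<Rightarrow> real \<Rightarrow> real) \<Rightarrow> real \<Rightarrow> real \<Rightarrow> real \<Rightarrow> 'a \<Rightarrow> real"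
  assumes wf: "wealth_family M F W \<mu> \<sigma> (\<lambda>x. \<theta>) X" and P: "weighting_distribution P"
    and C: "open C" and l: "0 < l" "l \<notin> C" "{l<..} \<subseteq> C"
  shows "\<not> equilibrium M P X (\<lambda>x. \<theta>) C"
proof
  assume eq: "equilibrium M P X (\<lambda>x. \<theta>) C"
  \<comment> \<open>Beyond \<open>l\<close>, and with logarithm larger than
    \<open>\<bar>ln l\<bar>\<close>, which bounds every reward reachable from there.\<close>
  define x where "x = max (l + 1) (exp (\<bar>ln l\<bar> + 1))"
  have x: "l < x" "0 < x" using l by (auto simp: x_def)
  have "\<bar>ln l\<bar> + 1 \<le> ln x" using x(2) by (subst ln_ge_iff) (auto simp: x_def)
  then have lnx: "\<bar>ln l\<bar> < ln x" by simp
  define Y where "Y = X (\<lambda>s x. \<theta>) 0 x"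
  have wp: "wealth_process M F W \<mu> \<sigma> (\<lambda>s x. \<theta>) 0 x Y"
    using wf x by (simp add: wealth_family_def Y_def)
  have bound: "\<bar>stopped_reward P Y C 0 0 \<omega>\<bar> \<le> \<bar>ln l\<bar>" if \<omega>: "\<omega> \<in> space M" for \<omega>
  proof -
    have c: "continuous_on {0..} (\<lambda>r. Y r \<omega>)" and Y0: "Y 0 \<omega> = x" using wp \<omega> by (auto simp: wealth_process_def)
    show ?thesis
    proof (rule exit_time_cases[where X=Y and \<omega>=\<omega>, OF c C])
      fix T assume T: "0 \<le> T" "exit_time Y C 0 \<omega> = ereal T" "Y T \<omega> \<notin> C" "\<And>r. 0 \<le> r \<Longrightarrow> r < T \<Longrightarrow> Y r \<omega> \<in> C"
      have "Y T \<omega> = l"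
      proof (rule ccontr)
        assume ne: "Y T \<omega> \<noteq> l"
        then have lt: "Y T \<omega> < l" using T(3) l(3) by force
        obtain q where q: "0 \<le> q" "q \<le> T" "Y q \<omega> = l"
          using IVT2'[of "\<lambda>r. Y r \<omega>" T l 0] lt Y0 x T(1) continuous_on_subset[OF c, of "{0..T}"] by auto
        then have "q < T" using lt by (cases "q = T") auto
        then show False using T(4)[OF q(1)] q(3) l(2) by simp
      qed
      then have "stopped_reward P Y C 0 0 \<omega> = discount P T * ln l"
        using stopped_reward_eq[where X=Y and \<omega>=\<omega>, OF T(2), of P 0] by simp
      then show ?thesis using discount_props(1)[OF P T(1)] by (simp add: abs_mult mult_left_le_one_le)
    next
      assume "exit_time Y C 0 \<omega> = \<infinity>"
      then show ?thesis by (simp add: stopped_reward_def)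
    qed
  qed
  have "\<bar>payoff M P Y 0 (exit_time Y C 0)\<bar> \<le> \<bar>ln l\<bar>"
    unfolding payoff_eq by (rule abs_expectation_le) (use bound in auto)
  moreover have "ln x \<le> payoff M P Y 0 (exit_time Y C 0)"
    using eq x(2) by (auto simp: equilibrium_def Let_def Y_def)
  ultimately show False using lnx by simp
qed

text \<open>The boundary value \<open>ln 1 = 0\<close> makes the value on \<open>(0, 1)\<close>
  vanish, so the argument by sign has nothing to work with. Started at 1 and watched only from time
  \<open>\<epsilon>\<close>, the path earns the discounted \<open>ln Y\<close> if it is above 1 and
  nothing otherwise; the positive part of a Brownian increment has mean of order
  \<open>sqrt \<epsilon>\<close>.\<close>

lemma not_equilibrium_unit_interval:
  fixes X :: "(real \<Rightarrow> real \<Rightarrow> real) \<Rightarrow> real \<Rightarrow> real \<Rightarrow> real \<Rightarrow> 'a \<Rightarrow> real"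
  assumes wf: "wealth_family M F W \<mu> \<sigma> (\<lambda>x. \<theta>) X" and P: "weighting_distribution P" and pos: "0 < \<sigma>" "0 < \<theta>"
  shows "\<not> equilibrium M P X (\<lambda>x. \<theta>) {0<..<1}"
proof
  assume eq: "equilibrium M P X (\<lambda>x. \<theta>) {0<..<1}"
  let ?C = "{0<..<1::real}"
  define Y where "Y = X (\<lambda>s x. \<theta>) 0 1"
  define m where "m = \<mu> * \<theta> - (\<sigma> * \<theta>)\<^sup>2 / 2"
  define k where "k = \<sigma> * \<theta>"
  have k: "0 < k" using pos by (simp add: k_def)
  have wp: "wealth_process M F W \<mu> \<sigma> (\<lambda>s x. \<theta>) 0 1 Y"
    using wf by (simp add: wealth_family_def Y_def)
  have lb: "log_brownian Y 0 \<infinity> m k"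
    unfolding m_def k_def by (rule wealth_log_brownian(1)[OF wp order_refl order_refl pos]) simp
  note Y = log_brownianD[OF lb]
  have Y0: "Y 0 \<omega> = 1" if "\<omega> \<in> space M" for \<omega> using wp that by (simp add: wealth_process_def)
  define J where "J s = payoff M P Y 0 (exit_time Y ?C s)" for s
  have reward: "stopped_reward P Y ?C 0 \<epsilon> \<omega> = discount P \<epsilon> * max 0 (ln (Y \<epsilon> \<omega>))" if \<omega>: "\<omega> \<in> space M" and \<epsilon>: "0 \<le> \<epsilon>" for \<epsilon> \<omega>
  proof -
    have c: "continuous_on {\<epsilon>..} (\<lambda>r. Y r \<omega>)" using Y(2)[OF \<omega>] \<epsilon> by (auto intro: continuous_on_subset)
    have p: "0 < Y r \<omega>" if "\<epsilon> \<le> r" for r using Y(3)[OF \<omega>] that \<epsilon> by auto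
    have O: "open ?C" by simp
    show ?thesis
    proof (cases "Y \<epsilon> \<omega> < 1")
      case True
      then have in_C: "Y \<epsilon> \<omega> \<in> ?C" and neg: "max 0 (ln (Y \<epsilon> \<omega>)) = 0" using p[of \<epsilon>] by auto
      have "stopped_reward P Y ?C 0 \<epsilon> \<omega> = 0"
      proof (cases "exit_time Y ?C \<epsilon> \<omega> < \<infinity>")
        case True
        then obtain T where T: "exit_time Y ?C \<epsilon> \<omega> = ereal T" using exit_time_ge[of \<epsilon> Y ?C \<omega>] by (cases "exit_time Y ?C \<epsilon> \<omega>") auto
        have "\<epsilon> \<le> T" "Y T \<omega> = 0 \<or> Y T \<omega> = 1"
          using exit_position[where X=Y and \<omega>=\<omega>, OF c O _ _ _ _ in_C T] by simp_all
        then have "Y T \<omega> = 1" using p[of T] by auto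
        then show ?thesis using stopped_reward_eq[where X=Y and \<omega>=\<omega>, OF T, of P 0] by simp
      qed (simp add: stopped_reward_def)
      then show ?thesis using neg by simp
    next
      case False
      have "exit_time Y ?C \<epsilon> \<omega> \<le> ereal \<epsilon>" unfolding exit_time_def by (rule Inf_lower) (use False in auto)
      then have T: "exit_time Y ?C \<epsilon> \<omega> = ereal \<epsilon>" using exit_time_ge[of \<epsilon> Y ?C \<omega>] by (rule antisym)
      show ?thesis using stopped_reward_eq[where X=Y and \<omega>=\<omega>, OF T, of P 0] False by simp
    qed
  qed
  have J: "J \<epsilon> = discount P \<epsilon> * expectation (\<lambda>\<omega>. max 0 (ln (Y \<epsilon> \<omega>)))" if "0 \<le> \<epsilon>" for \<epsilon>
  proof -
    have "J \<epsilon> = expectation (\<lambda>\<omega>. discount P \<epsilon> * max 0 (ln (Y \<epsilon> \<omega>)))"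
      unfolding J_def payoff_eq by (rule Bochner_Integration.integral_cong) (use reward that in auto)
    then show ?thesis by simp
  qed
  have J0: "J 0 = 0"
  proof -
    have "expectation (\<lambda>\<omega>. max 0 (ln (Y 0 \<omega>))) = expectation (\<lambda>\<omega>. 0)"
      by (rule Bochner_Integration.integral_cong) (use Y0 in auto)
    then show ?thesis using J[of 0] by simp
  qed
  \<comment> \<open>The positive part of \<open>k * D\<close> is
    \<open>k / 2 * (D + \<bar>D\<bar>)\<close>. The even polynomial bounds the mean of
    \<open>\<bar>D\<bar>\<close> below by \<open>r - 3 / 4 * r\<close>, which gives
    \<open>k * r / 8\<close>; the drift costs at most
    \<open>\<bar>m\<bar> * r\<^sup>2\<close>.\<close>
  have lower: "k * r / 8 - \<bar>m\<bar> * r\<^sup>2 \<le> expectation (\<lambda>\<omega>. max 0 (ln (Y (r\<^sup>2) \<omega>)))" if r: "0 < r" for r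
  proof -
    define D where "D \<omega> = W (0 + r\<^sup>2) \<omega> - W 0 \<omega>" for \<omega>
    have ss: "0 < 0 + r\<^sup>2" using r by simp
    have D1: "has_bochner_integral M D 0" and D2: "has_bochner_integral M (\<lambda>\<omega>. (D \<omega>)\<^sup>2) (r\<^sup>2)"
      and D4: "has_bochner_integral M (\<lambda>\<omega>. D \<omega> ^ 4) (3 * (r\<^sup>2)\<^sup>2)"
      using increment_moments(1,2,3)[OF order_refl ss] by (simp_all add: D_def[abs_def])
    have hc: "has_bochner_integral M (\<lambda>_. x) x" for x :: real by (simp add: has_bochner_integral_iff prob_space)
    let ?g = "\<lambda>\<omega>. k / 2 * (D \<omega> + (1 / r * (D \<omega>)\<^sup>2 - 1 / (4 * r ^ 3) * D \<omega> ^ 4)) - \<bar>m\<bar> * r\<^sup>2"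
    have g: "has_bochner_integral M ?g (k / 2 * (0 + (1 / r * r\<^sup>2 - 1 / (4 * r ^ 3) * (3 * (r\<^sup>2)\<^sup>2))) - \<bar>m\<bar> * r\<^sup>2)"
      by (intro has_bochner_integral_diff has_bochner_integral_add has_bochner_integral_mult_right D1 D2 D4 hc)
    have gv: "k / 2 * (0 + (1 / r * r\<^sup>2 - 1 / (4 * r ^ 3) * (3 * (r\<^sup>2)\<^sup>2))) - \<bar>m\<bar> * r\<^sup>2 = k * r / 8 - \<bar>m\<bar> * r\<^sup>2"
    proof -
      have "1 / r * r\<^sup>2 = r" using r by (simp add: power2_eq_square)
      moreover have "1 / (4 * r ^ 3) * (3 * (r\<^sup>2)\<^sup>2) = 3 / 4 * r" using r by (simp add: power2_eq_square power3_eq_cube)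
      ultimately show ?thesis by simp
    qed
    let ?U = "\<lambda>\<omega>. m * r\<^sup>2 + k * D \<omega>"
    have Ui: "integrable M ?U" by (rule integrable.intros[OF has_bochner_integral_add[OF hc has_bochner_integral_mult_right[OF D1]]])
    then have Mi: "integrable M (\<lambda>\<omega>. max 0 (?U \<omega>))" by (intro integrable_max) simp_all
    have lnY: "AE \<omega> in M. max 0 (ln (Y (r\<^sup>2) \<omega>)) = max 0 (?U \<omega>)"
      using Y(4) AE_space by eventually_elim (use Y0 in \<open>simp add: D_def\<close>)
    have "Y (r\<^sup>2) \<in> borel_measurable M" by (rule measurable_F_M[OF _ Y(1)]) simp_all
    then have Ym: "(\<lambda>\<omega>. max 0 (ln (Y (r\<^sup>2) \<omega>))) \<in> borel_measurable M" by measurable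
    have "k * r / 8 - \<bar>m\<bar> * r\<^sup>2 = expectation ?g" using has_bochner_integral_integral_eq[OF g] unfolding gv by (rule sym)
    also have "\<dots> \<le> expectation (\<lambda>\<omega>. max 0 (?U \<omega>))"
    proof (rule integral_mono[OF integrable.intros[OF g] Mi])
      fix \<omega>
      have even: "1 / r * (D \<omega>)\<^sup>2 - 1 / (4 * r ^ 3) * D \<omega> ^ 4 \<le> \<bar>D \<omega>\<bar>"
        using abs_ge_even_polynomial[OF r, of "D \<omega>"] by simp
      have "k / 2 * (D \<omega> + (1 / r * (D \<omega>)\<^sup>2 - 1 / (4 * r ^ 3) * D \<omega> ^ 4)) \<le> k / 2 * (D \<omega> + \<bar>D \<omega>\<bar>)"
        by (rule mult_left_mono[OF add_left_mono[OF even]]) (use k in simp)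
      also have "\<dots> = max 0 (k * D \<omega>)" using k by (cases "0 \<le> D \<omega>") (auto simp: max_def zero_le_mult_iff)
      also have "\<dots> \<le> max 0 (?U \<omega>) + \<bar>m * r\<^sup>2\<bar>"
      proof -
        have "max 0 y \<le> max 0 (x + y) + \<bar>x\<bar>" for x y :: real by linarith
        then show ?thesis .
      qed
      finally have x: "k / 2 * (D \<omega> + (1 / r * (D \<omega>)\<^sup>2 - 1 / (4 * r ^ 3) * D \<omega> ^ 4)) \<le> max 0 (?U \<omega>) + \<bar>m * r\<^sup>2\<bar>" .
      have am: "\<bar>m * r\<^sup>2\<bar> = \<bar>m\<bar> * r\<^sup>2" by (simp add: abs_mult)
      show "?g \<omega> \<le> max 0 (?U \<omega>)" using x unfolding am diff_le_eq .
    qed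
    also have "\<dots> = expectation (\<lambda>\<omega>. max 0 (ln (Y (r\<^sup>2) \<omega>)))"
      by (rule integral_cong_AE[OF borel_measurable_integrable[OF Mi] Ym]) (use lnY in \<open>auto elim: eventually_mono\<close>)
    finally show ?thesis .
  qed
  define \<delta> where "\<delta> = discount P 1"
  have \<delta>: "0 < \<delta>" using discount_props(3)[OF P, of 1] by (simp add: \<delta>_def)
  \<comment> \<open>For \<open>r < b\<close> the lower bound times the discount
    \<open>\<delta>\<close> is at least \<open>r\<^sup>2\<close>, so the difference quotient is at
    least 1; \<open>r < 1\<close> ensures that the actual discount is no smaller than
    \<open>\<delta>\<close>.\<close>
  define b where "b = min 1 (\<delta> * k / (8 * (1 + \<delta> * \<bar>m\<bar>)))"
  have den: "0 < 8 * (1 + \<delta> * \<bar>m\<bar>)" using \<delta> by (intro mult_pos_pos add_pos_nonneg) auto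
  have b: "0 < b" using \<delta> k den by (simp add: b_def)
  have ge1: "1 \<le> (J (0 + \<epsilon>) - J 0) / \<epsilon>" if \<epsilon>: "0 < \<epsilon>" "\<epsilon> < b\<^sup>2" for \<epsilon>
  proof -
    define r where "r = sqrt \<epsilon>"
    have r: "0 < r" "r\<^sup>2 = \<epsilon>" using \<epsilon> by (auto simp: r_def)
    have rb: "r < b" unfolding r_def using real_sqrt_less_mono[OF \<epsilon>(2)] b by simp
    then have r1: "r < 1" "r \<le> \<delta> * k / (8 * (1 + \<delta> * \<bar>m\<bar>))" by (auto simp: b_def)
    have "r * (8 * (1 + \<delta> * \<bar>m\<bar>)) \<le> \<delta> * k" using r1(2) den by (simp add: pos_le_divide_eq)
    then have "r * (r * (8 * (1 + \<delta> * \<bar>m\<bar>))) \<le> r * (\<delta> * k)" using r by (intro mult_left_mono) auto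
    then have main: "\<epsilon> \<le> \<delta> * (k * r / 8 - \<bar>m\<bar> * r\<^sup>2)" unfolding r(2)[symmetric] by (simp add: power2_eq_square algebra_simps)
    have low: "k * r / 8 - \<bar>m\<bar> * r\<^sup>2 \<le> expectation (\<lambda>\<omega>. max 0 (ln (Y \<epsilon> \<omega>)))" using lower[OF r(1)] unfolding r(2) .
    have e1: "\<epsilon> \<le> 1" using r1(1) r(1) power_le_one[of r 2] unfolding r(2) by simp
    have "\<epsilon> \<le> \<delta> * expectation (\<lambda>\<omega>. max 0 (ln (Y \<epsilon> \<omega>)))"
      by (rule order_trans[OF main mult_left_mono[OF low]]) (use \<delta> in simp)
    also have "\<dots> \<le> discount P \<epsilon> * expectation (\<lambda>\<omega>. max 0 (ln (Y \<epsilon> \<omega>)))"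
      unfolding \<delta>_def using discount_props(2)[OF P, of \<epsilon> 1] \<epsilon> e1
      by (intro mult_right_mono Bochner_Integration.integral_nonneg) auto
    finally have "\<epsilon> \<le> J \<epsilon>" using J[of \<epsilon>] \<epsilon> by simp
    then show ?thesis using \<epsilon> J0 by simp
  qed
  have "ereal 1 \<le> Liminf (at_right 0) (\<lambda>\<epsilon>. ereal ((J (0 + \<epsilon>) - J 0) / \<epsilon>))"
  proof (rule Liminf_bounded)
    show "\<forall>\<^sub>F \<epsilon> in at_right 0. ereal 1 \<le> ereal ((J (0 + \<epsilon>) - J 0) / \<epsilon>)"
      unfolding eventually_at_right_field using ge1 b by (intro exI[of _ "b\<^sup>2"]) auto
  qed
  also have "\<dots> \<le> Limsup (at_right 0) (\<lambda>\<epsilon>. ereal ((J (0 + \<epsilon>) - J 0) / \<epsilon>))"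
    by (rule Liminf_le_Limsup) simp
  also have "\<dots> \<le> 0"
  proof -
    have "\<forall>t\<ge>0. \<forall>x>0. Limsup (at_right 0) (\<lambda>\<epsilon>. ereal ((payoff M P (X (\<lambda>s x. \<theta>) t x) t (exit_time (X (\<lambda>s x. \<theta>) t x) ?C (t + \<epsilon>))
      - payoff M P (X (\<lambda>s x. \<theta>) t x) t (exit_time (X (\<lambda>s x. \<theta>) t x) ?C t)) / \<epsilon>)) \<le> 0"
      using eq unfolding equilibrium_def Let_def by (elim conjE) assumption
    from this[rule_format, OF order_refl zero_less_one] show ?thesis unfolding J_def Y_def .
  qed
  finally show False by simp
qed

end

section \<open>Case distinction over the components of the continuation region\<close>

theorem proposition4p3:
  fixes M :: "'a measure" and F :: "real \<Rightarrow> 'a measure" and W :: "real \<Rightarrow> 'a \<Rightarrow> real"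
    and P :: "real measure" and \<mu> \<sigma> \<theta> :: real and C :: "real set"
    and X :: "(real \<Rightarrow> real \<Rightarrow> real) \<Rightarrow> real \<Rightarrow> real \<Rightarrow> real \<Rightarrow> 'a \<Rightarrow> real"
  assumes "brownian_motion M F W"
    and "0 < \<mu>" and "0 < \<sigma>" and "0 < \<theta>"
    and "wealth_family M F W \<mu> \<sigma> (\<lambda>x. \<theta>) X"
    and "weighting_distribution P" and "\<not> is_singleton (measure_support P)"
    and "open C" and "C \<subseteq> {0<..}" and "C \<noteq> {0<..}" and "C \<noteq> {}"
  shows "\<not> equilibrium M P X (\<lambda>x. \<theta>) C"
proof -
  interpret brownian_motion M F W by fact
  let ?m = "\<mu> * \<theta> - (\<sigma> * \<theta>)\<^sup>2 / 2" and ?D = "(\<sigma> * \<theta>)\<^sup>2 / 2"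
  have D: "0 < ?D" using assms(3,4) by simp
  have P: "prob_space P" "sets P = sets borel" "AE \<beta> in P. 0 < \<beta>"
    using assms(6) by (simp_all add: weighting_distribution_def)
  note family = not_equilibrium_of_family[OF assms(3-8)]
  have positive: "0 < x" if "x \<in> C" for x using that assms(9) by auto
  show ?thesis
  \<comment> \<open>Asks whether some component of \<open>C\<close> has a positive lower
    end.\<close>
  proof (cases "\<exists>x\<in>C. \<exists>y. 0 < y \<and> y < x \<and> y \<notin> C")
    case True
    then obtain x y where xy: "x \<in> C" "0 < y" "y < x" "y \<notin> C" by blast
    obtain l where l: "y \<le> l" "l < x" "l \<notin> C" "{l<..x} \<subseteq> C" using component_lower[OF assms(8) xy(1,4,3)] by blast
    show ?thesis
    proof (cases "\<exists>y>x. y \<notin> C")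
      case True
      then obtain h where h: "x < h" "h \<notin> C" "{x..<h} \<subseteq> C" using component_upper[OF assms(8) xy(1)] by blast
      have lh: "0 < l" "l < h" using l h xy by auto
      have sub: "{l<..<h} \<subseteq> C"
      proof
        fix t assume "t \<in> {l<..<h}"
        then show "t \<in> C" using l(4) h(3) by (cases "t \<le> x") auto
      qed
      have LH: "ln l < ln h" using lh by simp
      obtain y0 where y0: "ln l < y0" "y0 < ln h"
        "(\<forall>\<beta>>0. 0 < exp_pair (coeff_pos ?m ?D (ln l) (ln h)) (coeff_neg ?m ?D (ln l) (ln h)) ?m ?D 0 \<beta> y0)
          \<or> (\<forall>\<beta>>0. exp_pair (coeff_pos ?m ?D (ln l) (ln h)) (coeff_neg ?m ?D (ln l) (ln h)) ?m ?D 0 \<beta> y0 < 0)"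
        using two_sided_sign[OF D LH, of ?m] by blast
      show ?thesis
      proof (rule family[OF _ lh(2) sub l(3) h(2) coeff_measurable two_sided_family[OF P D LH] _ _ _ _ _ y0(3)])
        show "0 \<le> l" using lh by simp
        show "exp_pair (coeff_pos ?m ?D (ln l) (ln h)) (coeff_neg ?m ?D (ln l) (ln h)) ?m ?D 0 \<beta> (ln h) = ln h" if "0 < \<beta>" for \<beta>
          by (rule two_sided_boundary(1)[OF D that LH])
        show "exp_pair (coeff_pos ?m ?D (ln l) (ln h)) (coeff_neg ?m ?D (ln l) (ln h)) ?m ?D 0 \<beta> (ln l) = ln l" if "0 < \<beta>" for \<beta>
          by (rule two_sided_boundary(2)[OF D that LH])
        show "exp t \<in> {l<..<h}" if "t \<in> {ln l<..<ln h}" for t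
        proof -
          have "exp (ln l) < exp t" "exp t < exp (ln h)" using that by auto
          then show ?thesis using lh by simp
        qed
        show "y0 \<in> {ln l<..<ln h}" using y0 by simp
      qed (use lh in simp)
    next
      case False
      have "t \<in> C" if "l < t" for t using False l(4) that by (cases "t \<le> x") auto
      then show ?thesis using not_equilibrium_of_ray[OF assms(5,6,8) _ l(3)] l(1) xy(2) by auto
    qed
  next
    case down: False
    obtain x where x: "x \<in> C" using assms(11) by blast
    \<comment> \<open>In this case \<open>C\<close> is closed downwards within the positive reals,
      so without a gap above \<open>x\<close> it would be all of them.\<close>
    have "\<exists>y>x. y \<notin> C"
    proof (rule ccontr)
      assume up: "\<not> (\<exists>y>x. y \<notin> C)"
      have "t \<in> C" if "0 < t" for t
        using up down x that by (metis linorder_neqE_linordered_idom)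
      then show False using assms(9,10) by auto
    qed
    then obtain h where h: "x < h" "h \<notin> C" "{x..<h} \<subseteq> C" using component_upper[OF assms(8) x] by blast
    have h0: "0 < h" using positive[OF x] h by simp
    have Ch: "C = {0<..<h}"
    proof (intro equalityI subsetI)
      fix t assume "t \<in> C"
      then show "t \<in> {0<..<h}" using down h(2) h0 positive[of t] by (metis greaterThanLessThan_iff linorder_neqE_linordered_idom)
    next
      fix t assume "t \<in> {0<..<h}"
      then show "t \<in> C" using down x h(3) by (cases "t < x") auto
    qed
    show ?thesis
    proof (cases "h = 1")
      case True
      then show ?thesis using not_equilibrium_unit_interval[OF assms(5,6,3,4)] Ch by simp
    next
      case False
      let ?H = "ln h"
      let ?c = "\<lambda>\<beta>. ?H * exp (- (root_pos ?m ?D \<beta> * ?H))"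
      have H: "?H \<noteq> 0" using False h0 by simp
      have v: "exp_pair ?c (\<lambda>_. 0) ?m ?D 0 \<beta> y = ?H * (exp (- (root_pos ?m ?D \<beta> * ?H)) * exp (root_pos ?m ?D \<beta> * y))" for \<beta> y
        by (simp add: exp_pair_def)
      show ?thesis
      \<comment> \<open>Each value is \<open>ln h\<close> times a positive factor, so the sign is
        that of \<open>ln h\<close> and any point below \<open>ln h\<close> would serve as
        \<open>y0\<close>.\<close>
      proof (rule family[OF order_refl h0 _ _ h(2) _ _ one_sided_family[OF P D]])
        show "?c \<in> borel_measurable borel" unfolding root_pos_def by measurable
        show "exp_pair ?c (\<lambda>_. 0) ?m ?D 0 \<beta> ?H = ?H" for \<beta>
          unfolding v exp_add[symmetric] by simp
        show "exp t \<in> {0<..<h}" if "t \<in> {..<?H}" for t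
        proof -
          have "exp t < exp ?H" using that by simp
          then show ?thesis using h0 by simp
        qed
        show "?H - 1 \<in> {..<?H}" by simp
        show "(\<forall>\<beta>>0. 0 < exp_pair ?c (\<lambda>_. 0) ?m ?D 0 \<beta> (?H - 1)) \<or> (\<forall>\<beta>>0. exp_pair ?c (\<lambda>_. 0) ?m ?D 0 \<beta> (?H - 1) < 0)"
          unfolding v using H by (cases "0 < ?H") (auto simp: zero_less_mult_iff mult_less_0_iff)
      qed (use Ch in auto)
    qed
  qed
qed

end
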